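(* Let $\{X_n;n\ge1\}$ be a sequence of independent random variables in a sub-linear expectation space $(\Omega,\mathscr H,\widehat{\mathbb E})$ with $\widehat{\mathbb E}[X_n^2]<\infty$ for all $n$, and let $\mathbb V$ be a sub-additive capacity on $\mathcal F$ satisfying the compatibility property (C). Put $s_n^2=\sum_{k=1}^n\widehat{\mathbb E}[X_k^2]$, $t_n=\sqrt{2\log\log s_n^2}$, $a_n=s_nt_n$, $\Gamma_n(p,\alpha)=\widehat{\mathbb E}[((|X_n|-\alpha s_n/t_n)^+)^p]$ and $\Lambda_n(p,\alpha)=\sum_{j=1}^n\widehat{\mathbb E}[((|X_j|-\alpha s_n/t_n)^+)^p]$. Suppose that (i) $\sum_{n=1}^\infty\mathbb V(|X_n|\ge\epsilon a_n)<\infty$ for all $\epsilon>0$; (ii) for every $\alpha>0$ there exist some $p\ge2$ and $d\ge0$ such that $\sum_{n=1}^\infty\frac{\Gamma_n(p,\alpha)}{a_n^p}\big(\frac{\Lambda_n(p,\alpha)}{a_n^p}\big)^d<\infty$; (iii) $\sum_{n=1}^\infty s_n^{-2}(\log s_n^2)^{\delta-1}\widehat{\mathbb E}[X_n^2]=\infty$ for all $\delta>0$; (iv) $\frac{1}{a_n}\sum_{j=1}^n\big(|\widehat{\mathbb E}[X_j]|+|\widehat{\mathcal E}[X_j]|\big)\to0$. Let $\{\tilde X_n;n\ge1\}$ be the copy of $\{X_n;n\ge1\}$ on $\mathbb R^\infty$ and $\tilde S_n=\sum_{i=1}^n\tilde X_i$. Then for $\widetilde V=\widetilde{\mathbb V}^{\widetilde{\mathscr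 P}}$, $\widetilde V=\widetilde{\mathbb C}^*$ or $\widetilde V=\widetilde{\mathbb V}^*$, $$\widetilde V\Big(\limsup_{n\to\infty}\frac{|\tilde S_n|}{a_n}>1\Big)=0\qquad\text{and}\qquad\widetilde V\Big(\liminf_{n\to\infty}\frac{\tilde S_n}{a_n}=-1\ \text{ and }\ \limsup_{n\to\infty}\frac{\tilde S_n}{a_n}=1\Big)=1.$$
   Context: Sub-linear expectation space: $(\Omega,\mathcal F)$ is a measurable space and $\mathscr H$ is a linear space of real measurable functions on it such that $\varphi(X_1,\dots,X_n)\in\mathscr H$ whenever $X_1,\dots,X_n\in\mathscr H$ and $\varphi\in C_{l,Lip}(\mathbb R^n)$, where $C_{l,Lip}(\mathbb R^n)$ is the set of $\varphi$ with $|\varphi(x)-\varphi(y)|\le C(1+|x|^m+|y|^m)|x-y|$ for some $C>0$, $m\in\mathbb N$ depending on $\varphi$. A sub-linear expectation is a map $\widehat{\mathbb E}:\mathscr H\to[-\infty,\infty]$ such that: $X\ge Y$ implies $\widehat{\mathbb E}[X]\ge\widehat{\mathbb E}[Y]$; $\widehat{\mathbb E}[c]=c$ for constants $c$; $\widehat{\mathbb E}[X+Y]\le\widehat{\mathbb E}[X]+\widehat{\mathbb E}[Y]$ whenever the right side is not of the form $\infty-\infty$; $\widehat{\mathbb E}[\lambda X]=\lambda\widehat{\mathbb E}[X]$ for $\lambda\ge0$ (with $0\cdot\infty=0$). The conjugate expectation is $\widehat{\mathcal E}[X]=-\widehat{\mathbb E}[-X]$. Elements of $\mathscr H$ are called random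 variables. Independence: a random vector $\bm Y\in\mathscr H^n$ is independent to $\bm X\in\mathscr H^m$ if $\widehat{\mathbb E}[\varphi(\bm X,\bm Y)]=\widehat{\mathbb E}\big[\widehat{\mathbb E}[\varphi(\bm x,\bm Y)]|_{\bm x=\bm X}\big]$ for each $\varphi\in C_{l,Lip}(\mathbb R^m\times\mathbb R^n)$ with $\overline\varphi(\bm x):=\widehat{\mathbb E}[|\varphi(\bm x,\bm Y)|]<\infty$ for all $\bm x$ and $\widehat{\mathbb E}[|\overline\varphi(\bm X)|]<\infty$. A sequence $\{X_n\}$ is independent if $X_{i+1}$ is independent to $(X_1,\dots,X_i)$ for each $i\ge1$. Capacities: a capacity is a monotone set function $V:\mathcal F\to[0,1]$ with $V(\emptyset)=0$, $V(\Omega)=1$; it is sub-additive if $V(A\cup B)\le V(A)+V(B)$. Property (C) for $\mathbb V$: $\widehat{\mathbb E}[f]\le\mathbb V(A)\le\widehat{\mathbb E}[g]$ whenever $f\le I_A\le g$, $f,g\in\mathscr H$, $A\in\mathcal F$. Copy on $\mathbb R^\infty$: let $\widetilde\Omega=\mathbb R^\infty=\{\bm x=(x_1,x_2,\dots)\}$ with Borel $\sigma$-field $\widetilde{\mathcal F}=\mathscr B(\mathbb R^\infty)$, $\pi_d\bm x=(x_1,\dots,x_d)$, and $\widetilde{\mathscr H}=\{\varphi_1\circ\pi_d:\varphi_1\in C_{l,Lip}(\mathbb R^d),d\ge1\}$. Define $\widetilde{\mathbb E}[\varphi_1\circ\pi_d]=\widehat{\mathbb E}[\varphi_1(X_1,\dots,X_d)]$,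 and $\tilde X_n(\bm x)=x_n$. Let $\widetilde{\mathscr P}$ be the set of all probability measures $P$ on $(\widetilde\Omega,\widetilde{\mathcal F})$ with $P[\varphi]\le\widetilde{\mathbb E}[\varphi]$ for all bounded $\varphi\in\widetilde{\mathscr H}$, where $P[\varphi]=\int\varphi\,dP$. For $A\in\widetilde{\mathcal F}$ define $\widetilde{\mathbb V}^{\widetilde{\mathscr P}}(A)=\sup_{P\in\widetilde{\mathscr P}}P(A)$ (identically $0$ if $\widetilde{\mathscr P}=\emptyset$); $\widetilde{\mathbb V}(A)=\inf\{\widetilde{\mathbb E}[\xi]:I_A\le\xi,\ \xi\in\widetilde{\mathscr H}\}$; $\widetilde{\mathbb V}^*(A)=\inf\{\sum_{n=1}^\infty\widetilde{\mathbb V}(A_n):A\subset\bigcup_{n=1}^\infty A_n\}$; $\widetilde{\mathbb C}^*(A)=\inf\{\lim_{n\to\infty}\widetilde{\mathbb E}[\sum_{i=1}^ng_i]:I_A\le\sum_{n=1}^\infty g_n,\ 0\le g_n\in\widetilde{\mathscr H}\}$. Conventions: $\log x=\ln\max(e,x)$; $x^+=\max(x,0)$. *)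

theory Defs
  imports "HOL-Probability.Probability"
begin

section \<open>Sub-linear expectation spaces\<close>

text \<open>
  A point of $R^n$ is represented by the first \<open>n\<close> coordinates of some \<open>x :: nat \<Rightarrow> real\<close> (so the
  mathematical $x_i$ is \<open>x (i - 1)\<close>), with Euclidean norm \<open>L2_set x {..<n}\<close>.  The local Lipschitz
  estimate below forces \<open>\<phi>\<close> to ignore the coordinates \<open>\<ge> n\<close> (lemma \<open>C_l_Lip_cong\<close>), so
  \<open>C_l_Lip n \<phi>\<close> says that \<open>\<phi>\<close> is $\varphi \circ \pi_n$ with $\varphi \in C_{l,Lip}(R^n)$.
\<close>

definition C_l_Lip :: "nat \<Rightarrow> ((nat \<Rightarrow> real) \<Rightarrow> real) \<Rightarrow> bool" where
  "C_l_Lip n \<phi> \<longleftrightarrow> (\<exists>C>0. \<exists>m::nat. \<forall>x y.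
     \<bar>\<phi> x - \<phi> y\<bar> \<le> C * (1 + L2_set x {..<n} ^ m + L2_set y {..<n} ^ m)
                       * L2_set (\<lambda>i. x i - y i) {..<n})"

lemma C_l_Lip_cong:
  assumes "C_l_Lip n \<phi>" and "\<And>i. i < n \<Longrightarrow> x i = y i"
  shows "\<phi> x = \<phi> y"
proof -
  have "L2_set (\<lambda>i. x i - y i) {..<n} = 0"
    using assms(2) by (simp add: L2_set_eq_0_iff)
  moreover obtain C m where "\<bar>\<phi> x - \<phi> y\<bar> \<le> C * (1 + L2_set x {..<n} ^ m + L2_set y {..<n} ^ m)
      * L2_set (\<lambda>i. x i - y i) {..<n}"
    using assms(1) unfolding C_l_Lip_def by blast
  ultimately show ?thesis by simp
qed

text \<open>
  \<open>M\<close> carries the measurable space \<open>(space M, sets M)\<close>; its measure plays no role.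
  The values of \<open>E\<close> outside \<open>H\<close> are irrelevant and never used.
\<close>

locale sublinear_expectation_space =
  fixes M :: "'a measure"
    and H :: "('a \<Rightarrow> real) set"
    and E :: "('a \<Rightarrow> real) \<Rightarrow> ereal"
  assumes H_measurable: "H \<subseteq> borel_measurable M"
    and H_zero: "(\<lambda>\<omega>. 0) \<in> H"
    and H_add: "X \<in> H \<Longrightarrow> Y \<in> H \<Longrightarrow> (\<lambda>\<omega>. X \<omega> + Y \<omega>) \<in> H"
    and H_scale: "X \<in> H \<Longrightarrow> (\<lambda>\<omega>. c * X \<omega>) \<in> H"
    and H_comp: "n \<ge> 1 \<Longrightarrow> (\<And>i. i < n \<Longrightarrow> Z i \<in> H) \<Longrightarrow> C_l_Lip n \<phi> \<Longrightarrow> (\<lambda>\<omega>. \<phi> (\<lambda>i. Z i \<omega>)) \<in> H"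
    and E_mono: "X \<in> H \<Longrightarrow> Y \<in> H \<Longrightarrow> (\<And>\<omega>. \<omega> \<in> space M \<Longrightarrow> Y \<omega> \<le> X \<omega>) \<Longrightarrow> E Y \<le> E X"
    and E_const: "E (\<lambda>\<omega>. c) = ereal c"
    and E_subadd: "X \<in> H \<Longrightarrow> Y \<in> H \<Longrightarrow>
          \<not> (E X = \<infinity> \<and> E Y = -\<infinity>) \<Longrightarrow> \<not> (E X = -\<infinity> \<and> E Y = \<infinity>) \<Longrightarrow>
          E (\<lambda>\<omega>. X \<omega> + Y \<omega>) \<le> E X + E Y"
    and E_pos_homogeneous: "X \<in> H \<Longrightarrow> 0 \<le> l \<Longrightarrow> E (\<lambda>\<omega>. l * X \<omega>) = ereal l * E X"

definition conj_expectation :: "(('a \<Rightarrow> real) \<Rightarrow> ereal) \<Rightarrow> ('a \<Rightarrow> real) \<Rightarrow> ereal" where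
  "conj_expectation E X = - E (\<lambda>\<omega>. - X \<omega>)"

section \<open>Independence\<close>

definition concat_vec :: "nat \<Rightarrow> (nat \<Rightarrow> real) \<Rightarrow> (nat \<Rightarrow> real) \<Rightarrow> nat \<Rightarrow> real" where
  "concat_vec m x y = (\<lambda>i. if i < m then x i else y (i - m))"

text \<open>
  \<open>indep_to H E m X n Y\<close>: the vector $(Y_0,\dots,Y_{n-1})$ is independent to $(X_0,\dots,X_{m-1})$.
  Since \<open>E\<close> is an expectation on \<open>H\<close> only, a test function takes part only if the two functions of
  \<open>X\<close> to which the outer expectation is applied belong to \<open>H\<close>.  Under the first finiteness
  condition, the inner expectations are finite, so \<open>real_of_ereal\<close> does not distort them.
\<close>

definition indep_to ::
  "('a \<Rightarrow> real) set \<Rightarrow> (('a \<Rightarrow> real) \<Rightarrow> ereal) \<Rightarrow>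
   nat \<Rightarrow> (nat \<Rightarrow> 'a \<Rightarrow> real) \<Rightarrow> nat \<Rightarrow> (nat \<Rightarrow> 'a \<Rightarrow> real) \<Rightarrow> bool" where
  "indep_to H E m X n Y \<longleftrightarrow>
     (\<forall>i<m. X i \<in> H) \<and> (\<forall>i<n. Y i \<in> H) \<and>
     (\<forall>\<phi>. C_l_Lip (m + n) \<phi> \<longrightarrow>
       (let phiY = (\<lambda>x \<omega>. \<phi> (concat_vec m x (\<lambda>i. Y i \<omega>)));
            inner = (\<lambda>\<omega>. real_of_ereal (E (phiY (\<lambda>i. X i \<omega>))));
            bar = (\<lambda>\<omega>. real_of_ereal (E (\<lambda>\<omega>'. \<bar>phiY (\<lambda>i. X i \<omega>) \<omega>'\<bar>)))
        in (\<forall>x. E (\<lambda>\<omega>. \<bar>phiY x \<omega>\<bar>) < \<infinity>) \<longrightarrow>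
           inner \<in> H \<longrightarrow> bar \<in> H \<longrightarrow> E (\<lambda>\<omega>. \<bar>bar \<omega>\<bar>) < \<infinity> \<longrightarrow>
           E (\<lambda>\<omega>. phiY (\<lambda>i. X i \<omega>) \<omega>) = E inner))"

text \<open>Sequences of random variables are indexed from 1; \<open>X 0\<close> is never used.\<close>

definition indep_sequence ::
  "('a \<Rightarrow> real) set \<Rightarrow> (('a \<Rightarrow> real) \<Rightarrow> ereal) \<Rightarrow> (nat \<Rightarrow> 'a \<Rightarrow> real) \<Rightarrow> bool" where
  "indep_sequence H E X \<longleftrightarrow>
     (\<forall>n\<ge>1. X n \<in> H) \<and>
     (\<forall>i\<ge>1. indep_to H E i (\<lambda>j. X (Suc j)) 1 (\<lambda>_. X (Suc i)))"

section \<open>Capacities\<close>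

definition capacity :: "'a measure \<Rightarrow> ('a set \<Rightarrow> real) \<Rightarrow> bool" where
  "capacity M V \<longleftrightarrow>
     V {} = 0 \<and> V (space M) = 1 \<and> (\<forall>A\<in>sets M. 0 \<le> V A \<and> V A \<le> 1) \<and>
     (\<forall>A\<in>sets M. \<forall>B\<in>sets M. A \<subseteq> B \<longrightarrow> V A \<le> V B)"

definition subadditive_capacity :: "'a measure \<Rightarrow> ('a set \<Rightarrow> real) \<Rightarrow> bool" where
  "subadditive_capacity M V \<longleftrightarrow>
     capacity M V \<and> (\<forall>A\<in>sets M. \<forall>B\<in>sets M. V (A \<union> B) \<le> V A + V B)"

definition property_C ::
  "'a measure \<Rightarrow> ('a \<Rightarrow> real) set \<Rightarrow> (('a \<Rightarrow> real) \<Rightarrow> ereal) \<Rightarrow> ('a set \<Rightarrow> real) \<Rightarrow> bool" where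
  "property_C M H E V \<longleftrightarrow>
     (\<forall>A\<in>sets M. \<forall>f\<in>H. \<forall>g\<in>H.
        (\<forall>\<omega>\<in>space M. f \<omega> \<le> indicator A \<omega> \<and> indicator A \<omega> \<le> g \<omega>) \<longrightarrow>
        E f \<le> ereal (V A) \<and> ereal (V A) \<le> E g)"

section \<open>The copy on the sequence space\<close>

text \<open>
  The sequence space is the type \<open>nat \<Rightarrow> real\<close> with the Borel sets of the product topology.
  Because elements of \<open>copy_H\<close> are already functions on that space, the copied expectation
  does not need a choice of the dimension \<open>d\<close>.
\<close>

definition copy_H :: "((nat \<Rightarrow> real) \<Rightarrow> real) set" where
  "copy_H = {\<phi>. \<exists>d\<ge>1. C_l_Lip d \<phi>}"

definition copy_E ::
  "(('a \<Rightarrow> real) \<Rightarrow> ereal) \<Rightarrow> (nat \<Rightarrow> 'a \<Rightarrow> real) \<Rightarrow> ((nat \<Rightarrow> real) \<Rightarrow> real) \<Rightarrow> ereal" where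
  "copy_E E X \<phi> = E (\<lambda>\<omega>. \<phi> (\<lambda>i. X (Suc i) \<omega>))"

definition copy_X :: "nat \<Rightarrow> (nat \<Rightarrow> real) \<Rightarrow> real" where
  "copy_X n x = x (n - 1)"

definition copy_S :: "nat \<Rightarrow> (nat \<Rightarrow> real) \<Rightarrow> real" where
  "copy_S n x = (\<Sum>i=1..n. copy_X i x)"

definition copy_P ::
  "(('a \<Rightarrow> real) \<Rightarrow> ereal) \<Rightarrow> (nat \<Rightarrow> 'a \<Rightarrow> real) \<Rightarrow> (nat \<Rightarrow> real) measure set" where
  "copy_P E X = {P. prob_space P \<and> sets P = sets borel \<and>
     (\<forall>\<phi>\<in>copy_H. bounded (range \<phi>) \<longrightarrow> ereal (\<integral>x. \<phi> x \<partial>P) \<le> copy_E E X \<phi>)}"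

definition V_P ::
  "(('a \<Rightarrow> real) \<Rightarrow> ereal) \<Rightarrow> (nat \<Rightarrow> 'a \<Rightarrow> real) \<Rightarrow> (nat \<Rightarrow> real) set \<Rightarrow> ereal" where
  "V_P E X A = (if copy_P E X = {} then 0 else (SUP P\<in>copy_P E X. ereal (measure P A)))"

definition V_outer ::
  "(('a \<Rightarrow> real) \<Rightarrow> ereal) \<Rightarrow> (nat \<Rightarrow> 'a \<Rightarrow> real) \<Rightarrow> (nat \<Rightarrow> real) set \<Rightarrow> ereal" where
  "V_outer E X A = (INF \<xi>\<in>{\<xi>\<in>copy_H. \<forall>x. indicator A x \<le> \<xi> x}. copy_E E X \<xi>)"

definition V_star ::
  "(('a \<Rightarrow> real) \<Rightarrow> ereal) \<Rightarrow> (nat \<Rightarrow> 'a \<Rightarrow> real) \<Rightarrow> (nat \<Rightarrow> real) set \<Rightarrow> ereal" where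
  "V_star E X A =
     (INF B\<in>{B :: nat \<Rightarrow> (nat \<Rightarrow> real) set. range B \<subseteq> sets borel \<and> A \<subseteq> (\<Union>n. B n)}.
        \<Sum>n. V_outer E X (B n))"

text \<open>The series of the \<open>g n\<close> may be infinite, hence it is summed in \<open>ereal\<close>.\<close>

definition C_star ::
  "(('a \<Rightarrow> real) \<Rightarrow> ereal) \<Rightarrow> (nat \<Rightarrow> 'a \<Rightarrow> real) \<Rightarrow> (nat \<Rightarrow> real) set \<Rightarrow> ereal" where
  "C_star E X A =
     (INF g\<in>{g :: nat \<Rightarrow> (nat \<Rightarrow> real) \<Rightarrow> real.
               (\<forall>n. g n \<in> copy_H \<and> (\<forall>x. 0 \<le> g n x)) \<and>
               (\<forall>x. indicator A x \<le> (\<Sum>n. ereal (g n x)))}.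
        lim (\<lambda>n. copy_E E X (\<lambda>x. \<Sum>i<n. g i x)))"

section \<open>Normalisation\<close>

definition logp :: "real \<Rightarrow> real" where
  "logp x = ln (max (exp 1) x)"

text \<open>\<open>s2 E X n\<close> is $s_n^2$; it is used only when all second moments are finite.\<close>

definition s2 :: "(('a \<Rightarrow> real) \<Rightarrow> ereal) \<Rightarrow> (nat \<Rightarrow> 'a \<Rightarrow> real) \<Rightarrow> nat \<Rightarrow> real" where
  "s2 E X n = real_of_ereal (\<Sum>k=1..n. E (\<lambda>\<omega>. (X k \<omega>)\<^sup>2))"

definition s_norm :: "(('a \<Rightarrow> real) \<Rightarrow> ereal) \<Rightarrow> (nat \<Rightarrow> 'a \<Rightarrow> real) \<Rightarrow> nat \<Rightarrow> real" where
  "s_norm E X n = sqrt (s2 E X n)"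

definition t_norm :: "(('a \<Rightarrow> real) \<Rightarrow> ereal) \<Rightarrow> (nat \<Rightarrow> 'a \<Rightarrow> real) \<Rightarrow> nat \<Rightarrow> real" where
  "t_norm E X n = sqrt (2 * logp (logp (s2 E X n)))"

definition a_norm :: "(('a \<Rightarrow> real) \<Rightarrow> ereal) \<Rightarrow> (nat \<Rightarrow> 'a \<Rightarrow> real) \<Rightarrow> nat \<Rightarrow> real" where
  "a_norm E X n = s_norm E X n * t_norm E X n"

text \<open>$\hat E[((|X_j| - \alpha s_n/t_n)^+)^p]$, possibly infinite\<close>

definition trunc_moment ::
  "(('a \<Rightarrow> real) \<Rightarrow> ereal) \<Rightarrow> (nat \<Rightarrow> 'a \<Rightarrow> real) \<Rightarrow> nat \<Rightarrow> nat \<Rightarrow> real \<Rightarrow> real \<Rightarrow> ereal" where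
  "trunc_moment E X n j p \<alpha> =
     E (\<lambda>\<omega>. (max (\<bar>X j \<omega>\<bar> - \<alpha> * s_norm E X n / t_norm E X n) 0) powr p)"

definition Gamma_n ::
  "(('a \<Rightarrow> real) \<Rightarrow> ereal) \<Rightarrow> (nat \<Rightarrow> 'a \<Rightarrow> real) \<Rightarrow> nat \<Rightarrow> real \<Rightarrow> real \<Rightarrow> ereal" where
  "Gamma_n E X n p \<alpha> = trunc_moment E X n n p \<alpha>"

definition Lambda_n ::
  "(('a \<Rightarrow> real) \<Rightarrow> ereal) \<Rightarrow> (nat \<Rightarrow> 'a \<Rightarrow> real) \<Rightarrow> nat \<Rightarrow> real \<Rightarrow> real \<Rightarrow> ereal" where
  "Lambda_n E X n p \<alpha> = (\<Sum>j=1..n. trunc_moment E X n j p \<alpha>)"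

text \<open>Real powers of a nonnegative extended real, for exponents \<open>d \<ge> 0\<close>; the zeroth power is 1.\<close>

definition ereal_powr :: "ereal \<Rightarrow> real \<Rightarrow> ereal" where
  "ereal_powr x d =
     (if d = 0 then 1 else if x = \<infinity> then \<infinity> else ereal (real_of_ereal x powr d))"

text \<open>
  The summand of condition (ii).  Indices with $a_n = 0$ (an initial segment on which
  $s_n = 0$) make the quotient meaningless and are dropped.
\<close>

definition moment_term ::
  "(('a \<Rightarrow> real) \<Rightarrow> ereal) \<Rightarrow> (nat \<Rightarrow> 'a \<Rightarrow> real) \<Rightarrow> nat \<Rightarrow> real \<Rightarrow> real \<Rightarrow> real \<Rightarrow> ereal" where
  "moment_term E X n p \<alpha> d =
     (if a_norm E X n = 0 then 0
      else Gamma_n E X n p \<alpha> / ereal (a_norm E X n powr p)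
           * ereal_powr (Lambda_n E X n p \<alpha> / ereal (a_norm E X n powr p)) d)"

end

theory Submission imports Defs begin

text \<open>
  Hypothesis (ii) splits the blocks on which $s_n^2$ grows by a fixed factor \<open>\<theta>\<close> into good ones, on
  which the variables may be truncated at a small multiple of $s_n / t_n$ with a negligible error,
  and bad ones, which are so rare that a crude exponential bound is summable over them.

  Upper half: independence makes exponentials of the truncated partial sums a supermartingale
  for the expectation itself. A maximal inequality for it yields countably many cylinder events with summable
  outer capacity, so the limit superior is a null set for the largest of the three set functions.

  Lower half: by Hahn--Banach and weak compactness each $X_n$ is dominated by a law that attains
  the upper second moment of the truncated variable, and the product of these laws is one of the
  measures defining the smallest set function. Under it the coordinates are independent in the
  classical sense, a Cramer-type lower bound holds on the good blocks, and the second
  Borel--Cantelli lemma applies because (iii) makes the block probabilities non-summable.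
\<close>

section \<open>Bounded Lipschitz functions\<close>

text \<open>\<open>E\<close> sees only functions in \<open>H\<close>, and independence only test
  functions whose inner expectations lie in \<open>H\<close> again. Everything is therefore carried
  out with bounded Lipschitz functions of finitely many coordinates, a class closed under products,
  exponentials and conditioning; indicators become ramps, at the price of shifted thresholds. The
  ratio \<theta> plays opposite roles: it is close to 1 in the upper half, so that the normalisation
  is nearly constant on a level, and large in the lower half, so that the past of a block is a small
  fraction of its variance. The exponent \<open>d\<close> in (ii) enters through
  \<open>q = d + 1\<close>: the running sums in (ii) integrate to a \<open>q\<close>-th power, so
  the bounds \<open>lam l\<close> on the normalised tail moments have only summable
  \<open>q\<close>-th powers, and errors on a level must be measured by \<open>lam l powr q\<close>.
  The dominated laws attain second moments truncated at levels growing faster than any multiple of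
  s_n/t_n; this condition mentions neither \<theta> nor \<alpha>, so a single measure serves every
  accuracy and both signs.\<close>

definition poly_lip :: "(real \<Rightarrow> real) \<Rightarrow> bool" where
  "poly_lip f \<longleftrightarrow> (\<exists>C m. 0 \<le> C \<and> (\<forall>x y. \<bar>f x - f y\<bar> \<le> C * (1 + \<bar>x\<bar> ^ m + \<bar>y\<bar> ^ m) * \<bar>x - y\<bar>))"

lemma poly_lip_C_l_Lip:
  assumes "poly_lip f" shows "C_l_Lip 1 (\<lambda>x. f (x 0))"
proof -
  obtain C m where C: "0 \<le> C" "\<And>x y. \<bar>f x - f y\<bar> \<le> C * (1 + \<bar>x\<bar> ^ m + \<bar>y\<bar> ^ m) * \<bar>x - y\<bar>"
    using assms unfolding poly_lip_def by blast
  have L: "L2_set x {..<1} = \<bar>x 0\<bar>" for x :: "nat \<Rightarrow> real"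
    by (simp add: L2_set_def lessThan_Suc)
  have "\<bar>f x - f y\<bar> \<le> (C+1) * (1 + \<bar>x\<bar> ^ m + \<bar>y\<bar> ^ m) * \<bar>x - y\<bar>" for x y
    by (rule order_trans[OF C(2)]) (intro mult_right_mono, auto)
  then show ?thesis unfolding C_l_Lip_def L using C(1)
    by (intro exI[of _ "C+1"] conjI exI[of _ m]) auto
qed

lemma poly_lip_lipschitz:
  assumes "\<And>x y. \<bar>f x - f y\<bar> \<le> L * \<bar>x - y\<bar>" shows "poly_lip f"
proof -
  have "\<bar>f x - f y\<bar> \<le> \<bar>L\<bar> * (1 + \<bar>x\<bar> ^ 0 + \<bar>y\<bar> ^ 0) * \<bar>x - y\<bar>" for x y
  proof (rule order_trans[OF assms], rule mult_right_mono)
    show "L \<le> \<bar>L\<bar> * (1 + \<bar>x\<bar> ^ 0 + \<bar>y\<bar> ^ 0)" by simp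
  qed simp
  then show ?thesis unfolding poly_lip_def by (intro exI[of _ "\<bar>L\<bar>"] exI[of _ 0]) simp
qed

section \<open>Real-valued calculus for the integrable elements of \<open>H\<close>\<close>

context sublinear_expectation_space
begin

text \<open>\<open>E\<close> may be infinite. On functions with finite absolute expectation it is
  real (\<open>E_integ\<close>), so \<open>ER\<close> loses nothing there and estimates become
  arithmetic over the reals.\<close>

definition integ :: "('a \<Rightarrow> real) \<Rightarrow> bool" where
  "integ Y \<longleftrightarrow> Y \<in> H \<and> E (\<lambda>\<omega>. \<bar>Y \<omega>\<bar>) < \<infinity>"

definition ER :: "('a \<Rightarrow> real) \<Rightarrow> real" where
  "ER Y = real_of_ereal (E Y)"

lemma H_comp1: "poly_lip f \<Longrightarrow> Y \<in> H \<Longrightarrow> (\<lambda>\<omega>. f (Y \<omega>)) \<in> H"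
  using H_comp[of 1 "\<lambda>_. Y" "\<lambda>x. f (x 0)"] poly_lip_C_l_Lip by simp

lemma H_const: "(\<lambda>\<omega>. c) \<in> H"
  using H_comp1[OF poly_lip_lipschitz[of "\<lambda>_. c" 0] H_zero] by simp

lemma H_abs: "Y \<in> H \<Longrightarrow> (\<lambda>\<omega>. \<bar>Y \<omega>\<bar>) \<in> H"
  using H_comp1[OF poly_lip_lipschitz[of "\<lambda>x. \<bar>x\<bar>" 1]] by simp

lemma H_uminus: "Y \<in> H \<Longrightarrow> (\<lambda>\<omega>. - Y \<omega>) \<in> H"
  using H_scale[of Y "-1"] by simp

lemma integ_H: "integ Y \<Longrightarrow> Y \<in> H" by (simp add: integ_def)

lemma integ_dominated:
  assumes "Y \<in> H" "integ Z" "\<And>\<omega>. \<omega> \<in> space M \<Longrightarrow> \<bar>Y \<omega>\<bar> \<le> Z \<omega>"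
  shows "integ Y"
proof -
  have "E (\<lambda>\<omega>. \<bar>Y \<omega>\<bar>) \<le> E (\<lambda>\<omega>. \<bar>Z \<omega>\<bar>)"
    using assms by (intro E_mono H_abs) (auto simp: integ_def intro: order_trans[OF _ abs_ge_self])
  then show ?thesis using assms by (auto simp: integ_def)
qed

lemma integ_abs: "integ Y \<Longrightarrow> integ (\<lambda>\<omega>. \<bar>Y \<omega>\<bar>)"
  by (simp add: integ_def H_abs)

lemma integ_uminus: "integ Y \<Longrightarrow> integ (\<lambda>\<omega>. - Y \<omega>)"
  by (simp add: integ_def H_uminus)

lemma E_abs_ge_0: "Y \<in> H \<Longrightarrow> 0 \<le> E (\<lambda>\<omega>. \<bar>Y \<omega>\<bar>)"
  using E_mono[of "\<lambda>\<omega>. \<bar>Y \<omega>\<bar>" "\<lambda>\<omega>. 0"] E_const[of 0] H_abs H_zero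
  by (simp add: zero_ereal_def)

text \<open>The value \<infinity> is excluded by comparison with the absolute value; -\<infinity> is
  excluded because subadditivity for \<open>Y\<close> and \<open>- Y\<close> would then give the
  constant 0 the expectation -\<infinity>.\<close>

lemma E_integ:
  assumes "integ Y" shows "E Y = ereal (ER Y)"
proof -
  note Y = integ_H[OF assms]
  have 1: "E Y < \<infinity>"
    using E_mono[of "\<lambda>\<omega>. \<bar>Y \<omega>\<bar>" Y, OF H_abs[OF Y] Y abs_ge_self] assms by (auto simp: integ_def)
  have 2: "E (\<lambda>\<omega>. - Y \<omega>) < \<infinity>"
    using E_mono[of "\<lambda>\<omega>. \<bar>Y \<omega>\<bar>" "\<lambda>\<omega>. - Y \<omega>", OF H_abs[OF Y] H_uminus[OF Y] abs_ge_minus_self] assms by (auto simp: integ_def)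
  have "E Y \<noteq> -\<infinity>"
  proof
    assume *: "E Y = -\<infinity>"
    have "E (\<lambda>\<omega>. Y \<omega> + - Y \<omega>) \<le> E Y + E (\<lambda>\<omega>. - Y \<omega>)"
      using * 2 by (intro E_subadd Y H_uminus) auto
    then show False using * 2 E_const[of 0] by (cases "E (\<lambda>\<omega>. - Y \<omega>)") auto
  qed
  with 1 show ?thesis unfolding ER_def by (cases "E Y") auto
qed

lemma integ_const: "integ (\<lambda>\<omega>. c)"
  using E_const[of "\<bar>c\<bar>"] by (simp add: integ_def H_const)

lemma ER_const [simp]: "ER (\<lambda>\<omega>. c) = c"
  by (simp add: ER_def E_const)

lemma integ_bounded: "Y \<in> H \<Longrightarrow> (\<And>\<omega>. \<omega> \<in> space M \<Longrightarrow> \<bar>Y \<omega>\<bar> \<le> B) \<Longrightarrow> integ Y"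
  using integ_dominated[OF _ integ_const] by blast

lemma integ_add:
  assumes "integ Y" "integ Z" shows "integ (\<lambda>\<omega>. Y \<omega> + Z \<omega>)"
proof -
  have "E (\<lambda>\<omega>. \<bar>Y \<omega> + Z \<omega>\<bar>) \<le> E (\<lambda>\<omega>. \<bar>Y \<omega>\<bar> + \<bar>Z \<omega>\<bar>)"
    using assms by (intro E_mono H_abs H_add) (auto simp: integ_def)
  also have "\<dots> \<le> E (\<lambda>\<omega>. \<bar>Y \<omega>\<bar>) + E (\<lambda>\<omega>. \<bar>Z \<omega>\<bar>)"
    using assms E_abs_ge_0[of Y] E_abs_ge_0[of Z] by (intro E_subadd H_abs) (auto simp: integ_def)
  also have "\<dots> < \<infinity>" using assms by (auto simp: integ_def)
  finally show ?thesis using assms by (auto simp: integ_def intro: H_add)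
qed

lemma integ_scale:
  assumes "integ Y" shows "integ (\<lambda>\<omega>. c * Y \<omega>)"
proof -
  have "E (\<lambda>\<omega>. \<bar>c * Y \<omega>\<bar>) = ereal \<bar>c\<bar> * E (\<lambda>\<omega>. \<bar>Y \<omega>\<bar>)"
    unfolding abs_mult using assms by (intro E_pos_homogeneous H_abs) (auto simp: integ_def)
  also have "\<dots> < \<infinity>"
    using E_integ[OF integ_abs[OF assms]] by simp
  finally show ?thesis using assms by (auto simp: integ_def intro: H_scale)
qed

lemma integ_sum: "(\<And>i. i \<in> I \<Longrightarrow> integ (Y i)) \<Longrightarrow> integ (\<lambda>\<omega>. \<Sum>i\<in>I. Y i \<omega>)"
proof (induction I rule: infinite_finite_induct)
  case (insert x F)
  then show ?case using integ_add[of "Y x" "\<lambda>\<omega>. \<Sum>i\<in>F. Y i \<omega>"] by simp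
qed (simp_all add: integ_const)

lemma ER_mono:
  assumes "integ Y" "integ Z" "\<And>\<omega>. \<omega> \<in> space M \<Longrightarrow> Y \<omega> \<le> Z \<omega>"
  shows "ER Y \<le> ER Z"
  using E_mono[of Z Y] assms by (simp add: E_integ integ_H)

lemma ER_nonneg: "integ Y \<Longrightarrow> (\<And>\<omega>. \<omega> \<in> space M \<Longrightarrow> 0 \<le> Y \<omega>) \<Longrightarrow> 0 \<le> ER Y"
  using ER_mono[OF integ_const, of Y 0] by simp

lemma ER_add_le:
  assumes "integ Y" "integ Z" shows "ER (\<lambda>\<omega>. Y \<omega> + Z \<omega>) \<le> ER Y + ER Z"
  using E_subadd[of Y Z] assms by (simp add: E_integ integ_H integ_add)

lemma ER_scale: "integ Y \<Longrightarrow> 0 \<le> c \<Longrightarrow> ER (\<lambda>\<omega>. c * Y \<omega>) = c * ER Y"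
  using E_pos_homogeneous[of Y c] by (simp add: E_integ integ_H integ_scale)

lemma ER_sum_le:
  "(\<And>i. i \<in> I \<Longrightarrow> integ (Y i)) \<Longrightarrow> ER (\<lambda>\<omega>. \<Sum>i\<in>I. Y i \<omega>) \<le> (\<Sum>i\<in>I. ER (Y i))"
proof (induction I rule: infinite_finite_induct)
  case (insert x F)
  then have "ER (\<lambda>\<omega>. Y x \<omega> + (\<Sum>i\<in>F. Y i \<omega>)) \<le> ER (Y x) + ER (\<lambda>\<omega>. \<Sum>i\<in>F. Y i \<omega>)"
    by (intro ER_add_le integ_sum) auto
  moreover have "ER (\<lambda>\<omega>. \<Sum>i\<in>F. Y i \<omega>) \<le> (\<Sum>i\<in>F. ER (Y i))" using insert by simp
  ultimately show ?case using insert.hyps by simp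
qed simp_all

text \<open>Subadditivity gives one inequality; adding \<open>- c\<close> back and applying it again
  gives the other, so constants pass through a sub-linear expectation exactly.\<close>

lemma ER_const_add:
  assumes "integ Y" shows "ER (\<lambda>\<omega>. c + Y \<omega>) = c + ER Y"
proof (rule antisym)
  show "ER (\<lambda>\<omega>. c + Y \<omega>) \<le> c + ER Y"
    using ER_add_le[OF integ_const assms, of c] by simp
  have "ER (\<lambda>\<omega>. - c + (c + Y \<omega>)) \<le> - c + ER (\<lambda>\<omega>. c + Y \<omega>)"
    using ER_add_le[OF integ_const integ_add[OF integ_const assms], of "-c" c] by simp
  then show "c + ER Y \<le> ER (\<lambda>\<omega>. c + Y \<omega>)" by simp
qed

text \<open>A sub-linear expectation is a contraction in the supremum norm. This keeps Lipschitz
  constants unchanged when a coordinate is integrated out.\<close>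

lemma ER_lip:
  assumes "integ Y" "integ Z" "\<And>\<omega>. \<omega> \<in> space M \<Longrightarrow> \<bar>Y \<omega> - Z \<omega>\<bar> \<le> D"
  shows "\<bar>ER Y - ER Z\<bar> \<le> D"
proof -
  have "ER Y \<le> ER (\<lambda>\<omega>. D + Z \<omega>)"
    using assms by (intro ER_mono integ_add integ_const) (auto simp: abs_le_iff algebra_simps)
  moreover have "ER Z \<le> ER (\<lambda>\<omega>. D + Y \<omega>)"
    using assms by (intro ER_mono integ_add integ_const) (auto simp: abs_le_iff algebra_simps)
  ultimately show ?thesis by (simp add: ER_const_add assms)
qed

end

section \<open>Bounded Lipschitz functions of one and of finitely many coordinates\<close>

definition blip :: "(real \<Rightarrow> real) \<Rightarrow> bool" where
  "blip f \<longleftrightarrow> (\<exists>B. \<forall>x. \<bar>f x\<bar> \<le> B) \<and> (\<exists>L. \<forall>x y. \<bar>f x - f y\<bar> \<le> L * \<bar>x - y\<bar>)"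

text \<open>The l1 distance replaces the Euclidean one because it splits over coordinates: freezing
  or averaging one coordinate just deletes its summand.\<close>

definition BL :: "nat \<Rightarrow> ((nat \<Rightarrow> real) \<Rightarrow> real) \<Rightarrow> bool" where
  "BL d \<phi> \<longleftrightarrow> (\<exists>B. \<forall>x. \<bar>\<phi> x\<bar> \<le> B) \<and> (\<exists>L. \<forall>x y. \<bar>\<phi> x - \<phi> y\<bar> \<le> L * (\<Sum>i<d. \<bar>x i - y i\<bar>))"

lemma BL_bound:
  assumes "BL d \<phi>" obtains B where "0 \<le> B" "\<And>x. \<bar>\<phi> x\<bar> \<le> B"
proof -
  obtain B where "\<And>x. \<bar>\<phi> x\<bar> \<le> B" using assms unfolding BL_def by blast
  moreover have "0 \<le> B" using calculation[of undefined] by linarith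
  ultimately show ?thesis using that by blast
qed

lemma BL_lip:
  assumes "BL d \<phi>" obtains L where "0 \<le> L" "\<And>x y. \<bar>\<phi> x - \<phi> y\<bar> \<le> L * (\<Sum>i<d. \<bar>x i - y i\<bar>)"
proof -
  obtain L where L: "\<And>x y. \<bar>\<phi> x - \<phi> y\<bar> \<le> L * (\<Sum>i<d. \<bar>x i - y i\<bar>)" using assms unfolding BL_def by blast
  have *: "L * s \<le> max 0 L * s" if "0 \<le> s" for s using that by (intro mult_right_mono) auto
  have "\<bar>\<phi> x - \<phi> y\<bar> \<le> max 0 L * (\<Sum>i<d. \<bar>x i - y i\<bar>)" for x y
    using L[of x y] by (rule order_trans) (intro * sum_nonneg, simp)
  then show ?thesis using that[of "max 0 L"] by simp
qed

lemma BL_I: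
  "(\<And>x. \<bar>\<phi> x\<bar> \<le> B) \<Longrightarrow> (\<And>x y. \<bar>\<phi> x - \<phi> y\<bar> \<le> L * (\<Sum>i<d. \<bar>x i - y i\<bar>)) \<Longrightarrow> BL d \<phi>"
  unfolding BL_def by (intro conjI exI allI)

lemma BL_cong:
  assumes "BL d \<phi>" "\<And>i. i < d \<Longrightarrow> x i = y i" shows "\<phi> x = \<phi> y"
proof -
  obtain L where L: "0 \<le> L" "\<And>x y. \<bar>\<phi> x - \<phi> y\<bar> \<le> L * (\<Sum>i<d. \<bar>x i - y i\<bar>)" using BL_lip[OF assms(1)] by metis
  have "(\<Sum>i<d. \<bar>x i - y i\<bar>) = 0" using assms(2) by (intro sum.neutral) auto
  then show ?thesis using L(2)[of x y] by simp
qed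

lemma BL_const: "BL d (\<lambda>_. c)"
  by (rule BL_I[of _ "\<bar>c\<bar>" 0]) auto

lemma BL_mono:
  assumes "BL d \<phi>" "d \<le> d'" shows "BL d' \<phi>"
proof -
  obtain B where B: "0 \<le> B" "\<And>x. \<bar>\<phi> x\<bar> \<le> B" using BL_bound[OF assms(1)] by metis
  obtain L where L: "0 \<le> L" "\<And>x y. \<bar>\<phi> x - \<phi> y\<bar> \<le> L * (\<Sum>i<d. \<bar>x i - y i\<bar>)" using BL_lip[OF assms(1)] by metis
  show ?thesis
  proof (rule BL_I[OF B(2)])
    fix x y :: "nat \<Rightarrow> real"
    have "(\<Sum>i<d. \<bar>x i - y i\<bar>) \<le> (\<Sum>i<d'. \<bar>x i - y i\<bar>)" using assms(2) by (intro sum_mono2) auto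
    then show "\<bar>\<phi> x - \<phi> y\<bar> \<le> L * (\<Sum>i<d'. \<bar>x i - y i\<bar>)" using L(2)[of x y] mult_left_mono[OF _ L(1)] order_trans by blast
  qed
qed

lemma BL_add:
  assumes "BL d \<phi>" "BL d \<psi>" shows "BL d (\<lambda>x. \<phi> x + \<psi> x)"
proof -
  obtain B where B: "0 \<le> B" "\<And>x. \<bar>\<phi> x\<bar> \<le> B" using BL_bound[OF assms(1)] by metis
  obtain L where L: "0 \<le> L" "\<And>x y. \<bar>\<phi> x - \<phi> y\<bar> \<le> L * (\<Sum>i<d. \<bar>x i - y i\<bar>)" using BL_lip[OF assms(1)] by metis
  obtain B' where B': "0 \<le> B'" "\<And>x. \<bar>\<psi> x\<bar> \<le> B'" using BL_bound[OF assms(2)] by metis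
  obtain L' where L': "0 \<le> L'" "\<And>x y. \<bar>\<psi> x - \<psi> y\<bar> \<le> L' * (\<Sum>i<d. \<bar>x i - y i\<bar>)" using BL_lip[OF assms(2)] by metis
  show ?thesis
  proof (rule BL_I[of _ "B + B'" "L + L'"])
    show "\<bar>\<phi> x + \<psi> x\<bar> \<le> B + B'" for x using B(2)[of x] B'(2)[of x] by linarith
    show "\<bar>\<phi> x + \<psi> x - (\<phi> y + \<psi> y)\<bar> \<le> (L + L') * (\<Sum>i<d. \<bar>x i - y i\<bar>)" for x y
      unfolding distrib_right using L(2)[of x y] L'(2)[of x y] by linarith
  qed
qed

lemma BL_mult:
  assumes "BL d \<phi>" "BL d \<psi>" shows "BL d (\<lambda>x. \<phi> x * \<psi> x)"
proof -
  obtain B where B: "0 \<le> B" "\<And>x. \<bar>\<phi> x\<bar> \<le> B" using BL_bound[OF assms(1)] by metis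
  obtain L where L: "0 \<le> L" "\<And>x y. \<bar>\<phi> x - \<phi> y\<bar> \<le> L * (\<Sum>i<d. \<bar>x i - y i\<bar>)" using BL_lip[OF assms(1)] by metis
  obtain B' where B': "0 \<le> B'" "\<And>x. \<bar>\<psi> x\<bar> \<le> B'" using BL_bound[OF assms(2)] by metis
  obtain L' where L': "0 \<le> L'" "\<And>x y. \<bar>\<psi> x - \<psi> y\<bar> \<le> L' * (\<Sum>i<d. \<bar>x i - y i\<bar>)" using BL_lip[OF assms(2)] by metis
  show ?thesis
  proof (rule BL_I[of _ "B * B'" "B * L' + B' * L"])
    show "\<bar>\<phi> x * \<psi> x\<bar> \<le> B * B'" for x unfolding abs_mult using B B' by (intro mult_mono) auto
    fix x y :: "nat \<Rightarrow> real"
    let ?s = "\<Sum>i<d. \<bar>x i - y i\<bar>"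
    have "\<phi> x * \<psi> x - \<phi> y * \<psi> y = \<phi> x * (\<psi> x - \<psi> y) + \<psi> y * (\<phi> x - \<phi> y)" by (simp add: algebra_simps)
    also have "\<bar>\<dots>\<bar> \<le> \<bar>\<phi> x\<bar> * \<bar>\<psi> x - \<psi> y\<bar> + \<bar>\<psi> y\<bar> * \<bar>\<phi> x - \<phi> y\<bar>"
      by (metis abs_mult abs_triangle_ineq)
    also have "\<dots> \<le> B * (L' * ?s) + B' * (L * ?s)"
      using B B' L L' by (intro add_mono mult_mono) auto
    finally show "\<bar>\<phi> x * \<psi> x - \<phi> y * \<psi> y\<bar> \<le> (B * L' + B' * L) * ?s" by (simp add: algebra_simps)
  qed
qed

text \<open>Local Lipschitz continuity of \<open>h\<close> suffices because the values of
  \<open>\<phi>\<close> stay in a bounded interval; this admits the exponential.\<close>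

lemma BL_comp:
  assumes "BL d \<phi>" and h: "\<And>B. \<exists>L. \<forall>u v. \<bar>u\<bar> \<le> B \<longrightarrow> \<bar>v\<bar> \<le> B \<longrightarrow> \<bar>h u - h v\<bar> \<le> L * \<bar>u - v\<bar>"
  shows "BL d (\<lambda>x. h (\<phi> x))"
proof -
  obtain B where B: "0 \<le> B" "\<And>x. \<bar>\<phi> x\<bar> \<le> B" using BL_bound[OF assms(1)] by metis
  obtain L where L: "0 \<le> L" "\<And>x y. \<bar>\<phi> x - \<phi> y\<bar> \<le> L * (\<Sum>i<d. \<bar>x i - y i\<bar>)" using BL_lip[OF assms(1)] by metis
  obtain K where K: "\<And>u v. \<bar>u\<bar> \<le> B \<Longrightarrow> \<bar>v\<bar> \<le> B \<Longrightarrow> \<bar>h u - h v\<bar> \<le> K * \<bar>u - v\<bar>" using h[of B] by blast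
  have K': "\<bar>h u - h v\<bar> \<le> \<bar>K\<bar> * \<bar>u - v\<bar>" if "\<bar>u\<bar> \<le> B" "\<bar>v\<bar> \<le> B" for u v
    using K[OF that] by (smt (verit) abs_ge_zero mult_right_mono)
  show ?thesis
  proof (rule BL_I[of _ "\<bar>h 0\<bar> + \<bar>K\<bar> * B" "\<bar>K\<bar> * L"])
    fix x
    have "\<bar>h (\<phi> x) - h 0\<bar> \<le> \<bar>K\<bar> * \<bar>\<phi> x - 0\<bar>" using B by (intro K') auto
    also have "\<dots> \<le> \<bar>K\<bar> * B" using B by (intro mult_left_mono) auto
    finally show "\<bar>h (\<phi> x)\<bar> \<le> \<bar>h 0\<bar> + \<bar>K\<bar> * B" by linarith
  next
    fix x y
    have "\<bar>h (\<phi> x) - h (\<phi> y)\<bar> \<le> \<bar>K\<bar> * \<bar>\<phi> x - \<phi> y\<bar>" using B by (intro K') auto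
    also have "\<dots> \<le> \<bar>K\<bar> * (L * (\<Sum>i<d. \<bar>x i - y i\<bar>))" using L by (intro mult_left_mono) auto
    finally show "\<bar>h (\<phi> x) - h (\<phi> y)\<bar> \<le> \<bar>K\<bar> * L * (\<Sum>i<d. \<bar>x i - y i\<bar>)" by (simp add: mult.assoc)
  qed
qed

lemma exp_lipschitz_le:
  fixes u v :: real assumes "u \<le> B" "v \<le> B" shows "\<bar>exp u - exp v\<bar> \<le> exp B * \<bar>u - v\<bar>"
proof -
  have *: "exp b - exp a \<le> exp B * (b - a)" if "a \<le> b" "b \<le> B" for a b :: real
  proof -
    have "1 - exp (a - b) \<le> b - a" using exp_ge_add_one_self[of "a - b"] by linarith
    then have "exp b * (1 - exp (a - b)) \<le> exp B * (b - a)" using that by (intro mult_mono) auto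
    then show ?thesis by (simp add: algebra_simps exp_diff)
  qed
  show ?thesis
  proof (cases "u \<le> v")
    case True then show ?thesis using *[of u v] assms exp_le_cancel_iff[of u v] by simp
  next
    case False then show ?thesis using *[of v u] assms exp_le_cancel_iff[of v u] by simp
  qed
qed

lemma BL_exp: "BL d \<phi> \<Longrightarrow> BL d (\<lambda>x. exp (\<phi> x))"
proof (erule BL_comp)
  fix B
  show "\<exists>L. \<forall>u v::real. \<bar>u\<bar> \<le> B \<longrightarrow> \<bar>v\<bar> \<le> B \<longrightarrow> \<bar>exp u - exp v\<bar> \<le> L * \<bar>u - v\<bar>"
    by (intro exI[of _ "exp B"] allI impI exp_lipschitz_le) auto
qed

lemma BL_lipschitz_comp: "BL d \<phi> \<Longrightarrow> (\<And>u v. \<bar>h u - h v\<bar> \<le> L * \<bar>u - v\<bar>) \<Longrightarrow> BL d (\<lambda>x. h (\<phi> x))"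
  by (erule BL_comp) (intro exI allI impI)

lemma BL_sum: "(\<And>i. i \<in> I \<Longrightarrow> BL d (\<phi> i)) \<Longrightarrow> BL d (\<lambda>x. \<Sum>i\<in>I. \<phi> i x)"
  by (induction I rule: infinite_finite_induct) (auto intro: BL_const BL_add)

lemma BL_prod: "(\<And>i. i \<in> I \<Longrightarrow> BL d (\<phi> i)) \<Longrightarrow> BL d (\<lambda>x. \<Prod>i\<in>I. \<phi> i x)"
  by (induction I rule: infinite_finite_induct) (auto intro: BL_const BL_mult)

lemma BL_scale: "BL d \<phi> \<Longrightarrow> BL d (\<lambda>x. c * \<phi> x)"
  by (intro BL_mult BL_const)

lemma BL_diff: "BL d \<phi> \<Longrightarrow> BL d \<psi> \<Longrightarrow> BL d (\<lambda>x. \<phi> x - \<psi> x)"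
  using BL_add[OF _ BL_scale[of d \<psi> "-1"]] by simp

lemma blip_lip:
  assumes "blip f" obtains L where "0 \<le> L" "\<And>x y. \<bar>f x - f y\<bar> \<le> L * \<bar>x - y\<bar>"
proof -
  obtain L where L: "\<And>x y. \<bar>f x - f y\<bar> \<le> L * \<bar>x - y\<bar>" using assms unfolding blip_def by blast
  have "0 \<le> L" using L[of 0 1] by simp
  with L show ?thesis using that by blast
qed

lemma blip_bound:
  assumes "blip f" obtains B where "0 \<le> B" "\<And>x. \<bar>f x\<bar> \<le> B"
proof -
  obtain B where B: "\<And>x. \<bar>f x\<bar> \<le> B" using assms unfolding blip_def by blast
  moreover have "0 \<le> B" using B[of undefined] by linarith
  ultimately show ?thesis using that by blast
qed

lemma BL_coord:
  assumes "blip f" "i < d" shows "BL d (\<lambda>x. f (x i))"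
proof -
  obtain B where B: "\<And>x. \<bar>f x\<bar> \<le> B" using blip_bound[OF assms(1)] by metis
  obtain L where L: "0 \<le> L" "\<And>x y. \<bar>f x - f y\<bar> \<le> L * \<bar>x - y\<bar>" using blip_lip[OF assms(1)] by metis
  show ?thesis
  proof (rule BL_I[OF B])
    fix x y :: "nat \<Rightarrow> real"
    have "\<bar>x i - y i\<bar> \<le> (\<Sum>i<d. \<bar>x i - y i\<bar>)" using assms(2) by (intro member_le_sum) auto
    then show "\<bar>f (x i) - f (y i)\<bar> \<le> L * (\<Sum>i<d. \<bar>x i - y i\<bar>)"
      using L(2)[of "x i" "y i"] mult_left_mono[OF _ L(1)] order_trans by blast
  qed
qed

lemma blip_poly_lip: "blip f \<Longrightarrow> poly_lip f"
  by (erule blip_lip) (rule poly_lip_lipschitz)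

lemma blip_exp: "blip f \<Longrightarrow> blip (\<lambda>x. exp (f x))"
proof -
  assume f: "blip f"
  obtain B where B: "0 \<le> B" "\<And>x. \<bar>f x\<bar> \<le> B" using blip_bound[OF f] by metis
  obtain L where L: "0 \<le> L" "\<And>x y. \<bar>f x - f y\<bar> \<le> L * \<bar>x - y\<bar>" using blip_lip[OF f] by metis
  have le: "f x \<le> B" for x using B(2)[of x] by linarith
  have "\<bar>exp (f x) - exp (f y)\<bar> \<le> exp B * L * \<bar>x - y\<bar>" for x y
    unfolding mult.assoc
    by (rule order_trans[OF exp_lipschitz_le[OF le le] mult_left_mono[OF L(2)]]) simp
  moreover have "\<bar>exp (f x)\<bar> \<le> exp B" for x using le by simp
  ultimately show ?thesis unfolding blip_def by blast
qed

text \<open>Exponent 0 in the polynomial factor is enough. The l1 distance is at most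
  \<open>d\<close> times the Euclidean one, whence the constant; the added 1 keeps it
  positive.\<close>

lemma BL_C_l_Lip:
  assumes "BL d \<phi>" shows "C_l_Lip d \<phi>"
proof -
  obtain L where L: "0 \<le> L" "\<And>x y. \<bar>\<phi> x - \<phi> y\<bar> \<le> L * (\<Sum>i<d. \<bar>x i - y i\<bar>)" using BL_lip[OF assms(1)] by metis
  have *: "(\<Sum>i<d. \<bar>z i\<bar>) \<le> d * L2_set z {..<d}" for z :: "nat \<Rightarrow> real"
    using sum_bounded_above[of "{..<d}" "\<lambda>i. \<bar>z i\<bar>" "L2_set z {..<d}"]
    using member_le_L2_set[of "{..<d}" _ "\<lambda>i. \<bar>z i\<bar>"] by (simp add: L2_set_def)
  have "\<bar>\<phi> x - \<phi> y\<bar> \<le> (L * d + 1) * (1 + L2_set x {..<d} ^ 0 + L2_set y {..<d} ^ 0) * L2_set (\<lambda>i. x i - y i) {..<d}" for x y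
  proof -
    have "\<bar>\<phi> x - \<phi> y\<bar> \<le> L * (\<Sum>i<d. \<bar>x i - y i\<bar>)" by (rule L)
    also have "\<dots> \<le> L * (d * L2_set (\<lambda>i. x i - y i) {..<d})" using * L by (intro mult_left_mono) auto
    also have "\<dots> \<le> ((L * d + 1) * (1 + L2_set x {..<d} ^ 0 + L2_set y {..<d} ^ 0)) * L2_set (\<lambda>i. x i - y i) {..<d}"
      unfolding mult.assoc[symmetric] using L by (intro mult_right_mono) (auto simp: algebra_simps)
    finally show ?thesis .
  qed
  then show ?thesis unfolding C_l_Lip_def using L by (intro exI[of _ "L * d + 1"] conjI exI[of _ 0]) (auto simp: add_nonneg_pos)
qed

lemma BL_copy_H: assumes "BL d \<phi>" shows "\<phi> \<in> copy_H"
  \<comment> \<open>\<open>copy_H\<close> asks for a positive dimension, whereas \<open>BL 0\<close>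
    contains the constants.\<close>
  using BL_C_l_Lip[OF BL_mono[OF assms, of "max 1 d"]] unfolding copy_H_def by (auto intro!: exI[of _ "max 1 d"])

section \<open>The maximal inequality and null sets\<close>

lemma blip_update: "BL (Suc m) \<phi> \<Longrightarrow> blip (\<lambda>v. \<phi> (x(m := v)))"
proof -
  assume a: "BL (Suc m) \<phi>"
  obtain B where B: "0 \<le> B" "\<And>x. \<bar>\<phi> x\<bar> \<le> B" using BL_bound[OF a] by metis
  obtain L where L: "0 \<le> L" "\<And>x y. \<bar>\<phi> x - \<phi> y\<bar> \<le> L * (\<Sum>i<Suc m. \<bar>x i - y i\<bar>)" using BL_lip[OF a] by metis
  have "(\<Sum>i<Suc m. \<bar>(x(m := u)) i - (x(m := v)) i\<bar>) = \<bar>u - v\<bar>" for u v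
    by simp
  then have "\<bar>\<phi> (x(m := u)) - \<phi> (x(m := v))\<bar> \<le> L * \<bar>u - v\<bar>" for u v
    using L(2)[of "x(m := u)" "x(m := v)"] by simp
  then show ?thesis unfolding blip_def using B(2) by blast
qed

lemma (in sublinear_expectation_space) integ_blip: assumes "blip f" "Y \<in> H" shows "integ (\<lambda>\<omega>. f (Y \<omega>))"
proof -
  obtain B where B: "0 \<le> B" "\<And>x. \<bar>f x\<bar> \<le> B" using blip_bound[OF assms(1)] by metis
  show ?thesis by (rule integ_bounded[OF H_comp1[OF blip_poly_lip[OF assms(1)] assms(2)]]) (rule B)
qed

section \<open>The copied expectation of an independent sequence and its tower property\<close>

locale indep_rv_sequence = sublinear_expectation_space M H E
  for M :: "'a measure" and H :: "('a \<Rightarrow> real) set" and E :: "('a \<Rightarrow> real) \<Rightarrow> ereal" +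
  fixes X :: "nat \<Rightarrow> 'a \<Rightarrow> real"
  assumes indep: "indep_sequence H E X"
begin

lemma X_H: "X (Suc j) \<in> H"
  using indep unfolding indep_sequence_def by simp

definition F :: "((nat \<Rightarrow> real) \<Rightarrow> real) \<Rightarrow> real" where
  "F \<phi> = ER (\<lambda>\<omega>. \<phi> (\<lambda>i. X (Suc i) \<omega>))"

lemma H_copy: "\<phi> \<in> copy_H \<Longrightarrow> (\<lambda>\<omega>. \<phi> (\<lambda>i. X (Suc i) \<omega>)) \<in> H"
  unfolding copy_H_def using H_comp[of _ "\<lambda>i. X (Suc i)" \<phi>] X_H by blast

lemma integ_BL:
  assumes "BL d \<phi>" shows "integ (\<lambda>\<omega>. \<phi> (\<lambda>i. X (Suc i) \<omega>))"
proof -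
  obtain B where B: "0 \<le> B" "\<And>x. \<bar>\<phi> x\<bar> \<le> B" using BL_bound[OF assms] by metis
  show ?thesis by (rule integ_bounded[OF H_copy[OF BL_copy_H[OF assms]]]) (rule B)
qed

lemma copy_E_BL: "BL d \<phi> \<Longrightarrow> copy_E E X \<phi> = ereal (F \<phi>)"
  unfolding copy_E_def F_def by (rule E_integ[OF integ_BL])

lemma F_mono: "BL d \<phi> \<Longrightarrow> BL d \<psi> \<Longrightarrow> (\<And>x. \<phi> x \<le> \<psi> x) \<Longrightarrow> F \<phi> \<le> F \<psi>"
  unfolding F_def by (intro ER_mono integ_BL)

lemma F_const [simp]: "F (\<lambda>_. c) = c"
  unfolding F_def by simp

text \<open>Integrating out the last coordinate keeps both the bound and the Lipschitz constant:
  \<open>ER\<close> is a supremum norm contraction, and coordinate \<open>m\<close> carries the same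
  value on both sides, so it drops out of the l1 distance.\<close>

lemma BL_cond:
  assumes "BL (Suc m) \<phi>"
  shows "BL m (\<lambda>x. ER (\<lambda>\<omega>. \<phi> (x(m := X (Suc m) \<omega>))))"
proof -
  obtain B where B: "0 \<le> B" "\<And>x. \<bar>\<phi> x\<bar> \<le> B" using BL_bound[OF assms(1)] by metis
  obtain L where L: "0 \<le> L" "\<And>x y. \<bar>\<phi> x - \<phi> y\<bar> \<le> L * (\<Sum>i<Suc m. \<bar>x i - y i\<bar>)" using BL_lip[OF assms(1)] by metis
  have I: "integ (\<lambda>\<omega>. \<phi> (x(m := X (Suc m) \<omega>)))" for x
    by (rule integ_blip[OF blip_update[OF assms] X_H])
  show ?thesis
  proof (rule BL_I[of _ B L])
    show "\<bar>ER (\<lambda>\<omega>. \<phi> (x(m := X (Suc m) \<omega>)))\<bar> \<le> B" for x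
      using ER_lip[OF I[of x] integ_const[of 0], of B] B by simp
    fix x y :: "nat \<Rightarrow> real"
    show "\<bar>ER (\<lambda>\<omega>. \<phi> (x(m := X (Suc m) \<omega>))) - ER (\<lambda>\<omega>. \<phi> (y(m := X (Suc m) \<omega>)))\<bar>
        \<le> L * (\<Sum>i<m. \<bar>x i - y i\<bar>)"
    proof (rule ER_lip[OF I I])
      fix \<omega>
      show "\<bar>\<phi> (x(m := X (Suc m) \<omega>)) - \<phi> (y(m := X (Suc m) \<omega>))\<bar> \<le> L * (\<Sum>i<m. \<bar>x i - y i\<bar>)"
        using L(2)[of "x(m := X (Suc m) \<omega>)" "y(m := X (Suc m) \<omega>)"] by simp
    qed
  qed
qed

lemma BL_abs: "BL d \<phi> \<Longrightarrow> BL d (\<lambda>x. \<bar>\<phi> x\<bar>)"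
  by (rule BL_lipschitz_comp[where L = 1]) auto

text \<open>Fubini for the copied expectation. For bounded Lipschitz functions every side condition
  in \<open>indep_to\<close> (finiteness, and membership of both inner expectations in
  \<open>H\<close>) holds automatically, so independence applies.\<close>

lemma F_cond:
  assumes \<phi>: "BL (Suc m) \<phi>"
  shows "F \<phi> = F (\<lambda>x. ER (\<lambda>\<omega>. \<phi> (x(m := X (Suc m) \<omega>))))"
proof (cases "m = 0")
  case True
  \<comment> \<open>Independence is postulated only with a nonempty past. Without a past,
    \<open>\<phi>\<close> depends on one coordinate, and the inner expectation is already the whole
    one.\<close>
  have "ER (\<lambda>\<omega>. \<phi> (x(m := X (Suc m) \<omega>))) = F \<phi>" for x
    unfolding F_def by (intro arg_cong[where f = ER] ext BL_cong[OF \<phi>]) (simp add: True)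
  then show ?thesis by simp
next
  case False
  let ?X = "\<lambda>\<omega> j. X (Suc j) \<omega>"
  let ?up = "\<lambda>\<phi> x. ER (\<lambda>\<omega>. \<phi> (x(m := X (Suc m) \<omega>)))"
  \<comment> \<open>\<open>concat_vec\<close> repeats the new variable from coordinate
    \<open>m\<close> on, while the update keeps the old tail; \<open>\<phi>\<close> sees only the
    coordinates up to \<open>m\<close> and cannot tell the difference.\<close>
  have conc: "\<psi> (concat_vec m x (\<lambda>i. X (Suc m) \<omega>)) = \<psi> (x(m := X (Suc m) \<omega>))"
    if "BL (Suc m) \<psi>" for \<psi> x \<omega>
    by (rule BL_cong[OF that]) (auto simp: concat_vec_def)
  note c = conc[OF \<phi>] conc[OF BL_abs[OF \<phi>]]
  have ind: "indep_to H E m (\<lambda>j. X (Suc j)) 1 (\<lambda>_. X (Suc m))"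
    using indep False unfolding indep_sequence_def by simp
  have lip: "C_l_Lip (m + 1) \<phi>" using BL_C_l_Lip[OF \<phi>] by simp
  have I: "integ (\<lambda>\<omega>. \<psi> (x(m := X (Suc m) \<omega>)))" if "BL (Suc m) \<psi>" for x \<psi>
    by (rule integ_blip[OF blip_update[OF that] X_H])
  have J: "integ (\<lambda>\<omega>. ?up \<psi> (?X \<omega>))" if "BL (Suc m) \<psi>" for \<psi>
    using integ_BL[OF BL_cond[OF that]] .
  let ?c = "\<lambda>x \<omega>. concat_vec m x (\<lambda>i. X (Suc m) \<omega>)"
  have "(\<forall>x. E (\<lambda>\<omega>. \<bar>\<phi> (?c x \<omega>)\<bar>) < \<infinity>) \<longrightarrow>
      (\<lambda>\<omega>. real_of_ereal (E (\<lambda>\<omega>'. \<phi> (?c (?X \<omega>) \<omega>')))) \<in> H \<longrightarrow>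
      (\<lambda>\<omega>. real_of_ereal (E (\<lambda>\<omega>'. \<bar>\<phi> (?c (?X \<omega>) \<omega>')\<bar>))) \<in> H \<longrightarrow>
      E (\<lambda>\<omega>. \<bar>real_of_ereal (E (\<lambda>\<omega>'. \<bar>\<phi> (?c (?X \<omega>) \<omega>')\<bar>))\<bar>) < \<infinity> \<longrightarrow>
      E (\<lambda>\<omega>. \<phi> (?c (?X \<omega>) \<omega>)) = E (\<lambda>\<omega>. real_of_ereal (E (\<lambda>\<omega>'. \<phi> (?c (?X \<omega>) \<omega>'))))"
    using ind lip unfolding indep_to_def Let_def by blast
  then have "E (\<lambda>\<omega>. \<phi> (?c (?X \<omega>) \<omega>)) = E (\<lambda>\<omega>. real_of_ereal (E (\<lambda>\<omega>'. \<phi> (?c (?X \<omega>) \<omega>'))))"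
    unfolding c
    using I[OF BL_abs[OF \<phi>]] J[OF BL_abs[OF \<phi>]] J[OF \<phi>] unfolding integ_def ER_def by simp
  \<comment> \<open>Once the past is filled with the variables themselves, the update is
    vacuous.\<close>
  moreover have "(?X \<omega>)(m := X (Suc m) \<omega>) = ?X \<omega>" for \<omega> by auto
  ultimately show ?thesis unfolding F_def c by (simp add: ER_def)
qed

lemma V_outer_le: "\<xi> \<in> copy_H \<Longrightarrow> (\<And>x. indicator A x \<le> \<xi> x) \<Longrightarrow> V_outer E X A \<le> copy_E E X \<xi>"
  unfolding V_outer_def by (intro INF_lower) auto

lemma V_outer_le_F: "BL d \<xi> \<Longrightarrow> (\<And>x. indicator A x \<le> \<xi> x) \<Longrightarrow> V_outer E X A \<le> ereal (F \<xi>)"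
  using V_outer_le[OF BL_copy_H] by (simp add: copy_E_BL[symmetric])

lemma copy_E_nonneg:
  assumes "\<xi> \<in> copy_H" "\<And>x. 0 \<le> \<xi> x" shows "0 \<le> copy_E E X \<xi>"
proof -
  have "E (\<lambda>\<omega>. 0) \<le> copy_E E X \<xi>"
    unfolding copy_E_def using assms by (intro E_mono H_copy H_zero) auto
  then show ?thesis using E_const[of 0] by (simp add: zero_ereal_def)
qed

lemma V_outer_nonneg: "0 \<le> V_outer E X A"
  unfolding V_outer_def by (rule INF_greatest) (auto intro!: copy_E_nonneg intro: order_trans[OF indicator_pos_le])

lemma V_outer_le_1: "V_outer E X A \<le> 1"
  using V_outer_le_F[OF BL_const[of 0 1], of A] by (simp add: indicator_def one_ereal_def)

lemma V_outer_empty: "V_outer E X {} = 0"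
  using V_outer_le_F[OF BL_const[of 0 0], of "{}"] V_outer_nonneg[of "{}"] by (simp add: antisym zero_ereal_def)

text \<open>
  The function \<open>\<Phi> m\<close> below is the expected final payoff of the supermartingale
  $z_m = e^{U_m - c_1 - \dots - c_m}$ stopped when \<open>U\<close> exceeds the level \<open>K\<close>, where stopping is
  smoothed by the Lipschitz weights \<open>g\<close> so that all functions stay in the domain of \<open>E\<close>.
\<close>

lemma maximal_inequality:
  assumes f: "\<And>j. j < n \<Longrightarrow> blip (f j)"
    and c0: "\<And>j. j < n \<Longrightarrow> 0 \<le> c j"
    and c: "\<And>j. j < n \<Longrightarrow> ER (\<lambda>\<omega>. exp (f j (X (Suc j) \<omega>))) \<le> exp (c j)"
  shows "V_outer E X {x. \<exists>m\<le>n. K + 1 \<le> (\<Sum>j<m. f j (x j))} \<le> ereal (exp ((\<Sum>j<n. c j) - K))"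
proof -
  define U where "U m x = (\<Sum>j<m. f j (x j))" for m and x :: "nat \<Rightarrow> real"
  \<comment> \<open>A ramp between \<open>K\<close> and \<open>K + 1\<close> in place of a sharp
    stopping rule; this is why the event in the claim has level \<open>K + 1\<close>.\<close>
  define g where "g u = min 1 (max 0 (u - K))" for u
  \<comment> \<open>\<open>B m\<close> is the weight not yet stopped after time \<open>m\<close>,
    and \<open>D m\<close> below is the part of the exponential budget still to be spent.\<close>
  define B where "B m x = (\<Prod>i<Suc m. 1 - g (U i x))" for m x
  define D where "D m = (\<Sum>j=m..<n. c j)" for m
  define \<Phi> where "\<Phi> m x = 1 - B m x + B m x * exp (U m x + (D m - K))" for m x
  have gL: "\<bar>g u - g v\<bar> \<le> 1 * \<bar>u - v\<bar>" for u v unfolding g_def by auto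
  have g01: "0 \<le> g u" "g u \<le> 1" for u unfolding g_def by auto
  have BLU: "BL d (U m)" if "m \<le> d" "d \<le> n" for m d
    unfolding U_def using that by (intro BL_sum BL_coord f) auto
  have BLB: "BL d (B m)" if "m \<le> d" "d \<le> n" for m d
    unfolding B_def using that by (intro BL_prod BL_diff BL_const BL_lipschitz_comp[OF BLU gL]) auto
  have BL\<Phi>: "BL d (\<Phi> m)" if "m \<le> d" "d \<le> n" for m d
    unfolding \<Phi>_def using that by (intro BL_add BL_mult BL_diff BL_const BL_exp BLU BLB)
  have B01: "0 \<le> B m x" "B m x \<le> 1" for m x
    unfolding B_def using g01 by (intro prod_nonneg prod_le_1; simp)+
  have D_Suc: "D m = c m + D (Suc m)" if "m < n" for m
    unfolding D_def using that by (simp add: sum.atLeast_Suc_lessThan)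
  have D0: "0 \<le> D m" for m unfolding D_def using c0 by (intro sum_nonneg) auto
  have step: "F (\<Phi> (Suc m)) \<le> F (\<Phi> m)" if m: "m < n" for m
  proof -
    let ?e = "\<lambda>\<omega>. exp (f m (X (Suc m) \<omega>))"
    have bf: "blip (\<lambda>v. exp (f m v))" by (intro blip_exp f m)
    have e: "integ ?e" by (rule integ_blip[OF bf X_H])
    have "ER (\<lambda>\<omega>. \<Phi> (Suc m) (x(m := X (Suc m) \<omega>))) \<le> \<Phi> m x" for x
    proof -
      define b where "b = B m x * exp (U m x + (D (Suc m) - K))"
      have b: "0 \<le> b" unfolding b_def using B01 by simp
      have "ER (\<lambda>\<omega>. \<Phi> (Suc m) (x(m := X (Suc m) \<omega>))) \<le> ER (\<lambda>\<omega>. (1 - B m x) + b * ?e \<omega>)"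
      proof (rule ER_mono)
        show "integ (\<lambda>\<omega>. \<Phi> (Suc m) (x(m := X (Suc m) \<omega>)))"
          using m by (intro integ_blip[OF blip_update X_H] BL\<Phi>) auto
        show "integ (\<lambda>\<omega>. (1 - B m x) + b * ?e \<omega>)"
          by (intro integ_add integ_const integ_scale e)
        fix \<omega>
        define v where "v = X (Suc m) \<omega>"
        have Ui: "U i (x(m := v)) = U i x" if "i \<le> m" for i
          unfolding U_def using that by (intro sum.cong) auto
        have US: "U (Suc m) (x(m := v)) = U m x + f m v"
          unfolding U_def by simp
        define z where "z = exp (U m x + f m v + (D (Suc m) - K))"
        define q where "q = g (U m x + f m v)"
        have "B (Suc m) (x(m := v)) = (\<Prod>i<Suc m. 1 - g (U i (x(m := v)))) * (1 - q)"
          unfolding B_def q_def by (subst prod.lessThan_Suc) (simp add: US)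
        also have "(\<Prod>i<Suc m. 1 - g (U i (x(m := v)))) = B m x"
          unfolding B_def by (intro prod.cong) (auto simp: Ui)
        finally have BS: "B (Suc m) (x(m := v)) = B m x * (1 - q)" .
        \<comment> \<open>Stopping the weight \<open>q\<close> pays 1 instead of \<open>z\<close>.
          It happens only above level \<open>K\<close>, where the remaining budget is nonnegative
          and hence \<open>z\<close> is at least 1.\<close>
        have qz: "q \<le> q * z"
        proof (cases "U m x + f m v \<le> K")
          case True then show ?thesis unfolding q_def g_def by simp
        next
          case False
          then have "1 \<le> z" unfolding z_def using D0[of "Suc m"] by simp
          then have "q * 1 \<le> q * z" using g01 by (intro mult_left_mono) (auto simp: q_def)
          then show ?thesis by simp
        qed
        have "\<Phi> (Suc m) (x(m := v)) = 1 - B m x + B m x * (q + (1 - q) * z)"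
          unfolding \<Phi>_def BS US z_def by (simp add: algebra_simps)
        also have "\<dots> \<le> 1 - B m x + B m x * z"
          using qz B01 by (intro add_left_mono mult_left_mono) (auto simp: algebra_simps)
        also have "\<dots> = (1 - B m x) + b * exp (f m v)"
          unfolding b_def z_def by (simp add: exp_add[symmetric] algebra_simps)
        finally show "\<Phi> (Suc m) (x(m := X (Suc m) \<omega>)) \<le> (1 - B m x) + b * exp (f m (X (Suc m) \<omega>))"
          unfolding v_def .
      qed
      also have "\<dots> = 1 - B m x + b * ER ?e"
        by (simp add: ER_const_add integ_scale e ER_scale b)
      also have "\<dots> \<le> 1 - B m x + b * exp (c m)"
        using c[OF m] b by (intro add_left_mono mult_left_mono)
      also have "\<dots> = \<Phi> m x"
        unfolding \<Phi>_def b_def D_Suc[OF m] by (simp add: exp_add exp_diff field_simps)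
      finally show ?thesis .
    qed
    then show ?thesis
      using m by (subst F_cond[OF BL\<Phi>[of "Suc m" "Suc m"]])
        (simp_all add: F_mono[OF BL_cond[OF BL\<Phi>[of "Suc m" "Suc m"]] BL\<Phi>[of m m]])
  qed
  have "F (\<Phi> m) \<le> F (\<Phi> 0)" if "m \<le> n" for m using that
  proof (induction m)
    case (Suc m) then show ?case using step[of m] by simp
  qed simp
  then have "F (\<Phi> n) \<le> F (\<Phi> 0)" by simp
  also have "\<Phi> 0 x \<le> exp (D 0 - K)" for x
  proof (cases "0 \<le> K")
    case True
    then have "B 0 x = 1" unfolding B_def U_def g_def by simp
    then show ?thesis unfolding \<Phi>_def U_def by simp
  next
    \<comment> \<open>For negative \<open>K\<close> some weight is stopped at time 0 already, but
      then the claimed bound is at least 1.\<close>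
    case False
    then have "1 \<le> exp (D 0 - K)" using D0[of 0] by simp
    then have "(1 - B 0 x) * 1 + B 0 x * exp (D 0 - K) \<le> (1 - B 0 x) * exp (D 0 - K) + B 0 x * exp (D 0 - K)"
      using B01[of 0 x] by (intro add_right_mono mult_left_mono) auto
    then show ?thesis unfolding \<Phi>_def U_def by (simp add: algebra_simps)
  qed
  then have "F (\<Phi> 0) \<le> F (\<lambda>_. exp (D 0 - K))" by (intro F_mono[OF BL\<Phi>[of 0 0] BL_const]) auto
  finally have 1: "F (\<Phi> n) \<le> exp ((\<Sum>j<n. c j) - K)" by (simp add: D_def atLeast0LessThan)
  have "V_outer E X {x. \<exists>m\<le>n. K + 1 \<le> U m x} \<le> ereal (F (\<Phi> n))"
  proof (rule V_outer_le_F[OF BL\<Phi>[of n n]])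
    fix x
    have nn: "0 \<le> \<Phi> n x" unfolding \<Phi>_def using B01[of n x] by simp
    show "indicator {x. \<exists>m\<le>n. K + 1 \<le> U m x} x \<le> \<Phi> n x"
    proof (cases "\<exists>m\<le>n. K + 1 \<le> U m x")
      case True
      then obtain m where m: "m \<le> n" "K + 1 \<le> U m x" by blast
      \<comment> \<open>A factor of the product vanishes, so all weight has been stopped and the
        payoff is exactly 1.\<close>
      then have "1 - g (U m x) = 0" unfolding g_def by simp
      then have "B n x = 0" unfolding B_def using m by (intro prod_zero) auto
      then show ?thesis unfolding \<Phi>_def by (simp add: indicator_def)
    next
      case False
      then have "x \<notin> {x. \<exists>m\<le>n. K + 1 \<le> U m x}" by blast
      then have "indicator {x. \<exists>m\<le>n. K + 1 \<le> U m x} x = (0::real)" by (rule indicator_simps)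
      then show ?thesis using nn by simp
    qed
  qed auto
  also have "\<dots> \<le> ereal (exp ((\<Sum>j<n. c j) - K))" using 1 by simp
  finally show ?thesis unfolding U_def .
qed

section \<open>The sigma-ideal of sets that are null for the largest set function\<close>

definition null :: "(nat \<Rightarrow> real) set \<Rightarrow> bool" where
  "null A \<longleftrightarrow> V_star E X A = 0"

lemma suminf_V_outer_nonneg: "0 \<le> (\<Sum>n. V_outer E X (B n))"
  by (intro suminf_0_le summable_ereal_pos V_outer_nonneg)

lemma V_star_nonneg: "0 \<le> V_star E X A"
  unfolding V_star_def by (rule INF_greatest) (rule suminf_V_outer_nonneg)

lemma V_star_le: "(\<And>n. B n \<in> sets borel) \<Longrightarrow> A \<subseteq> (\<Union>n. B n) \<Longrightarrow> V_star E X A \<le> (\<Sum>n. V_outer E X (B n))"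
  unfolding V_star_def by (intro INF_lower) auto

lemma null_iff:
  "null A \<longleftrightarrow> (\<forall>e>0. \<exists>B. range B \<subseteq> sets borel \<and> A \<subseteq> (\<Union>n. B n) \<and> (\<Sum>n. V_outer E X (B n)) \<le> ereal e)"
proof
  assume "null A"
  then have z: "V_star E X A = 0" by (simp add: null_def)
  show "\<forall>e>0. \<exists>B. range B \<subseteq> sets borel \<and> A \<subseteq> (\<Union>n. B n) \<and> (\<Sum>n. V_outer E X (B n)) \<le> ereal e"
  proof (intro allI impI)
    fix e :: real assume "0 < e"
    then have "V_star E X A < ereal e" using z by simp
    then show "\<exists>B. range B \<subseteq> sets borel \<and> A \<subseteq> (\<Union>n. B n) \<and> (\<Sum>n. V_outer E X (B n)) \<le> ereal e"
      unfolding V_star_def INF_less_iff by (auto intro: less_imp_le)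
  qed
next
  assume *: "\<forall>e>0. \<exists>B. range B \<subseteq> sets borel \<and> A \<subseteq> (\<Union>n. B n) \<and> (\<Sum>n. V_outer E X (B n)) \<le> ereal e"
  have *: "V_star E X A \<le> 0 + ereal e" if e: "0 < e" for e
  proof -
    obtain B where B: "range B \<subseteq> sets borel" "A \<subseteq> (\<Union>n. B n)" "(\<Sum>n. V_outer E X (B n)) \<le> ereal e"
      using *[rule_format, OF e] by metis
    have "V_star E X A \<le> (\<Sum>n. V_outer E X (B n))" using B by (intro V_star_le) auto
    also note B(3)
    finally show ?thesis by simp
  qed
  have "V_star E X A \<le> 0" by (rule ereal_le_epsilon2) (use * in blast)
  then show "null A" unfolding null_def using V_star_nonneg[of A] by (simp add: antisym)
qed

lemma null_subset:
  assumes "null A" "B \<subseteq> A" shows "null B"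
proof -
  have "V_star E X B \<le> V_star E X A"
    unfolding V_star_def using assms(2) by (intro INF_superset_mono) auto
  then show ?thesis using assms(1) V_star_nonneg[of B] by (simp add: null_def antisym)
qed

text \<open>Countable subadditivity: \<open>A k\<close> is covered up to
  \<open>e / 2 ^ (k + 1)\<close>, and the double family of covering sets is renumbered by
  pairs.\<close>

lemma null_UN:
  assumes "\<And>k::nat. null (A k)" shows "null (\<Union>k. A k)"
  unfolding null_iff
proof (intro allI impI)
  fix e :: real assume e: "0 < e"
  have "\<exists>B. range B \<subseteq> sets borel \<and> A k \<subseteq> (\<Union>n. B n) \<and> (\<Sum>n. V_outer E X (B n)) \<le> ereal (e * (1/2) ^ Suc k)" for k
    using assms[of k] e unfolding null_iff by simp
  then obtain B where B: "\<And>k. range (B k) \<subseteq> sets borel" "\<And>k. A k \<subseteq> (\<Union>n. B k n)"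
    "\<And>k. (\<Sum>n. V_outer E X (B k n)) \<le> ereal (e * (1/2) ^ Suc k)" by metis
  define C where "C i = (case prod_decode i of (k, n) \<Rightarrow> B k n)" for i
  have Ck: "C (prod_encode (k, n)) = B k n" for k n unfolding C_def by simp
  have "(\<Sum>i. V_outer E X (C i)) \<le> ereal e"
  proof (rule suminf_bound, rule allI)
    fix N
    \<comment> \<open>Both components of a pair are at most its code, so the codes below
      \<open>N\<close> lie in a finite square, over which the double sum is bounded row by
      row.\<close>
    have le: "prod_decode i \<in> {..i} \<times> {..i}" for i
    proof -
      obtain k n where kn: "prod_decode i = (k, n)" by (rule prod.exhaust)
      have "i = prod_encode (k, n)" unfolding kn[symmetric] by simp
      then show ?thesis unfolding kn using le_prod_encode_1[of k n] le_prod_encode_2[of n k] by simp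
    qed
    have sub: "prod_decode i \<in> {..N} \<times> {..N}" if "i \<in> {..<N}" for i
      using le[of i] that by (auto simp: mem_Times_iff)
    let ?h = "\<lambda>p. V_outer E X (B (fst p) (snd p))"
    have "(\<Sum>i<N. V_outer E X (C i)) = sum ?h (prod_decode ` {..<N})"
      unfolding C_def using inj_on_subset[OF inj_prod_decode subset_UNIV]
      by (subst sum.reindex) (auto simp: split_def)
    also have "\<dots> \<le> sum ?h ({..N} \<times> {..N})"
    proof (rule sum_mono2)
      show "prod_decode ` {..<N} \<subseteq> {..N} \<times> {..N}" using sub by blast
    qed (auto intro: V_outer_nonneg)
    also have "\<dots> = (\<Sum>k\<le>N. \<Sum>n\<le>N. V_outer E X (B k n))" by (simp add: sum.cartesian_product split_def)
    also have "\<dots> \<le> (\<Sum>k\<le>N. ereal (e * (1/2) ^ Suc k))"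
    proof (rule sum_mono)
      fix k
      have "(\<Sum>n\<le>N. V_outer E X (B k n)) \<le> (\<Sum>n. V_outer E X (B k n))"
        unfolding lessThan_Suc_atMost[symmetric]
        by (intro sum_le_suminf summable_ereal_pos V_outer_nonneg) auto
      then show "(\<Sum>n\<le>N. V_outer E X (B k n)) \<le> ereal (e * (1/2) ^ Suc k)" using B(3) order_trans by blast
    qed
    also have "\<dots> = ereal (e * (\<Sum>k\<le>N. (1/2) ^ Suc k))" by (simp add: sum_distrib_left)
    also have "\<dots> \<le> ereal e"
    proof -
      have "(\<Sum>k<Suc N. (1/2::real) ^ Suc k) \<le> 1"
        using sum_le_suminf[of "\<lambda>k. (1/2::real) ^ Suc k" "{..<Suc N}"] power_half_series
        by (auto simp: sums_iff)
      then have "e * (\<Sum>k\<le>N. (1/2) ^ Suc k) \<le> e * 1" unfolding lessThan_Suc_atMost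
        using e by (intro mult_left_mono) auto
      then show ?thesis by simp
    qed
    finally show "(\<Sum>i<N. V_outer E X (C i)) \<le> ereal e" .
  qed (rule V_outer_nonneg)
  moreover have "(\<Union>k. A k) \<subseteq> (\<Union>i. C i)"
  proof
    fix x assume "x \<in> (\<Union>k. A k)"
    then obtain k n where "x \<in> B k n" using B(2) by blast
    then show "x \<in> (\<Union>i. C i)" using Ck[of k n] by blast
  qed
  moreover have "range C \<subseteq> sets borel" unfolding C_def using B(1) by (auto split: prod.split)
  ultimately show "\<exists>B. range B \<subseteq> sets borel \<and> (\<Union>k. A k) \<subseteq> (\<Union>n. B n) \<and> (\<Sum>n. V_outer E X (B n)) \<le> ereal e"
    by blast
qed

lemma null_Un: "null A \<Longrightarrow> null B \<Longrightarrow> null (A \<union> B)"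
  using null_UN[of "\<lambda>k. if k = (0::nat) then A else B"]
  by (rule null_subset) (auto split: if_splits)

text \<open>The first Borel-Cantelli lemma for outer capacities: the events from any index on cover
  the limit superior, and the tail of a convergent series is small.\<close>

lemma null_limsup:
  assumes A: "\<And>n. A n \<in> sets borel" and g: "\<And>n. n \<ge> n0 \<Longrightarrow> V_outer E X (A n) \<le> ereal (g n)" and s: "summable g"
  shows "null {x. \<exists>\<^sub>\<infinity>n. x \<in> A n}"
  unfolding null_iff
proof (intro allI impI)
  fix e :: real assume e: "0 < e"
  obtain N where N: "\<And>n. n \<ge> N \<Longrightarrow> norm (\<Sum>i. g (i + n)) < e"
    using suminf_exist_split[OF e s] by blast
  define m where "m = max N n0"
  have s': "summable (\<lambda>i. g (i + m))" using s by simp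
  have "(\<Sum>i. V_outer E X (A (i + m))) \<le> (\<Sum>i. ereal (g (i + m)))"
    by (intro suminf_le_pos V_outer_nonneg g) (simp add: m_def)
  also have "\<dots> = ereal (\<Sum>i. g (i + m))" by (rule suminf_ereal'[OF s'])
  also have "\<dots> \<le> ereal e" using N[of m] by (simp add: m_def)
  finally have "(\<Sum>i. V_outer E X (A (i + m))) \<le> ereal e" .
  moreover have "{x. \<exists>\<^sub>\<infinity>n. x \<in> A n} \<subseteq> (\<Union>i. A (i + m))"
  proof
    fix x assume "x \<in> {x. \<exists>\<^sub>\<infinity>n. x \<in> A n}"
    then obtain n where "n \<ge> m" "x \<in> A n" by (auto simp: INFM_nat_le)
    then show "x \<in> (\<Union>i. A (i + m))" by (intro UN_I[of "n - m"]) auto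
  qed
  ultimately show "\<exists>B. range B \<subseteq> sets borel \<and> {x. \<exists>\<^sub>\<infinity>n. x \<in> A n} \<subseteq> (\<Union>n. B n) \<and> (\<Sum>n. V_outer E X (B n)) \<le> ereal e"
    using A by (intro exI[of _ "\<lambda>i. A (i + m)"]) auto
qed

end

section \<open>Distributions dominated by a sub-linear expectation\<close>

definition sublin :: "((nat \<Rightarrow> real) \<Rightarrow> real) \<Rightarrow> bool" where
  "sublin p \<longleftrightarrow> (\<forall>v w. p (\<lambda>i. v i + w i) \<le> p v + p w) \<and> (\<forall>c\<ge>0. \<forall>v. p (\<lambda>i. c * v i) = c * p v)"

lemma sublin_add: "sublin p \<Longrightarrow> p (\<lambda>i. v i + w i) \<le> p v + p w"
  by (simp add: sublin_def)

lemma sublin_scale: "sublin p \<Longrightarrow> 0 \<le> c \<Longrightarrow> p (\<lambda>i. c * v i) = c * p v"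
  by (simp add: sublin_def)

lemma sublin_zero: "sublin p \<Longrightarrow> p (\<lambda>i. 0) = 0"
  using sublin_scale[of p 0 "\<lambda>_. 0"] by simp

lemma sublin_uminus: "sublin p \<Longrightarrow> - p (\<lambda>i. - v i) \<le> p v"
  using sublin_add[of p v "\<lambda>i. - v i"] sublin_zero[of p] by simp

lemma sublin_sum:
  assumes "sublin p" shows "p (\<lambda>i. \<Sum>k\<in>I. v k i) \<le> (\<Sum>k\<in>I. p (v k))"
proof (induction I rule: infinite_finite_induct)
  case (insert x F)
  then show ?case using sublin_add[OF assms, of "v x" "\<lambda>i. \<Sum>k\<in>F. v k i"] by simp
qed (simp_all add: sublin_zero[OF assms])

text \<open>The classical step towards a minimal sublinear functional: \<open>q v\<close> is the
  infimum over \<open>t \<ge> 0\<close> of \<open>p (v + t y) - t p y\<close>. It lies below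
  \<open>p\<close> and makes the direction \<open>y\<close> linear.\<close>

lemma sublin_reduce:
  assumes p: "sublin p"
  obtains q where "sublin q" "\<And>v. q v \<le> p v" "q (\<lambda>i. - y i) \<le> - p y"
proof
  define h where "h v t = p (\<lambda>i. v i + t * y i) - t * p y" for v t
  define q where "q v = (INF t\<in>{0..}. h v t)" for v
  \<comment> \<open>Subadditivity gives a lower bound free of \<open>t\<close>, so the infimum is
    finite.\<close>
  have low: "- p (\<lambda>i. - v i) \<le> h v t" if "0 \<le> t" for v t
  proof -
    have "p (\<lambda>i. (v i + t * y i) + - v i) \<le> p (\<lambda>i. v i + t * y i) + p (\<lambda>i. - v i)" by (rule sublin_add[OF p])
    moreover have "(\<lambda>i. (v i + t * y i) + - v i) = (\<lambda>i. t * y i)" by auto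
    ultimately show ?thesis using sublin_scale[OF p that, of y] unfolding h_def by simp
  qed
  have bdd: "bdd_below (h v ` {0..})" for v
    using low by (intro bdd_belowI[of _ "- p (\<lambda>i. - v i)"]) auto
  have q_le: "q v \<le> h v t" if "0 \<le> t" for v t
    unfolding q_def using that by (intro cINF_lower bdd) auto
  have q_ge: "a \<le> q v" if "\<And>t. 0 \<le> t \<Longrightarrow> a \<le> h v t" for a v
    unfolding q_def using that by (intro cINF_greatest) auto
  show "q v \<le> p v" for v using q_le[of 0 v] by (simp add: h_def)
  show "q (\<lambda>i. - y i) \<le> - p y"
    using q_le[of 1 "\<lambda>i. - y i"] sublin_zero[OF p] by (simp add: h_def)
  have add: "q (\<lambda>i. v i + w i) \<le> q v + q w" for v w
  proof -
    have "q (\<lambda>i. v i + w i) - h v s \<le> q w" if s: "0 \<le> s" for s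
    proof (rule q_ge)
      fix t :: real assume t: "0 \<le> t"
      have "q (\<lambda>i. v i + w i) \<le> h (\<lambda>i. v i + w i) (s + t)" using s t by (intro q_le) auto
      also have "(\<lambda>i. (v i + w i) + (s + t) * y i) = (\<lambda>i. (v i + s * y i) + (w i + t * y i))"
        by (auto simp: algebra_simps)
      then have "h (\<lambda>i. v i + w i) (s + t) \<le> h v s + h w t"
        using sublin_add[OF p, of "\<lambda>i. v i + s * y i" "\<lambda>i. w i + t * y i"] unfolding h_def by (simp add: algebra_simps)
      finally show "q (\<lambda>i. v i + w i) - h v s \<le> h w t" by simp
    qed
    then have "q (\<lambda>i. v i + w i) - q w \<le> h v s" if "0 \<le> s" for s
      using that by (simp add: algebra_simps)
    then have "q (\<lambda>i. v i + w i) - q w \<le> q v" by (rule q_ge)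
    then show ?thesis by simp
  qed
  have sc: "c * q v \<le> q (\<lambda>i. c * v i)" if c: "0 < c" for c v
  proof (rule q_ge)
    fix t :: real assume t: "0 \<le> t"
    have "c * q v \<le> c * h v (t / c)" using c t by (intro mult_left_mono q_le) auto
    also have "\<dots> = h (\<lambda>i. c * v i) t"
      using c sublin_scale[OF p, of c "\<lambda>i. v i + t / c * y i"] unfolding h_def by (simp add: algebra_simps)
    finally show "c * q v \<le> h (\<lambda>i. c * v i) t" .
  qed
  have scale: "q (\<lambda>i. c * v i) = c * q v" if "0 \<le> c" for c v
  proof (cases "c = 0")
    case True
    have "q (\<lambda>i. 0) \<le> 0" using q_le[of 0 "\<lambda>i. 0"] sublin_zero[OF p] by (simp add: h_def)
    moreover have "0 \<le> q (\<lambda>i. 0)" using low[of _ "\<lambda>i. 0"] sublin_zero[OF p] by (intro q_ge) simp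
    ultimately show ?thesis using True by simp
  next
    case False
    with that have c: "0 < c" by simp
    have "inverse c * q (\<lambda>i. c * v i) \<le> q v"
      using sc[of "inverse c" "\<lambda>i. c * v i"] c by (simp add: field_simps)
    then have "q (\<lambda>i. c * v i) \<le> c * q v" using c by (simp add: field_simps)
    with sc[OF c, of v] show ?thesis by simp
  qed
  show "sublin q" unfolding sublin_def using add scale by blast
qed

text \<open>The reduction is repeated along \<open>y 0, y 1, ...\<close>. Directions made linear
  earlier stay so, because a smaller sublinear functional cannot change its value where the larger
  one is linear. The first reduction starts from \<open>p\<close> itself, which fixes the value at
  \<open>y 0\<close>.\<close>

lemma sublin_linear_along:
  fixes n :: nat
  assumes "sublin p"
  shows "\<exists>q. sublin q \<and> (\<forall>v. q v \<le> p v) \<and> (\<forall>k<n. q (\<lambda>i. - y k i) = - q (y k)) \<and> (0 < n \<longrightarrow> q (y 0) = p (y 0))"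
proof (induction n)
  case 0
  show ?case using assms by auto
next
  case (Suc n)
  have "\<exists>q. sublin q \<and> (\<forall>v. q v \<le> p v) \<and> (\<forall>k<n. q (\<lambda>i. - y k i) = - q (y k)) \<and>
      (0 < n \<longrightarrow> q (y 0) = p (y 0)) \<and> (n = 0 \<longrightarrow> q = p)"
    using Suc assms by (cases "n = 0") auto
  then obtain q where q: "sublin q" "\<And>v. q v \<le> p v" "\<And>k. k < n \<Longrightarrow> q (\<lambda>i. - y k i) = - q (y k)"
    "0 < n \<Longrightarrow> q (y 0) = p (y 0)" "n = 0 \<Longrightarrow> q = p" by blast
  obtain r where r: "sublin r" "\<And>v. r v \<le> q v" "r (\<lambda>i. - y n i) \<le> - q (y n)" using sublin_reduce[OF q(1), of "y n"] by metis
  have neg: "r (\<lambda>i. - y k i) = - r (y k) \<and> r (y k) = q (y k)" if "k < Suc n" for k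
  proof -
    have "r (\<lambda>i. - y k i) \<le> - q (y k)"
    proof (cases "k = n")
      case False
      then show ?thesis using that q(3)[of k] r(2)[of "\<lambda>i. - y k i"] by simp
    qed (use r in simp)
    then show ?thesis using sublin_uminus[OF r(1), of "y k"] r(2)[of "y k"] by linarith
  qed
  have "r (y 0) = p (y 0)" using neg[of 0] q(4,5) by (cases n) auto
  then show ?case using r(1) neg order_trans[OF r(2) q(2)] by (intro exI[of _ r]) auto
qed

text \<open>A linear functional below \<open>p\<close> that touches it at \<open>v0\<close>:
  \<open>p\<close> is reduced along \<open>v0\<close> and then along the unit vectors, and the
  values of the result on the unit vectors are the weights. By \<open>loc\<close>, only the
  coordinates up to \<open>n\<close> matter.\<close>

lemma finite_Hahn_Banach:
  assumes p: "sublin p" and loc: "\<And>v w. (\<And>i. i \<le> n \<Longrightarrow> v i = w i) \<Longrightarrow> p v = p w"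
  shows "\<exists>w. (\<forall>v. (\<Sum>i\<le>n. w i * v i) \<le> p v) \<and> (\<Sum>i\<le>n. w i * v0 i) = p v0"
proof -
  define e where "e k i = (if i = k then 1 else (0::real))" for k i :: nat
  define y where "y k = (case k of 0 \<Rightarrow> v0 | Suc j \<Rightarrow> e j)" for k
  obtain q where q: "sublin q" "\<And>v. q v \<le> p v" "\<And>k. k < Suc (Suc n) \<Longrightarrow> q (\<lambda>i. - y k i) = - q (y k)" "q (y 0) = p (y 0)"
    using sublin_linear_along[OF p, of "Suc (Suc n)" y] by auto
  define w where "w k = q (e k)" for k
  have one: "q (\<lambda>i. c * e k i) = c * w k" if "k \<le> n" for c k
  proof (cases "0 \<le> c")
    case True then show ?thesis using sublin_scale[OF q(1)] unfolding w_def by blast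
  next
    case False
    have "q (\<lambda>i. (- c) * (- e k i)) = (- c) * q (\<lambda>i. - e k i)" using False by (intro sublin_scale[OF q(1)]) auto
    then show ?thesis using q(3)[of "Suc k"] that unfolding w_def y_def by simp
  qed
  \<comment> \<open>\<open>R v\<close> is \<open>v\<close> cut off after coordinate
    \<open>n\<close>, the part that the weights see; by \<open>loc\<close> it has the same value
    under \<open>p\<close>.\<close>
  define R where "R v i = (\<Sum>k\<le>n. v k * e k i)" for v i
  have R: "R v i = v i" if "i \<le> n" for v i
    unfolding R_def e_def using that by (simp add: if_distrib[of "(*) _"] sum.delta cong: if_cong)
  have qR: "q (R v) \<le> (\<Sum>k\<le>n. w k * v k)" for v
    unfolding R_def using sublin_sum[OF q(1), of "\<lambda>k i. v k * e k i" "{..n}"] one by (simp add: mult.commute)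
  have Rm: "R (\<lambda>i. - v i) = (\<lambda>i. - R v i)" for v unfolding R_def by (simp add: sum_negf)
  have qR2: "(\<Sum>k\<le>n. w k * v k) \<le> q (R v)" for v
    using qR[of "\<lambda>i. - v i"] sublin_uminus[OF q(1), of "R v"] unfolding Rm by (simp add: sum_negf)
  have le: "(\<Sum>k\<le>n. w k * v k) \<le> p v" for v
  proof -
    have "(\<Sum>k\<le>n. w k * v k) \<le> p (R v)" using qR2[of v] q(2)[of "R v"] by linarith
    also have "p (R v) = p v" by (rule loc) (rule R)
    finally show ?thesis .
  qed
  have "- (\<Sum>k\<le>n. w k * v0 k) \<le> - p v0"
  proof -
    have 1: "q (\<lambda>i. - v0 i) = - p v0" using q(3)[of 0] q(4) unfolding y_def by simp
    \<comment> \<open>\<open>v0\<close> and its cut-off differ by a vector invisible to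
      \<open>p\<close>, so the touching at \<open>v0\<close> carries over to
      \<open>R v0\<close>.\<close>
    have m: "p (\<lambda>i. R v0 i - v0 i) = 0" "p (\<lambda>i. v0 i - R v0 i) = 0"
      using loc[of "\<lambda>i. R v0 i - v0 i" "\<lambda>i. 0"] loc[of "\<lambda>i. v0 i - R v0 i" "\<lambda>i. 0"] R[of _ v0] sublin_zero[OF p] by auto
    have "q (\<lambda>i. - R v0 i) \<le> q (\<lambda>i. - v0 i) + q (\<lambda>i. v0 i - R v0 i)"
      using sublin_add[OF q(1), of "\<lambda>i. - v0 i" "\<lambda>i. v0 i - R v0 i"] by simp
    then have "q (\<lambda>i. - R v0 i) \<le> - p v0" using m(2) q(2)[of "\<lambda>i. v0 i - R v0 i"] 1 by simp
    moreover have "(\<Sum>k\<le>n. w k * (- v0 k)) \<le> q (\<lambda>i. - R v0 i)" using qR2[of "\<lambda>i. - v0 i"] unfolding Rm .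
    ultimately show ?thesis by (simp add: sum_negf)
  qed
  with le[of v0] have "(\<Sum>k\<le>n. w k * v0 k) = p v0" by simp
  with le show ?thesis by (intro exI[of _ w]) simp
qed

text \<open>
  The weights \<open>grid_weight N i\<close> form a Lipschitz partition of unity subordinate to the grid
  \<open>grid_point N i\<close>, the two extreme ones taking care of the tails.
\<close>

definition grid_point :: "nat \<Rightarrow> nat \<Rightarrow> real" where
  "grid_point N i = (real i - real N ^ 2) / real N"

text \<open>An interior ramp climbs from 0 to 1 between its grid point and the next one. The values
  forced at \<open>i = 0\<close> and beyond \<open>2 * N ^ 2\<close> make the differences telescope
  to exactly 1 and send everything outside the grid to its two end points.\<close>

definition grid_ramp :: "nat \<Rightarrow> nat \<Rightarrow> real \<Rightarrow> real" where
  "grid_ramp N i x = (if i = 0 then 1 else if i > 2 * N ^ 2 then 0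
     else min 1 (max 0 (real N * x + real N ^ 2 - real i)))"

definition grid_weight :: "nat \<Rightarrow> nat \<Rightarrow> real \<Rightarrow> real" where
  "grid_weight N i x = grid_ramp N i x - grid_ramp N (Suc i) x"

lemma grid_weight_nonneg: "0 \<le> grid_weight N i x"
  unfolding grid_weight_def grid_ramp_def by auto

lemma grid_weight_sum: "(\<Sum>i\<le>2 * N ^ 2. grid_weight N i x) = 1"
proof -
  have "(\<Sum>i<Suc (2 * N ^ 2). grid_ramp N i x - grid_ramp N (Suc i) x) = grid_ramp N 0 x - grid_ramp N (Suc (2 * N ^ 2)) x"
    by (rule sum_lessThan_telescope')
  then show ?thesis unfolding grid_weight_def lessThan_Suc_atMost by (simp add: grid_ramp_def)
qed

lemma grid_ramp_lip: "\<bar>grid_ramp N i x - grid_ramp N i y\<bar> \<le> real N * \<bar>x - y\<bar>"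
proof -
  have "\<bar>min 1 (max 0 u) - min 1 (max 0 v)\<bar> \<le> \<bar>u - v\<bar>" for u v :: real by auto
  from this[of "real N * x + real N ^ 2 - real i" "real N * y + real N ^ 2 - real i"]
  have "\<bar>min 1 (max 0 (real N * x + real N ^ 2 - real i)) - min 1 (max 0 (real N * y + real N ^ 2 - real i))\<bar> \<le> \<bar>real N * (x - y)\<bar>"
    by (simp add: algebra_simps)
  then show ?thesis unfolding grid_ramp_def by (auto simp: abs_mult)
qed

lemma grid_weight_blip: "blip (grid_weight N i)"
  unfolding blip_def
proof (intro conjI exI allI)
  show "\<bar>grid_weight N i x\<bar> \<le> 2" for x unfolding grid_weight_def grid_ramp_def by auto
  show "\<bar>grid_weight N i x - grid_weight N i y\<bar> \<le> (2 * real N) * \<bar>x - y\<bar>" for x y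
    using grid_ramp_lip[of N i x y] grid_ramp_lip[of N "Suc i" x y] unfolding grid_weight_def by linarith
qed

text \<open>An interior weight is a hat on an interval of length 2/N to the right of its grid point.
  The end weights also take what lies outside [-N, N], and there the grid point is closer to 0 than
  \<open>x\<close>.\<close>

lemma grid_weight_support:
  assumes N: "0 < N" and "grid_weight N i x \<noteq> 0" "i \<le> 2 * N ^ 2"
  shows "\<bar>grid_point N i - x\<bar> \<le> 2 / N \<or> real N \<le> \<bar>x\<bar> \<and> \<bar>grid_point N i\<bar> \<le> \<bar>x\<bar>"
proof -
  have pos: "0 < grid_weight N i x" using assms grid_weight_nonneg[of N i x] by linarith
  have a: "grid_point N i \<le> x" if "i \<noteq> 0"
  proof -
    have "real N * x + real N ^ 2 - real i > 0"
      using pos that assms(3) unfolding grid_weight_def grid_ramp_def by (auto split: if_splits)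
    then show ?thesis using N unfolding grid_point_def by (simp add: field_simps)
  qed
  have b: "x \<le> grid_point N i + 2 / N" if "i \<noteq> 2 * N ^ 2"
  proof -
    have "real N * x + real N ^ 2 - real (Suc i) < 1"
      using pos that assms(3) unfolding grid_weight_def grid_ramp_def by (auto split: if_splits)
    then show ?thesis using N unfolding grid_point_def by (simp add: field_simps)
  qed
  have c: "grid_point N 0 = - real N" "grid_point N (2 * N ^ 2) = real N"
    using N unfolding grid_point_def by (auto simp: field_simps power2_eq_square)
  have N2: "2 * N ^ 2 \<noteq> 0" using N by simp
  consider "grid_point N i \<le> x" "x \<le> grid_point N i + 2 / N" | "i = 0" "x < grid_point N i" | "i = 2 * N ^ 2" "grid_point N i \<le> x"
    using a b N2 by force
  then show ?thesis
  proof cases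
    case 1 then show ?thesis by (simp add: abs_le_iff)
  next
    case 2
    then show ?thesis using c by auto
  next
    case 3
    then show ?thesis using c by auto
  qed
qed

text \<open>Near a grid point the Lipschitz bound applies; otherwise |x| is at least N, so the
  trivial error 2B is at most 2B|x|/N. An error linear in |x| is what an integrable variable can
  absorb.\<close>

lemma grid_sum_approx:
  assumes N: "0 < N" and B: "\<And>x. \<bar>f x\<bar> \<le> B" and L: "0 \<le> L" "\<And>x y. \<bar>f x - f y\<bar> \<le> L * \<bar>x - y\<bar>"
  shows "\<bar>(\<Sum>i\<le>2 * N ^ 2. f (grid_point N i) * grid_weight N i x) - f x\<bar> \<le> (2 * L + 2 * B * \<bar>x\<bar>) / N"
proof -
  have B0: "0 \<le> B" using B[of 0] by linarith
  have "(\<Sum>i\<le>2 * N ^ 2. f (grid_point N i) * grid_weight N i x) - f x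
      = (\<Sum>i\<le>2 * N ^ 2. (f (grid_point N i) - f x) * grid_weight N i x)"
    using grid_weight_sum[of N x] by (simp add: algebra_simps sum_subtractf sum_distrib_left[symmetric])
  also have "\<bar>\<dots>\<bar> \<le> (\<Sum>i\<le>2 * N ^ 2. \<bar>(f (grid_point N i) - f x) * grid_weight N i x\<bar>)" by (rule sum_abs)
  also have "\<dots> \<le> (\<Sum>i\<le>2 * N ^ 2. ((2 * L + 2 * B * \<bar>x\<bar>) / N) * grid_weight N i x)"
  proof (rule sum_mono)
    fix i assume i: "i \<in> {..2 * N ^ 2}"
    show "\<bar>(f (grid_point N i) - f x) * grid_weight N i x\<bar> \<le> ((2 * L + 2 * B * \<bar>x\<bar>) / N) * grid_weight N i x"
    proof (cases "grid_weight N i x = 0")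
      case False
      have "\<bar>f (grid_point N i) - f x\<bar> \<le> (2 * L + 2 * B * \<bar>x\<bar>) / N"
      proof (cases "\<bar>grid_point N i - x\<bar> \<le> 2 / N")
        case True
        have "\<bar>f (grid_point N i) - f x\<bar> \<le> L * (2 / N)"
          using L(2)[of "grid_point N i" x] mult_left_mono[OF True L(1)] by linarith
        also have "\<dots> \<le> (2 * L + 2 * B * \<bar>x\<bar>) / N" using B0 N by (simp add: field_simps)
        finally show ?thesis .
      next
        case far: False
        then have "real N \<le> \<bar>x\<bar>" using grid_weight_support[OF N False] i by auto
        then have "2 * B * real N \<le> 2 * B * \<bar>x\<bar>" using B0 by (intro mult_left_mono) auto
        then have "2 * B \<le> (2 * L + 2 * B * \<bar>x\<bar>) / N" using N L(1) by (simp add: field_simps)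
        moreover have "\<bar>f (grid_point N i) - f x\<bar> \<le> 2 * B" using B[of x] B[of "grid_point N i"] by linarith
        ultimately show ?thesis by linarith
      qed
      then show ?thesis unfolding abs_mult abs_of_nonneg[OF grid_weight_nonneg]
        by (rule mult_right_mono) (rule grid_weight_nonneg)
    qed simp
  qed
  also have "\<dots> = (2 * L + 2 * B * \<bar>x\<bar>) / N"
    unfolding sum_distrib_left[symmetric] grid_weight_sum by simp
  finally show ?thesis .
qed

lemma grid_abs_approx:
  assumes N: "0 < N"
  shows "(\<Sum>i\<le>2 * N ^ 2. \<bar>grid_point N i\<bar> * grid_weight N i x) \<le> \<bar>x\<bar> + 2"
proof -
  have "(\<Sum>i\<le>2 * N ^ 2. \<bar>grid_point N i\<bar> * grid_weight N i x) \<le> (\<Sum>i\<le>2 * N ^ 2. (\<bar>x\<bar> + 2) * grid_weight N i x)"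
  proof (rule sum_mono)
    fix i assume i: "i \<in> {..2 * N ^ 2}"
    have "2 / real N \<le> 2" using N by (simp add: field_simps)
    then have "grid_weight N i x \<noteq> 0 \<Longrightarrow> \<bar>grid_point N i\<bar> \<le> \<bar>x\<bar> + 2"
      using grid_weight_support[OF N, of i x] i by auto
    then show "\<bar>grid_point N i\<bar> * grid_weight N i x \<le> (\<bar>x\<bar> + 2) * grid_weight N i x"
      using grid_weight_nonneg[of N i x] by (cases "grid_weight N i x = 0") (auto intro: mult_right_mono)
  qed
  also have "\<dots> = \<bar>x\<bar> + 2"
    unfolding sum_distrib_left[symmetric] grid_weight_sum by simp
  finally show ?thesis .
qed

section \<open>Discretised dominated laws and their weak limit\<close>

context sublinear_expectation_space
begin

lemma ER_abs_diff_le: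
  assumes "integ Y" "integ Z" "integ D" "\<And>\<omega>. \<omega> \<in> space M \<Longrightarrow> \<bar>Y \<omega> - Z \<omega>\<bar> \<le> D \<omega>"
  shows "\<bar>ER Y - ER Z\<bar> \<le> ER D"
proof -
  have "ER Y \<le> ER (\<lambda>\<omega>. D \<omega> + Z \<omega>)" "ER Z \<le> ER (\<lambda>\<omega>. D \<omega> + Y \<omega>)"
    using assms by (intro ER_mono integ_add; force simp: abs_le_iff)+
  then show ?thesis using ER_add_le[OF assms(3,1)] ER_add_le[OF assms(3,2)] by linarith
qed

text \<open>Hahn-Banach is applied to the functional that sends a vector \<open>v\<close> of values
  on the grid to the expectation of its interpolation at \<open>Y\<close>. The linear functional
  found is a vector of weights, and domination makes it a probability.\<close>

lemma grid_measure_exists: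
  assumes Y: "integ Y" and N: "0 < N" and f0: "f0 \<in> borel_measurable borel"
  shows "\<exists>\<mu>. real_distribution \<mu> \<and>
     (\<forall>f\<in>borel_measurable borel. (\<integral>x. f x \<partial>\<mu>) \<le> ER (\<lambda>\<omega>. \<Sum>i\<le>2 * N ^ 2. f (grid_point N i) * grid_weight N i (Y \<omega>))) \<and>
     (\<integral>x. f0 x \<partial>\<mu>) = ER (\<lambda>\<omega>. \<Sum>i\<le>2 * N ^ 2. f0 (grid_point N i) * grid_weight N i (Y \<omega>))"
proof -
  let ?n = "2 * N ^ 2"
  define p where "p v = ER (\<lambda>\<omega>. \<Sum>i\<le>?n. v i * grid_weight N i (Y \<omega>))" for v
  have I: "integ (\<lambda>\<omega>. \<Sum>i\<le>?n. v i * grid_weight N i (Y \<omega>))" for v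
    by (rule integ_sum, rule integ_scale, rule integ_blip[OF grid_weight_blip integ_H[OF Y]])
  have sub: "sublin p" unfolding sublin_def
  proof (intro conjI allI impI)
    fix v w
    show "p (\<lambda>i. v i + w i) \<le> p v + p w"
      using ER_add_le[OF I[of v] I[of w]] unfolding p_def by (simp add: distrib_right sum.distrib)
  next
    fix c :: real and v assume "0 \<le> c"
    then show "p (\<lambda>i. c * v i) = c * p v"
      using ER_scale[OF I[of v], of c] unfolding p_def by (simp add: sum_distrib_left mult.assoc)
  qed
  have loc: "p v = p w" if "\<And>i. i \<le> ?n \<Longrightarrow> v i = w i" for v w
    unfolding p_def using that by simp
  have "\<exists>w. (\<forall>v. (\<Sum>i\<le>?n. w i * v i) \<le> p v) \<and> (\<Sum>i\<le>?n. w i * f0 (grid_point N i)) = p (\<lambda>i. f0 (grid_point N i))"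
    by (rule finite_Hahn_Banach[OF sub]) (rule loc)
  then obtain w where w: "\<And>v. (\<Sum>i\<le>?n. w i * v i) \<le> p v" "(\<Sum>i\<le>?n. w i * f0 (grid_point N i)) = p (\<lambda>i. f0 (grid_point N i))"
    by blast
  have w0: "0 \<le> w j" if "j \<le> ?n" for j
  proof -
    \<comment> \<open>Testing with minus the \<open>j\<close>-th unit vector, on which
      \<open>p\<close> is at most 0, shows that the weight is nonnegative.\<close>
    have "(\<Sum>i\<le>?n. w i * (if i = j then - 1 else 0)) \<le> p (\<lambda>i. if i = j then - 1 else 0)" by (rule w)
    also have "\<dots> \<le> ER (\<lambda>_. 0)"
      unfolding p_def
    proof (intro ER_mono I integ_const sum_nonpos)
      fix \<omega> i show "(if i = j then - 1 else 0) * grid_weight N i (Y \<omega>) \<le> 0"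
        using grid_weight_nonneg[of N j "Y \<omega>"] by simp
    qed
    finally show ?thesis using that by (simp add: if_distrib[of "(*) _"] sum.delta cong: if_cong)
  qed
  \<comment> \<open>Since \<open>p\<close> is the identity on constants, testing with 1 and -1 pins
    the total mass to 1.\<close>
  have "(\<Sum>i\<le>?n. w i * 1) \<le> p (\<lambda>_. 1)" "(\<Sum>i\<le>?n. w i * (-1)) \<le> p (\<lambda>_. -1)" by (rule w)+
  moreover have "p (\<lambda>_. c) = c" for c
    unfolding p_def sum_distrib_left[symmetric] grid_weight_sum by simp
  ultimately have w1: "(\<Sum>i\<le>?n. w i) = 1" by (simp add: sum_negf)
  define \<nu> where "\<nu> = point_measure {..?n} w"
  have sp: "space \<nu> = {..?n}" "sets \<nu> = Pow {..?n}" unfolding \<nu>_def by (auto simp: space_point_measure sets_point_measure)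
  have "emeasure \<nu> (space \<nu>) = (\<Sum>i\<le>?n. ennreal (w i))"
    unfolding \<nu>_def by (subst emeasure_point_measure_finite) (auto simp: space_point_measure)
  also have "\<dots> = 1" using w0 w1 by (subst sum_ennreal) auto
  finally interpret \<nu>: prob_space \<nu> by (intro prob_spaceI)
  have meas: "grid_point N \<in> \<nu> \<rightarrow>\<^sub>M borel" by (auto simp: measurable_def sp)
  define \<mu> where "\<mu> = distr \<nu> borel (grid_point N)"
  have rd: "real_distribution \<mu>" unfolding \<mu>_def by (rule \<nu>.real_distribution_distr[OF meas])
  have int: "(\<integral>x. f x \<partial>\<mu>) = (\<Sum>i\<le>?n. w i * f (grid_point N i))" if "f \<in> borel_measurable borel" for f
    unfolding \<mu>_def \<nu>_def using meas[unfolded \<nu>_def] that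
    by (subst integral_distr, simp, simp, subst lebesgue_integral_point_measure_finite) (simp_all add: w0)
  have "(\<integral>x. f x \<partial>\<mu>) \<le> p (\<lambda>i. f (grid_point N i))" if "f \<in> borel_measurable borel" for f
    unfolding int[OF that] by (rule w)
  moreover have "(\<integral>x. f0 x \<partial>\<mu>) = p (\<lambda>i. f0 (grid_point N i))"
    unfolding int[OF f0] by (rule w)
  ultimately show ?thesis using rd unfolding p_def by blast
qed

lemma blip_continuous: "blip f \<Longrightarrow> continuous_on UNIV f"
proof -
  assume f: "blip f"
  obtain L where L: "0 \<le> L" "\<And>x y. \<bar>f x - f y\<bar> \<le> L * \<bar>x - y\<bar>" using blip_lip[OF f] by metis
  then have "L-lipschitz_on UNIV f" by (intro lipschitz_onI) (auto simp: dist_real_def)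
  then show ?thesis by (rule lipschitz_on_continuous_on)
qed

lemma blip_measurable: "blip f \<Longrightarrow> f \<in> borel_measurable borel"
  by (intro borel_measurable_continuous_onI blip_continuous)

text \<open>The laws on the grids are tight by Markov's inequality, since \<open>Y\<close> is
  integrable. Along a weakly convergent subsequence both the inequality for every bounded Lipschitz
  \<open>f\<close> and the equality for \<open>f0\<close> survive. Equality is asked for one
  function only, because a dominating sublinear functional is touched at one prescribed
  vector.\<close>

theorem dominated_distribution_exists:
  assumes Y: "integ Y" and f0: "blip f0"
  obtains \<mu> where "real_distribution \<mu>" "\<And>f. blip f \<Longrightarrow> (\<integral>x. f x \<partial>\<mu>) \<le> ER (\<lambda>\<omega>. f (Y \<omega>))"
    "(\<integral>x. f0 x \<partial>\<mu>) = ER (\<lambda>\<omega>. f0 (Y \<omega>))"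
proof -
  define g where "g f n = ER (\<lambda>\<omega>. \<Sum>i\<le>2 * Suc n ^ 2. f (grid_point (Suc n) i) * grid_weight (Suc n) i (Y \<omega>))" for f n
  have I: "integ (\<lambda>\<omega>. \<Sum>i\<le>2 * Suc n ^ 2. v i * grid_weight (Suc n) i (Y \<omega>))" for v n
    by (rule integ_sum, rule integ_scale, rule integ_blip[OF grid_weight_blip integ_H[OF Y]])
  have "\<forall>n. \<exists>\<mu>. real_distribution \<mu> \<and> (\<forall>f\<in>borel_measurable borel. (\<integral>x. f x \<partial>\<mu>) \<le> g f n) \<and> (\<integral>x. f0 x \<partial>\<mu>) = g f0 n"
    unfolding g_def using grid_measure_exists[OF Y _ blip_measurable[OF f0]] by blast
  then obtain \<mu> where \<mu>: "\<And>n. real_distribution (\<mu> n)" "\<And>n f. f \<in> borel_measurable borel \<Longrightarrow> (\<integral>x. f x \<partial>\<mu> n) \<le> g f n"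
    "\<And>n. (\<integral>x. f0 x \<partial>\<mu> n) = g f0 n" by metis
  define m where "m = ER (\<lambda>\<omega>. \<bar>Y \<omega>\<bar>)"
  have m0: "0 \<le> m" unfolding m_def by (rule ER_nonneg[OF integ_abs[OF Y]]) simp
  have tight: "tight \<mu>" unfolding tight_def
  proof (intro conjI allI impI)
    fix e :: real assume e: "0 < e"
    \<comment> \<open>Markov's inequality leaves mass at most (m + 2)/b outside the interval, which
      is strictly below \<open>e\<close> for this \<open>b\<close>.\<close>
    define b where "b = (m + 3) / e"
    have b: "0 < b" using m0 e by (simp add: b_def)
    have "1 - e < measure (\<mu> n) {- b<..b}" for n
    proof -
      interpret real_distribution "\<mu> n" by (rule \<mu>)
      let ?A = "- {- b<..b}"
      have "(\<integral>x. indicator ?A x \<partial>\<mu> n) \<le> g (indicator ?A) n" by (rule \<mu>) simp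
      also have "\<dots> \<le> ER (\<lambda>\<omega>. (1 / b) * (2 + \<bar>Y \<omega>\<bar>))"
        unfolding g_def
      proof (intro ER_mono I integ_scale integ_add integ_const integ_abs Y)
        fix \<omega>
        have "(\<Sum>i\<le>2 * Suc n ^ 2. indicator ?A (grid_point (Suc n) i) * grid_weight (Suc n) i (Y \<omega>))
          \<le> (\<Sum>i\<le>2 * Suc n ^ 2. ((1 / b) * \<bar>grid_point (Suc n) i\<bar>) * grid_weight (Suc n) i (Y \<omega>))"
          using b by (intro sum_mono mult_right_mono grid_weight_nonneg) (auto simp: indicator_def field_simps)
        also have "\<dots> = (1 / b) * (\<Sum>i\<le>2 * Suc n ^ 2. \<bar>grid_point (Suc n) i\<bar> * grid_weight (Suc n) i (Y \<omega>))"
          by (simp only: sum_distrib_left mult.assoc)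
        also have "\<dots> \<le> (1 / b) * (2 + \<bar>Y \<omega>\<bar>)"
          using grid_abs_approx[of "Suc n" "Y \<omega>"] b by (intro mult_left_mono) auto
        finally show "(\<Sum>i\<le>2 * Suc n ^ 2. indicator ?A (grid_point (Suc n) i) * grid_weight (Suc n) i (Y \<omega>)) \<le> (1 / b) * (2 + \<bar>Y \<omega>\<bar>)" .
      qed
      also have "\<dots> = (1 / b) * (2 + m)"
        unfolding m_def using b by (subst ER_scale) (auto simp: ER_const_add integ_abs Y intro!: integ_add integ_const)
      also have "\<dots> < e" using e m0 unfolding b_def by (simp add: field_simps)
      finally have "measure (\<mu> n) ?A < e" by simp
      moreover have "measure (\<mu> n) ?A = 1 - measure (\<mu> n) {- b<..b}"
        using prob_compl[of "{- b<..b}"] by (simp add: Compl_eq_Diff_UNIV)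
      ultimately show ?thesis by simp
    qed
    then show "\<exists>a b. a < b \<and> (\<forall>n. 1 - e < measure (\<mu> n) {a<..b})"
      using b by (intro exI[of _ "- b"] exI[of _ b]) auto
  qed (rule \<mu>)
  have "\<exists>r \<nu>. strict_mono (r :: nat \<Rightarrow> nat) \<and> real_distribution \<nu> \<and> weak_conv_m (\<mu> \<circ> id \<circ> r) \<nu>"
    by (rule tight_imp_convergent_subsubsequence[OF tight]) (simp add: strict_mono_def)
  then obtain r \<nu> where r: "strict_mono (r :: nat \<Rightarrow> nat)" and \<nu>: "real_distribution \<nu>" and conv: "weak_conv_m (\<lambda>n. \<mu> (r n)) \<nu>"
    by (auto simp: comp_def)
  have lim: "(\<lambda>k. \<integral>x. f x \<partial>\<mu> (r k)) \<longlonglongrightarrow> (\<integral>x. f x \<partial>\<nu>)" if f: "blip f" for f :: "real \<Rightarrow> real"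
  proof -
    obtain B where B: "\<And>x. \<bar>f x\<bar> \<le> B" using blip_bound[OF f] by metis
    show ?thesis
      by (rule weak_conv_imp_integral_bdd_continuous_conv[OF \<mu>(1) \<nu> conv, where B = B])
        (use B blip_continuous[OF f] in \<open>auto simp: continuous_on_eq_continuous_at\<close>)
  qed
  have glim: "(\<lambda>k. g f (r k)) \<longlonglongrightarrow> ER (\<lambda>\<omega>. f (Y \<omega>))" if f: "blip f" for f
  proof -
    obtain B where B: "0 \<le> B" "\<And>x. \<bar>f x\<bar> \<le> B" using blip_bound[OF f] by metis
    obtain L where L: "0 \<le> L" "\<And>x y. \<bar>f x - f y\<bar> \<le> L * \<bar>x - y\<bar>" using blip_lip[OF f] by metis
    have b: "\<bar>g f n - ER (\<lambda>\<omega>. f (Y \<omega>))\<bar> \<le> (2 * L + 2 * B * m) / Suc n" for n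
    proof -
      have iD: "integ (\<lambda>\<omega>. (1 / real (Suc n)) * (2 * L + 2 * B * \<bar>Y \<omega>\<bar>))"
        by (intro integ_scale integ_add integ_const integ_abs Y)
      have "\<bar>g f n - ER (\<lambda>\<omega>. f (Y \<omega>))\<bar> \<le> ER (\<lambda>\<omega>. (1 / real (Suc n)) * (2 * L + 2 * B * \<bar>Y \<omega>\<bar>))"
        unfolding g_def
      proof (rule ER_abs_diff_le[OF I integ_blip[OF f integ_H[OF Y]] iD])
        fix \<omega>
        show "\<bar>(\<Sum>i\<le>2 * Suc n ^ 2. f (grid_point (Suc n) i) * grid_weight (Suc n) i (Y \<omega>)) - f (Y \<omega>)\<bar>
            \<le> (1 / real (Suc n)) * (2 * L + 2 * B * \<bar>Y \<omega>\<bar>)"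
          using grid_sum_approx[of "Suc n" f B L "Y \<omega>"] B L by simp
      qed
      also have "\<dots> = (1 / real (Suc n)) * ER (\<lambda>\<omega>. 2 * L + 2 * B * \<bar>Y \<omega>\<bar>)"
        by (intro ER_scale integ_scale integ_add integ_const integ_abs Y) simp
      also have "ER (\<lambda>\<omega>. 2 * L + 2 * B * \<bar>Y \<omega>\<bar>) = 2 * L + 2 * B * m"
        using B unfolding m_def by (subst ER_const_add) (auto intro!: integ_scale integ_abs Y ER_scale)
      finally show ?thesis by simp
    qed
    have "(\<lambda>n. g f n - ER (\<lambda>\<omega>. f (Y \<omega>))) \<longlonglongrightarrow> 0"
    proof (rule Lim_null_comparison)
      show "\<forall>\<^sub>F n in sequentially. norm (g f n - ER (\<lambda>\<omega>. f (Y \<omega>))) \<le> (2 * L + 2 * B * m) / Suc n"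
        using b by simp
      show "(\<lambda>n. (2 * L + 2 * B * m) / real (Suc n)) \<longlonglongrightarrow> 0"
        using tendsto_mult_right[OF LIMSEQ_inverse_real_of_nat, of "2 * L + 2 * B * m"] by (simp add: field_simps)
    qed
    then have "(\<lambda>n. g f n) \<longlonglongrightarrow> ER (\<lambda>\<omega>. f (Y \<omega>))" by (simp add: LIM_zero_iff)
    from LIMSEQ_subseq_LIMSEQ[OF this r] show ?thesis by (simp add: comp_def)
  qed
  have dom: "(\<integral>x. f x \<partial>\<nu>) \<le> ER (\<lambda>\<omega>. f (Y \<omega>))" if f: "blip f" for f
    by (rule LIMSEQ_le[OF lim[OF f] glim[OF f]]) (use \<mu>(2)[OF blip_measurable[OF f]] in auto)
  have eq: "(\<integral>x. f0 x \<partial>\<nu>) = ER (\<lambda>\<omega>. f0 (Y \<omega>))"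
    using LIMSEQ_unique[OF lim[OF f0]] glim[OF f0] \<mu>(3) by simp
  show ?thesis using that[OF \<nu> dom eq] .
qed

end

section \<open>Comparison of the capacities on the sequence space\<close>

lemma continuous_on_C_l_Lip:
  assumes "C_l_Lip d \<phi>" shows "continuous_on UNIV \<phi>"
  unfolding continuous_on_eq_continuous_at[OF open_UNIV]
proof
  fix x :: "nat \<Rightarrow> real"
  obtain C m where C: "\<And>x y. \<bar>\<phi> x - \<phi> y\<bar> \<le> C * (1 + L2_set x {..<d} ^ m + L2_set y {..<d} ^ m) * L2_set (\<lambda>i. x i - y i) {..<d}"
    using assms unfolding C_l_Lip_def by blast
  define g where "g y = C * (1 + L2_set y {..<d} ^ m + L2_set x {..<d} ^ m) * L2_set (\<lambda>i. y i - x i) {..<d}" for y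
  have "continuous_on UNIV g"
    unfolding g_def L2_set_def by (intro continuous_intros continuous_on_product_coordinates)
  then have "g \<midarrow>x\<rightarrow> g x" by (simp add: continuous_on_def)
  moreover have "g x = 0" unfolding g_def L2_set_def by simp
  ultimately have "g \<midarrow>x\<rightarrow> 0" by simp
  then have "(\<lambda>y. \<phi> y - \<phi> x) \<midarrow>x\<rightarrow> 0"
    by (rule Lim_null_comparison[rotated]) (auto simp: g_def C)
  then have "\<phi> \<midarrow>x\<rightarrow> \<phi> x" by (simp add: LIM_zero_iff)
  then show "isCont \<phi> x" by (simp add: isCont_def)
qed

lemma copy_H_measurable: "\<phi> \<in> copy_H \<Longrightarrow> \<phi> \<in> borel_measurable borel"
  unfolding copy_H_def using continuous_on_C_l_Lip by (blast intro: borel_measurable_continuous_onI)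

lemma L2_set_mono_dim: "(d::nat) \<le> d' \<Longrightarrow> L2_set x {..<d} \<le> L2_set x {..<d'}"
  unfolding L2_set_def by (intro real_sqrt_le_mono sum_mono2) auto

text \<open>Brings two functions to a common dimension and exponent, so that they can be added.
  Raising the exponent costs \<open>a ^ m \<le> 1 + b ^ n\<close>, and the two extra ones are
  absorbed by the factor 3.\<close>

lemma C_l_Lip_raise:
  assumes "C_l_Lip d \<phi>" "d \<le> d'"
  shows "\<exists>C m0. 0 \<le> C \<and> (\<forall>m\<ge>m0. \<forall>x y. \<bar>\<phi> x - \<phi> y\<bar> \<le> C * (1 + L2_set x {..<d'} ^ m + L2_set y {..<d'} ^ m) * L2_set (\<lambda>i. x i - y i) {..<d'})"
proof -
  obtain C m where C: "C > 0" "\<And>x y. \<bar>\<phi> x - \<phi> y\<bar> \<le> C * (1 + L2_set x {..<d} ^ m + L2_set y {..<d} ^ m) * L2_set (\<lambda>i. x i - y i) {..<d}"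
    using assms(1) unfolding C_l_Lip_def by blast
  have pow: "a ^ m \<le> 1 + b ^ n" if "0 \<le> a" "a \<le> b" "m \<le> n" for a b :: real and n
  proof (cases "b \<le> 1")
    case True
    then have "a ^ m \<le> 1" using that by (intro power_le_one) auto
    then show ?thesis using that by (smt (verit) zero_le_power)
  next
    case False
    have "a ^ m \<le> b ^ m" using that by (intro power_mono) auto
    also have "\<dots> \<le> b ^ n" using False that by (intro power_increasing) auto
    finally show ?thesis by simp
  qed
  show ?thesis
  proof (intro exI[of _ "3 * C"] exI[of _ m] conjI allI impI)
    fix n x y assume n: "m \<le> n"
    have "\<bar>\<phi> x - \<phi> y\<bar> \<le> C * (1 + L2_set x {..<d} ^ m + L2_set y {..<d} ^ m) * L2_set (\<lambda>i. x i - y i) {..<d}" by (rule C)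
    also have "\<dots> \<le> (3 * C * (1 + L2_set x {..<d'} ^ n + L2_set y {..<d'} ^ n)) * L2_set (\<lambda>i. x i - y i) {..<d'}"
    proof (rule mult_mono)
      have "1 + L2_set x {..<d} ^ m + L2_set y {..<d} ^ m \<le> 1 + (1 + L2_set x {..<d'} ^ n) + (1 + L2_set y {..<d'} ^ n)"
        by (intro add_mono order_refl pow L2_set_mono_dim assms n L2_set_nonneg)
      also have "\<dots> \<le> 3 * (1 + L2_set x {..<d'} ^ n + L2_set y {..<d'} ^ n)"
        by simp
      finally show "C * (1 + L2_set x {..<d} ^ m + L2_set y {..<d} ^ m) \<le> 3 * C * (1 + L2_set x {..<d'} ^ n + L2_set y {..<d'} ^ n)"
        using C(1) by (simp add: mult.assoc mult.left_commute[of 3])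
      show "0 \<le> 3 * C * (1 + L2_set x {..<d'} ^ n + L2_set y {..<d'} ^ n)" using C(1) by (simp add: add_nonneg_nonneg)
    qed (use assms in \<open>auto intro: L2_set_mono_dim\<close>)
    finally show "\<bar>\<phi> x - \<phi> y\<bar> \<le> 3 * C * (1 + L2_set x {..<d'} ^ n + L2_set y {..<d'} ^ n) * L2_set (\<lambda>i. x i - y i) {..<d'}" .
  qed (use C in simp)
qed

lemma copy_H_add:
  assumes "\<phi> \<in> copy_H" "\<psi> \<in> copy_H" shows "(\<lambda>x. \<phi> x + \<psi> x) \<in> copy_H"
proof -
  obtain d1 d2 where d: "d1 \<ge> 1" "C_l_Lip d1 \<phi>" "C_l_Lip d2 \<psi>" using assms unfolding copy_H_def by auto
  define d where "d = max d1 d2"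
  obtain C1 m1 where C1: "0 \<le> C1" "\<And>m x y. m1 \<le> m \<Longrightarrow> \<bar>\<phi> x - \<phi> y\<bar> \<le> C1 * (1 + L2_set x {..<d} ^ m + L2_set y {..<d} ^ m) * L2_set (\<lambda>i. x i - y i) {..<d}"
    using C_l_Lip_raise[OF d(2) max.cobounded1, of d2, folded d_def] by blast
  obtain C2 m2 where C2: "0 \<le> C2" "\<And>m x y. m2 \<le> m \<Longrightarrow> \<bar>\<psi> x - \<psi> y\<bar> \<le> C2 * (1 + L2_set x {..<d} ^ m + L2_set y {..<d} ^ m) * L2_set (\<lambda>i. x i - y i) {..<d}"
    using C_l_Lip_raise[OF d(3) max.cobounded2, of d1, folded d_def] by blast
  have "C_l_Lip d (\<lambda>x. \<phi> x + \<psi> x)"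
    unfolding C_l_Lip_def
  proof (intro exI[of _ "C1 + C2 + 1"] exI[of _ "max m1 m2"] conjI allI)
    fix x y
    define a where "a = 1 + L2_set x {..<d} ^ max m1 m2 + L2_set y {..<d} ^ max m1 m2"
    define b where "b = L2_set (\<lambda>i. x i - y i) {..<d}"
    have "0 \<le> a * b" unfolding a_def b_def by (simp add: add_nonneg_nonneg)
    moreover have "\<bar>\<phi> x - \<phi> y\<bar> \<le> C1 * a * b" "\<bar>\<psi> x - \<psi> y\<bar> \<le> C2 * a * b"
      unfolding a_def b_def by (rule C1 C2; simp)+
    ultimately have "\<bar>\<phi> x + \<psi> x - (\<phi> y + \<psi> y)\<bar> \<le> (C1 + C2 + 1) * (a * b)"
      unfolding distrib_right mult.assoc by linarith
    then show "\<bar>\<phi> x + \<psi> x - (\<phi> y + \<psi> y)\<bar> \<le> (C1 + C2 + 1) * (1 + L2_set x {..<d} ^ max m1 m2 + L2_set y {..<d} ^ max m1 m2) * L2_set (\<lambda>i. x i - y i) {..<d}"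
      unfolding a_def b_def by (simp add: mult.assoc)
  qed (use C1 C2 in simp)
  then show ?thesis unfolding copy_H_def d_def using d(1) by (auto intro!: exI[of _ "max d1 d2"])
qed

lemma copy_H_const: "(\<lambda>x. c) \<in> copy_H"
  by (rule BL_copy_H) (rule BL_const[of 0])

lemma copy_H_sum: "(\<And>i. i \<in> I \<Longrightarrow> g i \<in> copy_H) \<Longrightarrow> (\<lambda>x. \<Sum>i\<in>I. g i x) \<in> copy_H"
  by (induction I rule: infinite_finite_induct) (auto intro: copy_H_add copy_H_const)

lemma copy_H_min:
  assumes "\<phi> \<in> copy_H" shows "(\<lambda>x. min (\<phi> x) K) \<in> copy_H"
proof -
  obtain d where d: "d \<ge> 1" "C_l_Lip d \<phi>" using assms unfolding copy_H_def by auto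
  have "\<bar>min a K - min b K\<bar> \<le> \<bar>a - b\<bar>" for a b by auto
  then have "C_l_Lip d (\<lambda>x. min (\<phi> x) K)"
    using d(2) unfolding C_l_Lip_def by (meson order_trans)
  with d show ?thesis unfolding copy_H_def by auto
qed

section \<open>The chain of inequalities from dominated measures to \<open>C_star\<close> and
  \<open>V_star\<close>\<close>

context indep_rv_sequence
begin

lemma copy_E_mono: "\<phi> \<in> copy_H \<Longrightarrow> \<psi> \<in> copy_H \<Longrightarrow> (\<And>x. \<phi> x \<le> \<psi> x) \<Longrightarrow> copy_E E X \<phi> \<le> copy_E E X \<psi>"
  unfolding copy_E_def by (intro E_mono H_copy)

text \<open>Membership in \<open>copy_P\<close> tests bounded functions only; cutting at height
  \<open>K\<close> and monotone convergence extend the domination to nonnegative unbounded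
  ones.\<close>

lemma nn_integral_le_copy_E:
  assumes P: "P \<in> copy_P E X" and \<xi>: "\<xi> \<in> copy_H" "\<And>x. 0 \<le> \<xi> x"
  shows "enn2ereal (\<integral>\<^sup>+x. ennreal (\<xi> x) \<partial>P) \<le> copy_E E X \<xi>"
proof -
  interpret P: prob_space P using P by (simp add: copy_P_def)
  have sP[measurable_cong]: "sets P = sets borel" using P by (simp add: copy_P_def)
  have [measurable]: "\<xi> \<in> borel_measurable P" using copy_H_measurable[OF \<xi>(1)] by simp
  have c0: "0 \<le> copy_E E X \<xi>" by (rule copy_E_nonneg[OF \<xi>])
  have K: "(\<integral>\<^sup>+x. ennreal (min (\<xi> x) (real K)) \<partial>P) \<le> e2ennreal (copy_E E X \<xi>)" for K :: nat
  proof -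
    let ?f = "\<lambda>x. min (\<xi> x) (real K)"
    have bd: "\<bar>?f x\<bar> \<le> real K" for x using \<xi>(2)[of x] by auto
    have int: "integrable P ?f" by (rule P.integrable_const_bound[of _ "real K"]) (use bd in auto)
    have "bounded (range ?f)" using bd unfolding bounded_iff by auto
    then have "ereal (\<integral>x. ?f x \<partial>P) \<le> copy_E E X ?f"
      using P copy_H_min[OF \<xi>(1)] unfolding copy_P_def by blast
    also have "\<dots> \<le> copy_E E X \<xi>" by (intro copy_E_mono copy_H_min \<xi>) auto
    finally have "e2ennreal (ereal (\<integral>x. ?f x \<partial>P)) \<le> e2ennreal (copy_E E X \<xi>)" by (rule e2ennreal_mono)
    moreover have "(\<integral>\<^sup>+x. ennreal (?f x) \<partial>P) = ennreal (\<integral>x. ?f x \<partial>P)"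
      using \<xi>(2) by (intro nn_integral_eq_integral int) auto
    ultimately show ?thesis by simp
  qed
  have "(\<integral>\<^sup>+x. ennreal (\<xi> x) \<partial>P) = (\<integral>\<^sup>+x. (SUP K. ennreal (min (\<xi> x) (real K))) \<partial>P)"
  proof (intro nn_integral_cong antisym)
    fix x
    obtain K where "\<xi> x \<le> real K" using real_arch_simple by blast
    then have "ennreal (\<xi> x) = ennreal (min (\<xi> x) (real K))" by simp
    then show "ennreal (\<xi> x) \<le> (SUP K. ennreal (min (\<xi> x) (real K)))" by (metis SUP_upper UNIV_I)
    show "(SUP K. ennreal (min (\<xi> x) (real K))) \<le> ennreal (\<xi> x)"
      by (intro SUP_least ennreal_leI) auto
  qed
  also have "\<dots> = (SUP K. \<integral>\<^sup>+x. ennreal (min (\<xi> x) (real K)) \<partial>P)"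
    by (intro nn_integral_monotone_convergence_SUP) (auto simp: mono_def le_fun_def intro!: ennreal_leI)
  also have "\<dots> \<le> e2ennreal (copy_E E X \<xi>)" by (intro SUP_least K)
  finally have "enn2ereal (\<integral>\<^sup>+x. ennreal (\<xi> x) \<partial>P) \<le> enn2ereal (e2ennreal (copy_E E X \<xi>))"
    by (simp add: less_eq_ennreal.rep_eq)
  also have "\<dots> = copy_E E X \<xi>" by (rule enn2ereal_e2ennreal[OF c0])
  finally show ?thesis .
qed

text \<open>Monotone convergence under \<open>P\<close> matches the limit of expectations of finite
  sums in the definition of \<open>C_star\<close>.\<close>

lemma copy_P_le_C_star:
  assumes P: "P \<in> copy_P E X" and A: "A \<in> sets borel"
  shows "ereal (measure P A) \<le> C_star E X A"
  unfolding C_star_def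
proof (rule INF_greatest, clarify)
  fix g :: "nat \<Rightarrow> (nat \<Rightarrow> real) \<Rightarrow> real"
  assume g: "\<forall>n. g n \<in> copy_H \<and> (\<forall>x. 0 \<le> g n x)" and cov: "\<forall>x. indicator A x \<le> (\<Sum>n. ereal (g n x))"
  interpret P: prob_space P using P by (simp add: copy_P_def)
  have sP[measurable_cong]: "sets P = sets borel" using P by (simp add: copy_P_def)
  have [measurable]: "g n \<in> borel_measurable P" for n using copy_H_measurable[of "g n"] g by simp
  let ?S = "\<lambda>n x. \<Sum>i<n. g i x"
  let ?e = "\<lambda>n. copy_E E X (?S n)"
  have S: "?S n \<in> copy_H" "0 \<le> ?S n x" for n x using g by (auto intro!: copy_H_sum sum_nonneg)
  \<comment> \<open>The expectations of the partial sums increase, so \<open>lim\<close> is a true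
    limit and equals the supremum.\<close>
  have "incseq ?e"
    using g by (intro incseq_SucI copy_E_mono S) auto
  then have lim: "lim ?e = (SUP n. ?e n)" by (intro limI LIMSEQ_SUP)
  have nng: "(\<integral>\<^sup>+x. ennreal (?S n x) \<partial>P) \<le> e2ennreal (SUP n. ?e n)" for n
  proof -
    have "enn2ereal (\<integral>\<^sup>+x. ennreal (?S n x) \<partial>P) \<le> ?e n" by (rule nn_integral_le_copy_E[OF P S])
    also have "\<dots> \<le> (SUP n. ?e n)" by (rule SUP_upper) simp
    finally show ?thesis using e2ennreal_mono by fastforce
  qed
  have "ennreal (measure P A) = emeasure P A" by (simp add: P.emeasure_eq_measure)
  also have "\<dots> = (\<integral>\<^sup>+x. indicator A x \<partial>P)" using A by (simp add: sP)
  also have "\<dots> \<le> (\<integral>\<^sup>+x. (SUP n. ennreal (?S n x)) \<partial>P)"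
  proof (rule nn_integral_mono)
    fix x
    have "(\<Sum>n. ereal (g n x)) = (SUP n. ereal (?S n x))"
      using g by (subst suminf_ereal_eq_SUP) auto
    also have "\<dots> \<le> enn2ereal (SUP n. ennreal (?S n x))"
    proof (rule SUP_least)
      fix n
      have "ereal (?S n x) = enn2ereal (ennreal (?S n x))" using S(2) by (simp add: enn2ereal_ennreal)
      also have "\<dots> \<le> enn2ereal (SUP n. ennreal (?S n x))"
        unfolding less_eq_ennreal.rep_eq[symmetric] by (rule SUP_upper) simp
      finally show "ereal (?S n x) \<le> enn2ereal (SUP n. ennreal (?S n x))" .
    qed
    finally have "indicator A x \<le> enn2ereal (SUP n. ennreal (?S n x))" using cov order_trans by blast
    then show "indicator A x \<le> (SUP n. ennreal (?S n x))"
      unfolding less_eq_ennreal.rep_eq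
      by (cases "x \<in> A") (simp_all add: one_ennreal.rep_eq zero_ennreal.rep_eq)
  qed
  also have "\<dots> = (SUP n. \<integral>\<^sup>+x. ennreal (?S n x) \<partial>P)"
    using g by (intro nn_integral_monotone_convergence_SUP) (auto simp: incseq_Suc_iff le_fun_def intro!: ennreal_leI)
  also have "\<dots> \<le> e2ennreal (SUP n. ?e n)" by (intro SUP_least nng)
  finally have "enn2ereal (ennreal (measure P A)) \<le> enn2ereal (e2ennreal (SUP n. ?e n))"
    by (simp add: less_eq_ennreal.rep_eq)
  moreover have "0 \<le> (SUP n. ?e n)"
    by (rule order_trans[OF _ SUP_upper[of 0]]) (auto intro!: copy_E_nonneg copy_H_const)
  ultimately have "ereal (measure P A) \<le> (SUP n. ?e n)"
    by (simp add: enn2ereal_e2ennreal)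
  then show "ereal (measure P A) \<le> lim ?e" unfolding lim .
qed

lemma copy_E_add_le:
  assumes "\<phi> \<in> copy_H" "\<psi> \<in> copy_H" "\<And>x. 0 \<le> \<phi> x" "\<And>x. 0 \<le> \<psi> x"
  shows "copy_E E X (\<lambda>x. \<phi> x + \<psi> x) \<le> copy_E E X \<phi> + copy_E E X \<psi>"
  using copy_E_nonneg[OF assms(1,3)] copy_E_nonneg[OF assms(2,4)] unfolding copy_E_def
  by (intro E_subadd H_copy assms) auto

lemma copy_E_sum_le:
  assumes "\<And>i. g i \<in> copy_H" "\<And>i x. 0 \<le> g i x"
  shows "copy_E E X (\<lambda>x. \<Sum>i<(n::nat). g i x) \<le> (\<Sum>i<n. copy_E E X (g i))"
proof (induction n)
  case 0
  then show ?case using E_const[of 0] by (simp add: copy_E_def zero_ereal_def)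
next
  case (Suc n)
  have "copy_E E X (\<lambda>x. (\<Sum>i<n. g i x) + g n x) \<le> copy_E E X (\<lambda>x. \<Sum>i<n. g i x) + copy_E E X (g n)"
    using assms by (intro copy_E_add_le copy_H_sum sum_nonneg) auto
  also have "\<dots> \<le> (\<Sum>i<n. copy_E E X (g i)) + copy_E E X (g n)" by (rule add_right_mono[OF Suc])
  finally show ?case by simp
qed

text \<open>Nearly optimal majorants of the sets in a cover, with errors
  \<open>e / 2 ^ (n + 1)\<close>, form an admissible sequence for \<open>C_star\<close>.\<close>

lemma C_star_le_V_star: "C_star E X A \<le> V_star E X A"
proof -
  have "C_star E X A \<le> (\<Sum>n. V_outer E X (B n))" if B: "range B \<subseteq> sets borel" "A \<subseteq> (\<Union>n. B n)" for B
  proof (rule ereal_le_epsilon2)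
    fix e :: real assume e: "0 < e"
    have "\<exists>\<xi>. \<xi> \<in> copy_H \<and> (\<forall>x. indicator (B n) x \<le> \<xi> x) \<and> copy_E E X \<xi> \<le> V_outer E X (B n) + ereal (e * (1/2) ^ Suc n)" for n
    proof -
      \<comment> \<open>The outer capacity is finite, so adding a positive error gives a strict
        inequality.\<close>
      obtain v where v: "V_outer E X (B n) = ereal v"
        using V_outer_nonneg[of "B n"] V_outer_le_1[of "B n"] by (cases "V_outer E X (B n)") auto
      have "V_outer E X (B n) < V_outer E X (B n) + ereal (e * (1/2) ^ Suc n)" using e by (simp add: v)
      then obtain \<xi> where "\<xi> \<in> copy_H" "\<forall>x. indicator (B n) x \<le> \<xi> x" "copy_E E X \<xi> < V_outer E X (B n) + ereal (e * (1/2) ^ Suc n)"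
        unfolding V_outer_def INF_less_iff by blast
      then show ?thesis by (intro exI[of _ \<xi>]) (simp add: less_imp_le)
    qed
    then obtain g where g: "\<And>n. g n \<in> copy_H" "\<And>n x. indicator (B n) x \<le> g n x"
      "\<And>n. copy_E E X (g n) \<le> V_outer E X (B n) + ereal (e * (1/2) ^ Suc n)" by metis
    have g0: "0 \<le> g n x" for n x using g(2)[where n=n and x=x] by (rule order_trans[OF indicator_pos_le])
    let ?e = "\<lambda>n. copy_E E X (\<lambda>x. \<Sum>i<n. g i x)"
    have "incseq ?e" using g0 g(1) by (intro incseq_SucI copy_E_mono copy_H_sum) auto
    then have lim: "lim ?e = (SUP n. ?e n)" by (intro limI LIMSEQ_SUP)
    have "indicator A x \<le> (\<Sum>n. ereal (g n x))" for x
    proof (cases "x \<in> A")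
      case True
      then obtain n where "x \<in> B n" using B(2) by blast
      then have "1 \<le> ereal (g n x)" using g(2)[where n=n and x=x] by (simp add: one_ereal_def)
      also have "\<dots> = (\<Sum>i\<in>{n}. ereal (g i x))" by simp
      also have "\<dots> \<le> (\<Sum>n. ereal (g n x))" using g0 by (intro sum_le_suminf summable_ereal_pos) auto
      finally show ?thesis using True by simp
    next
      case False then show ?thesis using g0 by (simp add: suminf_0_le summable_ereal_pos)
    qed
    then have "C_star E X A \<le> lim ?e" unfolding C_star_def using g(1) g0 by (intro INF_lower) auto
    also have "\<dots> \<le> (\<Sum>n. V_outer E X (B n)) + ereal e"
      unfolding lim
    proof (rule SUP_least)
      fix n
      have "?e n \<le> (\<Sum>i<n. copy_E E X (g i))" by (rule copy_E_sum_le[OF g(1) g0])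
      also have "\<dots> \<le> (\<Sum>i<n. V_outer E X (B i) + ereal (e * (1/2) ^ Suc i))" by (intro sum_mono g)
      also have "\<dots> = (\<Sum>i<n. V_outer E X (B i)) + (\<Sum>i<n. ereal (e * (1/2) ^ Suc i))" by (rule sum.distrib)
      also have "\<dots> \<le> (\<Sum>n. V_outer E X (B n)) + ereal e"
      proof (rule add_mono)
        show "(\<Sum>i<n. V_outer E X (B i)) \<le> (\<Sum>n. V_outer E X (B n))"
          by (intro sum_le_suminf summable_ereal_pos V_outer_nonneg) auto
        have "(\<Sum>k<n. (1/2::real) ^ Suc k) \<le> 1"
          using sum_le_suminf[of "\<lambda>k. (1/2::real) ^ Suc k" "{..<n}"] power_half_series
          by (auto simp: sums_iff)
        then have "e * (\<Sum>k<n. (1/2) ^ Suc k) \<le> e * 1" using e by (intro mult_left_mono) auto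
        then show "(\<Sum>i<n. ereal (e * (1/2) ^ Suc i)) \<le> ereal e" by (simp add: sum_distrib_left)
      qed
      finally show "?e n \<le> (\<Sum>n. V_outer E X (B n)) + ereal e" .
    qed
    finally show "C_star E X A \<le> (\<Sum>n. V_outer E X (B n)) + ereal e" .
  qed
  then show ?thesis unfolding V_star_def by (intro INF_greatest) auto
qed

lemma V_star_le_1: "V_star E X A \<le> 1"
proof -
  define B :: "nat \<Rightarrow> (nat \<Rightarrow> real) set" where "B n = (if n = 0 then UNIV else {})" for n
  have "V_star E X A \<le> (\<Sum>n. V_outer E X (B n))" by (rule V_star_le) (auto simp: B_def)
  also have "\<dots> = (\<Sum>n\<in>{0}. V_outer E X (B n))" by (rule suminf_finite) (auto simp: B_def V_outer_empty)
  also have "\<dots> \<le> 1" by (simp add: V_outer_le_1)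
  finally show ?thesis .
qed

text \<open>A single Borel set covers itself, so the chain through \<open>C_star\<close> and
  \<open>V_star\<close> applies.\<close>

lemma copy_P_le_V_outer:
  assumes P: "P \<in> copy_P E X" and B: "B \<in> sets borel"
  shows "ereal (measure P B) \<le> V_outer E X B"
proof -
  have "V_star E X B \<le> (\<Sum>n. V_outer E X (if n = 0 then B else {}))"
    using B by (intro V_star_le) (auto split: if_splits)
  also have "\<dots> = (\<Sum>n\<in>{0::nat}. V_outer E X (if n = 0 then B else {}))"
    by (rule suminf_finite) (auto simp: V_outer_empty)
  finally show ?thesis
    using copy_P_le_C_star[OF P B] C_star_le_V_star[of B] by simp
qed

text \<open>A null set may fail to be measurable, so it is enclosed in an intersection of countably
  many Borel covers, whose measure is at most 1/(k + 1) for every k.\<close>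

lemma null_AE:
  assumes P: "P \<in> copy_P E X" and A: "null A"
  shows "AE x in P. x \<notin> A"
proof -
  interpret P: prob_space P using P by (simp add: copy_P_def)
  have sP[measurable_cong]: "sets P = sets borel" using P by (simp add: copy_P_def)
  have "\<exists>B. range B \<subseteq> sets borel \<and> A \<subseteq> (\<Union>n. B n) \<and> (\<Sum>n. V_outer E X (B n)) \<le> ereal (1 / real (Suc k))" for k
    using A unfolding null_iff by simp
  then obtain B where B: "\<And>k. range (B k) \<subseteq> sets borel" "\<And>k. A \<subseteq> (\<Union>n. B k n)"
    "\<And>k. (\<Sum>n. V_outer E X (B k n)) \<le> ereal (1 / real (Suc k))" by metis
  have Bm: "B k n \<in> sets P" for k n using B(1)[of k] sP by auto
  define N where "N = (\<Inter>k. \<Union>n. B k n)"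
  have N: "N \<in> sets P" unfolding N_def using Bm by auto
  have le: "emeasure P N \<le> ennreal (1 / real (Suc k))" for k
  proof -
    have "emeasure P N \<le> emeasure P (\<Union>n. B k n)"
      using Bm by (intro emeasure_mono) (auto simp: N_def)
    also have "\<dots> \<le> (\<Sum>n. emeasure P (B k n))" using Bm by (intro emeasure_subadditive_countably) auto
    also have "\<dots> \<le> ennreal (1 / real (Suc k))"
    proof (rule suminf_le_const)
      fix n
      have "ereal (\<Sum>i<n. measure P (B k i)) \<le> (\<Sum>i<n. V_outer E X (B k i))"
        unfolding sum_ereal[symmetric] using Bm sP by (intro sum_mono copy_P_le_V_outer[OF P]) auto
      also have "\<dots> \<le> (\<Sum>n. V_outer E X (B k n))"
        by (intro sum_le_suminf summable_ereal_pos V_outer_nonneg) auto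
      also have "\<dots> \<le> ereal (1 / real (Suc k))" by (rule B)
      finally have "(\<Sum>i<n. measure P (B k i)) \<le> 1 / real (Suc k)" by simp
      then show "(\<Sum>i<n. emeasure P (B k i)) \<le> ennreal (1 / real (Suc k))"
        unfolding P.emeasure_eq_measure by (subst sum_ennreal) (auto intro: ennreal_leI)
    qed auto
    finally show ?thesis .
  qed
  have "measure P N \<le> 1 / real (Suc k)" for k
    using le[of k] unfolding P.emeasure_eq_measure by (simp add: ennreal_le_iff)
  then have "measure P N \<le> 0"
    by (intro LIMSEQ_le_const[OF LIMSEQ_inverse_real_of_nat]) (auto simp: inverse_eq_divide)
  then have "emeasure P N = 0" by (simp add: P.emeasure_eq_measure measure_le_0_iff)
  moreover have "A \<subseteq> N" unfolding N_def using B(2) by blast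
  ultimately show ?thesis using N by (intro AE_I[of _ _ N]) auto
qed

end

section \<open>Product measures dominated by the copied expectation\<close>

definition clamp :: "real \<Rightarrow> real \<Rightarrow> real" where
  "clamp c x = max (- c) (min c x)"

lemma clamp_abs_le: "0 \<le> c \<Longrightarrow> \<bar>clamp c x\<bar> \<le> c"
  unfolding clamp_def by auto

lemma clamp_lip: "\<bar>clamp c x - clamp c y\<bar> \<le> \<bar>x - y\<bar>"
  unfolding clamp_def by auto

lemma clamp_eq: "\<bar>x\<bar> \<le> c \<Longrightarrow> clamp c x = x"
  unfolding clamp_def by auto

text \<open>A bounded element of \<open>copy_H\<close> may have unbounded local Lipschitz constants.
  On a cube the polynomial factor is bounded, so composing with coordinatewise clamping lands in
  \<open>BL\<close>.\<close>

lemma BL_clamp: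
  assumes "C_l_Lip d \<phi>" and B: "\<And>x. \<bar>\<phi> x\<bar> \<le> B" and R: "0 \<le> R"
  shows "BL d (\<lambda>x. \<phi> (\<lambda>i. clamp R (x i)))"
proof -
  obtain C m where C: "C > 0" "\<And>x y. \<bar>\<phi> x - \<phi> y\<bar> \<le> C * (1 + L2_set x {..<d} ^ m + L2_set y {..<d} ^ m) * L2_set (\<lambda>i. x i - y i) {..<d}"
    using assms(1) unfolding C_l_Lip_def by blast
  let ?c = "\<lambda>x i. clamp R (x i)"
  have le: "L2_set (?c x) {..<d} \<le> d * R" for x
  proof -
    have "L2_set (?c x) {..<d} \<le> (\<Sum>i<d. \<bar>?c x i\<bar>)" by (rule L2_set_le_sum_abs)
    also have "\<dots> \<le> (\<Sum>i<d. R)" by (intro sum_mono clamp_abs_le R)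
    finally show ?thesis by simp
  qed
  show ?thesis
  proof (rule BL_I[of _ B])
    show "\<bar>\<phi> (?c x)\<bar> \<le> B" for x by (rule B)
    fix x y
    have "L2_set (\<lambda>i. ?c x i - ?c y i) {..<d} \<le> (\<Sum>i<d. \<bar>?c x i - ?c y i\<bar>)" by (rule L2_set_le_sum_abs)
    also have "\<dots> \<le> (\<Sum>i<d. \<bar>x i - y i\<bar>)" by (intro sum_mono clamp_lip)
    finally have 1: "L2_set (\<lambda>i. ?c x i - ?c y i) {..<d} \<le> (\<Sum>i<d. \<bar>x i - y i\<bar>)" .
    have "C * (1 + L2_set (?c x) {..<d} ^ m + L2_set (?c y) {..<d} ^ m) \<le> C * (1 + (d * R) ^ m + (d * R) ^ m)"
      using C(1) by (intro mult_left_mono add_mono order_refl power_mono le) auto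
    then have "\<bar>\<phi> (?c x) - \<phi> (?c y)\<bar> \<le> C * (1 + (d * R) ^ m + (d * R) ^ m) * L2_set (\<lambda>i. ?c x i - ?c y i) {..<d}"
      by (intro order_trans[OF C(2)] mult_right_mono) auto
    also have "\<dots> \<le> C * (1 + (d * R) ^ m + (d * R) ^ m) * (\<Sum>i<d. \<bar>x i - y i\<bar>)"
      using C(1) R by (intro mult_left_mono 1) (auto intro!: mult_nonneg_nonneg add_nonneg_nonneg)
    finally show "\<bar>\<phi> (?c x) - \<phi> (?c y)\<bar> \<le> C * (1 + (d * R) ^ m + (d * R) ^ m) * (\<Sum>i<d. \<bar>x i - y i\<bar>)" .
  qed
qed

text \<open>Points of the finite product are sequences with the value \<open>undefined\<close> from
  \<open>k\<close> on; each coordinate is thus a projection or a constant.\<close>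

lemma PiM_initial_measurable:
  fixes \<mu> :: "nat \<Rightarrow> real measure"
  assumes "\<And>j. sets (\<mu> j) = sets borel"
  shows "(\<lambda>x. x) \<in> PiM {..<k} \<mu> \<rightarrow>\<^sub>M (borel :: (nat \<Rightarrow> real) measure)"
proof (rule measurable_coordinatewise_then_product)
  fix i
  show "(\<lambda>x. x i) \<in> borel_measurable (PiM {..<k} \<mu>)"
  proof (cases "i < k")
    case True
    then have "(\<lambda>x. x i) \<in> PiM {..<k} \<mu> \<rightarrow>\<^sub>M \<mu> i" by (intro measurable_component_singleton) auto
    then show ?thesis unfolding measurable_cong_sets[OF refl assms] .
  next
    case False
    have "w i = undefined" if "w \<in> space (PiM {..<k} \<mu>)" for w
      using that False PiE_arb[of w "{..<k}" "\<lambda>j. space (\<mu> j)" i] by (simp add: space_PiM)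
    then have "(\<lambda>x. x i) \<in> borel_measurable (PiM {..<k} \<mu>) \<longleftrightarrow> (\<lambda>x. undefined :: real) \<in> borel_measurable (PiM {..<k} \<mu>)"
      by (rule measurable_cong)
    then show ?thesis by simp
  qed
qed

context indep_rv_sequence
begin

text \<open>The last coordinate is integrated on both sides: with the past frozen its law is
  dominated by \<open>ER\<close>, and the resulting conditional expectation is again in
  \<open>BL\<close>, so the induction hypothesis applies to it.\<close>

lemma product_measure_BL:
  assumes \<mu>: "\<And>j. real_distribution (\<mu> j)"
    and dom: "\<And>j f. blip f \<Longrightarrow> (\<integral>v. f v \<partial>\<mu> j) \<le> ER (\<lambda>\<omega>. f (X (Suc j) \<omega>))"
    and \<phi>: "BL d \<phi>"
  shows "(\<integral>x. \<phi> x \<partial>PiM {..<d} \<mu>) \<le> F \<phi>"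
  using \<phi>
proof (induction d arbitrary: \<phi>)
  case 0
  interpret real_distribution "\<mu> j" for j by (rule \<mu>)
  interpret Pe: prob_space "PiM {..<0::nat} \<mu>" by (intro prob_space_PiM prob_space_axioms)
  have "\<phi> x = \<phi> undefined" for x by (rule BL_cong[OF 0]) simp
  then have \<phi>: "\<phi> = (\<lambda>_. \<phi> undefined)" by (rule ext)
  have "(\<integral>x. \<phi> undefined \<partial>PiM {..<0} \<mu>) = \<phi> undefined" by (simp only: lebesgue_integral_const Pe.prob_space scaleR_one)
  moreover have "F (\<lambda>_. \<phi> undefined) = \<phi> undefined" by simp
  ultimately show ?case using \<phi> by (metis order_refl)
next
  case (Suc m)
  note \<phi> = Suc.prems
  interpret \<mu>: real_distribution "\<mu> j" for j by (rule \<mu>)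
  interpret pp: product_prob_space \<mu> UNIV
    by (intro product_prob_spaceI) (rule \<mu>.prob_space_axioms)
  interpret Pm: prob_space "PiM {..<m} \<mu>" by (intro prob_space_PiM \<mu>.prob_space_axioms)
  interpret Pm': prob_space "PiM {..<Suc m} \<mu>" by (intro prob_space_PiM \<mu>.prob_space_axioms)
  note incl = PiM_initial_measurable[of \<mu>, OF \<mu>.events_eq_borel]
  have meas: "\<psi> \<in> borel_measurable (PiM {..<k} \<mu>)" if "BL k' \<psi>" for k k' \<psi>
    using measurable_compose[OF incl copy_H_measurable[OF BL_copy_H[OF that]]] .
  obtain B where B: "0 \<le> B" "\<And>x. \<bar>\<phi> x\<bar> \<le> B" using BL_bound[OF \<phi>] by metis
  have insert: "insert m {..<m} = {..<Suc m}" by auto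
  have int: "integrable (PiM (insert m {..<m}) \<mu>) \<phi>"
    unfolding insert by (rule Pm'.integrable_const_bound[of _ B]) (use B meas[OF \<phi>] in auto)
  let ?G = "\<lambda>x. ER (\<lambda>\<omega>. \<phi> (x(m := X (Suc m) \<omega>)))"
  obtain C where C: "0 \<le> C" "\<And>x. \<bar>?G x\<bar> \<le> C" using BL_bound[OF BL_cond[OF \<phi>]] by metis
  have "(\<integral>x. \<phi> x \<partial>PiM {..<Suc m} \<mu>) = (\<integral>x. (\<integral>y. \<phi> (x(m := y)) \<partial>\<mu> m) \<partial>PiM {..<m} \<mu>)"
    using pp.product_integral_insert[OF _ _ int] unfolding insert by simp
  also have "\<dots> \<le> (\<integral>x. ?G x \<partial>PiM {..<m} \<mu>)"
  proof (rule integral_mono)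
    have "(\<lambda>(x, y). x(m := y)) \<in> PiM {..<m} \<mu> \<Otimes>\<^sub>M \<mu> m \<rightarrow>\<^sub>M PiM (insert m {..<m}) \<mu>"
      by (rule measurable_add_dim)
    then have "(\<lambda>p. \<phi> ((fst p)(m := snd p))) \<in> borel_measurable (PiM {..<m} \<mu> \<Otimes>\<^sub>M \<mu> m)"
      using measurable_compose[OF _ meas[OF \<phi>, of "Suc m"]] unfolding insert by (simp add: split_beta')
    then have "(\<lambda>x. \<integral>y. \<phi> (x(m := y)) \<partial>\<mu> m) \<in> borel_measurable (PiM {..<m} \<mu>)"
      by (intro \<mu>.borel_measurable_lebesgue_integral) (simp add: split_beta')
    moreover have "\<bar>\<integral>y. \<phi> (x(m := y)) \<partial>\<mu> m\<bar> \<le> B" for x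
    proof -
      have f: "blip (\<lambda>v. \<phi> (x(m := v)))" by (rule blip_update[OF \<phi>])
      have int: "integrable (\<mu> m) (\<lambda>v. \<phi> (x(m := v)))"
        by (rule \<mu>.integrable_const_bound[of _ B]) (use B blip_measurable[OF f] in auto)
      have "\<bar>\<integral>y. \<phi> (x(m := y)) \<partial>\<mu> m\<bar> \<le> (\<integral>y. \<bar>\<phi> (x(m := y))\<bar> \<partial>\<mu> m)" by (rule integral_abs_bound)
      also have "\<dots> \<le> (\<integral>y. B \<partial>\<mu> m)" using int B by (intro integral_mono) auto
      also have "\<dots> = B" by (simp only: lebesgue_integral_const \<mu>.prob_space scaleR_one)
      finally show ?thesis .
    qed
    ultimately show "integrable (PiM {..<m} \<mu>) (\<lambda>x. \<integral>y. \<phi> (x(m := y)) \<partial>\<mu> m)"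
      by (intro Pm.integrable_const_bound[of _ B]) auto
    show "integrable (PiM {..<m} \<mu>) ?G"
      by (rule Pm.integrable_const_bound[of _ C]) (simp add: C, rule meas[OF BL_cond[OF \<phi>]])
    show "(\<integral>y. \<phi> (x(m := y)) \<partial>\<mu> m) \<le> ?G x" for x by (rule dom[OF blip_update[OF \<phi>]])
  qed
  also have "\<dots> \<le> F ?G" by (rule Suc.IH[OF BL_cond[OF \<phi>]])
  also have "\<dots> = F \<phi>" by (rule F_cond[OF \<phi>, symmetric])
  finally show ?case .
qed

text \<open>For functions in \<open>BL\<close> the infinite product reduces to a finite one. A
  bounded function in \<open>copy_H\<close> is reached by clamping its arguments to [-R, R] and
  letting R grow. Since \<open>E\<close> need not be continuous along limits, the error under
  \<open>E\<close> is bounded explicitly through the first moments.\<close>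

theorem product_measure_in_copy_P:
  assumes \<mu>: "\<And>j. real_distribution (\<mu> j)"
    and dom: "\<And>j f. blip f \<Longrightarrow> (\<integral>v. f v \<partial>\<mu> j) \<le> ER (\<lambda>\<omega>. f (X (Suc j) \<omega>))"
    and int: "\<And>j. integ (X (Suc j))"
  shows "PiM UNIV \<mu> \<in> copy_P E X"
proof -
  interpret \<mu>: real_distribution "\<mu> j" for j by (rule \<mu>)
  interpret pp: product_prob_space \<mu> UNIV
    by (intro product_prob_spaceI) (rule \<mu>.prob_space_axioms)
  define Q where "Q = PiM UNIV \<mu>"
  interpret Q: prob_space Q unfolding Q_def by (intro prob_space_PiM \<mu>.prob_space_axioms)
  have sQ[measurable_cong]: "sets Q = sets borel"
    unfolding Q_def by (subst sets_PiM_cong[OF refl \<mu>.events_eq_borel]) (rule sets_PiM_equal_borel)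
  have BL: "(\<integral>x. \<phi> x \<partial>Q) \<le> F \<phi>" if \<phi>: "BL d \<phi>" for d \<phi>
  proof -
    note incl = PiM_initial_measurable[of \<mu> d, OF \<mu>.events_eq_borel]
    have meas: "\<phi> \<in> borel_measurable (PiM {..<d} \<mu>)"
      using measurable_compose[OF incl copy_H_measurable[OF BL_copy_H[OF \<phi>]]] .
    have "(\<integral>x. \<phi> x \<partial>PiM {..<d} \<mu>) = (\<integral>x. \<phi> x \<partial>distr (PiM UNIV \<mu>) (PiM {..<d} \<mu>) (\<lambda>x. restrict x {..<d}))"
      by (subst pp.distr_PiM_restrict_finite) auto
    also have "\<dots> = (\<integral>x. \<phi> (restrict x {..<d}) \<partial>Q)"
      unfolding Q_def using meas by (intro integral_distr measurable_restrict_subset) auto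
    also have "\<dots> = (\<integral>x. \<phi> x \<partial>Q)"
      by (intro Bochner_Integration.integral_cong refl BL_cong[OF \<phi>]) auto
    finally show ?thesis using product_measure_BL[OF \<mu> dom \<phi>] by simp
  qed
  have "ereal (\<integral>x. \<phi> x \<partial>Q) \<le> copy_E E X \<phi>" if \<phi>: "\<phi> \<in> copy_H" and bd: "bounded (range \<phi>)" for \<phi>
  proof -
    obtain d where d: "d \<ge> 1" "C_l_Lip d \<phi>" using \<phi> unfolding copy_H_def by auto
    obtain B where B: "\<And>x. \<bar>\<phi> x\<bar> \<le> B" using bd unfolding bounded_iff by auto
    have B0: "0 \<le> B" using B[of undefined] by linarith
    have meas[measurable]: "\<phi> \<in> borel_measurable borel" by (rule copy_H_measurable[OF \<phi>])
    have I: "integ (\<lambda>\<omega>. \<phi> (\<lambda>i. X (Suc i) \<omega>))" by (rule integ_bounded[OF H_copy[OF \<phi>]]) (rule B)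
    define R where "R n = real (Suc n)" for n
    define c where "c n x i = clamp (R n) (x i)" for n and x :: "nat \<Rightarrow> real" and i :: nat
    have BLc: "BL d (\<lambda>x. \<phi> (c n x))" for n
      unfolding c_def by (rule BL_clamp[OF d(2) B]) (simp add: R_def)
    have lim: "(\<lambda>n. \<integral>x. \<phi> (c n x) \<partial>Q) \<longlonglongrightarrow> (\<integral>x. \<phi> x \<partial>Q)"
    proof (rule integral_dominated_convergence[where w = "\<lambda>_. B"])
      show "(\<lambda>x. \<phi> (c n x)) \<in> borel_measurable Q" for n
        using copy_H_measurable[OF BL_copy_H[OF BLc]] by simp
      show "AE x in Q. (\<lambda>n. \<phi> (c n x)) \<longlonglongrightarrow> \<phi> x"
      proof (rule AE_I2)
        fix x :: "nat \<Rightarrow> real"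
        obtain N where N: "(\<Sum>i<d. \<bar>x i\<bar>) \<le> real N" using real_arch_simple by blast
        have "\<phi> (c n x) = \<phi> x" if "n \<ge> N" for n
        proof (rule C_l_Lip_cong[OF d(2)])
          fix i assume "i < d"
          then have "\<bar>x i\<bar> \<le> (\<Sum>i<d. \<bar>x i\<bar>)" by (intro member_le_sum) auto
          also have "\<dots> \<le> R n" using N that by (simp add: R_def)
          finally show "c n x i = x i" unfolding c_def by (rule clamp_eq)
        qed
        then have "\<forall>\<^sub>F n in sequentially. \<phi> (c n x) = \<phi> x" unfolding eventually_sequentially by blast
        then show "(\<lambda>n. \<phi> (c n x)) \<longlonglongrightarrow> \<phi> x" by (rule tendsto_eventually)
      qed
    qed (use B in auto)
    define m where "m = (\<Sum>i<d. ER (\<lambda>\<omega>. \<bar>X (Suc i) \<omega>\<bar>))"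
    have le: "(\<integral>x. \<phi> (c n x) \<partial>Q) \<le> ER (\<lambda>\<omega>. \<phi> (\<lambda>i. X (Suc i) \<omega>)) + 2 * B * m / Suc n" for n
    proof -
      have iS: "integ (\<lambda>\<omega>. \<Sum>i<d. \<bar>X (Suc i) \<omega>\<bar>)" by (intro integ_sum integ_abs int)
      have "F (\<lambda>x. \<phi> (c n x)) \<le> ER (\<lambda>\<omega>. \<phi> (\<lambda>i. X (Suc i) \<omega>) + (2 * B / R n) * (\<Sum>i<d. \<bar>X (Suc i) \<omega>\<bar>))"
        unfolding F_def
      proof (intro ER_mono integ_BL[OF BLc] integ_add I integ_scale iS)
        fix \<omega>
        define x where "x i = X (Suc i) \<omega>" for i
        have "\<phi> (c n x) \<le> \<phi> x + 2 * B / R n * (\<Sum>i<d. \<bar>x i\<bar>)"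
        proof (cases "\<forall>i<d. \<bar>x i\<bar> \<le> R n")
          case True
          then have "\<phi> (c n x) = \<phi> x" by (intro C_l_Lip_cong[OF d(2)]) (auto simp: c_def clamp_eq)
          then show ?thesis using B0 by (simp add: R_def sum_nonneg)
        next
          case False
          \<comment> \<open>Some coordinate exceeds \<open>R n\<close>, so the trivial error
            \<open>2 * B\<close> is at most \<open>2 * B / R n\<close> times the sum of the absolute
            values.\<close>
          then obtain i where i: "i < d" "R n < \<bar>x i\<bar>" by auto
          have "\<bar>x i\<bar> \<le> (\<Sum>i<d. \<bar>x i\<bar>)" using i by (intro member_le_sum) auto
          then have "2 * B * R n \<le> 2 * B * (\<Sum>i<d. \<bar>x i\<bar>)" using i B0 by (intro mult_left_mono) auto
          then have "2 * B \<le> 2 * B / R n * (\<Sum>i<d. \<bar>x i\<bar>)" by (simp add: R_def field_simps)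
          then show ?thesis using B[of "c n x"] B[of x] by linarith
        qed
        then show "\<phi> (c n (\<lambda>i. X (Suc i) \<omega>)) \<le> \<phi> (\<lambda>i. X (Suc i) \<omega>) + 2 * B / R n * (\<Sum>i<d. \<bar>X (Suc i) \<omega>\<bar>)"
          unfolding x_def .
      qed
      also have "\<dots> \<le> ER (\<lambda>\<omega>. \<phi> (\<lambda>i. X (Suc i) \<omega>)) + ER (\<lambda>\<omega>. (2 * B / R n) * (\<Sum>i<d. \<bar>X (Suc i) \<omega>\<bar>))"
        by (intro ER_add_le I integ_scale iS)
      also have "ER (\<lambda>\<omega>. (2 * B / R n) * (\<Sum>i<d. \<bar>X (Suc i) \<omega>\<bar>)) = (2 * B / R n) * ER (\<lambda>\<omega>. \<Sum>i<d. \<bar>X (Suc i) \<omega>\<bar>)"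
        using B0 by (intro ER_scale iS) (simp add: R_def)
      also have "\<dots> \<le> (2 * B / R n) * m"
        unfolding m_def using B0 by (intro mult_left_mono ER_sum_le integ_abs int) (simp add: R_def)
      finally show ?thesis using BL[OF BLc[of n]] by (simp add: R_def)
    qed
    have "(\<lambda>n. ER (\<lambda>\<omega>. \<phi> (\<lambda>i. X (Suc i) \<omega>)) + 2 * B * m / Suc n) \<longlonglongrightarrow> ER (\<lambda>\<omega>. \<phi> (\<lambda>i. X (Suc i) \<omega>)) + 2 * B * m * 0"
      unfolding mult_zero_right by (intro tendsto_add tendsto_const LIMSEQ_Suc[OF lim_const_over_n])
    then have "(\<integral>x. \<phi> x \<partial>Q) \<le> ER (\<lambda>\<omega>. \<phi> (\<lambda>i. X (Suc i) \<omega>)) + 2 * B * m * 0"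
      by (rule LIMSEQ_le[OF lim]) (use le in blast)
    then have "(\<integral>x. \<phi> x \<partial>Q) \<le> ER (\<lambda>\<omega>. \<phi> (\<lambda>i. X (Suc i) \<omega>))" by simp
    then show ?thesis unfolding copy_E_def E_integ[OF I] by simp
  qed
  then show ?thesis unfolding copy_P_def Q_def[symmetric] using sQ Q.prob_space_axioms by blast
qed

end

section \<open>Iterated logarithms and the normalising sequences\<close>

definition LL :: "real \<Rightarrow> real" where "LL v = logp (logp v)"

text \<open>\<open>aa\<close> and \<open>ss\<close> are $a_n = s_n t_n$ and $s_n / t_n$ as functions of $s_n^2$.\<close>

definition aa :: "real \<Rightarrow> real" where "aa v = sqrt v * sqrt (2 * LL v)"

definition ss :: "real \<Rightarrow> real" where "ss v = sqrt v / sqrt (2 * LL v)"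

lemma logp_ge_1: "1 \<le> logp x"
proof -
  have "ln (exp 1) \<le> logp x" unfolding logp_def by (intro ln_mono) auto
  then show ?thesis by simp
qed

lemma logp_neq_0: "logp x \<noteq> 0"
  using logp_ge_1[of x] by linarith

lemma logp_mono: "x \<le> y \<Longrightarrow> logp x \<le> logp y"
  unfolding logp_def by (intro ln_mono) (auto simp: less_max_iff_disj)

text \<open>Slow growth in a crude form that survives iteration: as \<open>logp\<close> is at least
  1, the additive term \<open>ln k\<close> is at most \<open>(k - 1) * logp x\<close>.\<close>

lemma logp_mult_le:
  assumes "1 \<le> k" "0 \<le> x" shows "logp (k * x) \<le> k * logp x"
proof -
  have m: "0 < max (exp 1) x" by (simp add: less_max_iff_disj)
  have "max (exp 1) (k * x) \<le> k * max (exp 1) x"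
  proof (rule max.boundedI)
    have "1 * exp 1 \<le> k * max (exp 1) x" using assms by (intro mult_mono) auto
    then show "exp 1 \<le> k * max (exp 1) x" by simp
    show "k * x \<le> k * max (exp 1) x" using assms by (intro mult_left_mono) auto
  qed
  then have "logp (k * x) \<le> ln (k * max (exp 1) x)"
    unfolding logp_def by (intro ln_mono) (auto simp: less_max_iff_disj)
  also have "\<dots> = ln k + logp x" unfolding logp_def using assms m by (subst ln_mult) auto
  also have "\<dots> \<le> (k - 1) * logp x + logp x"
  proof -
    have "ln k \<le> (k - 1) * 1" using ln_le_minus_one[of k] assms by simp
    also have "\<dots> \<le> (k - 1) * logp x" using assms logp_ge_1 by (intro mult_left_mono) auto
    finally show ?thesis by simp
  qed
  also have "\<dots> = k * logp x" by (simp add: algebra_simps)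
  finally show ?thesis .
qed

lemma LL_ge_1: "1 \<le> LL v" unfolding LL_def by (rule logp_ge_1)

lemma LL_pos: "0 < LL v" using LL_ge_1[of v] by linarith

lemma LL_mono: "v \<le> w \<Longrightarrow> LL v \<le> LL w" unfolding LL_def by (intro logp_mono)

lemma LL_mult_le: "1 \<le> k \<Longrightarrow> 0 \<le> v \<Longrightarrow> LL (k * v) \<le> k * LL v"
  unfolding LL_def
  by (rule order_trans[OF logp_mono[OF logp_mult_le] logp_mult_le]) (use logp_ge_1[of v] in auto)

lemma aa_nonneg: "0 \<le> v \<Longrightarrow> 0 \<le> aa v" unfolding aa_def using LL_pos[of v] by simp

lemma aa_pos: "0 < v \<Longrightarrow> 0 < aa v" unfolding aa_def using LL_pos[of v] by simp

lemma aa_mono: "0 \<le> v \<Longrightarrow> v \<le> w \<Longrightarrow> aa v \<le> aa w"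
  unfolding aa_def using LL_pos[of v] LL_mono[of v w] by (intro mult_mono) auto

lemma aa_mult_le:
  assumes "1 \<le> k" "0 \<le> v" shows "aa (k * v) \<le> k * aa v"
proof -
  have "aa (k * v) \<le> sqrt (k * v) * sqrt (k * (2 * LL v))"
    unfolding aa_def using LL_mult_le[OF assms] assms by (intro mult_left_mono) auto
  also have "\<dots> = k * aa v" unfolding aa_def using assms by (simp add: real_sqrt_mult)
  finally show ?thesis .
qed

lemma aa_mult_ge:
  assumes "1 \<le> k" "0 \<le> v" shows "sqrt k * aa v \<le> aa (k * v)"
proof -
  have "v \<le> k * v" using assms by (simp add: mult_le_cancel_right1)
  then have "sqrt (k * v) * sqrt (2 * LL v) \<le> aa (k * v)"
    unfolding aa_def using LL_mono[of v "k * v"] assms by (intro mult_left_mono) auto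
  then show ?thesis unfolding aa_def by (simp add: real_sqrt_mult)
qed

lemma ss_nonneg: "0 \<le> v \<Longrightarrow> 0 \<le> ss v" unfolding ss_def using LL_pos[of v] by simp

lemma ss_pos: "0 < v \<Longrightarrow> 0 < ss v" unfolding ss_def using LL_pos[of v] by simp

lemma ss_mult_le:
  assumes "1 \<le> k" "0 \<le> v" shows "ss (k * v) \<le> k * ss v"
proof -
  have le: "v \<le> k * v" using assms by (simp add: mult_le_cancel_right1)
  have "ss (k * v) \<le> sqrt (k * v) / sqrt (2 * LL v)"
    unfolding ss_def using LL_mono[OF le] LL_pos[of v] assms by (intro divide_left_mono) auto
  also have "\<dots> = sqrt k * ss v" unfolding ss_def by (simp add: real_sqrt_mult)
  also have "\<dots> \<le> k * ss v" using assms ss_nonneg[of v] by (intro mult_right_mono real_sqrt_le_iff[THEN iffD2, of k "k^2", simplified]) (auto simp: power2_eq_square mult_le_cancel_right1 real_le_lsqrt)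
  finally show ?thesis .
qed

text \<open>Multiplying the argument by \<open>k\<close> multiplies \<open>LL\<close> by at most
  \<open>k\<close>, so the numerator wins.\<close>

lemma ss_mono:
  assumes "0 < v" "v \<le> w" shows "ss v \<le> ss w"
proof -
  define k where "k = w / v"
  have k: "1 \<le> k" "w = k * v" using assms by (auto simp: k_def)
  have "sqrt (2 * LL w) \<le> sqrt (k * (2 * LL v))" using LL_mult_le[OF k(1), of v] assms k by simp
  then have "sqrt w / sqrt (k * (2 * LL v)) \<le> ss w"
    unfolding ss_def using assms k LL_pos[of v] LL_pos[of w] by (intro divide_left_mono mult_pos_pos) auto
  moreover have "sqrt w / sqrt (k * (2 * LL v)) = ss v"
    unfolding ss_def k(2) using k(1) by (simp add: real_sqrt_mult)
  ultimately show ?thesis by simp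
qed

lemma aa_eq_ss: "aa v = ss v * (2 * LL v)"
proof -
  have "sqrt (2 * LL v) * sqrt (2 * LL v) = 2 * LL v" using LL_pos[of v] by simp
  then show ?thesis unfolding aa_def ss_def using LL_pos[of v] by (simp add: field_simps)
qed

section \<open>Power inequalities behind the use of condition (ii)\<close>

lemma powr_mean_value:
  fixes a b :: real assumes "0 \<le> a" "a \<le> b" "1 \<le> q"
  shows "b powr q - a powr q \<le> q * b powr (q - 1) * (b - a)"
proof (cases "a = b")
  case False
  then have ab: "a < b" using assms by simp
  have D: "((\<lambda>z. z powr q) has_real_derivative q * x powr (q - 1)) (at x)" if "a < x" for x
    using that assms by (intro has_real_derivative_powr) auto
  have "continuous_on {a..b} (\<lambda>z. z powr q)" using assms by (intro continuous_on_powr' continuous_intros) auto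
  then have "\<exists>l z. a < z \<and> z < b \<and> ((\<lambda>z. z powr q) has_real_derivative l) (at z) \<and> b powr q - a powr q = (b - a) * l"
    using D by (intro MVT ab) (auto simp: real_differentiable_def)
  then obtain z where z: "a < z" "z < b" "b powr q - a powr q = (b - a) * (q * z powr (q - 1))"
    using DERIV_unique[OF D] by blast
  have "z powr (q - 1) \<le> b powr (q - 1)" using z assms by (intro powr_mono2) auto
  then have "(b - a) * (q * z powr (q - 1)) \<le> (b - a) * (q * b powr (q - 1))"
    using ab assms by (intro mult_left_mono) auto
  with z(3) show ?thesis by (simp add: mult_ac)
qed simp

text \<open>A discrete form of d(S^q) = q S^(q-1) dS for partial sums S. It converts the running
  sums that occur in (ii) into a power of the whole block sum.\<close>

lemma sum_powr_increment:
  fixes y :: "nat \<Rightarrow> real"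
  assumes y: "\<And>j. 0 \<le> y j" and q: "1 \<le> q"
  shows "(\<Sum>j=m..<n. y j) powr q \<le> q * (\<Sum>j=m..<n. y j * (\<Sum>i=m..j. y i) powr (q - 1))"
proof (induction n)
  case (Suc n)
  show ?case
  proof (cases "m \<le> n")
    case True
    let ?S = "\<Sum>j=m..<n. y j"
    have e: "(\<Sum>i=m..n. y i) = ?S + y n" using True by (simp add: atLeastLessThanSuc_atLeastAtMost[symmetric])
    have "(?S + y n) powr q - ?S powr q \<le> q * (?S + y n) powr (q - 1) * (?S + y n - ?S)"
      using y by (intro powr_mean_value q sum_nonneg) auto
    with Suc show ?thesis using True by (simp add: e algebra_simps)
  qed simp
qed simp

text \<open>Convexity at the points \<open>a\<close> and \<open>b / (1 - r)\<close> with weights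
  \<open>r\<close> and \<open>1 - r\<close>. The coefficient \<open>r < 1\<close> in front of the
  first power is what permits absorption in a recursion.\<close>

lemma powr_convex_le:
  fixes a b :: real assumes "0 < r" "r < 1" "0 < a" "0 \<le> b" "1 \<le> q"
  shows "(r * a + b) powr q \<le> r * a powr q + (1 - r) powr (1 - q) * b powr q"
proof (cases "b = 0")
  case True
  have "r powr q \<le> r powr 1" using assms by (intro powr_mono') auto
  then have "r powr q * a powr q \<le> r * a powr q" using assms by (intro mult_right_mono) auto
  then show ?thesis using True assms by (simp add: powr_mult)
next
  case False
  define c where "c = b / (1 - r)"
  have c: "0 < c" "b = (1 - r) * c" using assms False by (auto simp: c_def)
  have "(r * a + (1 - r) * c) powr q \<le> r * a powr q + (1 - r) * c powr q"
    using convex_onD[OF powr_convex[OF assms(5)], of "1 - r" a c] assms c by simp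
  also have "(1 - r) * c powr q = (1 - r) powr (1 - q) * b powr q"
    unfolding c_def using assms False by (simp add: powr_divide powr_diff)
  finally show ?thesis using c by simp
qed

text \<open>The convexity estimate bounds a partial sum of the powers by \<open>r\<close> times
  itself plus a constant; partial sums are finite, so the first term may be absorbed.\<close>

lemma summable_powr_recursion:
  fixes lam x :: "nat \<Rightarrow> real"
  assumes r: "0 < r" "r < 1" and q: "1 \<le> q" and pos: "\<And>l. 0 < lam l" and x: "\<And>l. 0 \<le> x l"
    and rec: "\<And>l. lam (Suc l) = r * lam l + x l" and s: "summable (\<lambda>l. x l powr q)"
  shows "summable (\<lambda>l. lam l powr q)"
proof (rule summableI_nonneg_bounded)
  define C where "C = (1 - r) powr (1 - q)"
  have C: "0 \<le> C" unfolding C_def by simp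
  fix L
  let ?S = "\<Sum>l<L. lam l powr q"
  have "?S \<le> (\<Sum>l<Suc L. lam l powr q)" by simp
  also have "\<dots> = lam 0 powr q + (\<Sum>l<L. lam (Suc l) powr q)" by (rule sum.lessThan_Suc_shift)
  also have "(\<Sum>l<L. lam (Suc l) powr q) \<le> (\<Sum>l<L. r * lam l powr q + C * x l powr q)"
    unfolding rec C_def using r q pos x by (intro sum_mono powr_convex_le)
  also have "\<dots> = r * ?S + C * (\<Sum>l<L. x l powr q)" by (simp add: sum.distrib sum_distrib_left)
  also have "(\<Sum>l<L. x l powr q) \<le> (\<Sum>l. x l powr q)" using s by (intro sum_le_suminf) auto
  finally have "?S \<le> lam 0 powr q + (r * ?S + C * (\<Sum>l. x l powr q))"
    using C by (simp add: mult_left_mono)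
  then have "(1 - r) * ?S \<le> lam 0 powr q + C * (\<Sum>l. x l powr q)" by (simp add: algebra_simps)
  then show "?S \<le> (lam 0 powr q + C * (\<Sum>l. x l powr q)) / (1 - r)"
    using r by (simp add: field_simps)
qed simp

lemma poly_lip_square: "poly_lip (\<lambda>x. x\<^sup>2)"
  unfolding poly_lip_def
proof (intro exI[of _ 1] conjI allI)
  fix x y :: real
  have "\<bar>x\<^sup>2 - y\<^sup>2\<bar> = \<bar>x + y\<bar> * \<bar>x - y\<bar>" by (simp add: power2_eq_square abs_mult[symmetric] algebra_simps)
  also have "\<dots> \<le> (1 + \<bar>x\<bar> ^ 1 + \<bar>y\<bar> ^ 1) * \<bar>x - y\<bar>" by (intro mult_right_mono) auto
  finally show "\<bar>x\<^sup>2 - y\<^sup>2\<bar> \<le> 1 * (1 + \<bar>x\<bar> ^ 1 + \<bar>y\<bar> ^ 1) * \<bar>x - y\<bar>" by simp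
qed simp

text \<open>The mean value theorem yields the factor \<open>b powr (p - 1)\<close>, which is at most
  \<open>1 + B ^ m\<close> for a natural \<open>m \<ge> p - 1\<close>; the truncation itself is
  1-Lipschitz.\<close>

lemma poly_lip_trunc_powr:
  assumes "1 \<le> p" "0 \<le> c"
  shows "poly_lip (\<lambda>x. (max (\<bar>x\<bar> - c) 0) powr p)"
proof -
  obtain m :: nat where m: "p - 1 \<le> real m" using real_arch_simple by blast
  have *: "\<bar>b powr p - a powr p\<bar> \<le> p * (1 + B ^ m) * \<bar>b - a\<bar>" if "0 \<le> a" "a \<le> b" "b \<le> B" for a b B :: real
  proof -
    have "b powr (p - 1) \<le> 1 + B ^ m"
    proof (cases "b \<le> 1")
      case True
      then have "b powr (p - 1) \<le> 1" using that assms by (intro powr_le1) auto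
      moreover have "0 \<le> B ^ m" using that by simp
      ultimately show ?thesis by linarith
    next
      case False
      then have "b powr (p - 1) \<le> b powr m" using m by (intro powr_mono) auto
      also have "\<dots> = b ^ m" using False by (simp add: powr_realpow)
      also have "\<dots> \<le> B ^ m" using that by (intro power_mono) auto
      finally show ?thesis by simp
    qed
    then have "p * b powr (p - 1) * (b - a) \<le> p * (1 + B ^ m) * (b - a)"
      using assms that by (intro mult_right_mono mult_left_mono) auto
    moreover have "a powr p \<le> b powr p" using that assms by (intro powr_mono2) auto
    ultimately show ?thesis using powr_mean_value[OF that(1,2) assms(1)] that by simp
  qed
  let ?f = "\<lambda>x. max (\<bar>x\<bar> - c) 0"
  have main: "\<bar>?f x powr p - ?f y powr p\<bar> \<le> p * (1 + \<bar>x\<bar> ^ m + \<bar>y\<bar> ^ m) * \<bar>x - y\<bar>" if xy: "\<bar>y\<bar> \<le> \<bar>x\<bar>" for x y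
  proof -
    have "\<bar>?f x powr p - ?f y powr p\<bar> \<le> p * (1 + \<bar>x\<bar> ^ m) * \<bar>?f x - ?f y\<bar>"
      using xy assms by (intro *) auto
    also have "\<dots> \<le> p * (1 + \<bar>x\<bar> ^ m + \<bar>y\<bar> ^ m) * \<bar>x - y\<bar>"
      using assms by (intro mult_mono mult_left_mono) auto
    finally show ?thesis .
  qed
  show ?thesis unfolding poly_lip_def
  proof (intro exI[of _ p] exI[of _ m] conjI allI)
    fix x y
    show "\<bar>?f x powr p - ?f y powr p\<bar> \<le> p * (1 + \<bar>x\<bar> ^ m + \<bar>y\<bar> ^ m) * \<bar>x - y\<bar>"
      using main[of y x] main[of x y] by (cases "\<bar>y\<bar> \<le> \<bar>x\<bar>") (auto simp: abs_minus_commute add_ac)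
  qed (use assms in simp)
qed

section \<open>The hypotheses in normalised form and the geometric levels\<close>

locale lil_hypotheses = indep_rv_sequence M H E X
  for M :: "'a measure" and H :: "('a \<Rightarrow> real) set" and E :: "('a \<Rightarrow> real) \<Rightarrow> ereal"
    and X :: "nat \<Rightarrow> 'a \<Rightarrow> real" +
  fixes VV :: "'a set \<Rightarrow> real"
  assumes second_moments: "\<And>n. n \<ge> 1 \<Longrightarrow> E (\<lambda>\<omega>. (X n \<omega>)\<^sup>2) < \<infinity>"
    and capacity: "subadditive_capacity M VV"
    and compatible: "property_C M H E VV"
    and i: "\<And>\<epsilon>::real. \<epsilon> > 0 \<Longrightarrow>
      (\<Sum>n. ereal (VV {\<omega>\<in>space M. \<bar>X (Suc n) \<omega>\<bar> \<ge> \<epsilon> * a_norm E X (Suc n)})) < \<infinity>"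
    and ii: "\<And>\<alpha>::real. \<alpha> > 0 \<Longrightarrow>
      \<exists>p d :: real. p \<ge> 2 \<and> d \<ge> 0 \<and> (\<Sum>n. moment_term E X (Suc n) p \<alpha> d) < \<infinity>"
    and iii: "\<And>\<delta>::real. \<delta> > 0 \<Longrightarrow>
      (\<Sum>n. ereal (1 / s2 E X (Suc n) * logp (s2 E X (Suc n)) powr (\<delta> - 1))
             * E (\<lambda>\<omega>. (X (Suc n) \<omega>)\<^sup>2)) = \<infinity>"
    and iv: "(\<lambda>n. (\<Sum>j=1..n. \<bar>E (X j)\<bar> + \<bar>conj_expectation E (X j)\<bar>) / ereal (a_norm E X n))
      \<longlonglongrightarrow> 0"
begin

text \<open>Indices are shifted so that \<open>\<sigma>2 j\<close> belongs to coordinate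
  \<open>j\<close> of the sequence space, that is, to \<open>X (Suc j)\<close>.\<close>

definition \<sigma>2 :: "nat \<Rightarrow> real" where "\<sigma>2 j = ER (\<lambda>\<omega>. (X (Suc j) \<omega>)\<^sup>2)"

definition v :: "nat \<Rightarrow> real" where "v n = (\<Sum>j<n. \<sigma>2 j)"

lemma integ_square: "integ (\<lambda>\<omega>. (X (Suc j) \<omega>)\<^sup>2)"
  unfolding integ_def using second_moments[of "Suc j"] H_comp1[OF poly_lip_square X_H[of j]] by simp

lemma integ_X: "integ (X (Suc j))"
proof (rule integ_dominated[OF X_H])
  show "integ (\<lambda>\<omega>. 1 + (X (Suc j) \<omega>)\<^sup>2)" by (intro integ_add integ_const integ_square)
  fix \<omega>
  have "2 * \<bar>X (Suc j) \<omega>\<bar> \<le> 1 + (X (Suc j) \<omega>)\<^sup>2"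
    using zero_le_power2[of "\<bar>X (Suc j) \<omega>\<bar> - 1"] unfolding power2_diff by simp
  then show "\<bar>X (Suc j) \<omega>\<bar> \<le> 1 + (X (Suc j) \<omega>)\<^sup>2"
    using abs_ge_zero[of "X (Suc j) \<omega>"] by linarith
qed

lemma E_square: "E (\<lambda>\<omega>. (X (Suc j) \<omega>)\<^sup>2) = ereal (\<sigma>2 j)"
  unfolding \<sigma>2_def by (rule E_integ[OF integ_square])

lemma \<sigma>2_nonneg: "0 \<le> \<sigma>2 j"
  unfolding \<sigma>2_def by (rule ER_nonneg[OF integ_square]) simp

lemma s2_eq: "s2 E X n = v n"
proof -
  have "(\<Sum>k=1..n. E (\<lambda>\<omega>. (X k \<omega>)\<^sup>2)) = (\<Sum>k<n. E (\<lambda>\<omega>. (X (Suc k) \<omega>)\<^sup>2))"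
    by (rule sum.reindex_bij_witness[of _ Suc "\<lambda>k. k - 1"]) auto
  then show ?thesis unfolding s2_def v_def E_square by simp
qed

lemma v_0 [simp]: "v 0 = 0" by (simp add: v_def)

lemma v_Suc: "v (Suc n) = v n + \<sigma>2 n" by (simp add: v_def)

lemma v_mono: "m \<le> n \<Longrightarrow> v m \<le> v n"
  unfolding v_def using \<sigma>2_nonneg by (intro sum_mono2) auto

lemma v_nonneg: "0 \<le> v n" using v_mono[of 0 n] by simp

lemma a_norm_eq: "a_norm E X n = aa (v n)"
  unfolding a_norm_def s_norm_def t_norm_def aa_def LL_def s2_eq ..

lemma s_norm_over_t_norm: "\<alpha> * s_norm E X n / t_norm E X n = \<alpha> * ss (v n)"
  unfolding s_norm_def t_norm_def ss_def LL_def s2_eq by simp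

text \<open>Condition (iii) with \<delta> = 1 says that the sum of
  \<open>\<sigma>2 n / v (Suc n)\<close> diverges. If \<open>v\<close> were bounded, its first
  positive value would bound the denominators from below, and the series would converge.\<close>

lemma v_unbounded: "\<exists>n. B < v n"
proof (rule ccontr)
  assume "\<not> ?thesis"
  then have B: "v n \<le> B" for n by (simp add: not_less)
  let ?t = "\<lambda>n. 1 / s2 E X (Suc n) * logp (s2 E X (Suc n)) powr (1 - 1)"
  have "\<exists>c>0. \<forall>n. \<sigma>2 n / v (Suc n) \<le> \<sigma>2 n / c"
  proof (cases "\<exists>n. 0 < v n")
    case True
    define m where "m = (LEAST n. 0 < v n)"
    have m: "0 < v m" unfolding m_def using True by (rule LeastI_ex)
    have "\<sigma>2 n / v (Suc n) \<le> \<sigma>2 n / v m" for n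
    proof (cases "0 < v (Suc n)")
      case True
      then have "m \<le> Suc n" unfolding m_def by (rule Least_le)
      then show ?thesis using m \<sigma>2_nonneg[of n] v_mono[of m "Suc n"] by (intro divide_left_mono) auto
    next
      case False
      \<comment> \<open>Division by zero yields 0, so an initial segment of vanishing variance
        contributes nothing.\<close>
      then have "v (Suc n) = 0" using v_nonneg[of "Suc n"] by simp
      then show ?thesis using m \<sigma>2_nonneg[of n] by simp
    qed
    with m show ?thesis by blast
  next
    case False
    then have "v n = 0" for n using v_nonneg[of n] by (simp add: not_less antisym)
    then show ?thesis using \<sigma>2_nonneg by (intro exI[of _ 1]) simp
  qed
  then obtain c where c: "0 < c" "\<And>n. \<sigma>2 n / v (Suc n) \<le> \<sigma>2 n / c" by blast
  have "(\<Sum>n. ereal (?t n) * E (\<lambda>\<omega>. (X (Suc n) \<omega>)\<^sup>2)) \<le> ereal (B / c)"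
  proof (rule suminf_bound, rule allI)
    fix N
    have "(\<Sum>n<N. ereal (?t n) * E (\<lambda>\<omega>. (X (Suc n) \<omega>)\<^sup>2)) = ereal (\<Sum>n<N. \<sigma>2 n / v (Suc n))"
      unfolding E_square s2_eq by (simp add: logp_neq_0)
    also have "\<dots> \<le> ereal (\<Sum>n<N. \<sigma>2 n / c)" using c by (simp add: sum_mono)
    also have "(\<Sum>n<N. \<sigma>2 n / c) = v N / c" unfolding v_def by (simp add: sum_divide_distrib)
    also have "ereal (v N / c) \<le> ereal (B / c)" using B[of N] c by (simp add: divide_right_mono)
    finally show "(\<Sum>n<N. ereal (?t n) * E (\<lambda>\<omega>. (X (Suc n) \<omega>)\<^sup>2)) \<le> ereal (B / c)" .
  next
    show "0 \<le> ereal (?t n) * E (\<lambda>\<omega>. (X (Suc n) \<omega>)\<^sup>2)" for n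
      unfolding E_square s2_eq using \<sigma>2_nonneg[of n] v_nonneg[of "Suc n"] by simp
  qed
  then show False using iii[of 1] by simp
qed

text \<open>The last index before the variance reaches \<open>\<theta> ^ Suc l\<close>; the maximum
  exists because \<open>v\<close> is monotone and unbounded. Consecutive levels have the same value
  when \<open>v\<close> jumps over one.\<close>

definition N :: "real \<Rightarrow> nat \<Rightarrow> nat" where
  "N \<theta> l = Max {n. v n < \<theta> ^ Suc l}"

lemma N_iff:
  assumes "1 < \<theta>" shows "n \<le> N \<theta> l \<longleftrightarrow> v n < \<theta> ^ Suc l"
proof -
  let ?A = "{n. v n < \<theta> ^ Suc l}"
  obtain m where m: "\<theta> ^ Suc l < v m" using v_unbounded by blast
  have "n \<le> m" if "n \<in> ?A" for n using that m v_mono[of m n] by (cases "n \<le> m") auto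
  then have fin: "finite ?A" by (intro finite_subset[of ?A "{..m}"]) auto
  have "0 \<in> ?A" using assms by simp
  then have "?A \<noteq> {}" by blast
  with fin have "Max ?A \<in> ?A" by (rule Max_in)
  then have 1: "v (N \<theta> l) < \<theta> ^ Suc l" unfolding N_def by simp
  show ?thesis
  proof
    assume "n \<le> N \<theta> l"
    then show "v n < \<theta> ^ Suc l" using 1 v_mono[of n "N \<theta> l"] by simp
  next
    assume "v n < \<theta> ^ Suc l"
    then show "n \<le> N \<theta> l" unfolding N_def using fin by (intro Max_ge) auto
  qed
qed

lemma v_N_less: "1 < \<theta> \<Longrightarrow> v (N \<theta> l) < \<theta> ^ Suc l"
  using N_iff[of \<theta> "N \<theta> l" l] by simp

lemma N_mono:
  assumes "1 < \<theta>" "l \<le> k" shows "N \<theta> l \<le> N \<theta> k"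
proof -
  have "v (N \<theta> l) < \<theta> ^ Suc l" by (rule v_N_less[OF assms(1)])
  also have "\<dots> \<le> \<theta> ^ Suc k" using assms by (intro power_increasing) auto
  finally show ?thesis using N_iff[OF assms(1)] by simp
qed

lemma level_exists:
  assumes "1 < \<theta>" "1 \<le> v n" shows "\<exists>l. \<theta> ^ l \<le> v n \<and> v n < \<theta> ^ Suc l"
proof -
  obtain k where k: "v n < \<theta> ^ k" using real_arch_pow[OF assms(1)] by blast
  define m where "m = (LEAST k. v n < \<theta> ^ k)"
  have m: "v n < \<theta> ^ m" unfolding m_def using k by (rule LeastI)
  then obtain l where l: "m = Suc l" using assms(2) by (cases m) auto
  then have "\<not> v n < \<theta> ^ l" unfolding m_def by (metis lessI not_less_Least)
  then show ?thesis using m l by (intro exI[of _ l]) auto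
qed

end

section \<open>The tail conditions\<close>

lemma ereal_powr_ge:
  assumes "ereal x \<le> z" "0 \<le> x" "0 \<le> d" shows "ereal (x powr d) \<le> ereal_powr z d"
proof (cases z)
  case (real r)
  then show ?thesis using assms unfolding ereal_powr_def by (auto simp: one_ereal_def intro: powr_mono2)
next
  case PInf
  then show ?thesis using assms unfolding ereal_powr_def by (auto simp: one_ereal_def)
next
  case MInf
  then show ?thesis using assms by simp
qed

lemma ereal_powr_nonneg: "0 \<le> ereal_powr z d"
  unfolding ereal_powr_def by auto

lemma summable_finite_suminf:
  fixes f :: "nat \<Rightarrow> ereal"
  assumes "\<And>n. 0 \<le> f n" "suminf f < \<infinity>"
  shows "\<exists>g. (\<forall>n. f n = ereal (g n)) \<and> summable g"
proof -
  obtain g where g: "f = (\<lambda>n. ereal (g n))" using suminf_PInfty_fun[of f] assms by auto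
  have g0: "0 \<le> g n" for n using assms(1)[of n] g by simp
  have s0: "0 \<le> suminf f" by (intro suminf_0_le summable_ereal_pos assms)
  then obtain S where S: "suminf f = ereal S" using assms(2) by (cases "suminf f") auto
  have "summable g"
  proof (rule summableI_nonneg_bounded[OF g0])
    fix n
    have "(\<Sum>i<n. f i) \<le> suminf f" by (intro sum_le_suminf summable_ereal_pos assms) auto
    then show "(\<Sum>i<n. g i) \<le> S" unfolding S unfolding g by simp
  qed
  with g show ?thesis by auto
qed

section \<open>From condition (ii) to summable powers of level-wise tail moments\<close>

context lil_hypotheses
begin

text \<open>Each variable is truncated at its own threshold, whereas \<open>Lambda_n\<close>
  truncates all variables at the threshold of the last index. \<open>block_term_le\<close> bridges
  the difference.\<close>

definition \<gamma> :: "real \<Rightarrow> real \<Rightarrow> nat \<Rightarrow> real" where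
  "\<gamma> \<alpha> p j = ER (\<lambda>\<omega>. max (\<bar>X (Suc j) \<omega>\<bar> - \<alpha> * ss (v (Suc j))) 0 powr p)"

text \<open>Indices with $s_n = 0$ are skipped, because the hypotheses leave their $p$-th moments unbounded.\<close>

definition U :: "real \<Rightarrow> real \<Rightarrow> nat \<Rightarrow> real" where
  "U \<alpha> p n = (\<Sum>j<n. if 0 < v (Suc j) then \<gamma> \<alpha> p j else 0)"

lemma H_trunc: "1 \<le> p \<Longrightarrow> 0 \<le> c \<Longrightarrow> (\<lambda>\<omega>. max (\<bar>X (Suc j) \<omega>\<bar> - c) 0 powr p) \<in> H"
  using H_comp1[OF poly_lip_trunc_powr X_H] by simp

lemma trunc_moment_eq: "trunc_moment E X n (Suc j) p \<alpha> = E (\<lambda>\<omega>. max (\<bar>X (Suc j) \<omega>\<bar> - \<alpha> * ss (v n)) 0 powr p)"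
  unfolding trunc_moment_def s_norm_over_t_norm by simp

lemma E_nonneg: "Y \<in> H \<Longrightarrow> (\<And>\<omega>. 0 \<le> Y \<omega>) \<Longrightarrow> 0 \<le> E Y"
  using E_mono[of Y "\<lambda>\<omega>. 0"] E_const[of 0] H_zero by (simp add: zero_ereal_def)

lemma trunc_moment_nonneg:
  assumes "1 \<le> p" "0 \<le> \<alpha>" shows "0 \<le> trunc_moment E X n (Suc j) p \<alpha>"
  unfolding trunc_moment_eq using assms ss_nonneg[OF v_nonneg] by (intro E_nonneg H_trunc) auto

lemma Lambda_n_eq: "Lambda_n E X n p \<alpha> = (\<Sum>j<n. trunc_moment E X n (Suc j) p \<alpha>)"
  unfolding Lambda_n_def by (rule sum.reindex_bij_witness[of _ Suc "\<lambda>k. k - 1"]) auto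

lemma moment_term_nonneg:
  assumes "1 \<le> p" "0 \<le> \<alpha>" shows "0 \<le> moment_term E X (Suc j) p \<alpha> d"
proof -
  have "0 \<le> Gamma_n E X (Suc j) p \<alpha>" unfolding Gamma_n_def by (rule trunc_moment_nonneg[OF assms])
  then show ?thesis
    unfolding moment_term_def using ereal_powr_nonneg
    by (auto intro!: ereal_0_le_mult zero_le_divide_ereal)
qed

text \<open>The moment is also a summand of \<open>Lambda_n\<close>. Were it infinite, the second
  factor of \<open>moment_term\<close> would be infinite too, or 1 if \<open>d = 0\<close>; so no
  product of \<infinity> and 0 can hide it.\<close>

lemma moment_term_finite_imp_integ:
  assumes p: "1 \<le> p" and \<alpha>: "0 \<le> \<alpha>" and v: "0 < v (Suc j)" and fin: "moment_term E X (Suc j) p \<alpha> d \<noteq> \<infinity>"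
  shows "integ (\<lambda>\<omega>. max (\<bar>X (Suc j) \<omega>\<bar> - \<alpha> * ss (v (Suc j))) 0 powr p)"
proof -
  let ?c = "aa (v (Suc j)) powr p"
  have c: "0 < ?c" using aa_pos[OF v] by simp
  let ?G = "trunc_moment E X (Suc j) (Suc j) p \<alpha>"
  have "?G \<noteq> \<infinity>"
  proof
    assume G: "?G = \<infinity>"
    have "?G \<le> Lambda_n E X (Suc j) p \<alpha>"
      unfolding Lambda_n_eq unfolding sum.lessThan_Suc
      by (intro add_increasing sum_nonneg trunc_moment_nonneg[OF p \<alpha>] order_refl)
    then have "Lambda_n E X (Suc j) p \<alpha> = \<infinity>" using G by simp
    then have "moment_term E X (Suc j) p \<alpha> d = \<infinity>"
      unfolding moment_term_def a_norm_eq Gamma_n_def G using c aa_pos[OF v] by (simp add: ereal_powr_def one_ereal_def)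
    with fin show False by simp
  qed
  then show ?thesis
    unfolding integ_def trunc_moment_eq
    using H_trunc[of p "\<alpha> * ss (v (Suc j))" j] p \<alpha> ss_nonneg[OF v_nonneg] by auto
qed

lemma \<gamma>_nonneg:
  assumes "integ (\<lambda>\<omega>. max (\<bar>X (Suc j) \<omega>\<bar> - \<alpha> * ss (v (Suc j))) 0 powr p)"
  shows "0 \<le> \<gamma> \<alpha> p j"
  unfolding \<gamma>_def by (rule ER_nonneg[OF assms]) simp

lemma trunc_powr_mono: "1 \<le> p \<Longrightarrow> c \<le> c' \<Longrightarrow> max (\<bar>x\<bar> - c') 0 powr p \<le> max (\<bar>x\<bar> - c) 0 powr p" for x c c' p :: real
  by (intro powr_mono2) auto

text \<open>Within a level, s_n/t_n and a_n vary by a factor of at most \<theta>. Raising the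
  truncation to \<open>\<theta> * \<alpha>\<close> and the normalisation to
  \<open>\<theta> * aa (\<theta> ^ Suc l)\<close> therefore puts each term below the corresponding
  one in (ii) for \<alpha>.\<close>

lemma block_term_le:
  assumes \<theta>: "1 < \<theta>" and \<alpha>: "0 < \<alpha>" and p: "2 \<le> p" and d: "0 \<le> d"
    and j: "N \<theta> l \<le> j" "j < N \<theta> (Suc l)"
    and int: "\<And>j. 0 < v (Suc j) \<Longrightarrow> integ (\<lambda>\<omega>. max (\<bar>X (Suc j) \<omega>\<bar> - \<alpha> * ss (v (Suc j))) 0 powr p)"
  shows "ereal (\<gamma> (\<theta> * \<alpha>) p j / (\<theta> * aa (\<theta> ^ Suc l)) powr p
      * ((\<Sum>i=N \<theta> l..j. \<gamma> (\<theta> * \<alpha>) p i) / (\<theta> * aa (\<theta> ^ Suc l)) powr p) powr d)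
    \<le> moment_term E X (Suc j) p \<alpha> d"
proof -
  let ?y = "\<gamma> (\<theta> * \<alpha>) p" and ?D = "(\<theta> * aa (\<theta> ^ Suc l)) powr p" and ?a = "aa (v (Suc j))"
  define c where "c = ?a powr p"
  have vge: "\<theta> ^ Suc l \<le> v (Suc i)" if "N \<theta> l \<le> i" for i
    using N_iff[OF \<theta>, of "Suc i" l] that by simp
  have vlt: "v (Suc j) < \<theta> ^ Suc (Suc l)" using N_iff[OF \<theta>, of "Suc j" "Suc l"] j by simp
  have tp: "0 < \<theta> ^ Suc l" using \<theta> by simp
  have vpos: "0 < v (Suc i)" if "N \<theta> l \<le> i" for i using vge[OF that] tp by linarith
  have apos: "0 < ?a" by (rule aa_pos[OF vpos[OF j(1)]])
  have ale: "?a \<le> \<theta> * aa (\<theta> ^ Suc l)"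
  proof -
    have "?a \<le> aa (\<theta> * \<theta> ^ Suc l)" using vlt v_nonneg by (intro aa_mono) auto
    also have "\<dots> \<le> \<theta> * aa (\<theta> ^ Suc l)" using \<theta> by (intro aa_mult_le) auto
    finally show ?thesis .
  qed
  have c: "0 < c" "c \<le> ?D" unfolding c_def using apos ale p by (auto intro!: powr_mono2)
  have int': "integ (\<lambda>\<omega>. max (\<bar>X (Suc i) \<omega>\<bar> - \<theta> * \<alpha> * ss (v (Suc i))) 0 powr p)" if "0 < v (Suc i)" for i
  proof (rule integ_dominated[OF H_trunc int[OF that]])
    show "1 \<le> p" "0 \<le> \<theta> * \<alpha> * ss (v (Suc i))" using p \<theta> \<alpha> ss_nonneg[OF v_nonneg] by auto
    have "1 * (\<alpha> * ss (v (Suc i))) \<le> \<theta> * (\<alpha> * ss (v (Suc i)))"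
      using \<theta> \<alpha> ss_nonneg[OF v_nonneg] by (intro mult_right_mono) auto
    then show "\<bar>max (\<bar>X (Suc i) \<omega>\<bar> - \<theta> * \<alpha> * ss (v (Suc i))) 0 powr p\<bar> \<le> max (\<bar>X (Suc i) \<omega>\<bar> - \<alpha> * ss (v (Suc i))) 0 powr p" for \<omega>
      using p by (simp add: mult.assoc trunc_powr_mono)
  qed
  have y0: "0 \<le> ?y i" if "0 < v (Suc i)" for i by (rule \<gamma>_nonneg[OF int'[OF that]])
  define Y where "Y = (\<Sum>i=N \<theta> l..j. ?y i)"
  have Y0: "0 \<le> Y" unfolding Y_def by (intro sum_nonneg y0 vpos) auto
  have tm: "ereal (?y i) \<le> trunc_moment E X (Suc j) (Suc i) p \<alpha>" if i: "N \<theta> l \<le> i" "i \<le> j" for i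
  proof -
    have "ss (v (Suc j)) \<le> ss (\<theta> * \<theta> ^ Suc l)" using vlt by (intro ss_mono vpos j) auto
    also have "\<dots> \<le> \<theta> * ss (\<theta> ^ Suc l)" using \<theta> by (intro ss_mult_le) auto
    also have "\<dots> \<le> \<theta> * ss (v (Suc i))" using \<theta> by (intro mult_left_mono ss_mono tp vge i) auto
    finally have "\<alpha> * ss (v (Suc j)) \<le> \<theta> * \<alpha> * ss (v (Suc i))" using \<alpha> by (simp add: mult.assoc mult.left_commute[of \<theta>])
    then have "E (\<lambda>\<omega>. max (\<bar>X (Suc i) \<omega>\<bar> - \<theta> * \<alpha> * ss (v (Suc i))) 0 powr p)
        \<le> E (\<lambda>\<omega>. max (\<bar>X (Suc i) \<omega>\<bar> - \<alpha> * ss (v (Suc j))) 0 powr p)"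
      using p \<theta> \<alpha> ss_nonneg[OF v_nonneg] by (intro E_mono H_trunc trunc_powr_mono) auto
    then show ?thesis unfolding trunc_moment_eq \<gamma>_def E_integ[OF int'[OF vpos[OF i(1)]]] .
  qed
  obtain g where g: "trunc_moment E X (Suc j) (Suc j) p \<alpha> = ereal g"
    unfolding trunc_moment_eq using E_integ[OF int[OF vpos[OF j(1)]]] by blast
  have gy: "?y j \<le> g" using tm[of j] j g by simp
  have Lam: "ereal Y \<le> Lambda_n E X (Suc j) p \<alpha>"
  proof -
    have "ereal Y = (\<Sum>i=N \<theta> l..j. ereal (?y i))" unfolding Y_def by simp
    also have "\<dots> \<le> (\<Sum>i=N \<theta> l..j. trunc_moment E X (Suc j) (Suc i) p \<alpha>)" by (intro sum_mono tm) auto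
    also have "\<dots> \<le> Lambda_n E X (Suc j) p \<alpha>"
      unfolding Lambda_n_eq using p \<alpha> by (intro sum_mono2 trunc_moment_nonneg) auto
    finally show ?thesis .
  qed
  have "?y j / ?D * (Y / ?D) powr d \<le> g / c * (Y / c) powr d"
    using c gy y0[OF vpos[OF j(1)]] Y0 d
    by (intro mult_mono powr_mono2 frac_le divide_nonneg_nonneg) auto
  then have "ereal (?y j / ?D * (Y / ?D) powr d) \<le> ereal (g / c) * ereal ((Y / c) powr d)" by simp
  also have "\<dots> \<le> ereal (g / c) * ereal_powr (Lambda_n E X (Suc j) p \<alpha> / ereal c) d"
  proof (intro ereal_mult_left_mono ereal_powr_ge d)
    have "ereal Y / ereal c \<le> Lambda_n E X (Suc j) p \<alpha> / ereal c" using Lam c by (intro ereal_divide_right_mono) auto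
    then show "ereal (Y / c) \<le> Lambda_n E X (Suc j) p \<alpha> / ereal c" using c by simp
    show "0 \<le> Y / c" using Y0 c by simp
    show "0 \<le> ereal (g / c)" using gy y0[OF vpos[OF j(1)]] c by simp
  qed
  also have "\<dots> = moment_term E X (Suc j) p \<alpha> d"
    unfolding moment_term_def a_norm_eq Gamma_n_def g c_def[symmetric] using apos c by simp
  finally show ?thesis unfolding Y_def .
qed

text \<open>The ratios \<open>lam\<close> obey a recursion: passing to the next level shrinks the
  old ratio by \<open>r < 1\<close>, since \<open>aa\<close> grows by at least the factor
  \<open>sqrt \<theta>\<close>, and adds the normalised contribution \<open>x l\<close> of the new
  block. The \<open>q\<close>-th powers of \<open>x l\<close> are summable by (ii), and the
  recursion hands this on to \<open>lam\<close>.\<close>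

lemma tail_moments:
  assumes \<theta>: "1 < \<theta>" and \<alpha>: "0 < \<alpha>"
  shows "\<exists>p q lam. 2 \<le> p \<and> 1 \<le> q \<and>
    (\<forall>j. 0 < v (Suc j) \<longrightarrow> integ (\<lambda>\<omega>. max (\<bar>X (Suc j) \<omega>\<bar> - \<alpha> * ss (v (Suc j))) 0 powr p)) \<and>
    (\<forall>l. 0 < lam l) \<and> (\<forall>l. U \<alpha> p (N \<theta> l) \<le> lam l * aa (\<theta> ^ l) powr p) \<and> summable (\<lambda>l. lam l powr q)"
proof -
  \<comment> \<open>Condition (ii) is used at the smaller level \<open>\<alpha> / \<theta>\<close>,
    because comparing thresholds inside a level costs a factor \<theta>.\<close>
  define \<beta> where "\<beta> = \<alpha> / \<theta>"
  have \<beta>: "0 < \<beta>" "\<alpha> = \<theta> * \<beta>" "\<beta> \<le> \<alpha>" using \<theta> \<alpha> by (auto simp: \<beta>_def field_simps mult_le_cancel_right1)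
  obtain p d where p: "2 \<le> p" and d: "0 \<le> d" and fin: "(\<Sum>n. moment_term E X (Suc n) p \<beta> d) < \<infinity>"
    using ii[OF \<beta>(1)] by blast
  \<comment> \<open>One power comes from \<open>Gamma_n\<close>, the other \<open>d\<close> from
    \<open>Lambda_n\<close>.\<close>
  define q where "q = d + 1"
  have q: "1 \<le> q" using d by (simp add: q_def)
  have "\<exists>\<tau>. (\<forall>n. moment_term E X (Suc n) p \<beta> d = ereal (\<tau> n)) \<and> summable \<tau>"
    using fin p \<beta> by (intro summable_finite_suminf moment_term_nonneg) auto
  then obtain \<tau> where \<tau>: "\<And>n. moment_term E X (Suc n) p \<beta> d = ereal (\<tau> n)" "summable \<tau>" by blast
  have \<tau>0: "0 \<le> \<tau> n" for n using moment_term_nonneg[of p \<beta> n d] p \<beta> \<tau>(1)[of n] by simp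
  have int\<beta>: "integ (\<lambda>\<omega>. max (\<bar>X (Suc j) \<omega>\<bar> - \<beta> * ss (v (Suc j))) 0 powr p)" if "0 < v (Suc j)" for j
    using p \<beta> \<tau>(1)[of j] by (intro moment_term_finite_imp_integ[OF _ _ that, of _ _ d]) auto
  have int: "integ (\<lambda>\<omega>. max (\<bar>X (Suc j) \<omega>\<bar> - \<alpha> * ss (v (Suc j))) 0 powr p)" if "0 < v (Suc j)" for j
  proof (rule integ_dominated[OF H_trunc int\<beta>[OF that]])
    show "1 \<le> p" "0 \<le> \<alpha> * ss (v (Suc j))" using p \<alpha> ss_nonneg[OF v_nonneg] by auto
    have "\<beta> * ss (v (Suc j)) \<le> \<alpha> * ss (v (Suc j))"
      using \<beta> ss_nonneg[OF v_nonneg] by (intro mult_right_mono) auto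
    then show "\<bar>max (\<bar>X (Suc j) \<omega>\<bar> - \<alpha> * ss (v (Suc j))) 0 powr p\<bar> \<le> max (\<bar>X (Suc j) \<omega>\<bar> - \<beta> * ss (v (Suc j))) 0 powr p" for \<omega>
      using p by (simp add: trunc_powr_mono)
  qed
  define y where "y j = (if 0 < v (Suc j) then \<gamma> \<alpha> p j else 0)" for j
  have y0: "0 \<le> y j" for j unfolding y_def using \<gamma>_nonneg[OF int] by simp
  define A where "A l = aa (\<theta> ^ l)" for l
  have A: "0 < A l" for l unfolding A_def using \<theta> by (intro aa_pos) auto
  define x where "x l = (\<Sum>j=N \<theta> l..<N \<theta> (Suc l). y j) / A (Suc l) powr p" for l
  define r where "r = \<theta> powr (- p / 2)"
  \<comment> \<open>The added 1 keeps \<open>lam\<close> strictly positive, so that its logarithm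
    and negative powers are available.\<close>
  define lam where "lam = rec_nat (U \<alpha> p (N \<theta> 0) / A 0 powr p + 1) (\<lambda>l a. r * a + x l)"
  have lam: "lam 0 = U \<alpha> p (N \<theta> 0) / A 0 powr p + 1" "\<And>l. lam (Suc l) = r * lam l + x l" unfolding lam_def by auto
  have U_eq: "U \<alpha> p n = (\<Sum>j<n. y j)" for n unfolding U_def y_def ..
  have U0: "0 \<le> U \<alpha> p n" for n unfolding U_eq by (intro sum_nonneg y0)
  have x0: "0 \<le> x l" for l unfolding x_def by (intro divide_nonneg_nonneg sum_nonneg y0) auto
  have r: "0 < r" "r < 1" unfolding r_def using \<theta> p powr_less_mono[of "- p / 2" 0 \<theta>] by auto
  have lam0: "0 < lam l" for l
  proof (induction l)
    case 0
    have "0 \<le> U \<alpha> p (N \<theta> 0) / A 0 powr p" using U0 by (intro divide_nonneg_nonneg) auto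
    then show ?case unfolding lam by linarith
  next
    case (Suc l) then show ?case unfolding lam using r x0[of l] by (simp add: add_pos_nonneg)
  qed
  have Ar: "A l powr p \<le> r * A (Suc l) powr p" for l
  proof -
    have "sqrt \<theta> * A l \<le> A (Suc l)" unfolding A_def power_Suc using \<theta> by (intro aa_mult_ge) auto
    then have "(sqrt \<theta> * A l) powr p \<le> A (Suc l) powr p" using A[of l] \<theta> p by (intro powr_mono2) auto
    then have "sqrt \<theta> powr p * A l powr p \<le> A (Suc l) powr p" using A[of l] \<theta> by (simp add: powr_mult)
    moreover have "sqrt \<theta> powr p = inverse r"
      unfolding r_def using \<theta> by (simp add: powr_half_sqrt[symmetric] powr_powr powr_minus)
    ultimately show ?thesis using r by (simp add: field_simps)
  qed
  have UN: "U \<alpha> p (N \<theta> l) \<le> lam l * A l powr p" for l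
  proof (induction l)
    case 0
    have "U \<alpha> p (N \<theta> 0) = U \<alpha> p (N \<theta> 0) / A 0 powr p * A 0 powr p" using A[of 0] by simp
    also have "\<dots> \<le> lam 0 * A 0 powr p" unfolding lam using A[of 0] by (intro mult_right_mono) auto
    finally show ?case .
  next
    case (Suc l)
    have "U \<alpha> p (N \<theta> (Suc l)) = U \<alpha> p (N \<theta> l) + (\<Sum>j=N \<theta> l..<N \<theta> (Suc l). y j)"
      unfolding U_eq using N_mono[OF \<theta>, of l "Suc l"] by (simp add: lessThan_atLeast0 sum.atLeastLessThan_concat)
    also have "(\<Sum>j=N \<theta> l..<N \<theta> (Suc l). y j) = x l * A (Suc l) powr p" unfolding x_def using A[of "Suc l"] by simp
    also have "U \<alpha> p (N \<theta> l) \<le> lam l * (r * A (Suc l) powr p)"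
      using Suc mult_left_mono[OF Ar[of l] less_imp_le[OF lam0[of l]]] by linarith
    finally show ?case unfolding lam by (simp add: algebra_simps)
  qed
  have xb: "x l powr q \<le> (\<theta> powr p) powr q * q * (\<Sum>j=N \<theta> l..<N \<theta> (Suc l). \<tau> j)" for l
  proof -
    define D where "D = (\<theta> * aa (\<theta> ^ Suc l)) powr p"
    have D: "0 < D" "D = \<theta> powr p * A (Suc l) powr p"
      unfolding D_def using A[of "Suc l"] \<theta> by (auto simp: powr_mult A_def)
    have ygam: "y i = \<gamma> \<alpha> p i" if "N \<theta> l \<le> i" for i
    proof -
      have "0 < \<theta> ^ Suc l" using \<theta> by simp
      also have "\<dots> \<le> v (Suc i)" using N_iff[OF \<theta>, of "Suc i" l] that by simp
      finally show ?thesis unfolding y_def by simp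
    qed
    have "(\<Sum>j=N \<theta> l..<N \<theta> (Suc l). y j / D) powr q
        \<le> q * (\<Sum>j=N \<theta> l..<N \<theta> (Suc l). y j / D * (\<Sum>i=N \<theta> l..j. y i / D) powr (q - 1))"
      using y0 D q by (intro sum_powr_increment) auto
    also have "\<dots> \<le> q * (\<Sum>j=N \<theta> l..<N \<theta> (Suc l). \<tau> j)"
    proof (intro mult_left_mono sum_mono)
      fix j assume j: "j \<in> {N \<theta> l..<N \<theta> (Suc l)}"
      have "ereal (\<gamma> \<alpha> p j / D * ((\<Sum>i=N \<theta> l..j. \<gamma> \<alpha> p i) / D) powr d) \<le> ereal (\<tau> j)"
        using block_term_le[OF \<theta> \<beta>(1) p d, of l j] j int\<beta> unfolding \<beta>(2)[symmetric] D_def[symmetric] \<tau>(1) by auto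
      moreover have "(\<Sum>i=N \<theta> l..j. y i / D) = (\<Sum>i=N \<theta> l..j. \<gamma> \<alpha> p i) / D"
        unfolding sum_divide_distrib by (intro sum.cong) (auto simp: ygam)
      ultimately show "y j / D * (\<Sum>i=N \<theta> l..j. y i / D) powr (q - 1) \<le> \<tau> j"
        using ygam[of j] j by (simp add: q_def)
    qed (use q in simp)
    finally have 1: "(\<Sum>j=N \<theta> l..<N \<theta> (Suc l). y j / D) powr q \<le> q * (\<Sum>j=N \<theta> l..<N \<theta> (Suc l). \<tau> j)" .
    have "x l = \<theta> powr p * (\<Sum>j=N \<theta> l..<N \<theta> (Suc l). y j / D)"
      unfolding x_def D(2) sum_divide_distrib[symmetric] using \<theta> A[of "Suc l"] by simp
    then have "x l powr q = (\<theta> powr p) powr q * (\<Sum>j=N \<theta> l..<N \<theta> (Suc l). y j / D) powr q"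
      using y0 D by (simp add: powr_mult sum_nonneg)
    with 1 show ?thesis by (simp add: mult.assoc mult_left_mono)
  qed
  have "summable (\<lambda>l. x l powr q)"
  proof (rule summableI_nonneg_bounded)
    fix L
    let ?K = "(\<theta> powr p) powr q * q"
    have "(\<Sum>l<L. x l powr q) \<le> (\<Sum>l<L. ?K * (\<Sum>j=N \<theta> l..<N \<theta> (Suc l). \<tau> j))" by (intro sum_mono xb)
    also have "\<dots> = ?K * (\<Sum>l<L. \<Sum>j=N \<theta> l..<N \<theta> (Suc l). \<tau> j)" by (simp add: sum_distrib_left)
    also have "(\<Sum>l<L. \<Sum>j=N \<theta> l..<N \<theta> (Suc l). \<tau> j) = (\<Sum>j=N \<theta> 0..<N \<theta> L. \<tau> j)"
    proof (induction L)
      case (Suc L)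
      have "(\<Sum>j=N \<theta> 0..<N \<theta> L. \<tau> j) + (\<Sum>j=N \<theta> L..<N \<theta> (Suc L). \<tau> j) = (\<Sum>j=N \<theta> 0..<N \<theta> (Suc L). \<tau> j)"
        using N_mono[OF \<theta>, of 0 L] N_mono[OF \<theta>, of L "Suc L"] by (intro sum.atLeastLessThan_concat) auto
      with Suc show ?case by simp
    qed simp
    also have "?K * \<dots> \<le> ?K * suminf \<tau>"
      using q \<tau>0 \<tau>(2) by (intro mult_left_mono sum_le_suminf) auto
    finally show "(\<Sum>l<L. x l powr q) \<le> ?K * suminf \<tau>" .
  qed simp
  then have "summable (\<lambda>l. lam l powr q)"
    using r q lam0 x0 lam(2) by (intro summable_powr_recursion[of r q lam x]) auto
  then show ?thesis using p q int lam0 UN unfolding A_def by blast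
qed

text \<open>Condition (i) is read at \<open>\<epsilon> / 2\<close>, which leaves room for a
  Lipschitz ramp between the indicators of the two thresholds. Property (C) puts the expectation of
  the ramp below the capacity, and the first Borel-Cantelli lemma applies.\<close>

lemma null_large:
  assumes \<epsilon>: "0 < \<epsilon>" shows "null {x. \<exists>\<^sub>\<infinity>j. \<epsilon> * aa (v (Suc j)) < \<bar>x j\<bar>}"
proof -
  let ?W = "\<lambda>n. VV {\<omega>\<in>space M. \<bar>X (Suc n) \<omega>\<bar> \<ge> \<epsilon> / 2 * a_norm E X (Suc n)}"
  have mX: "X (Suc n) \<in> borel_measurable M" for n using X_H H_measurable by blast
  have mS: "{\<omega>\<in>space M. \<bar>X (Suc n) \<omega>\<bar> \<ge> c} \<in> sets M" for n c using mX[of n] by measurable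
  have W0: "0 \<le> ereal (?W n)" for n
    using capacity mS[of "\<epsilon> / 2 * a_norm E X (Suc n)" n]
    unfolding subadditive_capacity_def capacity_def ereal_less_eq zero_ereal_def by blast
  obtain g where g: "\<And>n. ereal (?W n) = ereal (g n)" "summable g"
    using summable_finite_suminf[of "\<lambda>n. ereal (?W n)"] W0 i[of "\<epsilon> / 2"] \<epsilon> by auto
  obtain n0 where n0: "0 < v n0" using v_unbounded by blast
  define A where "A j = {x :: nat \<Rightarrow> real. \<epsilon> * aa (v (Suc j)) < \<bar>x j\<bar>}" for j
  have "null {x. \<exists>\<^sub>\<infinity>j. x \<in> A j}"
  proof (rule null_limsup[where ?n0.0 = n0 and g = g])
    have "(\<lambda>x :: nat \<Rightarrow> real. x j) \<in> borel_measurable borel" for j by (rule measurable_product_coordinates)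
    then show "A j \<in> sets borel" for j unfolding A_def by measurable
    fix j assume "n0 \<le> j"
    then have "0 < v (Suc j)" using n0 v_mono[of n0 "Suc j"] by simp
    then have a: "0 < aa (v (Suc j))" by (rule aa_pos)
    define b where "b = \<epsilon> * aa (v (Suc j)) / 2"
    have b: "0 < b" using a \<epsilon> by (simp add: b_def)
    \<comment> \<open>Zero up to \<open>b\<close> and one from \<open>2 * b\<close> on:
      \<open>2 * b\<close> is the threshold in \<open>A j\<close>, and \<open>b\<close> the one in
      (i).\<close>
    define f where "f u = min 1 (max 0 (\<bar>u\<bar> / b - 1))" for u
    have bf: "blip f" unfolding blip_def
    proof (intro conjI exI allI)
      show "\<bar>f u\<bar> \<le> 1" for u unfolding f_def by auto
      fix u w
      have "\<bar>min 1 (max 0 (s - 1)) - min 1 (max 0 (t - 1))\<bar> \<le> \<bar>s - t\<bar>" for s t :: real by auto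
      from this[of "\<bar>u\<bar> / b" "\<bar>w\<bar> / b"] have "\<bar>f u - f w\<bar> \<le> \<bar>\<bar>u\<bar> / b - \<bar>w\<bar> / b\<bar>" unfolding f_def .
      also have "\<dots> = (1 / b) * \<bar>\<bar>u\<bar> - \<bar>w\<bar>\<bar>" using b by (simp add: diff_divide_distrib[symmetric])
      also have "\<dots> \<le> (1 / b) * \<bar>u - w\<bar>" using b by (intro mult_left_mono) auto
      finally show "\<bar>f u - f w\<bar> \<le> (1 / b) * \<bar>u - w\<bar>" .
    qed
    have "V_outer E X (A j) \<le> ereal (F (\<lambda>x. f (x j)))"
    proof (rule V_outer_le_F[OF BL_coord[OF bf, of j "Suc j"]])
      show "indicator (A j) x \<le> f (x j)" for x
      proof (cases "x \<in> A j")
        case True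
        then have "2 \<le> \<bar>x j\<bar> / b" using b unfolding A_def b_def by (simp add: field_simps)
        then show ?thesis using True unfolding f_def by simp
      qed (simp add: f_def)
    qed simp
    also have "F (\<lambda>x. f (x j)) = ER (\<lambda>\<omega>. f (X (Suc j) \<omega>))" unfolding F_def ..
    also have "ereal (ER (\<lambda>\<omega>. f (X (Suc j) \<omega>))) = E (\<lambda>\<omega>. f (X (Suc j) \<omega>))"
      by (rule E_integ[OF integ_blip[OF bf X_H], symmetric])
    also have "\<dots> \<le> ereal (?W j)"
    proof -
      let ?S = "{\<omega>\<in>space M. \<bar>X (Suc j) \<omega>\<bar> \<ge> \<epsilon> / 2 * a_norm E X (Suc j)}"
      have "f (X (Suc j) \<omega>) \<le> indicator ?S \<omega> \<and> indicator ?S \<omega> \<le> (1::real)" if "\<omega> \<in> space M" for \<omega>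
      proof (cases "\<omega> \<in> ?S")
        case True then show ?thesis unfolding f_def by simp
      next
        case False
        then have "\<bar>X (Suc j) \<omega>\<bar> / b \<le> 1" using that b unfolding b_def a_norm_eq by (simp add: field_simps)
        then show ?thesis using False unfolding f_def by simp
      qed
      then have "E (\<lambda>\<omega>. f (X (Suc j) \<omega>)) \<le> ereal (VV ?S) \<and> ereal (VV ?S) \<le> E (\<lambda>\<omega>. 1)"
        by (intro compatible[unfolded property_C_def, rule_format] mS integ_H[OF integ_blip[OF bf X_H[of j]]] H_const)
      then show ?thesis by (rule conjunct1)
    qed
    also have "\<dots> = ereal (g j)" by (rule g)
    finally show "V_outer E X (A j) \<le> ereal (g j)" .
  qed (rule g)
  then show ?thesis unfolding A_def by simp
qed

definition drift :: "nat \<Rightarrow> real" where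
  "drift n = (\<Sum>j<n. \<bar>ER (X (Suc j))\<bar> + \<bar>ER (\<lambda>\<omega>. - X (Suc j) \<omega>)\<bar>)"

lemma drift_small: "(\<lambda>n. drift n / aa (v n)) \<longlonglongrightarrow> 0"
proof -
  have e: "(\<Sum>j=1..n. \<bar>E (X j)\<bar> + \<bar>conj_expectation E (X j)\<bar>) = ereal (drift n)" for n
  proof -
    have "(\<Sum>j=1..n. \<bar>E (X j)\<bar> + \<bar>conj_expectation E (X j)\<bar>) = (\<Sum>j<n. \<bar>E (X (Suc j))\<bar> + \<bar>conj_expectation E (X (Suc j))\<bar>)"
      by (rule sum.reindex_bij_witness[of _ Suc "\<lambda>k. k - 1"]) auto
    also have "\<dots> = ereal (drift n)"
      unfolding conj_expectation_def E_integ[OF integ_X] E_integ[OF integ_uminus[OF integ_X]] drift_def by simp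
    finally show ?thesis .
  qed
  obtain n0 where n0: "0 < v n0" using v_unbounded by blast
  have "\<forall>\<^sub>F n in sequentially. (\<Sum>j=1..n. \<bar>E (X j)\<bar> + \<bar>conj_expectation E (X j)\<bar>) / ereal (a_norm E X n) = ereal (drift n / aa (v n))"
    unfolding eventually_sequentially
  proof (intro exI[of _ n0] allI impI)
    fix n assume "n0 \<le> n"
    then have "0 < aa (v n)" using n0 v_mono[of n0 n] by (intro aa_pos) simp
    then show "(\<Sum>j=1..n. \<bar>E (X j)\<bar> + \<bar>conj_expectation E (X j)\<bar>) / ereal (a_norm E X n) = ereal (drift n / aa (v n))"
      unfolding e a_norm_eq by simp
  qed
  from tendsto_cong[OF this] iv have "(\<lambda>n. ereal (drift n / aa (v n))) \<longlonglongrightarrow> ereal 0" by (simp add: zero_ereal_def)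
  then show ?thesis by simp
qed

end

section \<open>Exponential moments of truncated variables\<close>

lemma min_lip: "\<bar>min s y - min t y\<bar> \<le> \<bar>s - t\<bar>" for s t y :: real
proof (cases "s \<le> t")
  case True
  then have "0 \<le> min t y - min s y" "min t y - min s y \<le> t - s" by (simp_all add: min_def)
  then show ?thesis using True by simp
next
  case False
  then have "0 \<le> min s y - min t y" "min s y - min t y \<le> s - t" by (simp_all add: min_def)
  then show ?thesis using False by simp
qed
lemma max_lip: "\<bar>max s y - max t y\<bar> \<le> \<bar>s - t\<bar>" for s t y :: real
  using min_lip[of "- s" "- y" "- t"] by (simp add: minus_max_eq_min[symmetric] abs_minus_commute)

text \<open>Taylor's formula with Lagrange remainder; the intermediate point stays in
  [-u, u].\<close>

lemma exp_quadratic_bounds: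
  fixes y u :: real assumes "\<bar>y\<bar> \<le> u"
  shows "exp y \<le> 1 + y + y\<^sup>2 / 2 * exp u" "1 + y + y\<^sup>2 / 2 * exp (- u) \<le> exp y"
proof -
  obtain t where t: "\<bar>t\<bar> \<le> \<bar>y\<bar>" "exp y = (\<Sum>m<2. y ^ m / fact m) + exp t / fact 2 * y ^ 2"
    using Maclaurin_exp_le[of y 2] by blast
  have e: "exp y = 1 + y + y\<^sup>2 / 2 * exp t" using t(2) by (simp add: numeral_2_eq_2)
  have "exp t \<le> exp u" "exp (- u) \<le> exp t" using t(1) assms by auto
  then show "exp y \<le> 1 + y + y\<^sup>2 / 2 * exp u" "1 + y + y\<^sup>2 / 2 * exp (- u) \<le> exp y"
    unfolding e by (auto intro!: mult_left_mono)
qed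

lemma tail_le_square:
  fixes x y :: real assumes "0 < y" shows "max (\<bar>x\<bar> - y) 0 \<le> x\<^sup>2 / (4 * y)"
proof -
  have "0 \<le> (\<bar>x\<bar> - 2 * y)\<^sup>2" by simp
  then have "4 * y * (\<bar>x\<bar> - y) \<le> x\<^sup>2" unfolding power2_diff by (simp add: power2_eq_square algebra_simps)
  then show ?thesis using assms by (simp add: field_simps)
qed

text \<open>The gap between \<open>c\<close> and \<open>2 * c\<close> is used: beyond
  \<open>2 * c\<close> the ratio (|x| - c)/c exceeds 1, so its power \<open>p - 1\<close> may be
  multiplied in.\<close>

lemma tail_le_powr:
  fixes x c p :: real assumes c: "0 < c" and p: "1 \<le> p"
  shows "max (\<bar>x\<bar> - 2 * c) 0 \<le> c powr (1 - p) * max (\<bar>x\<bar> - c) 0 powr p"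
proof (cases "\<bar>x\<bar> \<le> 2 * c")
  case False
  define z where "z = \<bar>x\<bar> - c"
  have z: "c < z" using False by (simp add: z_def)
  have "\<bar>x\<bar> - 2 * c \<le> z * 1" using c by (simp add: z_def)
  also have "\<dots> \<le> z * (z / c) powr (p - 1)"
    using z c p by (intro mult_left_mono ge_one_powr_ge_zero) auto
  also have "\<dots> = c powr (1 - p) * z powr p"
    using z c by (simp add: powr_divide powr_diff powr_one field_simps)
  finally show ?thesis using False z c unfolding z_def by simp
qed simp

lemma one_le_powr_ratio:
  fixes x c p :: real assumes c: "0 < c" and p: "0 \<le> p" and x: "2 * c < \<bar>x\<bar>"
  shows "1 \<le> c powr (- p) * max (\<bar>x\<bar> - c) 0 powr p"
proof -
  have "1 \<le> ((\<bar>x\<bar> - c) / c) powr p" using assms by (intro ge_one_powr_ge_zero) auto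
  also have "\<dots> = c powr (- p) * max (\<bar>x\<bar> - c) 0 powr p"
    using assms by (simp add: powr_divide powr_minus field_simps)
  finally show ?thesis .
qed

lemma blip_clamp: "0 \<le> y \<Longrightarrow> blip (\<lambda>u. b * clamp y u)"
  unfolding blip_def
proof (intro conjI exI allI)
  assume y: "0 \<le> y"
  show "\<bar>b * clamp y u\<bar> \<le> \<bar>b\<bar> * y" for u
    unfolding abs_mult by (intro mult_left_mono clamp_abs_le y) auto
  show "\<bar>b * clamp y u - b * clamp y w\<bar> \<le> \<bar>b\<bar> * \<bar>u - w\<bar>" for u w
    unfolding right_diff_distrib[symmetric] abs_mult by (intro mult_left_mono clamp_lip) auto
qed

lemma blip_tail: "0 \<le> y \<Longrightarrow> blip (\<lambda>u. b * min (max (\<bar>u\<bar> - c) 0) y)"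
  unfolding blip_def
proof (intro conjI exI allI)
  assume y: "0 \<le> y"
  show "\<bar>b * min (max (\<bar>u\<bar> - c) 0) y\<bar> \<le> \<bar>b\<bar> * y" for u
    unfolding abs_mult using y by (intro mult_left_mono) auto
  show "\<bar>b * min (max (\<bar>u\<bar> - c) 0) y - b * min (max (\<bar>w\<bar> - c) 0) y\<bar> \<le> \<bar>b\<bar> * \<bar>u - w\<bar>" for u w
  proof -
    have "\<bar>min (max (\<bar>u\<bar> - c) 0) y - min (max (\<bar>w\<bar> - c) 0) y\<bar> \<le> \<bar>(\<bar>u\<bar> - c) - (\<bar>w\<bar> - c)\<bar>"
      by (rule order_trans[OF min_lip max_lip])
    also have "\<dots> \<le> \<bar>u - w\<bar>" using abs_triangle_ineq3[of u w] by simp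
    finally have "\<bar>b\<bar> * \<bar>min (max (\<bar>u\<bar> - c) 0) y - min (max (\<bar>w\<bar> - c) 0) y\<bar> \<le> \<bar>b\<bar> * \<bar>u - w\<bar>"
      by (rule mult_left_mono) simp
    then show ?thesis by (simp only: abs_mult[symmetric] right_diff_distrib)
  qed
qed

context lil_hypotheses
begin

lemma borel_max_event:
  assumes "\<And>j. j < n \<Longrightarrow> blip (f j)"
  shows "{x :: nat \<Rightarrow> real. \<exists>m\<le>n. K \<le> (\<Sum>j<m. f j (x j))} \<in> sets borel"
proof -
  have c[measurable]: "(\<lambda>x :: nat \<Rightarrow> real. x j) \<in> borel_measurable borel" for j by (rule measurable_product_coordinates)
  have S[measurable]: "(\<lambda>x :: nat \<Rightarrow> real. \<Sum>j<m. f j (x j)) \<in> borel_measurable borel" if "m \<le> n" for m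
    using that by (intro borel_measurable_sum measurable_compose[OF c blip_measurable] assms) auto
  have "{x :: nat \<Rightarrow> real. \<exists>m\<le>n. K \<le> (\<Sum>j<m. f j (x j))} = (\<Union>m\<le>n. {x \<in> space borel. K \<le> (\<Sum>j<m. f j (x j))})" by auto
  also have "\<dots> \<in> sets borel" by (intro sets.finite_UN borel_measurable_le S) auto
  finally show ?thesis .
qed

definition T :: "real \<Rightarrow> nat \<Rightarrow> real" where "T y j = ER (\<lambda>\<omega>. max (\<bar>X (Suc j) \<omega>\<bar> - y) 0)"

lemma integ_tail:
  assumes "0 \<le> y" shows "integ (\<lambda>\<omega>. max (\<bar>X (Suc j) \<omega>\<bar> - y) 0)"
proof (rule integ_dominated[OF _ integ_abs[OF integ_X[of j]]])
  have "\<bar>max (\<bar>u\<bar> - y) 0 - max (\<bar>w\<bar> - y) 0\<bar> \<le> 1 * \<bar>u - w\<bar>" for u w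
    using max_lip[of "\<bar>u\<bar> - y" 0 "\<bar>w\<bar> - y"] abs_triangle_ineq3[of u w] by simp
  then show "(\<lambda>\<omega>. max (\<bar>X (Suc j) \<omega>\<bar> - y) 0) \<in> H"
    by (rule H_comp1[OF poly_lip_lipschitz X_H])
qed (use assms in auto)

lemma T_nonneg: "0 \<le> y \<Longrightarrow> 0 \<le> T y j"
  unfolding T_def by (rule ER_nonneg[OF integ_tail]) auto

lemma T_le_square: assumes "0 < y" shows "T y j \<le> \<sigma>2 j / (4 * y)"
proof -
  have "T y j \<le> ER (\<lambda>\<omega>. (1 / (4 * y)) * (X (Suc j) \<omega>)\<^sup>2)"
    unfolding T_def using assms tail_le_square[OF assms]
    by (intro ER_mono integ_tail integ_scale integ_square) auto
  also have "\<dots> = (1 / (4 * y)) * \<sigma>2 j" unfolding \<sigma>2_def using assms by (intro ER_scale integ_square) auto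
  finally show ?thesis by simp
qed

lemma T_le_powr:
  assumes int: "integ (\<lambda>\<omega>. max (\<bar>X (Suc j) \<omega>\<bar> - \<alpha> * ss (v (Suc j))) 0 powr p)"
    and c: "0 < c" "\<alpha> * ss (v (Suc j)) \<le> c" and p: "1 \<le> p"
  shows "T (2 * c) j \<le> c powr (1 - p) * \<gamma> \<alpha> p j"
proof -
  have "T (2 * c) j \<le> ER (\<lambda>\<omega>. c powr (1 - p) * max (\<bar>X (Suc j) \<omega>\<bar> - \<alpha> * ss (v (Suc j))) 0 powr p)"
    unfolding T_def
  proof (intro ER_mono integ_tail integ_scale int)
    show "max (\<bar>X (Suc j) \<omega>\<bar> - 2 * c) 0 \<le> c powr (1 - p) * max (\<bar>X (Suc j) \<omega>\<bar> - \<alpha> * ss (v (Suc j))) 0 powr p" for \<omega>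
      by (rule order_trans[OF tail_le_powr[OF c(1) p] mult_left_mono[OF trunc_powr_mono[OF p c(2)]]]) simp
  qed (use c in simp)
  also have "\<dots> = c powr (1 - p) * \<gamma> \<alpha> p j" unfolding \<gamma>_def by (intro ER_scale int) simp
  finally show ?thesis .
qed

definition mean_bound :: "nat \<Rightarrow> real" where
  "mean_bound j = \<bar>ER (X (Suc j))\<bar> + \<bar>ER (\<lambda>\<omega>. - X (Suc j) \<omega>)\<bar>"

text \<open>Clamping changes the variable by exactly its tail beyond \<open>y\<close>. The variables
  are not centred; (iv) controls the sum of the \<open>mean_bound\<close> terms.\<close>

lemma clamp_mean:
  assumes y: "0 \<le> y" and sg: "\<bar>sg\<bar> = 1"
  shows "ER (\<lambda>\<omega>. sg * clamp y (X (Suc j) \<omega>)) \<le> mean_bound j + T y j"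
proof -
  have isg: "integ (\<lambda>\<omega>. sg * X (Suc j) \<omega>)" by (intro integ_scale integ_X)
  have "ER (\<lambda>\<omega>. sg * clamp y (X (Suc j) \<omega>)) \<le> ER (\<lambda>\<omega>. sg * X (Suc j) \<omega> + max (\<bar>X (Suc j) \<omega>\<bar> - y) 0)"
  proof (intro ER_mono integ_blip[OF blip_clamp[OF y] X_H] integ_add isg integ_tail y)
    fix \<omega>
    have "sg = 1 \<or> sg = - 1" using sg by linarith
    then show "sg * clamp y (X (Suc j) \<omega>) \<le> sg * X (Suc j) \<omega> + max (\<bar>X (Suc j) \<omega>\<bar> - y) 0"
      using y unfolding clamp_def by auto
  qed
  also have "\<dots> \<le> ER (\<lambda>\<omega>. sg * X (Suc j) \<omega>) + T y j" unfolding T_def by (intro ER_add_le isg integ_tail y)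
  also have "ER (\<lambda>\<omega>. sg * X (Suc j) \<omega>) \<le> mean_bound j"
  proof -
    have "sg = 1 \<or> sg = - 1" using sg by linarith
    then show ?thesis unfolding mean_bound_def by auto
  qed
  finally show ?thesis by simp
qed

text \<open>The second order Taylor bound, subadditivity, and \<open>1 + z \<le> exp z\<close>. The
  quadratic term is enlarged to the second moment before clamping.\<close>

lemma clamp_mgf:
  assumes y: "0 \<le> y" and h: "0 \<le> h" and sg: "\<bar>sg\<bar> = 1"
  shows "ER (\<lambda>\<omega>. exp (h * (sg * clamp y (X (Suc j) \<omega>)))) \<le> exp (h * mean_bound j + h * T y j + h\<^sup>2 / 2 * exp (h * y) * \<sigma>2 j)"
proof -
  have b: "blip (\<lambda>u. h * (sg * clamp y u))" using blip_clamp[OF y, of "h * sg"] by (simp add: mult.assoc)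
  have i1: "integ (\<lambda>\<omega>. h * (sg * clamp y (X (Suc j) \<omega>)))" by (rule integ_blip[OF b X_H])
  have i0: "integ (\<lambda>\<omega>. sg * clamp y (X (Suc j) \<omega>))" by (rule integ_blip[OF blip_clamp[OF y] X_H])
  let ?k = "h\<^sup>2 / 2 * exp (h * y)"
  have "ER (\<lambda>\<omega>. exp (h * (sg * clamp y (X (Suc j) \<omega>))))
      \<le> ER (\<lambda>\<omega>. 1 + (h * (sg * clamp y (X (Suc j) \<omega>)) + ?k * (X (Suc j) \<omega>)\<^sup>2))"
  proof (intro ER_mono integ_blip[OF blip_exp[OF b] X_H] integ_add integ_const i1 integ_scale integ_square)
    fix \<omega>
    let ?z = "clamp y (X (Suc j) \<omega>)"
    have "\<bar>h * (sg * ?z)\<bar> \<le> h * y"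
      using clamp_abs_le[OF y, of "X (Suc j) \<omega>"] h sg by (simp add: abs_mult mult_left_mono)
    then have "exp (h * (sg * ?z)) \<le> 1 + h * (sg * ?z) + (h * (sg * ?z))\<^sup>2 / 2 * exp (h * y)"
      by (rule exp_quadratic_bounds)
    also have "(h * (sg * ?z))\<^sup>2 = h\<^sup>2 * ?z\<^sup>2"
      using sg by (simp add: power_mult_distrib) (metis power2_abs power_one mult_1)
    also have "h\<^sup>2 * ?z\<^sup>2 / 2 * exp (h * y) \<le> ?k * (X (Suc j) \<omega>)\<^sup>2"
    proof -
      have "?z\<^sup>2 \<le> (X (Suc j) \<omega>)\<^sup>2" unfolding abs_le_square_iff[symmetric] using y by (auto simp: clamp_def)
      then have "(h\<^sup>2 / 2 * exp (h * y)) * ?z\<^sup>2 \<le> (h\<^sup>2 / 2 * exp (h * y)) * (X (Suc j) \<omega>)\<^sup>2" by (intro mult_left_mono) auto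
      then show ?thesis by (simp add: mult_ac)
    qed
    finally show "exp (h * (sg * ?z)) \<le> 1 + (h * (sg * ?z) + ?k * (X (Suc j) \<omega>)\<^sup>2)" by simp
  qed
  also have "\<dots> = 1 + ER (\<lambda>\<omega>. h * (sg * clamp y (X (Suc j) \<omega>)) + ?k * (X (Suc j) \<omega>)\<^sup>2)"
    by (intro ER_const_add integ_add i1 integ_scale integ_square)
  also have "\<dots> \<le> 1 + (ER (\<lambda>\<omega>. h * (sg * clamp y (X (Suc j) \<omega>))) + ER (\<lambda>\<omega>. ?k * (X (Suc j) \<omega>)\<^sup>2))"
    by (intro add_left_mono ER_add_le i1 integ_scale integ_square)
  also have "ER (\<lambda>\<omega>. h * (sg * clamp y (X (Suc j) \<omega>))) = h * ER (\<lambda>\<omega>. sg * clamp y (X (Suc j) \<omega>))"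
    by (rule ER_scale[OF i0 h])
  also have "ER (\<lambda>\<omega>. ?k * (X (Suc j) \<omega>)\<^sup>2) = ?k * \<sigma>2 j" unfolding \<sigma>2_def by (intro ER_scale integ_square) simp
  also have "1 + (h * ER (\<lambda>\<omega>. sg * clamp y (X (Suc j) \<omega>)) + ?k * \<sigma>2 j) \<le> 1 + (h * (mean_bound j + T y j) + ?k * \<sigma>2 j)"
    using clamp_mean[OF y sg, of j] h by (intro add_left_mono add_right_mono mult_left_mono)
  also have "\<dots> \<le> exp (h * mean_bound j + h * T y j + ?k * \<sigma>2 j)"
    using exp_ge_add_one_self[of "h * mean_bound j + h * T y j + ?k * \<sigma>2 j"] by (simp add: algebra_simps)
  finally show ?thesis .
qed

text \<open>The exponential differs from 1 only beyond \<open>2 * c\<close>, where it is at most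
  \<open>exp (h * y)\<close> and the normalised \<open>p\<close>-th power is at least 1.\<close>

lemma residual_mgf:
  assumes int: "integ (\<lambda>\<omega>. max (\<bar>X (Suc j) \<omega>\<bar> - \<alpha> * ss (v (Suc j))) 0 powr p)"
    and c: "0 < c" "\<alpha> * ss (v (Suc j)) \<le> c" and p: "1 \<le> p" and y: "0 \<le> y" and h: "0 \<le> h"
  shows "ER (\<lambda>\<omega>. exp (h * min (max (\<bar>X (Suc j) \<omega>\<bar> - 2 * c) 0) y)) \<le> exp (exp (h * y) * c powr (- p) * \<gamma> \<alpha> p j)"
proof -
  let ?k = "exp (h * y) * c powr (- p)"
  have "ER (\<lambda>\<omega>. exp (h * min (max (\<bar>X (Suc j) \<omega>\<bar> - 2 * c) 0) y))
      \<le> ER (\<lambda>\<omega>. 1 + ?k * max (\<bar>X (Suc j) \<omega>\<bar> - \<alpha> * ss (v (Suc j))) 0 powr p)"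
  proof (intro ER_mono integ_blip[OF blip_exp[OF blip_tail[OF y]] X_H] integ_add integ_const integ_scale int)
    fix \<omega>
    let ?x = "X (Suc j) \<omega>"
    have k0: "0 \<le> ?k" by simp
    show "exp (h * min (max (\<bar>?x\<bar> - 2 * c) 0) y) \<le> 1 + ?k * max (\<bar>?x\<bar> - \<alpha> * ss (v (Suc j))) 0 powr p"
    proof (cases "\<bar>?x\<bar> \<le> 2 * c")
      case True
      then have "min (max (\<bar>?x\<bar> - 2 * c) 0) y = 0" using y by auto
      then show ?thesis using k0 by simp
    next
      case False
      have "exp (h * min (max (\<bar>?x\<bar> - 2 * c) 0) y) \<le> exp (h * y) * 1" using h by (auto intro: mult_left_mono)
      also have "\<dots> \<le> exp (h * y) * (c powr (- p) * max (\<bar>?x\<bar> - c) 0 powr p)"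
        using False c p by (intro mult_left_mono one_le_powr_ratio) auto
      also have "\<dots> = ?k * max (\<bar>?x\<bar> - c) 0 powr p" by simp
      also have "\<dots> \<le> ?k * max (\<bar>?x\<bar> - \<alpha> * ss (v (Suc j))) 0 powr p"
        by (intro mult_left_mono trunc_powr_mono p c k0)
      finally show ?thesis by simp
    qed
  qed
  also have "\<dots> = 1 + ?k * \<gamma> \<alpha> p j"
    unfolding \<gamma>_def by (subst ER_const_add[OF integ_scale[OF int]], subst ER_scale[OF int]) auto
  also have "\<dots> \<le> exp (?k * \<gamma> \<alpha> p j)" by (rule exp_ge_add_one_self)
  finally show ?thesis .
qed

end

section \<open>The upper half\<close>

text \<open>\<open>LL (\<theta> ^ l)\<close> is at least the logarithm of
  \<open>l * ln \<theta>\<close>, so the terms are dominated by a multiple of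
  \<open>l powr (- \<kappa>)\<close>.\<close>

lemma summable_exp_LL:
  assumes \<theta>: "1 < \<theta>" and \<kappa>: "1 < \<kappa>" shows "summable (\<lambda>l. exp (- \<kappa> * LL (\<theta> ^ l)))"
proof (rule summable_comparison_test_ev)
  show "\<forall>\<^sub>F l in sequentially. norm (exp (- \<kappa> * LL (\<theta> ^ l))) \<le> ln \<theta> powr (- \<kappa>) * real l powr (- \<kappa>)"
    unfolding eventually_sequentially
  proof (intro exI[of _ 1] allI impI)
    fix l :: nat assume l: "1 \<le> l"
    have pos: "0 < real l * ln \<theta>" using l \<theta> by simp
    have "real l * ln \<theta> = ln (\<theta> ^ l)" using \<theta> by (simp add: ln_realpow)
    also have "\<dots> \<le> logp (\<theta> ^ l)" unfolding logp_def using \<theta> by (intro ln_mono) auto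
    finally have "real l * ln \<theta> \<le> max (exp 1) (logp (\<theta> ^ l))" by simp
    then have "ln (real l * ln \<theta>) \<le> LL (\<theta> ^ l)" unfolding LL_def logp_def[of "logp _"] using pos by (intro ln_mono) auto
    then have "exp (- \<kappa> * LL (\<theta> ^ l)) \<le> exp (- \<kappa> * ln (real l * ln \<theta>))" using \<kappa> by simp
    also have "\<dots> = (real l * ln \<theta>) powr (- \<kappa>)"
      using pos by (simp only: powr_def if_False less_imp_neq[OF pos, symmetric])
    also have "\<dots> = ln \<theta> powr (- \<kappa>) * real l powr (- \<kappa>)" using \<theta> by (simp add: powr_mult mult.commute)
    finally show "norm (exp (- \<kappa> * LL (\<theta> ^ l))) \<le> ln \<theta> powr (- \<kappa>) * real l powr (- \<kappa>)" by simp
  qed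
  show "summable (\<lambda>l. ln \<theta> powr (- \<kappa>) * real l powr (- \<kappa>))"
    using \<kappa> by (intro summable_mult) (simp add: summable_real_powr_iff)
qed

lemma ln_square_le: assumes "(1::real) \<le> x" shows "(ln x)\<^sup>2 \<le> 16 * x powr (1/2)"
proof -
  have "ln x \<le> 4 * x powr (1/4)" using ln_powr_bound[of x "1/4"] assms by simp
  then have "(ln x)\<^sup>2 \<le> (4 * x powr (1/4))\<^sup>2" using assms by (intro power_mono) auto
  also have "\<dots> = 16 * x powr (1/2)" using assms by (simp add: power_mult_distrib powr_power)
  finally show ?thesis .
qed

section \<open>Geometric levels, their parameters, and truncation on good levels\<close>

locale lil_blocks = lil_hypotheses M H E X VV
  for M :: "'a measure" and H :: "('a \<Rightarrow> real) set" and E :: "('a \<Rightarrow> real) \<Rightarrow> ereal"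
    and X :: "nat \<Rightarrow> 'a \<Rightarrow> real" and VV :: "'a set \<Rightarrow> real" +
  fixes \<theta> \<alpha> p q :: real and lam :: "nat \<Rightarrow> real"
  assumes \<theta>: "1 < \<theta>" and \<alpha>: "0 < \<alpha>" and p: "2 \<le> p" and q: "1 \<le> q"
    and mom: "\<And>j. 0 < v (Suc j) \<Longrightarrow> integ (\<lambda>\<omega>. max (\<bar>X (Suc j) \<omega>\<bar> - \<alpha> * ss (v (Suc j))) 0 powr p)"
    and lam_pos: "\<And>l. 0 < lam l"
    and U_le: "\<And>l. U \<alpha> p (N \<theta> l) \<le> lam l * aa (\<theta> ^ l) powr p"
    and lam_summable: "summable (\<lambda>l. lam l powr q)"
begin

abbreviation NN :: "nat \<Rightarrow> nat" where "NN l \<equiv> N \<theta> l"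

definition A :: "nat \<Rightarrow> real" where "A l = aa (\<theta> ^ l)"

text \<open>The square of t_n at s_n^2 = \<theta>^l; hence \<open>tt l / A l\<close> is t_n/s_n
  there.\<close>

definition tt :: "nat \<Rightarrow> real" where "tt l = 2 * LL (\<theta> ^ l)"

text \<open>Half of the truncation level used on good levels: the thresholds in
  \<open>\<gamma>\<close> are at most \<open>c l\<close>, and doubling provides the gap that
  \<open>tail_le_powr\<close> exploits.\<close>

definition c :: "nat \<Rightarrow> real" where "c l = \<alpha> * ss (v (NN l))"

text \<open>
  Only levels \<open>l\<close> for which some $s_n^2$ lies in $[\theta^l, \theta^{l+1})$ matter. The power of
  \<open>tt l\<close> is chosen so that bad levels satisfy \<open>tt l powr (- 2 * p * q) < lam l powr q\<close>,
  which is summable.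
\<close>

definition inhab :: "nat \<Rightarrow> bool" where "inhab l \<longleftrightarrow> \<theta> ^ l \<le> v (NN l)"

definition good :: "nat \<Rightarrow> bool" where "good l \<longleftrightarrow> inhab l \<and> lam l * tt l powr (2 * p) \<le> 1"

lemma \<theta>_pow_pos: "0 < \<theta> ^ l" using \<theta> by simp

lemma A_pos: "0 < A l" unfolding A_def by (intro aa_pos \<theta>_pow_pos)

lemma tt_ge: "2 \<le> tt l" unfolding tt_def using LL_ge_1[of "\<theta> ^ l"] by simp

lemma A_square: "A l * A l = \<theta> ^ l * tt l"
proof -
  have "sqrt (\<theta> ^ l) * sqrt (\<theta> ^ l) = \<theta> ^ l" "sqrt (2 * LL (\<theta> ^ l)) * sqrt (2 * LL (\<theta> ^ l)) = 2 * LL (\<theta> ^ l)"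
    using \<theta>_pow_pos[of l] LL_pos[of "\<theta> ^ l"] by simp_all
  then show ?thesis unfolding A_def aa_def tt_def by (simp only: mult_ac) (metis mult.commute mult.left_commute)
qed

lemma A_eq_ss: "A l = ss (\<theta> ^ l) * tt l" unfolding A_def tt_def by (rule aa_eq_ss)

lemma aa_le_A: "0 \<le> w \<Longrightarrow> w \<le> \<theta> ^ Suc l \<Longrightarrow> aa w \<le> \<theta> * A l"
proof -
  assume w: "0 \<le> w" "w \<le> \<theta> ^ Suc l"
  have "aa w \<le> aa (\<theta> * \<theta> ^ l)" using w by (intro aa_mono) auto
  also have "\<dots> \<le> \<theta> * A l" unfolding A_def using \<theta> by (intro aa_mult_le) auto
  finally show ?thesis .
qed

lemma A_unbounded: "\<exists>L. \<forall>l\<ge>L. K \<le> A l"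
proof -
  obtain L where L: "(max K 1)\<^sup>2 < \<theta> ^ L" using real_arch_pow[OF \<theta>] by blast
  have "K \<le> A l" if "L \<le> l" for l
  proof -
    have "\<theta> ^ L \<le> \<theta> ^ l" using \<theta> that by (intro power_increasing) auto
    then have "(max K 1)\<^sup>2 \<le> \<theta> ^ l" using L by linarith
    then have 1: "max K 1 \<le> sqrt (\<theta> ^ l)" by (rule real_le_rsqrt)
    have "sqrt (\<theta> ^ l) * 1 \<le> A l" unfolding A_def aa_def
      using LL_ge_1[of "\<theta> ^ l"] \<theta>_pow_pos[of l] by (intro mult_left_mono) auto
    with 1 show ?thesis by simp
  qed
  then show ?thesis by blast
qed

lemma NN_unbounded: "\<exists>L. \<forall>l\<ge>L. n \<le> NN l"
proof -
  obtain L where L: "v n < \<theta> ^ L" using real_arch_pow[OF \<theta>] by blast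
  have "n \<le> NN l" if "L \<le> l" for l
  proof -
    have "\<theta> ^ L \<le> \<theta> ^ Suc l" using \<theta> that by (intro power_increasing) auto
    then show ?thesis using L N_iff[OF \<theta>] by fastforce
  qed
  then show ?thesis by blast
qed

lemma tt_unbounded: "\<exists>L. \<forall>l\<ge>L. K \<le> tt l"
proof -
  obtain L where L: "exp (exp K) < \<theta> ^ L" using real_arch_pow[OF \<theta>] by blast
  have "K \<le> tt l" if "L \<le> l" for l
  proof -
    have "\<theta> ^ L \<le> \<theta> ^ l" using \<theta> that by (intro power_increasing) auto
    then have 1: "exp (exp K) \<le> max (exp 1) (\<theta> ^ l)" using L by linarith
    then have "ln (exp (exp K)) \<le> logp (\<theta> ^ l)" unfolding logp_def by (intro ln_mono) auto
    then have "exp K \<le> max (exp 1) (logp (\<theta> ^ l))" by simp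
    then have "ln (exp K) \<le> LL (\<theta> ^ l)" unfolding LL_def logp_def[of "logp _"] by (intro ln_mono) auto
    then show ?thesis unfolding tt_def using LL_ge_1[of "\<theta> ^ l"] by simp
  qed
  then show ?thesis by blast
qed

lemma c_bounds:
  assumes "inhab l"
  shows "\<alpha> * ss (\<theta> ^ l) \<le> c l" "c l \<le> \<alpha> * (\<theta> * ss (\<theta> ^ l))" "0 < c l" "0 < \<alpha> * ss (\<theta> ^ l)"
proof -
  have v: "\<theta> ^ l \<le> v (NN l)" using assms by (simp add: inhab_def)
  then have vpos: "0 < v (NN l)" using \<theta>_pow_pos[of l] by linarith
  show "\<alpha> * ss (\<theta> ^ l) \<le> c l" unfolding c_def using v \<alpha> by (intro mult_left_mono ss_mono \<theta>_pow_pos) auto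
  show "0 < \<alpha> * ss (\<theta> ^ l)" using \<alpha> ss_pos[OF \<theta>_pow_pos] by simp
  show "0 < c l" unfolding c_def using \<alpha> ss_pos[OF vpos] by simp
  have "ss (v (NN l)) \<le> ss (\<theta> * \<theta> ^ l)" using v_N_less[OF \<theta>, of l] by (intro ss_mono vpos) auto
  also have "\<dots> \<le> \<theta> * ss (\<theta> ^ l)" using \<theta> by (intro ss_mult_le) auto
  finally show "c l \<le> \<alpha> * (\<theta> * ss (\<theta> ^ l))" unfolding c_def using \<alpha> by (intro mult_left_mono) auto
qed

lemma threshold_le_c: "j < NN l \<Longrightarrow> 0 < v (Suc j) \<Longrightarrow> \<alpha> * ss (v (Suc j)) \<le> c l"
  unfolding c_def using \<alpha> v_mono[of "Suc j" "NN l"] by (intro mult_left_mono ss_mono) auto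

lemma good_inhab: "good l \<Longrightarrow> inhab l" by (simp add: good_def)

text \<open>The second bound dictates the exponent \<open>2 * p\<close> in \<open>good\<close>: even
  the square root of \<open>lam l\<close> must beat \<open>tt l powr p\<close>, as only this root
  survives in the residual estimate.\<close>

lemma good_lam:
  assumes "good l" shows "lam l * tt l powr p \<le> 1" "lam l powr (1/2) * tt l powr p \<le> 1" "lam l \<le> 1"
proof -
  have g: "lam l * tt l powr (2 * p) \<le> 1" using assms by (simp add: good_def)
  have t1: "1 \<le> tt l powr p" using tt_ge[of l] p by (intro ge_one_powr_ge_zero) auto
  have t2: "tt l powr (2 * p) = tt l powr p * tt l powr p" using tt_ge[of l] by (simp add: powr_add[symmetric])
  have "lam l * tt l powr p * 1 \<le> lam l * tt l powr p * tt l powr p"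
    using t1 lam_pos[of l] by (intro mult_left_mono) auto
  then show 1: "lam l * tt l powr p \<le> 1" using g unfolding t2 by (simp add: mult.assoc)
  have "lam l * 1 \<le> lam l * tt l powr p" using t1 lam_pos[of l] by (intro mult_left_mono) auto
  then show "lam l \<le> 1" using 1 by simp
  have "(lam l powr (1/2) * tt l powr p)\<^sup>2 \<le> 1"
    using g lam_pos[of l] unfolding t2 by (simp add: power_mult_distrib powr_power power2_eq_square[of "tt l powr p"])
  then have "(lam l powr (1/2) * tt l powr p)\<^sup>2 \<le> 1\<^sup>2" by simp
  then show "lam l powr (1/2) * tt l powr p \<le> 1" by (rule power2_le_imp_le) simp
qed

lemma sum_T_le:
  assumes l: "inhab l" shows "(\<Sum>j<NN l. T (2 * c l) j) \<le> c l powr (1 - p) * U \<alpha> p (NN l)"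
  unfolding U_def sum_distrib_left
proof (rule sum_mono)
  fix j assume j: "j \<in> {..<NN l}"
  show "T (2 * c l) j \<le> c l powr (1 - p) * (if 0 < v (Suc j) then \<gamma> \<alpha> p j else 0)"
  proof (cases "0 < v (Suc j)")
    case True
    then show ?thesis using T_le_powr[OF mom[OF True] c_bounds(3)[OF l] threshold_le_c] j p by simp
  next
    case False
    \<comment> \<open>Vanishing variance forces \<open>T = 0\<close> through the second moment
      bound.\<close>
    then have "\<sigma>2 j = 0" using v_Suc[of j] v_nonneg[of j] \<sigma>2_nonneg[of j] by linarith
    then show ?thesis using T_le_square[of "2 * c l" j] c_bounds(3)[OF l] False by simp
  qed
qed

text \<open>On a good level the mean lost by truncation is of order s_n/t_n, which is a factor
  \<open>tt l\<close> below the normalisation.\<close>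

lemma good_sum_T:
  assumes l: "good l" shows "(\<Sum>j<NN l. T (2 * c l) j) \<le> \<alpha> powr (1 - p) * (A l / tt l)"
proof -
  note cb = c_bounds[OF good_inhab[OF l]]
  define s where "s = ss (\<theta> ^ l)"
  have s: "0 < s" unfolding s_def by (intro ss_pos \<theta>_pow_pos)
  have t: "0 < tt l" using tt_ge[of l] by linarith
  have "c l powr (1 - p) \<le> (\<alpha> * s) powr (1 - p)" using cb p unfolding s_def by (intro powr_mono2') auto
  then have "c l powr (1 - p) * U \<alpha> p (NN l) \<le> (\<alpha> * s) powr (1 - p) * (lam l * A l powr p)"
  proof (rule mult_mono)
    show "U \<alpha> p (NN l) \<le> lam l * A l powr p" using U_le unfolding A_def .
    show "0 \<le> U \<alpha> p (NN l)" unfolding U_def using \<gamma>_nonneg[OF mom] by (intro sum_nonneg) auto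
  qed simp
  also have "\<dots> = \<alpha> powr (1 - p) * s * (lam l * tt l powr p)"
    unfolding A_eq_ss s_def[symmetric] using s \<alpha> t by (simp add: powr_mult powr_diff)
  also have "\<dots> \<le> \<alpha> powr (1 - p) * s * 1" using good_lam(1)[OF l] s by (intro mult_left_mono) auto
  also have "\<dots> = \<alpha> powr (1 - p) * (A l / tt l)" unfolding A_eq_ss s_def using t by simp
  finally show ?thesis using sum_T_le[OF good_inhab[OF l]] by linarith
qed

lemma sum_mean_bound: "(\<Sum>j<n. mean_bound j) = drift n"
  unfolding drift_def mean_bound_def ..

lemma drift_le:
  assumes "0 < \<eta>" shows "\<exists>L. \<forall>l\<ge>L. drift (NN l) \<le> \<eta> * A l"
proof -
  have "\<forall>\<^sub>F n in sequentially. drift n / aa (v n) < \<eta> / \<theta>"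
    using order_tendstoD(2)[OF drift_small, of "\<eta> / \<theta>"] assms \<theta> by simp
  then obtain n0 where n0: "\<And>n. n0 \<le> n \<Longrightarrow> drift n / aa (v n) < \<eta> / \<theta>" unfolding eventually_sequentially by blast
  obtain n1 where n1: "0 < v n1" using v_unbounded by blast
  obtain L where L: "\<And>l. L \<le> l \<Longrightarrow> max n0 n1 \<le> NN l" using NN_unbounded by blast
  have "drift (NN l) \<le> \<eta> * A l" if l: "L \<le> l" for l
  proof -
    have v: "0 < v (NN l)" using n1 v_mono[of n1 "NN l"] L[OF l] by simp
    have "drift (NN l) < \<eta> / \<theta> * aa (v (NN l))" using n0[of "NN l"] L[OF l] aa_pos[OF v] by (simp add: pos_divide_less_eq)
    also have "\<dots> \<le> \<eta> / \<theta> * (\<theta> * A l)" using assms \<theta> v v_N_less[OF \<theta>, of l] by (intro mult_left_mono aa_le_A) auto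
    also have "\<dots> = \<eta> * A l" using \<theta> by simp
    finally show ?thesis by simp
  qed
  then show ?thesis by blast
qed

text \<open>\<open>Q\<close> selects the levels on which the truncation levels behind
  \<open>f\<close> make sense; on all others the event is taken to be empty.\<close>

lemma null_events:
  assumes Q: "\<And>l. l \<ge> L \<Longrightarrow> Q l \<Longrightarrow> V_outer E X {x. \<exists>m\<le>NN l. K l \<le> (\<Sum>j<m. f l j (x j))} \<le> ereal (g l)"
    and f: "\<And>l j. Q l \<Longrightarrow> blip (f l j)" and g: "summable g" "\<And>l. 0 \<le> g l"
  shows "null {x. \<exists>\<^sub>\<infinity>l. Q l \<and> (\<exists>m\<le>NN l. K l \<le> (\<Sum>j<m. f l j (x j)))}"
proof -
  define B where "B l = (if Q l then {x :: nat \<Rightarrow> real. \<exists>m\<le>NN l. K l \<le> (\<Sum>j<m. f l j (x j))} else {})" for l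
  have "null {x. \<exists>\<^sub>\<infinity>l. x \<in> B l}"
  proof (rule null_limsup[OF _ _ g(1)])
    show "B l \<in> sets borel" for l
      unfolding B_def by (cases "Q l") (simp_all only: if_True if_False borel_max_event[OF f] sets.empty_sets)
    show "V_outer E X (B l) \<le> ereal (g l)" if "L \<le> l" for l
      using Q[OF that] g(2)[of l] by (cases "Q l") (simp_all only: B_def if_True if_False V_outer_empty ereal_less_eq zero_ereal_def)
  qed
  moreover have "x \<in> B l \<longleftrightarrow> Q l \<and> (\<exists>m\<le>NN l. K l \<le> (\<Sum>j<m. f l j (x j)))" for x l
    unfolding B_def by simp
  ultimately show ?thesis by (simp only:)
qed

text \<open>The Gaussian exponential bound with h = t_n/s_n, the optimal choice for the target a_n.
  The variance term uses at most half of \<open>(1 + \<delta>) * tt l\<close>, the drift at most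
  \<open>\<delta> / 4 * tt l\<close>, and the truncation a constant; the rest is
  \<open>(1 + \<delta> / 2) * LL (\<theta> ^ l)\<close>, a summable rate.\<close>

lemma null_good_clamp:
  assumes sg: "\<bar>sg\<bar> = 1" and \<delta>: "0 < \<delta>" and \<theta>\<alpha>: "\<theta> * exp (2 * (\<alpha> * \<theta>)) \<le> 1 + \<delta>"
  shows "null {x. \<exists>\<^sub>\<infinity>l. good l \<and> (\<exists>m\<le>NN l. (1 + \<delta>) * A l \<le> (\<Sum>j<m. sg * clamp (2 * c l) (x j)))}"
proof -
  define h where "h l = tt l / A l" for l
  have h: "0 < h l" for l unfolding h_def using tt_ge[of l] A_pos[of l] by simp
  have hA: "h l * A l = tt l" for l unfolding h_def using A_pos[of l] by simp
  obtain L where L: "\<And>l. L \<le> l \<Longrightarrow> drift (NN l) \<le> \<delta> / 4 * A l" using drift_le[of "\<delta> / 4"] \<delta> by auto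
  define C where "C = exp (\<alpha> powr (1 - p) + 1)"
  have "null {x. \<exists>\<^sub>\<infinity>l. good l \<and> (\<exists>m\<le>NN l. (1 + \<delta>) * tt l \<le> (\<Sum>j<m. h l * (sg * clamp (2 * c l) (x j))))}"
  proof (rule null_events[where L = L and g = "\<lambda>l. C * exp (- (1 + \<delta> / 2) * LL (\<theta> ^ l))"])
    show "blip (\<lambda>u. h l * (sg * clamp (2 * c l) u))" if "good l" for l
      using blip_clamp[of "2 * c l" "h l * sg"] c_bounds(3)[OF good_inhab[OF that]] by (simp add: mult.assoc)
    show "summable (\<lambda>l. C * exp (- (1 + \<delta> / 2) * LL (\<theta> ^ l)))"
      using \<delta> by (intro summable_mult summable_exp_LL \<theta>) auto
    show "0 \<le> C * exp (- (1 + \<delta> / 2) * LL (\<theta> ^ l))" for l unfolding C_def by simp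
    fix l assume l: "L \<le> l" "good l"
    note cb = c_bounds[OF good_inhab[OF l(2)]]
    define e where "e j = h l * mean_bound j + h l * T (2 * c l) j + (h l)\<^sup>2 / 2 * exp (h l * (2 * c l)) * \<sigma>2 j" for j
    have "V_outer E X {x. \<exists>m\<le>NN l. ((1 + \<delta>) * tt l - 1) + 1 \<le> (\<Sum>j<m. h l * (sg * clamp (2 * c l) (x j)))}
        \<le> ereal (exp ((\<Sum>j<NN l. e j) - ((1 + \<delta>) * tt l - 1)))"
    proof (rule maximal_inequality)
      show "blip (\<lambda>u. h l * (sg * clamp (2 * c l) u))"
        using blip_clamp[of "2 * c l" "h l * sg"] cb(3) by (simp add: mult.assoc)
      show "0 \<le> e j" for j unfolding e_def mean_bound_def using h[of l] cb(3) T_nonneg[of "2 * c l" j] \<sigma>2_nonneg[of j]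
        by (intro add_nonneg_nonneg mult_nonneg_nonneg) auto
      show "ER (\<lambda>\<omega>. exp (h l * (sg * clamp (2 * c l) (X (Suc j) \<omega>)))) \<le> exp (e j)" for j
        unfolding e_def using cb(3) h[of l] by (intro clamp_mgf sg) auto
    qed
    also have "(\<Sum>j<NN l. e j) \<le> \<delta> / 4 * tt l + \<alpha> powr (1 - p) + (1 + \<delta>) / 2 * tt l"
    proof -
      have "(\<Sum>j<NN l. e j) = h l * drift (NN l) + h l * (\<Sum>j<NN l. T (2 * c l) j) + (h l)\<^sup>2 / 2 * exp (h l * (2 * c l)) * v (NN l)"
        unfolding e_def v_def sum_mean_bound[symmetric] by (simp add: sum.distrib sum_distrib_left)
      moreover have "h l * drift (NN l) \<le> \<delta> / 4 * tt l"
        using mult_left_mono[OF L[OF l(1)], of "h l"] h[of l] hA[of l] by (simp add: mult.left_commute[of "h l"])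
      moreover have "h l * (\<Sum>j<NN l. T (2 * c l) j) \<le> \<alpha> powr (1 - p)"
      proof -
        have "h l * (\<Sum>j<NN l. T (2 * c l) j) \<le> h l * (\<alpha> powr (1 - p) * (A l / tt l))"
          using h[of l] by (intro mult_left_mono good_sum_T l) auto
        also have "\<dots> = \<alpha> powr (1 - p)" unfolding h_def using A_pos[of l] tt_ge[of l] by simp
        finally show ?thesis .
      qed
      moreover have "(h l)\<^sup>2 / 2 * exp (h l * (2 * c l)) * v (NN l) \<le> (1 + \<delta>) / 2 * tt l"
      proof -
        \<comment> \<open>\<open>c l\<close> is of order s_n/t_n and \<open>h l\<close> is the
          reciprocal scale, so the product stays bounded and the exponential factor is close to 1
          for small \<alpha>.\<close>
        have "h l * c l \<le> h l * (\<alpha> * (\<theta> * ss (\<theta> ^ l)))" using cb(2) h[of l] by (intro mult_left_mono) auto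
        also have "\<dots> = \<alpha> * \<theta>" unfolding h_def A_eq_ss using tt_ge[of l] ss_pos[OF \<theta>_pow_pos[of l]] by simp
        finally have e: "exp (h l * (2 * c l)) \<le> exp (2 * (\<alpha> * \<theta>))" by simp
        have h2: "(h l)\<^sup>2 * \<theta> ^ l = tt l"
        proof -
          have "(h l)\<^sup>2 * \<theta> ^ l = tt l * (\<theta> ^ l * tt l) / (A l * A l)" unfolding h_def power2_eq_square by simp
          also have "\<dots> = tt l" unfolding A_square[symmetric] using A_pos[of l] by simp
          finally show ?thesis .
        qed
        have "(h l)\<^sup>2 / 2 * exp (h l * (2 * c l)) * v (NN l) \<le> (h l)\<^sup>2 / 2 * exp (2 * (\<alpha> * \<theta>)) * \<theta> ^ Suc l"
          using e v_N_less[OF \<theta>, of l] v_nonneg by (intro mult_mono mult_left_mono) auto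
        also have "\<dots> = (\<theta> * exp (2 * (\<alpha> * \<theta>))) / 2 * tt l" unfolding h2[symmetric] by simp
        also have "\<dots> \<le> (1 + \<delta>) / 2 * tt l" using \<theta>\<alpha> tt_ge[of l] by (intro mult_right_mono divide_right_mono) auto
        finally show ?thesis .
      qed
      ultimately show ?thesis by linarith
    qed
    then have "exp ((\<Sum>j<NN l. e j) - ((1 + \<delta>) * tt l - 1)) \<le> exp ((\<alpha> powr (1 - p) + 1) + - (1 + \<delta> / 2) * LL (\<theta> ^ l))"
      unfolding tt_def by (simp add: field_simps)
    then have "ereal (exp ((\<Sum>j<NN l. e j) - ((1 + \<delta>) * tt l - 1))) \<le> ereal (C * exp (- (1 + \<delta> / 2) * LL (\<theta> ^ l)))"
      unfolding C_def exp_add[symmetric] by simp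
    finally show "V_outer E X {x. \<exists>m\<le>NN l. (1 + \<delta>) * tt l \<le> (\<Sum>j<m. h l * (sg * clamp (2 * c l) (x j)))}
        \<le> ereal (C * exp (- (1 + \<delta> / 2) * LL (\<theta> ^ l)))" by simp
  qed
  then show ?thesis
  proof (rule null_subset, intro Collect_mono impI)
    fix x :: "nat \<Rightarrow> real"
    assume "\<exists>\<^sub>\<infinity>l. good l \<and> (\<exists>m\<le>NN l. (1 + \<delta>) * A l \<le> (\<Sum>j<m. sg * clamp (2 * c l) (x j)))"
    then show "\<exists>\<^sub>\<infinity>l. good l \<and> (\<exists>m\<le>NN l. (1 + \<delta>) * tt l \<le> (\<Sum>j<m. h l * (sg * clamp (2 * c l) (x j))))"
    proof (rule INFM_mono)
      fix l assume "good l \<and> (\<exists>m\<le>NN l. (1 + \<delta>) * A l \<le> (\<Sum>j<m. sg * clamp (2 * c l) (x j)))"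
      then obtain m where m: "good l" "m \<le> NN l" "(1 + \<delta>) * A l \<le> (\<Sum>j<m. sg * clamp (2 * c l) (x j))" by blast
      from mult_left_mono[OF m(3), of "h l"] h[of l] hA[of l]
      have "(1 + \<delta>) * tt l \<le> (\<Sum>j<m. h l * (sg * clamp (2 * c l) (x j)))"
        by (simp add: sum_distrib_left[symmetric] mult.left_commute[of "h l"])
      with m show "good l \<and> (\<exists>m\<le>NN l. (1 + \<delta>) * tt l \<le> (\<Sum>j<m. h l * (sg * clamp (2 * c l) (x j))))" by blast
    qed
  qed
qed

lemma \<theta>_neq_0: "\<theta> \<noteq> 0" using \<theta> by simp

text \<open>This is the part of the variables beyond \<open>2 * c l\<close>, capped at
  \<open>\<epsilon> * A l\<close>. With the chosen \<open>h\<close> the cap costs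
  \<open>lam l powr (- (1/2))\<close>, which a good level can afford, while the level
  \<open>\<delta> * A l\<close> gains the power \<open>\<delta> / (2 * \<epsilon>)\<close> of
  \<open>lam l\<close>, and this exponent is at least \<open>q\<close>.\<close>

lemma null_good_residual:
  assumes \<delta>: "0 < \<delta>" and \<epsilon>: "0 < \<epsilon>" "\<epsilon> \<le> \<delta> / (2 * q)"
  shows "null {x. \<exists>\<^sub>\<infinity>l. good l \<and> \<delta> * A l \<le>
    (\<Sum>j<NN l. if 0 < v (Suc j) then min (max (\<bar>x j\<bar> - 2 * c l) 0) (\<epsilon> * A l) else 0)}"
proof -
  define h where "h l = - ln (lam l) / (2 * \<epsilon> * A l)" for l
  have h: "0 \<le> h l" if "good l" for l
    unfolding h_def using good_lam(3)[OF that] lam_pos[of l] A_pos[of l] \<epsilon> by (intro divide_nonneg_nonneg) auto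
  define f where "f l j u = (if 0 < v (Suc j) then h l * min (max (\<bar>u\<bar> - 2 * c l) 0) (\<epsilon> * A l) else 0)" for l j u
  have bf: "blip (f l j)" for l j
  proof (cases "0 < v (Suc j)")
    case True then show ?thesis unfolding f_def using blip_tail[of "\<epsilon> * A l" "h l" "2 * c l"] A_pos[of l] \<epsilon> by simp
  next
    case False then show ?thesis unfolding f_def using blip_clamp[of 0 0] by simp
  qed
  define C where "C = exp (\<alpha> powr (- p) + 1)"
  have "null {x. \<exists>\<^sub>\<infinity>l. good l \<and> (\<exists>m\<le>NN l. h l * (\<delta> * A l) \<le> (\<Sum>j<m. f l j (x j)))}"
  proof (rule null_events[where L = 0 and g = "\<lambda>l. C * lam l powr q"])
    show "summable (\<lambda>l. C * lam l powr q)" by (intro summable_mult lam_summable)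
    show "0 \<le> C * lam l powr q" for l unfolding C_def by simp
    show "blip (f l j)" for l j by (rule bf)
    fix l assume l: "good l"
    note cb = c_bounds[OF good_inhab[OF l]]
    define e where "e j = (if 0 < v (Suc j) then exp (h l * (\<epsilon> * A l)) * c l powr (- p) * \<gamma> \<alpha> p j else 0)" for j
    have hA: "h l * (\<epsilon> * A l) = - ln (lam l) / 2" unfolding h_def using \<epsilon> A_pos[of l] by simp
    have eh: "exp (h l * (\<epsilon> * A l)) = lam l powr (- (1/2))"
      unfolding hA powr_def using lam_pos[of l] by simp
    have "V_outer E X {x. \<exists>m\<le>NN l. (h l * (\<delta> * A l) - 1) + 1 \<le> (\<Sum>j<m. f l j (x j))}
        \<le> ereal (exp ((\<Sum>j<NN l. e j) - (h l * (\<delta> * A l) - 1)))"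
    proof (rule maximal_inequality)
      show "blip (f l j)" for j by (rule bf)
      show "0 \<le> e j" for j unfolding e_def using \<gamma>_nonneg[OF mom] by (auto intro!: mult_nonneg_nonneg)
      fix j assume j: "j < NN l"
      show "ER (\<lambda>\<omega>. exp (f l j (X (Suc j) \<omega>))) \<le> exp (e j)"
      proof (cases "0 < v (Suc j)")
        case True
        have "ER (\<lambda>\<omega>. exp (h l * min (max (\<bar>X (Suc j) \<omega>\<bar> - 2 * c l) 0) (\<epsilon> * A l)))
            \<le> exp (exp (h l * (\<epsilon> * A l)) * c l powr (- p) * \<gamma> \<alpha> p j)"
          using p \<epsilon> A_pos[of l] by (intro residual_mgf mom True cb(3) threshold_le_c j h l) auto
        then show ?thesis unfolding f_def e_def using True by simp
      next
        case False
        then show ?thesis unfolding f_def e_def by simp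
      qed
    qed
    also have "(\<Sum>j<NN l. e j) \<le> \<alpha> powr (- p)"
    proof -
      define s where "s = ss (\<theta> ^ l)"
      have s: "0 < s" unfolding s_def by (intro ss_pos \<theta>_pow_pos)
      have t: "0 < tt l" using tt_ge[of l] by linarith
      have "(\<Sum>j<NN l. e j) = lam l powr (- (1/2)) * (c l powr (- p) * U \<alpha> p (NN l))"
        unfolding e_def U_def eh sum_distrib_left by (intro sum.cong) auto
      also have "\<dots> \<le> lam l powr (- (1/2)) * ((\<alpha> * s) powr (- p) * (lam l * A l powr p))"
      proof (intro mult_left_mono mult_mono)
        show "c l powr (- p) \<le> (\<alpha> * s) powr (- p)" using cb p unfolding s_def by (intro powr_mono2') auto
        show "U \<alpha> p (NN l) \<le> lam l * A l powr p" using U_le unfolding A_def .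
        show "0 \<le> U \<alpha> p (NN l)" unfolding U_def using \<gamma>_nonneg[OF mom] by (intro sum_nonneg) auto
      qed auto
      also have "\<dots> = (lam l powr (- (1/2)) * lam l) * (\<alpha> powr (- p) * tt l powr p)"
        unfolding A_eq_ss s_def[symmetric] using s \<alpha> t by (simp add: powr_mult powr_minus field_simps)
      also have "lam l powr (- (1/2)) * lam l = lam l powr (1/2)"
      proof -
        have "lam l powr (- (1/2)) * lam l powr 1 = lam l powr (1/2)" unfolding powr_add[symmetric] by simp
        then show ?thesis using lam_pos[of l] by simp
      qed
      also have "lam l powr (1/2) * (\<alpha> powr (- p) * tt l powr p) = \<alpha> powr (- p) * (lam l powr (1/2) * tt l powr p)" by simp
      also have "\<dots> \<le> \<alpha> powr (- p) * 1" by (intro mult_left_mono good_lam(2) l) auto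
      finally show ?thesis by simp
    qed
    then have "exp ((\<Sum>j<NN l. e j) - (h l * (\<delta> * A l) - 1)) \<le> exp ((\<alpha> powr (- p) + 1) + - (h l * (\<delta> * A l)))" by simp
    also have "\<dots> = C * exp (- (h l * (\<delta> * A l)))" unfolding C_def exp_add ..
    also have "\<dots> \<le> C * lam l powr q"
    proof -
      have "q * (- ln (lam l)) \<le> (\<delta> / (2 * \<epsilon>)) * (- ln (lam l))"
        using \<epsilon> q good_lam(3)[OF l] lam_pos[of l] by (intro mult_right_mono) (auto simp: field_simps)
      also have "\<dots> = h l * (\<delta> * A l)" unfolding h_def using A_pos[of l] \<epsilon> by (simp add: field_simps)
      finally have "exp (- (h l * (\<delta> * A l))) \<le> exp (q * ln (lam l))" by simp
      also have "\<dots> = lam l powr q" unfolding powr_def using lam_pos[of l] by simp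
      finally show ?thesis unfolding C_def by (intro mult_left_mono) auto
    qed
    finally show "V_outer E X {x. \<exists>m\<le>NN l. h l * (\<delta> * A l) \<le> (\<Sum>j<m. f l j (x j))} \<le> ereal (C * lam l powr q)" by simp
  qed
  then show ?thesis
  proof (rule null_subset, intro Collect_mono impI)
    fix x :: "nat \<Rightarrow> real"
    let ?r = "\<lambda>l j. if 0 < v (Suc j) then min (max (\<bar>x j\<bar> - 2 * c l) 0) (\<epsilon> * A l) else 0"
    assume "\<exists>\<^sub>\<infinity>l. good l \<and> \<delta> * A l \<le> (\<Sum>j<NN l. ?r l j)"
    then show "\<exists>\<^sub>\<infinity>l. good l \<and> (\<exists>m\<le>NN l. h l * (\<delta> * A l) \<le> (\<Sum>j<m. f l j (x j)))"
    proof (rule INFM_mono)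
      fix l assume m: "good l \<and> \<delta> * A l \<le> (\<Sum>j<NN l. ?r l j)"
      then have "h l * (\<delta> * A l) \<le> h l * (\<Sum>j<NN l. ?r l j)" using h[of l] by (intro mult_left_mono) auto
      also have "\<dots> = (\<Sum>j<NN l. f l j (x j))"
        unfolding sum_distrib_left f_def by (intro sum.cong) auto
      finally show "good l \<and> (\<exists>m\<le>NN l. h l * (\<delta> * A l) \<le> (\<Sum>j<m. f l j (x j)))" using m by blast
    qed
  qed
qed

text \<open>On a bad level the moments give no useful truncation near s_n/t_n, but the rate
  \<open>tt l powr (- K)\<close> is enough, because badness bounds it by
  \<open>lam l powr q\<close>. So \<open>h\<close> is only of order \<open>ln (tt l) / A l\<close>,
  and clamping at \<open>\<epsilon> * A l\<close> keeps the truncation and variance terms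
  bounded.\<close>

lemma null_bad_clamp:
  assumes sg: "\<bar>sg\<bar> = 1" and \<delta>: "0 < \<delta>" and \<epsilon>: "0 < \<epsilon>" "\<epsilon> \<le> 1 / (4 * p * q)"
  shows "null {x. \<exists>\<^sub>\<infinity>l. (inhab l \<and> \<not> good l) \<and> (\<exists>m\<le>NN l. (1 + \<delta>) * A l \<le> (\<Sum>j<m. sg * clamp (\<epsilon> * A l) (x j)))}"
proof -
  define K where "K = 2 * p * q"
  have K: "0 < K" "\<epsilon> * K \<le> 1/2" unfolding K_def using p q \<epsilon> by (auto simp: field_simps)
  \<comment> \<open>As \<open>\<epsilon> * K \<le> 1/2\<close>, the clamp costs at most
    \<open>tt l powr (1/2)\<close>, which leaves half a power of \<open>tt l\<close> to beat the
    squared logarithm.\<close>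
  define h where "h l = K * ln (tt l) / A l" for l
  have h: "0 < h l" for l unfolding h_def using tt_ge[of l] A_pos[of l] K by simp
  have hA: "h l * A l = K * ln (tt l)" for l unfolding h_def using A_pos[of l] by simp
  obtain L where L: "\<And>l. L \<le> l \<Longrightarrow> drift (NN l) \<le> \<delta> * A l" using drift_le[OF \<delta>] by auto
  define C where "C = exp (K * \<theta> / (4 * \<epsilon>) + 8 * K\<^sup>2 * \<theta> + 1)"
  have y0: "0 \<le> \<epsilon> * A l" for l using \<epsilon> A_pos[of l] by simp
  have bf: "blip (\<lambda>u. h l * (sg * clamp (\<epsilon> * A l) u))" for l
    using blip_clamp[OF y0, of "h l * sg" l] by (simp add: mult.assoc)
  have "null {x. \<exists>\<^sub>\<infinity>l. (inhab l \<and> \<not> good l) \<and> (\<exists>m\<le>NN l. (1 + \<delta>) * (K * ln (tt l)) \<le> (\<Sum>j<m. h l * (sg * clamp (\<epsilon> * A l) (x j))))}"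
  proof (rule null_events[where L = L and g = "\<lambda>l. C * lam l powr q"])
    show "summable (\<lambda>l. C * lam l powr q)" by (intro summable_mult lam_summable)
    show "0 \<le> C * lam l powr q" for l unfolding C_def by simp
    show "blip (\<lambda>u. h l * (sg * clamp (\<epsilon> * A l) u))" for l by (rule bf)
    fix l assume l: "L \<le> l" "inhab l \<and> \<not> good l"
    have t: "2 \<le> tt l" by (rule tt_ge)
    have lnt: "0 \<le> ln (tt l)" "ln (tt l) \<le> tt l" using t ln_le_minus_one[of "tt l"] by auto
    define e where "e j = h l * mean_bound j + h l * T (\<epsilon> * A l) j + (h l)\<^sup>2 / 2 * exp (h l * (\<epsilon> * A l)) * \<sigma>2 j" for j
    have "V_outer E X {x. \<exists>m\<le>NN l. ((1 + \<delta>) * (K * ln (tt l)) - 1) + 1 \<le> (\<Sum>j<m. h l * (sg * clamp (\<epsilon> * A l) (x j)))}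
        \<le> ereal (exp ((\<Sum>j<NN l. e j) - ((1 + \<delta>) * (K * ln (tt l)) - 1)))"
    proof (rule maximal_inequality)
      show "blip (\<lambda>u. h l * (sg * clamp (\<epsilon> * A l) u))" by (rule bf)
      show "0 \<le> e j" for j unfolding e_def mean_bound_def using h[of l] T_nonneg[OF y0, of l j] \<sigma>2_nonneg[of j]
        by (intro add_nonneg_nonneg mult_nonneg_nonneg) auto
      show "ER (\<lambda>\<omega>. exp (h l * (sg * clamp (\<epsilon> * A l) (X (Suc j) \<omega>)))) \<le> exp (e j)" for j
        unfolding e_def using h[of l] by (intro clamp_mgf sg y0) auto
    qed
    also have "(\<Sum>j<NN l. e j) \<le> \<delta> * (K * ln (tt l)) + K * \<theta> / (4 * \<epsilon>) + 8 * K\<^sup>2 * \<theta>"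
    proof -
      have "(\<Sum>j<NN l. e j) = h l * drift (NN l) + h l * (\<Sum>j<NN l. T (\<epsilon> * A l) j) + (h l)\<^sup>2 / 2 * exp (h l * (\<epsilon> * A l)) * v (NN l)"
        unfolding e_def v_def sum_mean_bound[symmetric] by (simp add: sum.distrib sum_distrib_left)
      moreover have "h l * drift (NN l) \<le> \<delta> * (K * ln (tt l))"
        using mult_left_mono[OF L[OF l(1)], of "h l"] h[of l] hA[of l] by (simp add: mult.left_commute[of "h l"])
      moreover have "h l * (\<Sum>j<NN l. T (\<epsilon> * A l) j) \<le> K * \<theta> / (4 * \<epsilon>)"
      proof -
        \<comment> \<open>Clamping at the order of \<open>A l\<close> lets the crude second moment
          bound control the truncation error.\<close>
        have "(\<Sum>j<NN l. T (\<epsilon> * A l) j) \<le> (\<Sum>j<NN l. \<sigma>2 j / (4 * (\<epsilon> * A l)))"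
          using \<epsilon> A_pos[of l] by (intro sum_mono T_le_square) auto
        also have "\<dots> = v (NN l) / (4 * (\<epsilon> * A l))" unfolding v_def by (simp add: sum_divide_distrib)
        also have "\<dots> \<le> \<theta> ^ Suc l / (4 * (\<epsilon> * A l))"
          using v_N_less[OF \<theta>, of l] \<epsilon> A_pos[of l] by (intro divide_right_mono) auto
        finally have "h l * (\<Sum>j<NN l. T (\<epsilon> * A l) j) \<le> h l * (\<theta> ^ Suc l / (4 * (\<epsilon> * A l)))"
          using h[of l] by (intro mult_left_mono) auto
        also have "\<dots> = K * \<theta> / (4 * \<epsilon>) * (ln (tt l) * \<theta> ^ l / (A l * A l))"
          unfolding h_def by (simp add: mult_ac)
        also have "ln (tt l) * \<theta> ^ l / (A l * A l) = ln (tt l) / tt l"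
          unfolding A_square using \<theta>_neq_0 by simp
        also have "K * \<theta> / (4 * \<epsilon>) * (ln (tt l) / tt l) \<le> K * \<theta> / (4 * \<epsilon>) * 1"
          using lnt t K \<theta> \<epsilon> by (intro mult_left_mono) auto
        finally show ?thesis by simp
      qed
      moreover have "(h l)\<^sup>2 / 2 * exp (h l * (\<epsilon> * A l)) * v (NN l) \<le> 8 * K\<^sup>2 * \<theta>"
      proof -
        have "h l * (\<epsilon> * A l) = (\<epsilon> * K) * ln (tt l)" using hA[of l] by (simp add: mult_ac)
        also have "\<dots> \<le> 1/2 * ln (tt l)" using K lnt by (intro mult_right_mono) auto
        finally have "exp (h l * (\<epsilon> * A l)) \<le> exp (1/2 * ln (tt l))" by simp
        also have "\<dots> = tt l powr (1/2)" unfolding powr_def using t by simp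
        finally have e: "exp (h l * (\<epsilon> * A l)) \<le> tt l powr (1/2)" .
        have "(h l)\<^sup>2 / 2 * exp (h l * (\<epsilon> * A l)) * v (NN l) \<le> (h l)\<^sup>2 / 2 * tt l powr (1/2) * \<theta> ^ Suc l"
          using e v_N_less[OF \<theta>, of l] v_nonneg by (intro mult_mono mult_left_mono) auto
        also have "\<dots> = K\<^sup>2 * \<theta> / 2 * ((ln (tt l))\<^sup>2 * tt l powr (1/2)) * (\<theta> ^ l / (A l * A l))"
          unfolding h_def by (simp add: power2_eq_square mult_ac)
        also have "\<theta> ^ l / (A l * A l) = 1 / tt l" unfolding A_square using \<theta>_neq_0 by simp
        also have "K\<^sup>2 * \<theta> / 2 * ((ln (tt l))\<^sup>2 * tt l powr (1/2)) * (1 / tt l) \<le> K\<^sup>2 * \<theta> / 2 * ((16 * tt l powr (1/2)) * tt l powr (1/2)) * (1 / tt l)"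
          using t \<theta> ln_square_le[of "tt l"] by (intro mult_right_mono mult_left_mono) auto
        also have "(16 * tt l powr (1/2)) * tt l powr (1/2) = 16 * tt l" using t by (simp add: powr_add[symmetric])
        also have "K\<^sup>2 * \<theta> / 2 * (16 * tt l) * (1 / tt l) = 8 * K\<^sup>2 * \<theta>" using t by simp
        finally show ?thesis .
      qed
      ultimately show ?thesis by linarith
    qed
    then have "exp ((\<Sum>j<NN l. e j) - ((1 + \<delta>) * (K * ln (tt l)) - 1)) \<le> exp ((K * \<theta> / (4 * \<epsilon>) + 8 * K\<^sup>2 * \<theta> + 1) + - K * ln (tt l))"
      by (simp add: algebra_simps)
    also have "\<dots> = C * tt l powr (- K)" unfolding C_def exp_add powr_def using t by simp
    also have "\<dots> \<le> C * lam l powr q"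
    proof -
      have "1 < lam l * tt l powr (2 * p)" using l(2) unfolding good_def by linarith
      then have "1 / tt l powr (2 * p) < lam l" using t by (simp add: divide_less_eq)
      then have "tt l powr (- (2 * p)) \<le> lam l" by (simp add: powr_minus_divide)
      then have "(tt l powr (- (2 * p))) powr q \<le> lam l powr q" using q by (intro powr_mono2) auto
      then have "tt l powr (- K) \<le> lam l powr q" unfolding K_def by (simp add: powr_powr)
      then show ?thesis unfolding C_def by (intro mult_left_mono) auto
    qed
    finally show "V_outer E X {x. \<exists>m\<le>NN l. (1 + \<delta>) * (K * ln (tt l)) \<le> (\<Sum>j<m. h l * (sg * clamp (\<epsilon> * A l) (x j)))}
        \<le> ereal (C * lam l powr q)" by simp
  qed
  then show ?thesis
  proof (rule null_subset, intro Collect_mono impI)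
    fix x :: "nat \<Rightarrow> real"
    assume "\<exists>\<^sub>\<infinity>l. (inhab l \<and> \<not> good l) \<and> (\<exists>m\<le>NN l. (1 + \<delta>) * A l \<le> (\<Sum>j<m. sg * clamp (\<epsilon> * A l) (x j)))"
    then show "\<exists>\<^sub>\<infinity>l. (inhab l \<and> \<not> good l) \<and> (\<exists>m\<le>NN l. (1 + \<delta>) * (K * ln (tt l)) \<le> (\<Sum>j<m. h l * (sg * clamp (\<epsilon> * A l) (x j))))"
    proof (rule INFM_mono)
      fix l assume "(inhab l \<and> \<not> good l) \<and> (\<exists>m\<le>NN l. (1 + \<delta>) * A l \<le> (\<Sum>j<m. sg * clamp (\<epsilon> * A l) (x j)))"
      then obtain m where m: "inhab l \<and> \<not> good l" "m \<le> NN l" "(1 + \<delta>) * A l \<le> (\<Sum>j<m. sg * clamp (\<epsilon> * A l) (x j))" by blast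
      from mult_left_mono[OF m(3), of "h l"] h[of l] hA[of l]
      have "(1 + \<delta>) * (K * ln (tt l)) \<le> (\<Sum>j<m. h l * (sg * clamp (\<epsilon> * A l) (x j)))"
        by (simp add: sum_distrib_left[symmetric] mult.left_commute[of "h l"])
      with m show "(inhab l \<and> \<not> good l) \<and> (\<exists>m\<le>NN l. (1 + \<delta>) * (K * ln (tt l)) \<le> (\<Sum>j<m. h l * (sg * clamp (\<epsilon> * A l) (x j))))" by blast
    qed
  qed
qed

text \<open>Passage from indices to levels: late indices are covered by \<open>null_large\<close>,
  since \<open>aa (v (Suc j)) \<le> \<theta> * A l\<close>, and the finitely many early ones by the
  growth of \<open>A l\<close>.\<close>

lemma null_truncation:
  assumes \<epsilon>: "0 < \<epsilon>" shows "null {x. \<exists>\<^sub>\<infinity>l. \<exists>j<NN l. \<epsilon> * A l < \<bar>x j\<bar>}"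
proof (rule null_subset[OF null_large[of "\<epsilon> / \<theta>"]])
  show "0 < \<epsilon> / \<theta>" using \<epsilon> \<theta> by simp
  show "{x. \<exists>\<^sub>\<infinity>l. \<exists>j<NN l. \<epsilon> * A l < \<bar>x j\<bar>} \<subseteq> {x. \<exists>\<^sub>\<infinity>j. \<epsilon> / \<theta> * aa (v (Suc j)) < \<bar>x j\<bar>}"
  proof (rule subsetI, rule ccontr)
    fix x :: "nat \<Rightarrow> real"
    assume a: "x \<in> {x. \<exists>\<^sub>\<infinity>l. \<exists>j<NN l. \<epsilon> * A l < \<bar>x j\<bar>}" and "x \<notin> {x. \<exists>\<^sub>\<infinity>j. \<epsilon> / \<theta> * aa (v (Suc j)) < \<bar>x j\<bar>}"
    then have "\<forall>\<^sub>\<infinity>j. \<bar>x j\<bar> \<le> \<epsilon> / \<theta> * aa (v (Suc j))" by (simp add: not_INFM not_less)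
    then obtain J where J: "\<And>j. J \<le> j \<Longrightarrow> \<bar>x j\<bar> \<le> \<epsilon> / \<theta> * aa (v (Suc j))" unfolding MOST_nat_le by blast
    obtain L where L: "\<And>l. L \<le> l \<Longrightarrow> (\<Sum>j<J. \<bar>x j\<bar>) / \<epsilon> \<le> A l" using A_unbounded by blast
    obtain l j where l: "L \<le> l" "j < NN l" "\<epsilon> * A l < \<bar>x j\<bar>" using a unfolding mem_Collect_eq INFM_nat_le by blast
    show False
    proof (cases "J \<le> j")
      case True
      have "v (Suc j) \<le> \<theta> ^ Suc l" using N_iff[OF \<theta>, of "Suc j" l] l(2) by simp
      then have "\<epsilon> / \<theta> * aa (v (Suc j)) \<le> \<epsilon> / \<theta> * (\<theta> * A l)"
        using \<epsilon> \<theta> by (intro mult_left_mono aa_le_A v_nonneg) auto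
      then show False using J[OF True] l(3) \<theta> by simp
    next
      case False
      then have "\<bar>x j\<bar> \<le> (\<Sum>j<J. \<bar>x j\<bar>)" by (intro member_le_sum) auto
      also have "\<dots> \<le> \<epsilon> * A l" using L[OF l(1)] \<epsilon> by (simp add: field_simps)
      finally show False using l(3) by simp
    qed
  qed
qed

text \<open>Off two null sets the cap at \<open>\<epsilon> * A l\<close> is eventually not exceeded,
  so the capped sum is the whole tail up to the finitely many indices of vanishing variance. Their
  fixed contribution is absorbed by the second \<open>\<delta> * A l\<close>.\<close>

lemma null_good_tail:
  assumes \<delta>: "0 < \<delta>"
  shows "null {x. \<exists>\<^sub>\<infinity>l. good l \<and> 2 * \<delta> * A l \<le> (\<Sum>j<NN l. max (\<bar>x j\<bar> - 2 * c l) 0)}"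
proof -
  define \<epsilon> where "\<epsilon> = \<delta> / (2 * q)"
  have \<epsilon>: "0 < \<epsilon>" unfolding \<epsilon>_def using \<delta> q by simp
  let ?r = "\<lambda>x l j. if 0 < v (Suc j) then min (max (\<bar>x j\<bar> - 2 * c l) 0) (\<epsilon> * A l) else 0"
  let ?N1 = "{x. \<exists>\<^sub>\<infinity>l. good l \<and> \<delta> * A l \<le> (\<Sum>j<NN l. ?r x l j)}"
  let ?N2 = "{x. \<exists>\<^sub>\<infinity>l. \<exists>j<NN l. \<epsilon> * A l < \<bar>x j\<bar>}"
  have n1: "null ?N1" using \<epsilon> \<delta> by (intro null_good_residual) (simp_all add: \<epsilon>_def)
  obtain n1 where n1v: "0 < v n1" using v_unbounded by blast
  have n: "null (?N1 \<union> ?N2)" by (intro null_Un n1 null_truncation \<epsilon>)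
  show ?thesis
  proof (rule null_subset[OF n], rule subsetI, rule ccontr)
    fix x :: "nat \<Rightarrow> real"
    assume a: "x \<in> {x. \<exists>\<^sub>\<infinity>l. good l \<and> 2 * \<delta> * A l \<le> (\<Sum>j<NN l. max (\<bar>x j\<bar> - 2 * c l) 0)}" and "x \<notin> ?N1 \<union> ?N2"
    then have m: "\<forall>\<^sub>\<infinity>l. \<not> (good l \<and> \<delta> * A l \<le> (\<Sum>j<NN l. ?r x l j))" "\<forall>\<^sub>\<infinity>l. \<not> (\<exists>j<NN l. \<epsilon> * A l < \<bar>x j\<bar>)"
      by (simp_all add: not_INFM)
    obtain L1 where L1: "\<And>l. L1 \<le> l \<Longrightarrow> \<not> (good l \<and> \<delta> * A l \<le> (\<Sum>j<NN l. ?r x l j))" using m(1) unfolding MOST_nat_le by blast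
    obtain L2 where L2: "\<And>l. L2 \<le> l \<Longrightarrow> \<not> (\<exists>j<NN l. \<epsilon> * A l < \<bar>x j\<bar>)" using m(2) unfolding MOST_nat_le by blast
    obtain L3 where L3: "\<And>l. L3 \<le> l \<Longrightarrow> (\<Sum>j<n1. \<bar>x j\<bar>) / \<delta> \<le> A l" using A_unbounded by blast
    obtain l where l: "max (max L1 L2) L3 \<le> l" "good l" "2 * \<delta> * A l \<le> (\<Sum>j<NN l. max (\<bar>x j\<bar> - 2 * c l) 0)"
      using a unfolding mem_Collect_eq INFM_nat_le by blast
    have c0: "0 < c l" by (rule c_bounds(3)[OF good_inhab[OF l(2)]])
    have "(\<Sum>j<NN l. max (\<bar>x j\<bar> - 2 * c l) 0) \<le> (\<Sum>j<NN l. ?r x l j + (if j < n1 then \<bar>x j\<bar> else 0))"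
    proof (rule sum_mono)
      fix j assume j: "j \<in> {..<NN l}"
      have le: "\<bar>x j\<bar> \<le> \<epsilon> * A l" using L2[of l] l(1) j by auto
      have y: "0 \<le> \<epsilon> * A l" using \<epsilon> A_pos[of l] by simp
      show "max (\<bar>x j\<bar> - 2 * c l) 0 \<le> ?r x l j + (if j < n1 then \<bar>x j\<bar> else 0)"
      proof (cases "0 < v (Suc j)")
        case True
        have "max (\<bar>x j\<bar> - 2 * c l) 0 \<le> \<epsilon> * A l" using le y c0 by simp
        then show ?thesis using True by simp
      next
        case False
        then have "j < n1" using n1v v_mono[of n1 "Suc j"] by (cases "j < n1") auto
        then show ?thesis using False c0 by simp
      qed
    qed
    also have "\<dots> = (\<Sum>j<NN l. ?r x l j) + (\<Sum>j<NN l. if j < n1 then \<bar>x j\<bar> else 0)" by (rule sum.distrib)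
    also have "(\<Sum>j<NN l. if j < n1 then \<bar>x j\<bar> else 0) \<le> (\<Sum>j<n1. \<bar>x j\<bar>)"
    proof -
      have "(\<Sum>j<NN l. if j < n1 then \<bar>x j\<bar> else 0) = (\<Sum>j\<in>{..<NN l} \<inter> {j. j < n1}. \<bar>x j\<bar>)" by (simp add: sum.inter_restrict)
      also have "\<dots> \<le> (\<Sum>j<n1. \<bar>x j\<bar>)" by (intro sum_mono2) auto
      finally show ?thesis .
    qed
    also have "(\<Sum>j<n1. \<bar>x j\<bar>) \<le> \<delta> * A l" using L3[of l] l(1) \<delta> by (simp add: field_simps)
    finally have "(\<Sum>j<NN l. max (\<bar>x j\<bar> - 2 * c l) 0) \<le> (\<Sum>j<NN l. ?r x l j) + \<delta> * A l" by simp
    moreover have "(\<Sum>j<NN l. ?r x l j) < \<delta> * A l" using L1[of l] l by auto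
    ultimately show False using l(3) by simp
  qed
qed

lemma clamp_diff_le:
  assumes "\<bar>sg\<bar> = 1" "0 \<le> y" shows "sg * x \<le> sg * clamp y x + max (\<bar>x\<bar> - y) 0"
proof -
  have "sg = 1 \<or> sg = - 1" using assms by linarith
  then show ?thesis using assms unfolding clamp_def by auto
qed

text \<open>Every large \<open>n\<close> lies on an inhabited level with
  \<open>A l \<le> aa (v n)\<close>. On a good level the clamped sum uses
  \<open>1 + \<delta>\<close> and the tail \<open>2 * \<delta>\<close>; on a bad one no variable
  exceeds the clamp, so the clamped sum is the sum itself.\<close>

lemma null_upper:
  assumes sg: "\<bar>sg\<bar> = 1" and \<delta>: "0 < \<delta>" and \<theta>\<alpha>: "\<theta> * exp (2 * (\<alpha> * \<theta>)) \<le> 1 + \<delta>"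
  shows "null {x. \<exists>\<^sub>\<infinity>n. (1 + 3 * \<delta>) * aa (v n) < (\<Sum>j<n. sg * x j)}"
proof -
  define \<epsilon> where "\<epsilon> = 1 / (4 * p * q)"
  have \<epsilon>: "0 < \<epsilon>" unfolding \<epsilon>_def using p q by simp
  let ?N1 = "{x. \<exists>\<^sub>\<infinity>l. good l \<and> (\<exists>m\<le>NN l. (1 + \<delta>) * A l \<le> (\<Sum>j<m. sg * clamp (2 * c l) (x j)))}"
  let ?N2 = "{x. \<exists>\<^sub>\<infinity>l. good l \<and> 2 * \<delta> * A l \<le> (\<Sum>j<NN l. max (\<bar>x j\<bar> - 2 * c l) 0)}"
  let ?N3 = "{x. \<exists>\<^sub>\<infinity>l. (inhab l \<and> \<not> good l) \<and> (\<exists>m\<le>NN l. (1 + \<delta>) * A l \<le> (\<Sum>j<m. sg * clamp (\<epsilon> * A l) (x j)))}"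
  let ?N4 = "{x. \<exists>\<^sub>\<infinity>l. \<exists>j<NN l. \<epsilon> * A l < \<bar>x j\<bar>}"
  have n: "null (?N1 \<union> ?N2 \<union> ?N3 \<union> ?N4)"
    by (intro null_Un null_good_clamp null_good_tail null_bad_clamp null_truncation sg \<delta> \<theta>\<alpha> \<epsilon>) (simp add: \<epsilon>_def)
  show ?thesis
  proof (rule null_subset[OF n], rule subsetI, rule ccontr)
    fix x :: "nat \<Rightarrow> real"
    assume a: "x \<in> {x. \<exists>\<^sub>\<infinity>n. (1 + 3 * \<delta>) * aa (v n) < (\<Sum>j<n. sg * x j)}" and "x \<notin> ?N1 \<union> ?N2 \<union> ?N3 \<union> ?N4"
    then have m: "\<forall>\<^sub>\<infinity>l. \<not> (good l \<and> (\<exists>m\<le>NN l. (1 + \<delta>) * A l \<le> (\<Sum>j<m. sg * clamp (2 * c l) (x j))))"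
      "\<forall>\<^sub>\<infinity>l. \<not> (good l \<and> 2 * \<delta> * A l \<le> (\<Sum>j<NN l. max (\<bar>x j\<bar> - 2 * c l) 0))"
      "\<forall>\<^sub>\<infinity>l. \<not> ((inhab l \<and> \<not> good l) \<and> (\<exists>m\<le>NN l. (1 + \<delta>) * A l \<le> (\<Sum>j<m. sg * clamp (\<epsilon> * A l) (x j))))"
      "\<forall>\<^sub>\<infinity>l. \<not> (\<exists>j<NN l. \<epsilon> * A l < \<bar>x j\<bar>)"
      by (simp_all only: Un_iff mem_Collect_eq not_INFM de_Morgan_disj)
    obtain L1 where L1: "\<forall>l\<ge>L1. \<not> (good l \<and> (\<exists>m\<le>NN l. (1 + \<delta>) * A l \<le> (\<Sum>j<m. sg * clamp (2 * c l) (x j))))"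
      using m(1) unfolding MOST_nat_le by (rule exE)
    obtain L2 where L2: "\<forall>l\<ge>L2. \<not> (good l \<and> 2 * \<delta> * A l \<le> (\<Sum>j<NN l. max (\<bar>x j\<bar> - 2 * c l) 0))"
      using m(2) unfolding MOST_nat_le by (rule exE)
    obtain L3 where L3: "\<forall>l\<ge>L3. \<not> ((inhab l \<and> \<not> good l) \<and> (\<exists>m\<le>NN l. (1 + \<delta>) * A l \<le> (\<Sum>j<m. sg * clamp (\<epsilon> * A l) (x j))))"
      using m(3) unfolding MOST_nat_le by (rule exE)
    obtain L4 where L4: "\<forall>l\<ge>L4. \<not> (\<exists>j<NN l. \<epsilon> * A l < \<bar>x j\<bar>)"
      using m(4) unfolding MOST_nat_le by (rule exE)
    define L where "L = max (max L1 L2) (max L3 L4)"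
    obtain n0 where n0: "\<theta> ^ L < v n0" using v_unbounded by blast
    obtain n where n: "n0 \<le> n" "(1 + 3 * \<delta>) * aa (v n) < (\<Sum>j<n. sg * x j)"
      using a unfolding mem_Collect_eq INFM_nat_le by blast
    have vn: "\<theta> ^ L < v n" using n0 v_mono[OF n(1)] by linarith
    have "1 \<le> \<theta> ^ L" using \<theta> by simp
    then obtain l where l: "\<theta> ^ l \<le> v n" "v n < \<theta> ^ Suc l" using level_exists[OF \<theta>, of n] vn by auto
    have nN: "n \<le> NN l" using N_iff[OF \<theta>] l(2) by simp
    have Ll: "L \<le> l"
    proof (rule ccontr)
      assume "\<not> L \<le> l"
      then have "\<theta> ^ Suc l \<le> \<theta> ^ L" using \<theta> by (intro power_increasing) auto
      then show False using vn l(2) by linarith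
    qed
    have Li: "L1 \<le> l" "L2 \<le> l" "L3 \<le> l" "L4 \<le> l" using Ll unfolding L_def by simp_all
    note LL = L1[rule_format, OF Li(1)] L2[rule_format, OF Li(2)] L3[rule_format, OF Li(3)] L4[rule_format, OF Li(4)]
    have inh: "inhab l" unfolding inhab_def using l(1) v_mono[OF nN] by linarith
    have Aa: "A l \<le> aa (v n)" unfolding A_def using l(1) \<theta>_pow_pos[of l] by (intro aa_mono) auto
    have "(\<Sum>j<n. sg * x j) \<le> (1 + 3 * \<delta>) * A l"
    proof (cases "good l")
      case True
      have c0: "0 \<le> 2 * c l" using c_bounds(3)[OF inh] by simp
      have "(\<Sum>j<n. sg * x j) \<le> (\<Sum>j<n. sg * clamp (2 * c l) (x j)) + (\<Sum>j<n. max (\<bar>x j\<bar> - 2 * c l) 0)"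
        unfolding sum.distrib[symmetric] by (intro sum_mono clamp_diff_le sg c0)
      also have "(\<Sum>j<n. max (\<bar>x j\<bar> - 2 * c l) 0) \<le> (\<Sum>j<NN l. max (\<bar>x j\<bar> - 2 * c l) 0)"
        using nN by (intro sum_mono2) auto
      also have "(\<Sum>j<NN l. max (\<bar>x j\<bar> - 2 * c l) 0) \<le> 2 * \<delta> * A l" using LL(2) True by simp
      also have "(\<Sum>j<n. sg * clamp (2 * c l) (x j)) \<le> (1 + \<delta>) * A l"
      proof (rule ccontr)
        assume "\<not> ?thesis"
        then have "good l \<and> (\<exists>m\<le>NN l. (1 + \<delta>) * A l \<le> (\<Sum>j<m. sg * clamp (2 * c l) (x j)))"
          using True nN by (intro conjI exI[of _ n]) auto
        with LL(1) show False by (rule notE)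
      qed
      finally show ?thesis by (simp add: algebra_simps)
    next
      case False
      have small: "\<bar>x j\<bar> \<le> \<epsilon> * A l" if "j < NN l" for j
      proof (rule ccontr)
        assume "\<not> ?thesis"
        then have "\<exists>j<NN l. \<epsilon> * A l < \<bar>x j\<bar>" using that by (intro exI[of _ j]) auto
        with LL(4) show False by (rule notE)
      qed
      have "(\<Sum>j<n. sg * x j) = (\<Sum>j<n. sg * clamp (\<epsilon> * A l) (x j))"
      proof (rule sum.cong)
        fix j assume "j \<in> {..<n}"
        then have "\<bar>x j\<bar> \<le> \<epsilon> * A l" using small nN by simp
        then show "sg * x j = sg * clamp (\<epsilon> * A l) (x j)" by (simp add: clamp_eq)
      qed simp
      also have "\<dots> \<le> (1 + \<delta>) * A l"
      proof (rule ccontr)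
        assume "\<not> ?thesis"
        then have "(inhab l \<and> \<not> good l) \<and> (\<exists>m\<le>NN l. (1 + \<delta>) * A l \<le> (\<Sum>j<m. sg * clamp (\<epsilon> * A l) (x j)))"
          using False inh nN by (intro conjI exI[of _ n]) auto
        with LL(3) show False by (rule notE)
      qed
      also have "\<dots> \<le> (1 + 3 * \<delta>) * A l" using \<delta> A_pos[of l] by (intro mult_right_mono) auto
      finally show ?thesis .
    qed
    also have "\<dots> \<le> (1 + 3 * \<delta>) * aa (v n)" using Aa \<delta> by (intro mult_left_mono) auto
    finally show False using n(2) by simp
  qed
qed

end

section \<open>Tools from classical probability\<close>

text \<open>The second Borel-Cantelli lemma along an index set: \<open>1 - p \<le> exp (- p)\<close>
  turns divergence of the probabilities into probability 0 for missing all events from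
  \<open>n\<close> on.\<close>

lemma (in prob_space) borel_cantelli_indep_vars:
  fixes S :: "nat \<Rightarrow> 'a \<Rightarrow> real"
  assumes ind: "indep_vars (\<lambda>_. borel) S L"
    and div: "\<not> summable (\<lambda>l. if l \<in> L then prob {x \<in> space M. K l \<le> S l x} else 0)"
  shows "AE x in M. \<exists>\<^sub>\<infinity>l. l \<in> L \<and> K l \<le> S l x"
proof -
  define p where "p l = (if l \<in> L then prob {x \<in> space M. K l \<le> S l x} else 0)" for l
  have S[measurable]: "S l \<in> borel_measurable M" if "l \<in> L" for l using ind that by (auto simp: indep_vars_def)
  define G where "G l = {x \<in> space M. S l x < K l}" for l
  have G: "G l \<in> events" if "l \<in> L" for l unfolding G_def using S[OF that] by measurable
  have indG: "indep_events G L"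
    unfolding G_def by (rule indep_eventsI_indep_vars[OF ind]) auto
  have pG: "prob (G l) \<le> exp (- p l)" if l: "l \<in> L" for l
  proof -
    have m: "{x \<in> space M. K l \<le> S l x} \<in> events" using S[OF l] by measurable
    have "G l = space M - {x \<in> space M. K l \<le> S l x}" unfolding G_def by auto
    then have "prob (G l) = 1 - p l" using prob_compl[OF m] l unfolding p_def by simp
    then show ?thesis using exp_ge_add_one_self[of "- p l"] by simp
  qed
  define B where "B n = {x \<in> space M. \<forall>l\<ge>n. l \<in> L \<longrightarrow> x \<in> G l}" for n
  have "emeasure M (B n) = 0 \<and> B n \<in> events" for n
  proof -
    have Bm: "B n \<in> events"
      unfolding B_def
    proof (rule sets.sets_Collect_countable_All)
      fix l
      show "{x \<in> space M. n \<le> l \<longrightarrow> l \<in> L \<longrightarrow> x \<in> G l} \<in> events"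
      proof (cases "n \<le> l \<and> l \<in> L")
        case True
        then have "{x \<in> space M. n \<le> l \<longrightarrow> l \<in> L \<longrightarrow> x \<in> G l} = G l" unfolding G_def by auto
        then show ?thesis using G True by simp
      next
        case False
        then have "{x \<in> space M. n \<le> l \<longrightarrow> l \<in> L \<longrightarrow> x \<in> G l} = space M" by auto
        then show ?thesis by simp
      qed
    qed
    have le: "prob (B n) \<le> exp (- (\<Sum>l=n..<m. p l))" for m
    \<comment> \<open>The product formula for independent events requires a nonempty index set; for
      an empty one the bound is 1.\<close>
    proof (cases "{n..<m} \<inter> L = {}")
      case True
      then have "(\<Sum>l=n..<m. p l) = 0" unfolding p_def by (intro sum.neutral) auto
      then show ?thesis by simp
    next
      case False
      let ?J = "{n..<m} \<inter> L"
      have "prob (B n) \<le> prob (\<Inter>l\<in>?J. G l)"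
      proof (rule finite_measure_mono)
        show "B n \<subseteq> (\<Inter>l\<in>?J. G l)" unfolding B_def by auto
        show "(\<Inter>l\<in>?J. G l) \<in> events" using False G by (intro sets.finite_INT) auto
      qed
      also have "\<dots> = (\<Prod>l\<in>?J. prob (G l))" using indG False unfolding indep_events_def by auto
      also have "\<dots> \<le> (\<Prod>l\<in>?J. exp (- p l))" using pG by (intro prod_mono) auto
      also have "\<dots> = exp (- (\<Sum>l\<in>?J. p l))" by (simp add: exp_sum sum_negf[symmetric])
      also have "(\<Sum>l\<in>?J. p l) = (\<Sum>l=n..<m. p l)"
        unfolding p_def by (intro sum.mono_neutral_left) auto
      finally show ?thesis .
    qed
    have p0: "0 \<le> p l" for l unfolding p_def by simp
    have "\<exists>m. C < (\<Sum>l=n..<m. p l)" for C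
    proof (rule ccontr)
      assume "\<not> ?thesis"
      then have b: "(\<Sum>l=n..<m. p l) \<le> C" for m by (simp add: not_less)
      have "summable p"
      proof (rule summableI_nonneg_bounded[OF p0])
        fix m
        have "(\<Sum>l<m. p l) \<le> (\<Sum>l\<in>{..<n} \<union> {n..<m}. p l)" using p0 by (intro sum_mono2) auto
        also have "\<dots> = (\<Sum>l<n. p l) + (\<Sum>l=n..<m. p l)" by (intro sum.union_disjoint) auto
        finally show "(\<Sum>l<m. p l) \<le> (\<Sum>l<n. p l) + C" using b[of m] by linarith
      qed
      with div show False unfolding p_def by simp
    qed
    note unb = this
    have "prob (B n) = 0"
    proof (rule ccontr)
      assume "prob (B n) \<noteq> 0"
      then have pos: "0 < prob (B n)" using zero_less_measure_iff by blast
      obtain m where "- ln (prob (B n)) < (\<Sum>l=n..<m. p l)" using unb by blast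
      then have "exp (- (\<Sum>l=n..<m. p l)) < exp (ln (prob (B n)))" by simp
      then show False using le[of m] pos by simp
    qed
    then show ?thesis using Bm by (simp add: emeasure_eq_measure)
  qed
  then have "AE x in M. \<forall>n. x \<notin> B n" unfolding AE_all_countable by (auto intro!: AE_I'[of "B _"] simp: null_sets_def)
  then show ?thesis
  proof (rule AE_mp, intro AE_I2 impI)
    fix x assume x: "x \<in> space M" "\<forall>n. x \<notin> B n"
    show "\<exists>\<^sub>\<infinity>l. l \<in> L \<and> K l \<le> S l x"
      unfolding INFM_nat_le
    proof
      fix n
      obtain l where "n \<le> l" "l \<in> L" "x \<notin> G l" using x unfolding B_def by auto
      then show "\<exists>l\<ge>n. l \<in> L \<and> K l \<le> S l x" using x unfolding G_def by (intro exI[of _ l]) auto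
    qed
  qed
qed

text \<open>
  The lower half of Cramer's theorem without a change of measure: the contributions of
  \<open>Z\<close> too large or too small to the exponential moment are bounded by nearby exponential moments.
\<close>

lemma (in prob_space) tilted_lower_bound:
  fixes Z :: "'a \<Rightarrow> real"
  assumes Z[measurable]: "Z \<in> borel_measurable M" and bd: "\<And>x. \<bar>Z x\<bar> \<le> B"
    and w: "0 < w" and \<kappa>: "0 < \<kappa>" "\<kappa> < 1"
    and lo: "exp (W * (w\<^sup>2 / 2 - \<eta>)) \<le> expectation (\<lambda>x. exp (w * Z x))"
    and up1: "expectation (\<lambda>x. exp ((w * (1 + \<kappa>)) * Z x)) \<le> exp (W * ((w * (1 + \<kappa>))\<^sup>2 / 2 + \<eta>))"
    and up2: "expectation (\<lambda>x. exp ((w * (1 - \<kappa>)) * Z x)) \<le> exp (W * ((w * (1 - \<kappa>))\<^sup>2 / 2 + \<eta>))"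
    and small: "4 * exp (W * (2 * \<eta> - \<kappa>\<^sup>2 * w\<^sup>2 / 2)) \<le> 1"
  shows "exp (- (W * (w\<^sup>2 / 2 + \<kappa> * w\<^sup>2 + \<eta>))) / 2 \<le> prob {x \<in> space M. (1 - \<kappa>) * w * W \<le> Z x}"
proof -
  let ?D = "{x \<in> space M. (1 - \<kappa>) * w * W \<le> Z x}"
  have D: "?D \<in> events" by measurable
  have int: "integrable M (\<lambda>x. exp (b * Z x))" for b
  proof (rule integrable_const_bound[where B = "exp (\<bar>b\<bar> * B)"])
    have "b * Z x \<le> \<bar>b\<bar> * B" for x
      using mult_left_mono[OF bd[of x], of "\<bar>b\<bar>"] abs_ge_self[of "b * Z x"] by (simp add: abs_mult)
    then show "AE x in M. norm (exp (b * Z x)) \<le> exp (\<bar>b\<bar> * B)" by simp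
  qed measurable
  let ?e1 = "\<kappa> * (1 + \<kappa>) * w\<^sup>2 * W" and ?e2 = "\<kappa> * (1 - \<kappa>) * w\<^sup>2 * W"
  let ?R = "\<lambda>x. exp ((1 + \<kappa>) * w\<^sup>2 * W) * indicator ?D x
      + (exp (- ?e1) * exp ((w * (1 + \<kappa>)) * Z x) + exp ?e2 * exp ((w * (1 - \<kappa>)) * Z x))"
  have "expectation (\<lambda>x. exp (w * Z x)) \<le> expectation ?R"
  proof (rule integral_mono[OF int])
    show "integrable M ?R" using D by (intro Bochner_Integration.integrable_add integrable_mult_right int integrable_real_indicator) (auto simp: emeasure_eq_measure)
    fix x assume x: "x \<in> space M"
    show "exp (w * Z x) \<le> ?R x"
    proof -
      have nn: "0 \<le> exp ((1 + \<kappa>) * w\<^sup>2 * W) * indicator ?D x" "0 \<le> exp (- ?e1) * exp ((w * (1 + \<kappa>)) * Z x)"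
        "0 \<le> exp ?e2 * exp ((w * (1 - \<kappa>)) * Z x)" by simp_all
      \<comment> \<open>The window around \<open>w * W\<close>, the heuristic mean of the tilted
        law. On either side of it a neighbouring exponent dominates.\<close>
      consider "Z x < (1 - \<kappa>) * w * W" | "(1 + \<kappa>) * w * W < Z x" | "x \<in> ?D" "Z x \<le> (1 + \<kappa>) * w * W"
        using x by fastforce
      then show ?thesis
      proof cases
        case 1
        have "\<kappa> * w * Z x \<le> \<kappa> * w * ((1 - \<kappa>) * w * W)" using 1 w \<kappa> by (intro mult_left_mono) auto
        then have "w * Z x \<le> ?e2 + (w * (1 - \<kappa>)) * Z x" by (simp add: algebra_simps power2_eq_square)
        then have "exp (w * Z x) \<le> exp ?e2 * exp ((w * (1 - \<kappa>)) * Z x)" by (simp add: exp_add[symmetric])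
        then show ?thesis using nn by linarith
      next
        case 2
        have "\<kappa> * w * ((1 + \<kappa>) * w * W) \<le> \<kappa> * w * Z x" using 2 w \<kappa> by (intro mult_left_mono) auto
        then have "w * Z x \<le> - ?e1 + (w * (1 + \<kappa>)) * Z x" by (simp add: algebra_simps power2_eq_square)
        then have "exp (w * Z x) \<le> exp (- ?e1) * exp ((w * (1 + \<kappa>)) * Z x)" unfolding exp_add[symmetric] by simp
        then show ?thesis using nn by linarith
      next
        case 3
        have "w * Z x \<le> w * ((1 + \<kappa>) * w * W)" using 3 w by (intro mult_left_mono) auto
        then have "exp (w * Z x) \<le> exp ((1 + \<kappa>) * w\<^sup>2 * W)" by (simp add: algebra_simps power2_eq_square)
        also have "\<dots> = exp ((1 + \<kappa>) * w\<^sup>2 * W) * indicator ?D x" using 3 by simp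
        finally show ?thesis using nn by linarith
      qed
    qed
  qed
  also have "expectation ?R = exp ((1 + \<kappa>) * w\<^sup>2 * W) * prob ?D
      + (exp (- ?e1) * expectation (\<lambda>x. exp ((w * (1 + \<kappa>)) * Z x)) + exp ?e2 * expectation (\<lambda>x. exp ((w * (1 - \<kappa>)) * Z x)))"
    using D int by (simp add: emeasure_eq_measure)
  also have "\<dots> \<le> exp ((1 + \<kappa>) * w\<^sup>2 * W) * prob ?D
      + (exp (- ?e1) * exp (W * ((w * (1 + \<kappa>))\<^sup>2 / 2 + \<eta>)) + exp ?e2 * exp (W * ((w * (1 - \<kappa>))\<^sup>2 / 2 + \<eta>)))"
    using up1 up2 by (intro add_left_mono add_mono mult_left_mono) auto
  \<comment> \<open>Both error terms collapse to the same product: the main lower bound times a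
    factor that \<open>small\<close> makes at most 1/4.\<close>
  also have "exp (- ?e1) * exp (W * ((w * (1 + \<kappa>))\<^sup>2 / 2 + \<eta>)) = exp (W * (w\<^sup>2 / 2 - \<eta>)) * exp (W * (2 * \<eta> - \<kappa>\<^sup>2 * w\<^sup>2 / 2))"
    unfolding exp_add[symmetric] by (simp add: field_simps power2_eq_square)
  also have "exp ?e2 * exp (W * ((w * (1 - \<kappa>))\<^sup>2 / 2 + \<eta>)) = exp (W * (w\<^sup>2 / 2 - \<eta>)) * exp (W * (2 * \<eta> - \<kappa>\<^sup>2 * w\<^sup>2 / 2))"
    unfolding exp_add[symmetric] by (simp add: field_simps power2_eq_square)
  finally have "expectation (\<lambda>x. exp (w * Z x)) \<le> exp ((1 + \<kappa>) * w\<^sup>2 * W) * prob ?D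
      + exp (W * (w\<^sup>2 / 2 - \<eta>)) * (2 * exp (W * (2 * \<eta> - \<kappa>\<^sup>2 * w\<^sup>2 / 2)))" by simp
  also have "exp (W * (w\<^sup>2 / 2 - \<eta>)) * (2 * exp (W * (2 * \<eta> - \<kappa>\<^sup>2 * w\<^sup>2 / 2))) \<le> exp (W * (w\<^sup>2 / 2 - \<eta>)) * (1/2)"
    using small by (intro mult_left_mono) auto
  finally have "exp (W * (w\<^sup>2 / 2 - \<eta>)) / 2 \<le> exp ((1 + \<kappa>) * w\<^sup>2 * W) * prob ?D" using lo by simp
  then have "exp (- ((1 + \<kappa>) * w\<^sup>2 * W)) * (exp (W * (w\<^sup>2 / 2 - \<eta>)) / 2) \<le> exp (- ((1 + \<kappa>) * w\<^sup>2 * W)) * (exp ((1 + \<kappa>) * w\<^sup>2 * W) * prob ?D)"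
    by (rule mult_left_mono) simp
  also have "\<dots> = prob ?D" unfolding mult.assoc[symmetric] exp_add[symmetric] by simp
  also have "exp (- ((1 + \<kappa>) * w\<^sup>2 * W)) * (exp (W * (w\<^sup>2 / 2 - \<eta>)) / 2) = exp (- (W * (w\<^sup>2 / 2 + \<kappa> * w\<^sup>2 + \<eta>))) / 2"
    unfolding times_divide_eq_right exp_add[symmetric] by (simp add: field_simps)
  finally show ?thesis .
qed

text \<open>Both bounds are exponentials of quantities additive in the first two moments, ready to
  be multiplied over a block. The lower one takes the logarithm of the Taylor bound
  \<open>1 + z\<close> by \<open>ln (1 + z) \<ge> z - 2 * z^2\<close>. The condition
  \<open>u \<le> 2/5\<close> keeps |z| at most 1/2, and the square of \<open>z\<close> produces the
  factor 3 at the mean and the correction \<open>2 * u^2\<close> at the variance.\<close>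

lemma (in prob_space) mgf_bounds:
  fixes Y :: "'a \<Rightarrow> real"
  assumes Y[measurable]: "Y \<in> borel_measurable M" and h: "0 \<le> h" and bd: "\<And>x. h * \<bar>Y x\<bar> \<le> u" and u: "u \<le> 2/5"
  defines "m \<equiv> expectation Y" and "V \<equiv> expectation (\<lambda>x. (Y x)\<^sup>2)"
  shows "expectation (\<lambda>x. exp (h * Y x)) \<le> exp (h * \<bar>m\<bar> + h\<^sup>2 / 2 * exp u * V)"
    "exp (h\<^sup>2 / 2 * (exp (- u) - 2 * u\<^sup>2) * V - 3 * (h * \<bar>m\<bar>)) \<le> expectation (\<lambda>x. exp (h * Y x))"
proof -
  have u0: "0 \<le> u" using order_trans[OF mult_nonneg_nonneg[OF h abs_ge_zero] bd] .
  have hY: "\<bar>h * Y x\<bar> \<le> u" for x using bd[of x] h by (simp add: abs_mult)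
  have int1: "integrable M (\<lambda>x. h * Y x)" by (rule integrable_const_bound[of _ u]) (use hY in auto)
  have sq: "(h * Y x)\<^sup>2 \<le> u\<^sup>2" for x using hY[of x] by (intro abs_le_square_iff[THEN iffD1]) (use u0 in simp)
  have int2: "integrable M (\<lambda>x. (h * Y x)\<^sup>2)" by (rule integrable_const_bound[of _ "u\<^sup>2"]) (use sq in auto)
  have inte: "integrable M (\<lambda>x. exp (h * Y x))"
  proof (rule integrable_const_bound[of _ "exp u"])
    have "h * Y x \<le> u" for x using hY[of x] by linarith
    then show "AE x in M. norm (exp (h * Y x)) \<le> exp u" by simp
  qed measurable
  define m' where "m' = h * m"
  define V' where "V' = h\<^sup>2 * V"
  have em: "expectation (\<lambda>x. h * Y x) = m'" unfolding m'_def m_def by simp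
  have eV: "expectation (\<lambda>x. (h * Y x)\<^sup>2) = V'" unfolding V'_def V_def by (simp add: power_mult_distrib)
  have ebound: "expectation (\<lambda>x. 1 + h * Y x + (h * Y x)\<^sup>2 / 2 * b) = 1 + m' + V' / 2 * b" for b
  proof -
    have "expectation (\<lambda>x. 1 + h * Y x + (h * Y x)\<^sup>2 / 2 * b) = expectation (\<lambda>x. 1 + h * Y x) + expectation (\<lambda>x. (b / 2) * (h * Y x)\<^sup>2)"
      using int1 int2 by (subst Bochner_Integration.integral_add[symmetric]) (auto intro!: Bochner_Integration.integral_cong simp: field_simps)
    also have "\<dots> = 1 + m' + (b / 2) * V'"
      using int1 em eV by (simp only: Bochner_Integration.integral_add[OF integrable_const int1] lebesgue_integral_const prob_space integral_mult_right_zero) simp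
    finally show ?thesis by (simp add: field_simps)
  qed
  have ib: "integrable M (\<lambda>x. 1 + h * Y x + (h * Y x)\<^sup>2 / 2 * b)" for b
    using int1 int2 by (intro Bochner_Integration.integrable_add integrable_const integrable_mult_left integrable_divide)
  have "expectation (\<lambda>x. exp (h * Y x)) \<le> 1 + m' + V' / 2 * exp u"
    unfolding ebound[symmetric] by (intro integral_mono inte ib exp_quadratic_bounds(1) hY)
  also have "\<dots> \<le> exp (m' + V' / 2 * exp u)" using exp_ge_add_one_self[of "m' + V' / 2 * exp u"] by linarith
  also have "\<dots> \<le> exp (h * \<bar>m\<bar> + h\<^sup>2 / 2 * exp u * V)"
    unfolding m'_def V'_def using mult_left_mono[OF abs_ge_self[of m] h] by (simp add: mult_ac)
  finally show "expectation (\<lambda>x. exp (h * Y x)) \<le> exp (h * \<bar>m\<bar> + h\<^sup>2 / 2 * exp u * V)" .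
  define z where "z = m' + V' / 2 * exp (- u)"
  have low: "1 + z \<le> expectation (\<lambda>x. exp (h * Y x))"
    unfolding z_def add.assoc[symmetric] ebound[symmetric] by (intro integral_mono inte ib exp_quadratic_bounds(2) hY)
  have mu: "\<bar>m'\<bar> \<le> u"
  proof -
    have "\<bar>m'\<bar> \<le> expectation (\<lambda>x. \<bar>h * Y x\<bar>)" unfolding em[symmetric] by (rule integral_abs_bound)
    also have "\<dots> \<le> expectation (\<lambda>x. u)" using int1 hY by (intro integral_mono) auto
    finally show ?thesis by (simp add: prob_space)
  qed
  have V0: "0 \<le> V'" unfolding eV[symmetric] by simp
  have Vu: "V' \<le> u\<^sup>2"
  proof -
    have "V' \<le> expectation (\<lambda>x. u\<^sup>2)" unfolding eV[symmetric] using int2 sq by (intro integral_mono) auto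
    then show ?thesis by (simp add: prob_space)
  qed
  have u2: "u\<^sup>2 \<le> 4/25" using u u0 power_mono[of u "2/5" 2] by (simp add: power2_eq_square)
  define k where "k = V' / 2 * exp (- u)"
  have k: "0 \<le> k" "k \<le> V' / 2" unfolding k_def using V0 u0 by (auto intro: mult_left_le)
  have z: "\<bar>z\<bar> \<le> 1/2" unfolding z_def k_def[symmetric] using mu u k Vu u2 abs_triangle_ineq[of m' k] by linarith
  have "\<bar>ln (1 + z) - z\<bar> \<le> 2 * z\<^sup>2" by (rule abs_ln_one_plus_x_minus_x_bound[OF z])
  then have l1: "z - 2 * z\<^sup>2 \<le> ln (1 + z)" by (simp add: abs_le_iff)
  have z2: "2 * z\<^sup>2 \<le> 2 * \<bar>m'\<bar> + u\<^sup>2 * V'"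
  proof -
    have "0 \<le> (m' - k)\<^sup>2" by simp
    then have "z\<^sup>2 \<le> 2 * m'\<^sup>2 + 2 * k\<^sup>2" unfolding z_def k_def[symmetric] power2_sum power2_diff by simp
    moreover have "m'\<^sup>2 \<le> u * \<bar>m'\<bar>"
    proof -
      have "m'\<^sup>2 = \<bar>m'\<bar> * \<bar>m'\<bar>" by (simp add: power2_eq_square)
      also have "\<dots> \<le> u * \<bar>m'\<bar>" using mu by (intro mult_right_mono) auto
      finally show ?thesis .
    qed
    moreover have "u * \<bar>m'\<bar> \<le> (1/2) * \<bar>m'\<bar>" using u by (intro mult_right_mono) auto
    moreover have "k\<^sup>2 \<le> u\<^sup>2 * V' / 4"
    proof -
      have "k\<^sup>2 \<le> (V' / 2)\<^sup>2" using k by (intro power_mono) auto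
      also have "\<dots> = V' * V' / 4" by (simp add: power2_eq_square)
      also have "\<dots> \<le> u\<^sup>2 * V' / 4" using Vu V0 by (intro divide_right_mono mult_right_mono) auto
      finally show ?thesis .
    qed
    ultimately show ?thesis by linarith
  qed
  have "h\<^sup>2 / 2 * (exp (- u) - 2 * u\<^sup>2) * V - 3 * (h * \<bar>m\<bar>) = k - u\<^sup>2 * V' - 3 * \<bar>m'\<bar>"
    unfolding k_def V'_def m'_def abs_mult using h by (simp add: field_simps)
  also have "\<dots> \<le> z - 2 * z\<^sup>2"
  proof -
    have "- \<bar>m'\<bar> \<le> m'" by simp
    then show ?thesis using z2 unfolding z_def k_def[symmetric] by linarith
  qed
  also have "\<dots> \<le> ln (1 + z)" by (rule l1)
  finally have "exp (h\<^sup>2 / 2 * (exp (- u) - 2 * u\<^sup>2) * V - 3 * (h * \<bar>m\<bar>)) \<le> exp (ln (1 + z))" by simp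
  also have "\<dots> = 1 + z" using z by (simp add: abs_le_iff)
  also note low
  finally show "exp (h\<^sup>2 / 2 * (exp (- u) - 2 * u\<^sup>2) * V - 3 * (h * \<bar>m\<bar>)) \<le> expectation (\<lambda>x. exp (h * Y x))" .
qed

lemma indep_vars_PiM_coordinates:
  fixes \<mu> :: "nat \<Rightarrow> real measure"
  assumes "\<And>j. real_distribution (\<mu> j)"
  shows "prob_space.indep_vars (PiM UNIV \<mu>) (\<lambda>_. borel :: real measure) (\<lambda>j x. x j) UNIV"
    and "\<And>j. distr (PiM UNIV \<mu>) borel (\<lambda>x. x j) = \<mu> j"
    and "\<And>j. (\<lambda>x. x j) \<in> borel_measurable (PiM UNIV \<mu>)"
proof -
  interpret \<mu>: real_distribution "\<mu> j" for j by (rule assms)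
  interpret pp: product_prob_space \<mu> UNIV
    by (intro product_prob_spaceI) (rule \<mu>.prob_space_axioms)
  have Q: "prob_space (PiM UNIV \<mu>)" by (intro prob_space_PiM \<mu>.prob_space_axioms)
  show rv: "(\<lambda>x. x j) \<in> borel_measurable (PiM UNIV \<mu>)" for j
    using measurable_component_singleton[of j UNIV \<mu>] unfolding measurable_cong_sets[OF refl \<mu>.events_eq_borel] by simp
  show comp: "distr (PiM UNIV \<mu>) borel (\<lambda>x. x j) = \<mu> j" for j
  proof -
    have "distr (PiM UNIV \<mu>) borel (\<lambda>x. x j) = distr (PiM UNIV \<mu>) (\<mu> j) (\<lambda>x. x j)"
      by (intro distr_cong refl) simp
    also have "\<dots> = \<mu> j" by (rule pp.PiM_component) simp
    finally show ?thesis .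
  qed
  have "distr (PiM UNIV \<mu>) (PiM UNIV (\<lambda>i. borel)) (\<lambda>x. \<lambda>i\<in>UNIV. x i) = distr (PiM UNIV \<mu>) (PiM UNIV \<mu>) (\<lambda>x. x)"
    by (intro distr_cong refl) (auto intro!: sets_PiM_cong)
  also have "\<dots> = PiM UNIV \<mu>" by (rule distr_id)
  also have "\<dots> = PiM UNIV (\<lambda>i. distr (PiM UNIV \<mu>) borel (\<lambda>x. x i))" unfolding comp ..
  finally show "prob_space.indep_vars (PiM UNIV \<mu>) (\<lambda>_. borel :: real measure) (\<lambda>j x. x j) UNIV"
    by (subst prob_space.indep_vars_iff_distr_eq_PiM'[OF Q]) (use rv in auto)
qed

section \<open>The lower half\<close>

lemma blip_clamp_square:
  assumes y: "0 \<le> y" shows "blip (\<lambda>x. (clamp y x)\<^sup>2)"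
  unfolding blip_def
proof (intro conjI exI allI)
  show "\<bar>(clamp y x)\<^sup>2\<bar> \<le> y\<^sup>2" for x
    using clamp_abs_le[OF y, of x] by (simp add: abs_le_square_iff[symmetric] y)
  fix x z
  have "\<bar>(clamp y x)\<^sup>2 - (clamp y z)\<^sup>2\<bar> = \<bar>clamp y x + clamp y z\<bar> * \<bar>clamp y x - clamp y z\<bar>"
    unfolding abs_mult[symmetric] by (simp add: power2_eq_square algebra_simps)
  also have "\<dots> \<le> (2 * y) * \<bar>x - z\<bar>"
    using clamp_abs_le[OF y, of x] clamp_abs_le[OF y, of z] clamp_lip[of y x z] y
    by (intro mult_mono) auto
  finally show "\<bar>(clamp y x)\<^sup>2 - (clamp y z)\<^sup>2\<bar> \<le> (2 * y) * \<bar>x - z\<bar>" .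
qed

lemma blip_diff: "blip f \<Longrightarrow> blip g \<Longrightarrow> blip (\<lambda>x. f x - g x)"
proof -
  assume f: "blip f" and g: "blip g"
  obtain B where B: "0 \<le> B" "\<And>x. \<bar>f x\<bar> \<le> B" using blip_bound[OF f] by metis
  obtain L where L: "0 \<le> L" "\<And>x y. \<bar>f x - f y\<bar> \<le> L * \<bar>x - y\<bar>" using blip_lip[OF f] by metis
  obtain B' where B': "0 \<le> B'" "\<And>x. \<bar>g x\<bar> \<le> B'" using blip_bound[OF g] by metis
  obtain L' where L': "0 \<le> L'" "\<And>x y. \<bar>g x - g y\<bar> \<le> L' * \<bar>x - y\<bar>" using blip_lip[OF g] by metis
  have "\<bar>f x - g x\<bar> \<le> B + B'" for x using B(2)[of x] B'(2)[of x] by linarith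
  moreover have "\<bar>(f x - g x) - (f y - g y)\<bar> \<le> (L + L') * \<bar>x - y\<bar>" for x y
    unfolding distrib_right using L(2)[of x y] L'(2)[of x y] by linarith
  ultimately show ?thesis unfolding blip_def by blast
qed

lemma clamp_square_le: "0 \<le> y \<Longrightarrow> (clamp y x)\<^sup>2 \<le> x\<^sup>2"
  unfolding abs_le_square_iff[symmetric] by (auto simp: clamp_def)

lemma powr_two_minus: "0 < (z::real) \<Longrightarrow> z powr (2 - p) * z powr p = z\<^sup>2"
  using powr_add[of z "2 - p" p] powr_numeral[of z "num.Bit0 num.One"] by simp

text \<open>Beyond \<open>b \<ge> 2 * a\<close>, |x| is at most 2(|x| - a), and
  \<open>p \<ge> 2\<close> lets the square of |x| - a be traded for its \<open>p\<close>-th power at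
  the price \<open>a powr (2 - p)\<close>.\<close>

lemma square_le_clamp_tail:
  fixes x a b p :: real
  assumes a: "0 < a" "2 * a \<le> b" and p: "2 \<le> p"
  shows "x\<^sup>2 \<le> (clamp b x)\<^sup>2 + 4 * a powr (2 - p) * max (\<bar>x\<bar> - a) 0 powr p"
proof (cases "\<bar>x\<bar> \<le> b")
  case True
  then show ?thesis using clamp_eq[OF True] by simp
next
  case False
  define z where "z = \<bar>x\<bar> - a"
  have z: "a \<le> z" "\<bar>x\<bar> \<le> 2 * z" using False a by (auto simp: z_def)
  have "x\<^sup>2 \<le> (2 * z)\<^sup>2" using power_mono[OF z(2), of 2] by simp
  also have "\<dots> = 4 * (z powr (2 - p) * z powr p)" using z a powr_two_minus[of z p] by (simp add: power_mult_distrib)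
  also have "\<dots> \<le> 4 * (a powr (2 - p) * z powr p)"
    using z a p by (intro mult_left_mono mult_right_mono powr_mono2') auto
  also have "\<dots> = 4 * a powr (2 - p) * max (\<bar>x\<bar> - a) 0 powr p" using z a unfolding z_def by simp
  finally show ?thesis using zero_le_power2[of "clamp b x"] by linarith
qed

text \<open>\<open>\<mu>_attain\<close> prescribes the second moment truncated at \<open>j\<close>
  times s_n/t_n. The factor \<open>j\<close> eventually exceeds every multiple of \<alpha>, yet the
  condition mentions neither \<alpha> nor \<theta>, so the same laws serve all parameters.\<close>

locale lil_lower = lil_blocks M H E X VV \<theta> \<alpha> p q lam
  for M :: "'a measure" and H :: "('a \<Rightarrow> real) set" and E :: "('a \<Rightarrow> real) \<Rightarrow> ereal"
    and X :: "nat \<Rightarrow> 'a \<Rightarrow> real" and VV :: "'a set \<Rightarrow> real"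
    and \<theta> \<alpha> p q :: real and lam :: "nat \<Rightarrow> real" +
  fixes \<mu> :: "nat \<Rightarrow> real measure"
  assumes \<mu>_rd: "\<And>j. real_distribution (\<mu> j)"
    and \<mu>_dom: "\<And>j f. blip f \<Longrightarrow> (\<integral>u. f u \<partial>\<mu> j) \<le> ER (\<lambda>\<omega>. f (X (Suc j) \<omega>))"
    and \<mu>_attain: "\<And>j. (\<integral>u. (clamp (real j * ss (v (Suc j))) u)\<^sup>2 \<partial>\<mu> j)
      = ER (\<lambda>\<omega>. (clamp (real j * ss (v (Suc j))) (X (Suc j) \<omega>))\<^sup>2)"
begin

lemma \<mu>_integrable: "blip f \<Longrightarrow> integrable (\<mu> j) f"
proof -
  assume f: "blip f"
  interpret real_distribution "\<mu> j" by (rule \<mu>_rd)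
  obtain B where "\<And>x. \<bar>f x\<bar> \<le> B" using blip_bound[OF f] by metis
  then show ?thesis using blip_measurable[OF f] by (intro integrable_const_bound[of _ B]) auto
qed

lemma second_moment_le:
  assumes y: "0 \<le> y" shows "(\<integral>u. (clamp y u)\<^sup>2 \<partial>\<mu> j) \<le> \<sigma>2 j"
proof -
  have "(\<integral>u. (clamp y u)\<^sup>2 \<partial>\<mu> j) \<le> ER (\<lambda>\<omega>. (clamp y (X (Suc j) \<omega>))\<^sup>2)" by (rule \<mu>_dom[OF blip_clamp_square[OF y]])
  also have "\<dots> \<le> \<sigma>2 j" unfolding \<sigma>2_def
    by (intro ER_mono integ_blip[OF blip_clamp_square[OF y] X_H] integ_square clamp_square_le y)
  finally show ?thesis .
qed

text \<open>Two losses with the same bound make the factor 8: from the full second moment to the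
  attained one at \<open>b\<close>, and from \<open>b\<close> to \<open>y\<close>. In the second,
  the difference of the clamped squares is itself a test function, so domination applies to it
  directly.\<close>

lemma second_moment_ge:
  assumes v: "0 < v (Suc j)" and j: "2 * \<alpha> \<le> real j" and y: "2 * (\<alpha> * ss (v (Suc j))) \<le> y"
  shows "\<sigma>2 j - 8 * (\<alpha> * ss (v (Suc j))) powr (2 - p) * \<gamma> \<alpha> p j \<le> (\<integral>u. (clamp y u)\<^sup>2 \<partial>\<mu> j)"
proof -
  define a where "a = \<alpha> * ss (v (Suc j))"
  define b where "b = real j * ss (v (Suc j))"
  have a: "0 < a" unfolding a_def using \<alpha> ss_pos[OF v] by simp
  have "2 * \<alpha> * ss (v (Suc j)) \<le> real j * ss (v (Suc j))" using j ss_nonneg[OF v_nonneg] by (intro mult_right_mono) auto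
  then have b: "2 * a \<le> b" "0 \<le> b" unfolding a_def b_def using ss_nonneg[OF v_nonneg] by (auto simp: mult.assoc)
  have ya: "2 * a \<le> y" "0 \<le> y" using y a unfolding a_def[symmetric] by auto
  let ?r = "\<lambda>x. 4 * a powr (2 - p) * max (\<bar>x\<bar> - a) 0 powr p"
  have ir: "integ (\<lambda>\<omega>. ?r (X (Suc j) \<omega>))" unfolding a_def by (intro integ_scale mom v)
  have er: "ER (\<lambda>\<omega>. ?r (X (Suc j) \<omega>)) = 4 * a powr (2 - p) * \<gamma> \<alpha> p j"
    unfolding \<gamma>_def a_def by (intro ER_scale mom v) simp
  note bb = blip_clamp_square[OF b(2)] and bc = blip_clamp_square[OF ya(2)]
  have "\<sigma>2 j \<le> ER (\<lambda>\<omega>. (clamp b (X (Suc j) \<omega>))\<^sup>2 + ?r (X (Suc j) \<omega>))"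
    unfolding \<sigma>2_def by (intro ER_mono integ_square integ_add integ_blip[OF bb X_H] ir square_le_clamp_tail a b p)
  also have "\<dots> \<le> ER (\<lambda>\<omega>. (clamp b (X (Suc j) \<omega>))\<^sup>2) + ER (\<lambda>\<omega>. ?r (X (Suc j) \<omega>))"
    by (intro ER_add_le integ_blip[OF bb X_H] ir)
  finally have 1: "\<sigma>2 j \<le> (\<integral>u. (clamp b u)\<^sup>2 \<partial>\<mu> j) + 4 * a powr (2 - p) * \<gamma> \<alpha> p j"
    unfolding er using \<mu>_attain[of j] unfolding b_def by simp
  have "(\<integral>u. (clamp b u)\<^sup>2 - (clamp y u)\<^sup>2 \<partial>\<mu> j) \<le> ER (\<lambda>\<omega>. (clamp b (X (Suc j) \<omega>))\<^sup>2 - (clamp y (X (Suc j) \<omega>))\<^sup>2)"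
    by (rule \<mu>_dom[OF blip_diff[OF bb bc]])
  also have "\<dots> \<le> ER (\<lambda>\<omega>. ?r (X (Suc j) \<omega>))"
  proof (intro ER_mono integ_blip[OF blip_diff[OF bb bc] X_H] ir)
    fix \<omega>
    show "(clamp b (X (Suc j) \<omega>))\<^sup>2 - (clamp y (X (Suc j) \<omega>))\<^sup>2 \<le> ?r (X (Suc j) \<omega>)"
      using square_le_clamp_tail[OF a ya(1) p, of "X (Suc j) \<omega>"] clamp_square_le[OF b(2), of "X (Suc j) \<omega>"] by linarith
  qed
  also have "\<dots> = 4 * a powr (2 - p) * \<gamma> \<alpha> p j" by (rule er)
  also have "(\<integral>u. (clamp b u)\<^sup>2 - (clamp y u)\<^sup>2 \<partial>\<mu> j) = (\<integral>u. (clamp b u)\<^sup>2 \<partial>\<mu> j) - (\<integral>u. (clamp y u)\<^sup>2 \<partial>\<mu> j)"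
    by (intro Bochner_Integration.integral_diff \<mu>_integrable bb bc)
  finally show ?thesis using 1 unfolding a_def[symmetric] by simp
qed

text \<open>Domination is used for both signs, since the negative of a test function is a test
  function.\<close>

lemma clamp_mean_abs:
  assumes y: "0 \<le> y" and sg: "\<bar>sg\<bar> = 1"
  shows "\<bar>\<integral>u. sg * clamp y u \<partial>\<mu> j\<bar> \<le> mean_bound j + T y j"
proof -
  have "(\<integral>u. sg * clamp y u \<partial>\<mu> j) \<le> mean_bound j + T y j"
    using \<mu>_dom[OF blip_clamp[OF y, of sg], of j] clamp_mean[OF y sg, of j] by linarith
  moreover have "(\<integral>u. (- sg) * clamp y u \<partial>\<mu> j) \<le> mean_bound j + T y j"
    using \<mu>_dom[OF blip_clamp[OF y, of "- sg"], of j] clamp_mean[OF y, of "- sg" j] sg by simp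
  moreover have "(\<integral>u. (- sg) * clamp y u \<partial>\<mu> j) = - (\<integral>u. sg * clamp y u \<partial>\<mu> j)" by simp
  ultimately show ?thesis by (simp add: abs_le_iff)
qed

definition Q :: "(nat \<Rightarrow> real) measure" where "Q = PiM UNIV \<mu>"

lemma Q_prob: "prob_space Q"
  unfolding Q_def using \<mu>_rd by (intro prob_space_PiM) (simp add: real_distribution_def)

lemma mgf_product:
  fixes b :: real and g :: "nat \<Rightarrow> real \<Rightarrow> real"
  assumes D: "finite D" and g: "\<And>j. g j \<in> borel_measurable borel"
    and bd: "\<And>j x. \<bar>g j x\<bar> \<le> B"
  shows "(\<integral>x. exp (b * (\<Sum>j\<in>D. g j (x j))) \<partial>Q) = (\<Prod>j\<in>D. \<integral>u. exp (b * g j u) \<partial>\<mu> j)"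
proof -
  interpret Q: prob_space Q by (rule Q_prob)
  note co = indep_vars_PiM_coordinates[of \<mu>, OF \<mu>_rd, folded Q_def]
  have "(\<lambda>t :: real. exp (b * t)) \<in> borel_measurable borel" by measurable
  then have meas: "(\<lambda>u. exp (b * g j u)) \<in> borel_measurable borel" for j by (rule measurable_compose[OF g])
  have ind: "Q.indep_vars (\<lambda>_. borel) (\<lambda>j x. exp (b * g j (x j))) D"
    using Q.indep_vars_compose2[OF Q.indep_vars_subset[OF co(1) subset_UNIV], of D "\<lambda>j u. exp (b * g j u)" "\<lambda>_. borel"] meas by simp
  have int: "integrable Q (\<lambda>x. exp (b * g j (x j)))" for j
  proof (rule Q.integrable_const_bound[of _ "exp (\<bar>b\<bar> * B)"])
    have "b * g j u \<le> \<bar>b\<bar> * B" for u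
      using mult_left_mono[OF bd[of j u], of "\<bar>b\<bar>"] abs_ge_self[of "b * g j u"] by (simp add: abs_mult)
    then show "AE x in Q. norm (exp (b * g j (x j))) \<le> exp (\<bar>b\<bar> * B)" by simp
    show "(\<lambda>x. exp (b * g j (x j))) \<in> borel_measurable Q" by (rule measurable_compose[OF co(3) meas])
  qed
  have "(\<integral>x. exp (b * (\<Sum>j\<in>D. g j (x j))) \<partial>Q) = (\<integral>x. (\<Prod>j\<in>D. exp (b * g j (x j))) \<partial>Q)"
    using D by (simp add: exp_sum sum_distrib_left)
  also have "\<dots> = (\<Prod>j\<in>D. \<integral>x. exp (b * g j (x j)) \<partial>Q)"
    by (rule Q.indep_vars_lebesgue_integral[OF D ind]) (rule int)
  also have "\<dots> = (\<Prod>j\<in>D. \<integral>u. exp (b * g j u) \<partial>\<mu> j)"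
  proof (rule prod.cong)
    fix j
    have "(\<integral>u. exp (b * g j u) \<partial>\<mu> j) = (\<integral>u. exp (b * g j u) \<partial>distr Q borel (\<lambda>x. x j))" unfolding co(2) ..
    also have "\<dots> = (\<integral>x. exp (b * g j (x j)) \<partial>Q)" by (rule integral_distr[OF co(3) meas])
    finally show "(\<integral>x. exp (b * g j (x j)) \<partial>Q) = (\<integral>u. exp (b * g j u) \<partial>\<mu> j)" ..
  qed simp
  finally show ?thesis .
qed

text \<open>Evaluated at the true last index of the level, unlike \<open>tt\<close> and
  \<open>A\<close>, which refer to \<theta>^l; this makes the last two identities in
  \<open>inhab_scale\<close> exact.\<close>

definition W :: "nat \<Rightarrow> real" where "W l = 2 * LL (v (NN l))"

definition a :: "nat \<Rightarrow> real" where "a l = aa (v (NN l))"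

text \<open>
  The blocks reach back two levels: the variance before level \<open>l - 1\<close> is below $\theta^{l-1}$,
  hence a small fraction of the variance up to an inhabited level \<open>l\<close>, whereas consecutive
  levels need not be separated at all. Blocks of levels of equal parity are disjoint.
\<close>

definition D :: "nat \<Rightarrow> nat set" where "D l = {NN (l - 2)..<NN l}"

lemma inhab_v_pos: "inhab l \<Longrightarrow> 0 < v (NN l)"
  unfolding inhab_def using \<theta>_pow_pos[of l] by linarith

lemma inhab_scale:
  assumes l: "inhab l"
  shows "0 < a l" "A l \<le> a l" "tt l \<le> W l" "W l \<le> \<theta> * tt l" "(W l / a l)\<^sup>2 * v (NN l) = W l" "W l / a l * c l = \<alpha>"
proof -
  have le: "\<theta> ^ l \<le> v (NN l)" using l by (simp add: inhab_def)
  note v = inhab_v_pos[OF l]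
  show a: "0 < a l" unfolding a_def by (rule aa_pos[OF v])
  show "A l \<le> a l" unfolding a_def A_def using le \<theta>_pow_pos[of l] by (intro aa_mono) auto
  show "tt l \<le> W l" unfolding tt_def W_def using LL_mono[OF le] by simp
  have "LL (v (NN l)) \<le> LL (\<theta> * \<theta> ^ l)" using v_N_less[OF \<theta>, of l] by (intro LL_mono) auto
  also have "\<dots> \<le> \<theta> * LL (\<theta> ^ l)" using \<theta> by (intro LL_mult_le) auto
  finally show "W l \<le> \<theta> * tt l" unfolding tt_def W_def by simp
  have W: "0 < W l" unfolding W_def using LL_pos[of "v (NN l)"] by simp
  have s: "0 < ss (v (NN l))" by (rule ss_pos[OF v])
  have as: "a l = ss (v (NN l)) * W l" unfolding a_def W_def by (rule aa_eq_ss)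
  show "W l / a l * c l = \<alpha>" unfolding as c_def using W s by simp
  have "a l * a l = v (NN l) * W l"
  proof -
    have "sqrt (v (NN l)) * sqrt (v (NN l)) = v (NN l)" "sqrt (W l) * sqrt (W l) = W l" using v W by simp_all
    then show ?thesis unfolding a_def aa_def W_def[symmetric] by (simp only: mult_ac) (metis mult.commute mult.left_commute)
  qed
  then have "(W l / a l)\<^sup>2 * v (NN l) = W l * (v (NN l) * W l) / (v (NN l) * W l)" unfolding power2_eq_square by simp
  then show "(W l / a l)\<^sup>2 * v (NN l) = W l" using v W by simp
qed

text \<open>One \<open>1 / \<theta>\<close> is the variance before the block, which is below
  \<open>\<theta> ^ (l - 1)\<close>; the other is the truncation loss. On a good level that loss is
  at most a constant times \<open>\<theta> ^ l / tt l\<close>, hence below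
  \<open>\<theta> ^ l / \<theta>\<close> once \<open>tt l\<close> is large.\<close>

lemma block_variance:
  shows "\<exists>L. \<forall>l\<ge>L. good l \<longrightarrow> (1 - 2 / \<theta>) * v (NN l) \<le> (\<Sum>j\<in>D l. \<integral>u. (clamp (2 * c l) u)\<^sup>2 \<partial>\<mu> j)"
proof -
  define C where "C = 8 * (\<alpha> / \<theta>) powr (2 - p)"
  obtain L1 where L1: "\<And>l. L1 \<le> l \<Longrightarrow> C * \<theta> \<le> tt l" using tt_unbounded by blast
  obtain L2 where L2: "\<And>l. L2 \<le> l \<Longrightarrow> nat \<lceil>2 * \<alpha>\<rceil> \<le> NN l" using NN_unbounded by blast
  show ?thesis
  \<comment> \<open>The block starts two levels back, so its indices are large from
    \<open>L2 + 2\<close> on; then the factor \<open>j\<close> of the attained truncation is at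
    least \<open>2 * \<alpha>\<close>.\<close>
  proof (intro exI[of _ "max L1 (L2 + 2)"] allI impI)
    fix l assume "max L1 (L2 + 2) \<le> l" and g: "good l"
    then have l: "L1 \<le> l" "L2 \<le> l - 2" "2 \<le> l" by auto
    note inh = good_inhab[OF g]
    define s where "s = ss (\<theta> ^ l)"
    have s: "0 < s" unfolding s_def by (intro ss_pos \<theta>_pow_pos)
    have t: "0 < tt l" using tt_ge[of l] by linarith
    have pl: "\<theta> * \<theta> ^ (l - 1) = \<theta> ^ l" using l(3) by (simp add: power_eq_if)
    have Sl: "Suc (l - 2) = l - 1" using l(3) by simp
    have vge: "\<theta> ^ (l - 1) \<le> v (Suc j)" if "j \<in> D l" for j
      using N_iff[OF \<theta>, of "Suc j" "l - 2"] that unfolding D_def Sl by auto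
    have vpos: "0 < v (Suc j)" if "j \<in> D l" for j using vge[OF that] \<theta>_pow_pos[of "l - 1"] by linarith
    have sge: "\<alpha> * (s / \<theta>) \<le> \<alpha> * ss (v (Suc j))" if j: "j \<in> D l" for j
    proof -
      have "s \<le> \<theta> * ss (\<theta> ^ (l - 1))" unfolding s_def pl[symmetric] using \<theta> by (intro ss_mult_le) auto
      also have "\<dots> \<le> \<theta> * ss (v (Suc j))" using \<theta> by (intro mult_left_mono ss_mono \<theta>_pow_pos vge j) auto
      finally show ?thesis using \<theta> \<alpha> by (simp add: field_simps)
    qed
    have g0: "0 \<le> \<gamma> \<alpha> p j" if "0 < v (Suc j)" for j by (rule \<gamma>_nonneg[OF mom[OF that]])
    have each: "\<sigma>2 j - 8 * (\<alpha> * (s / \<theta>)) powr (2 - p) * \<gamma> \<alpha> p j \<le> (\<integral>u. (clamp (2 * c l) u)\<^sup>2 \<partial>\<mu> j)" if j: "j \<in> D l" for j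
    proof -
      have "real (nat \<lceil>2 * \<alpha>\<rceil>) \<le> real j" using L2[OF l(2)] j unfolding D_def by auto
      then have ja: "2 * \<alpha> \<le> real j" by linarith
      have "\<alpha> * ss (v (Suc j)) \<le> c l" using j unfolding D_def by (intro threshold_le_c vpos[OF j]) auto
      then have "\<sigma>2 j - 8 * (\<alpha> * ss (v (Suc j))) powr (2 - p) * \<gamma> \<alpha> p j \<le> (\<integral>u. (clamp (2 * c l) u)\<^sup>2 \<partial>\<mu> j)"
        by (intro second_moment_ge vpos j ja) auto
      moreover have "(\<alpha> * ss (v (Suc j))) powr (2 - p) \<le> (\<alpha> * (s / \<theta>)) powr (2 - p)"
        using sge[OF j] s \<alpha> \<theta> p by (intro powr_mono2') auto
      then have "8 * (\<alpha> * ss (v (Suc j))) powr (2 - p) * \<gamma> \<alpha> p j \<le> 8 * (\<alpha> * (s / \<theta>)) powr (2 - p) * \<gamma> \<alpha> p j"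
        using g0[OF vpos[OF j]] by (intro mult_right_mono mult_left_mono) auto
      ultimately show ?thesis by linarith
    qed
    have "(\<Sum>j\<in>D l. \<sigma>2 j) - 8 * (\<alpha> * (s / \<theta>)) powr (2 - p) * (\<Sum>j\<in>D l. \<gamma> \<alpha> p j) \<le> (\<Sum>j\<in>D l. \<integral>u. (clamp (2 * c l) u)\<^sup>2 \<partial>\<mu> j)"
      unfolding sum_distrib_left sum_subtractf[symmetric] by (intro sum_mono each)
    moreover have "(\<Sum>j\<in>D l. \<sigma>2 j) \<ge> v (NN l) - v (NN l) / \<theta>"
    proof -
      have "v (NN l) = v (NN (l - 2)) + (\<Sum>j\<in>D l. \<sigma>2 j)"
        unfolding v_def D_def using N_mono[OF \<theta>, of "l - 2" l] by (simp add: lessThan_atLeast0 sum.atLeastLessThan_concat)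
      moreover have "v (NN (l - 2)) \<le> v (NN l) / \<theta>"
      proof -
        have "v (NN (l - 2)) < \<theta> ^ (l - 1)" using v_N_less[OF \<theta>, of "l - 2"] unfolding Sl .
        moreover have "\<theta> * \<theta> ^ (l - 1) \<le> v (NN l)" unfolding pl using inh by (simp add: inhab_def)
        moreover have "\<theta> * v (NN (l - 2)) \<le> \<theta> * \<theta> ^ (l - 1)" using \<theta> calculation(1) by (intro mult_left_mono) auto
        ultimately have "\<theta> * v (NN (l - 2)) \<le> v (NN l)" by linarith
        then show ?thesis using \<theta> by (simp add: pos_le_divide_eq mult.commute)
      qed
      ultimately show ?thesis by linarith
    qed
    moreover have "8 * (\<alpha> * (s / \<theta>)) powr (2 - p) * (\<Sum>j\<in>D l. \<gamma> \<alpha> p j) \<le> v (NN l) / \<theta>"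
    proof -
      have "(\<Sum>j\<in>D l. \<gamma> \<alpha> p j) = (\<Sum>j\<in>D l. if 0 < v (Suc j) then \<gamma> \<alpha> p j else 0)"
        using vpos by (intro sum.cong) auto
      also have "\<dots> \<le> U \<alpha> p (NN l)" unfolding U_def D_def using g0 by (intro sum_mono2) auto
      also have "\<dots> \<le> lam l * A l powr p" using U_le unfolding A_def .
      finally have gU: "(\<Sum>j\<in>D l. \<gamma> \<alpha> p j) \<le> lam l * A l powr p" .
      have Keq: "8 * (\<alpha> * (s / \<theta>)) powr (2 - p) = C * s powr (2 - p)"
        unfolding C_def using \<alpha> s \<theta> powr_mult[of "\<alpha> / \<theta>" s "2 - p"] by (simp add: mult_ac)
      have "C * s powr (2 - p) * (\<Sum>j\<in>D l. \<gamma> \<alpha> p j) \<le> C * s powr (2 - p) * (lam l * A l powr p)"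
        using gU unfolding C_def by (intro mult_left_mono) auto
      also have "C * s powr (2 - p) * (lam l * A l powr p) = C * (s powr (2 - p) * s powr p) * (lam l * tt l powr p)"
        unfolding A_eq_ss s_def[symmetric] using s t by (simp add: powr_mult)
      also have "s powr (2 - p) * s powr p = s\<^sup>2" by (rule powr_two_minus[OF s])
      also have "C * s\<^sup>2 * (lam l * tt l powr p) \<le> C * s\<^sup>2 * 1"
        unfolding C_def by (intro mult_left_mono good_lam(1) g) auto
      also have "s\<^sup>2 = \<theta> ^ l / tt l"
        using A_square[of l] t unfolding A_eq_ss s_def[symmetric] by (simp add: power2_eq_square field_simps)
      also have "C * (\<theta> ^ l / tt l) * 1 \<le> \<theta> ^ l / \<theta>"
        using L1[OF l(1)] t \<theta> by (simp add: field_simps)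
      also have "\<dots> \<le> v (NN l) / \<theta>" using inh \<theta> unfolding inhab_def by (intro divide_right_mono) auto
      finally show ?thesis unfolding Keq .
    qed
    ultimately have "v (NN l) - v (NN l) / \<theta> - v (NN l) / \<theta> \<le> (\<Sum>j\<in>D l. \<integral>u. (clamp (2 * c l) u)\<^sup>2 \<partial>\<mu> j)" by linarith
    then show "(1 - 2 / \<theta>) * v (NN l) \<le> (\<Sum>j\<in>D l. \<integral>u. (clamp (2 * c l) u)\<^sup>2 \<partial>\<mu> j)" by (simp add: algebra_simps)
  qed
qed

text \<open>The clamped means sum to at most the drift plus the mean lost by truncation, both of
  smaller order than \<open>a l\<close>.\<close>

lemma block_mean:
  assumes \<eta>: "0 < \<eta>" and sg: "\<bar>sg\<bar> = 1"
  shows "\<exists>L. \<forall>l\<ge>L. good l \<longrightarrow> W l / a l * (\<Sum>j\<in>D l. \<bar>\<integral>u. sg * clamp (2 * c l) u \<partial>\<mu> j\<bar>) \<le> \<eta> * W l"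
proof -
  obtain L1 where L1: "\<And>l. L1 \<le> l \<Longrightarrow> drift (NN l) \<le> \<eta> / 2 * A l" using drift_le[of "\<eta> / 2"] \<eta> by auto
  obtain L2 where L2: "\<And>l. L2 \<le> l \<Longrightarrow> \<theta> * \<alpha> powr (1 - p) / (\<eta> / 2) \<le> tt l" using tt_unbounded by blast
  show ?thesis
  proof (intro exI[of _ "max L1 L2"] allI impI)
    fix l assume "max L1 L2 \<le> l" and g: "good l"
    then have l: "L1 \<le> l" "L2 \<le> l" by auto
    note inh = good_inhab[OF g]
    note sc = inhab_scale[OF inh]
    have W: "0 < W l" using sc(3) tt_ge[of l] by linarith
    have t: "0 < tt l" using tt_ge[of l] by linarith
    have "(\<Sum>j\<in>D l. \<bar>\<integral>u. sg * clamp (2 * c l) u \<partial>\<mu> j\<bar>) \<le> (\<Sum>j\<in>D l. mean_bound j + T (2 * c l) j)"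
      using c_bounds(3)[OF inh] by (intro sum_mono clamp_mean_abs sg) auto
    also have "\<dots> \<le> (\<Sum>j<NN l. mean_bound j + T (2 * c l) j)"
      unfolding D_def using T_nonneg[of "2 * c l"] c_bounds(3)[OF inh]
      by (intro sum_mono2) (auto simp: mean_bound_def intro!: add_nonneg_nonneg)
    also have "\<dots> = drift (NN l) + (\<Sum>j<NN l. T (2 * c l) j)" by (simp add: sum.distrib sum_mean_bound)
    also have "\<dots> \<le> \<eta> / 2 * A l + \<alpha> powr (1 - p) * (A l / tt l)" by (intro add_mono L1 l good_sum_T g)
    also have "\<dots> \<le> \<eta> / 2 * a l + \<alpha> powr (1 - p) * (a l / tt l)"
      using sc(2) \<eta> t by (intro add_mono mult_left_mono divide_right_mono) auto
    finally have "W l / a l * (\<Sum>j\<in>D l. \<bar>\<integral>u. sg * clamp (2 * c l) u \<partial>\<mu> j\<bar>)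
        \<le> W l / a l * (\<eta> / 2 * a l + \<alpha> powr (1 - p) * (a l / tt l))"
      using W sc(1) by (intro mult_left_mono) auto
    also have "\<dots> = \<eta> / 2 * W l + \<alpha> powr (1 - p) * (W l / tt l)" using sc(1) by (simp add: field_simps)
    also have "\<dots> \<le> \<eta> / 2 * W l + \<alpha> powr (1 - p) * \<theta>"
      using sc(4) t by (intro add_left_mono mult_left_mono) (auto simp: pos_divide_le_eq)
    also have "\<dots> \<le> \<eta> / 2 * W l + \<eta> / 2 * W l"
    proof -
      have "\<theta> * \<alpha> powr (1 - p) \<le> \<eta> / 2 * tt l" using L2[OF l(2)] \<eta> by (simp add: field_simps)
      also have "\<dots> \<le> \<eta> / 2 * W l" using sc(3) \<eta> by (intro mult_left_mono) auto
      finally show ?thesis by (simp add: mult.commute)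
    qed
    finally show "W l / a l * (\<Sum>j\<in>D l. \<bar>\<integral>u. sg * clamp (2 * c l) u \<partial>\<mu> j\<bar>) \<le> \<eta> * W l" by simp
  qed
qed

end

lemma logp_le_Suc_ln: "1 \<le> y \<Longrightarrow> logp y \<le> 1 + ln y"
proof -
  assume y: "1 \<le> y"
  have "max (exp 1) y \<le> exp 1 * y"
    using y mult_mono[of 1 "exp 1" y y] by (intro max.boundedI) auto
  then have "logp y \<le> ln (exp 1 * y)" unfolding logp_def by (intro ln_mono) (auto simp: less_max_iff_disj)
  then show ?thesis using y by (simp add: ln_mult)
qed

context lil_lower
begin

text \<open>Cramer's lower bound at \<open>w = 1 - 2 * \<kappa>\<close>: the exponent
  \<open>W * (w^2 / 2 + \<kappa> * w^2 + \<eta>0)\<close> stays below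
  \<open>(1 - \<kappa>) * LL\<close>, a rate slow enough for divergence. A1 and A2 keep the errors
  from truncation and from the variance left out small against \<open>\<kappa>^2\<close>.\<close>

lemma block_probability:
  assumes \<kappa>: "0 < \<kappa>" "\<kappa> \<le> 1/4" and sg: "\<bar>sg\<bar> = 1"
    and A1: "4 * (exp (4 * \<alpha>) - 1) \<le> \<kappa>\<^sup>2 / 32"
    and A2: "4 * (1 - (1 - 2 / \<theta>) * (exp (- (4 * \<alpha>)) - 2 * (4 * \<alpha>)\<^sup>2)) \<le> \<kappa>\<^sup>2 / 32"
    and A3: "0 \<le> exp (- (4 * \<alpha>)) - 2 * (4 * \<alpha>)\<^sup>2" and A4: "4 * \<alpha> \<le> 2/5"
  shows "\<exists>L. \<forall>l\<ge>L. good l \<longrightarrow> exp (- ((1 - \<kappa>) * LL (v (NN l)))) / 2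
    \<le> measure Q {x \<in> space Q. (1 - \<kappa>) * (1 - 2 * \<kappa>) * W l \<le> W l / a l * (\<Sum>j\<in>D l. sg * clamp (2 * c l) (x j))}"
proof -
  \<comment> \<open>With \<open>w \<ge> 1/2\<close> this budget gives
    \<open>2 * \<eta>0 - \<kappa>^2 * w^2 / 2 \<le> - \<kappa>^2 / 16\<close>, as the tilted bound
    needs for large \<open>W l\<close>. The means receive \<open>\<eta> = \<eta>0 / 12\<close>, so
    that \<open>6 * \<eta>\<close> is half of it.\<close>
  define \<eta>0 where "\<eta>0 = \<kappa>\<^sup>2 / 32"
  define \<eta> where "\<eta> = \<eta>0 / 12"
  have \<eta>0: "0 < \<eta>0" unfolding \<eta>0_def using \<kappa> by simp
  then have \<eta>: "0 < \<eta>" unfolding \<eta>_def by simp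
  obtain L1 where L1: "\<And>l. L1 \<le> l \<Longrightarrow> good l \<Longrightarrow> W l / a l * (\<Sum>j\<in>D l. \<bar>\<integral>u. sg * clamp (2 * c l) u \<partial>\<mu> j\<bar>) \<le> \<eta> * W l"
    using block_mean[OF \<eta> sg] by blast
  obtain L2 where L2: "\<And>l. L2 \<le> l \<Longrightarrow> good l \<Longrightarrow> (1 - 2 / \<theta>) * v (NN l) \<le> (\<Sum>j\<in>D l. \<integral>u. (clamp (2 * c l) u)\<^sup>2 \<partial>\<mu> j)"
    using block_variance by blast
  obtain L3 where L3: "\<And>l. L3 \<le> l \<Longrightarrow> ln 4 * 16 / \<kappa>\<^sup>2 \<le> tt l" using tt_unbounded by blast
  show ?thesis
  proof (intro exI[of _ "max (max L1 L2) L3"] allI impI)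
    fix l assume "max (max L1 L2) L3 \<le> l" and g: "good l"
    then have l: "L1 \<le> l" "L2 \<le> l" "L3 \<le> l" by auto
    note inh = good_inhab[OF g]
    note sc = inhab_scale[OF inh]
    interpret Q: prob_space Q by (rule Q_prob)
    note co = indep_vars_PiM_coordinates[of \<mu>, OF \<mu>_rd, folded Q_def]
    define h where "h = W l / a l"
    have Wp: "0 < W l" using sc(3) tt_ge[of l] by linarith
    have h: "0 < h" unfolding h_def using Wp sc(1) by simp
    define y where "y = 2 * c l"
    have y: "0 \<le> y" unfolding y_def using c_bounds(3)[OF inh] by simp
    define f where "f u = sg * clamp y u" for u
    have bf: "blip f" unfolding f_def by (rule blip_clamp[OF y])
    have fm: "f \<in> borel_measurable borel" by (rule blip_measurable[OF bf])
    have fb: "\<bar>f u\<bar> \<le> y" for u unfolding f_def abs_mult sg using clamp_abs_le[OF y] by simp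
    have f2: "(f u)\<^sup>2 = (clamp y u)\<^sup>2" for u
    proof -
      have "sg\<^sup>2 = 1" using sg by (metis power2_abs power_one)
      then show ?thesis unfolding f_def power_mult_distrib by simp
    qed
    define Mn where "Mn = (\<Sum>j\<in>D l. \<bar>\<integral>u. f u \<partial>\<mu> j\<bar>)"
    have Mn0: "0 \<le> h * Mn" unfolding Mn_def using h by (intro mult_nonneg_nonneg sum_nonneg) auto
    define k where "k = 1 - 2 / \<theta>"
    define Vs where "Vs = (\<Sum>j\<in>D l. \<integral>u. (f u)\<^sup>2 \<partial>\<mu> j)"
    have Mn: "h * Mn \<le> \<eta> * W l" unfolding h_def Mn_def f_def y_def using L1[OF l(1) g] .
    have Vs1: "(1 - 2 / \<theta>) * v (NN l) \<le> Vs" unfolding Vs_def f2 y_def using L2[OF l(2) g] .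
    have Vs2: "Vs \<le> v (NN l)"
    proof -
      have "Vs \<le> (\<Sum>j\<in>D l. \<sigma>2 j)" unfolding Vs_def f2 by (intro sum_mono second_moment_le y)
      also have "\<dots> \<le> v (NN l)" unfolding v_def D_def using \<sigma>2_nonneg by (intro sum_mono2) auto
      finally show ?thesis .
    qed
    have hv: "h\<^sup>2 * v (NN l) = W l" unfolding h_def by (rule sc(5))
    have finD: "finite (D l)" unfolding D_def by simp
    define Z where "Z x = h * (\<Sum>j\<in>D l. f (x j))" for x :: "nat \<Rightarrow> real"
    \<comment> \<open>Tilts \<open>w\<close> up to 2 occur and the clamp is at
      \<open>2 * c l\<close>; as \<open>h * c l = \<alpha>\<close>, the exponent per variable is at
      most \<open>4 * \<alpha>\<close>.\<close>
    define u where "u = 4 * \<alpha>"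
    define e where "e = exp (- u) - 2 * u\<^sup>2"
    have e: "0 \<le> e" unfolding e_def u_def by (rule A3)
    have mgf: "(\<integral>x. exp (w * Z x) \<partial>Q) = (\<Prod>j\<in>D l. \<integral>t. exp ((w * h) * f t) \<partial>\<mu> j)" for w
      using mgf_product[OF finD fm fb, of "w * h"] unfolding Z_def by (simp add: mult.assoc)
    have hu: "(w * h) * \<bar>f t\<bar> \<le> u" if "0 \<le> w" "w \<le> 2" for w t
    proof -
      have "(w * h) * \<bar>f t\<bar> \<le> (2 * h) * y" using that h fb[of t] by (intro mult_mono) auto
      also have "\<dots> = u" using sc(6) unfolding h_def y_def u_def by simp
      finally show ?thesis .
    qed
    have up: "(\<integral>x. exp (w * Z x) \<partial>Q) \<le> exp (W l * (w\<^sup>2 / 2 + \<eta>0))" if w: "0 \<le> w" "w \<le> 2" for w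
    proof -
      have w2: "w\<^sup>2 / 2 \<le> 2" using power_mono[OF w(2) w(1), of 2] by simp
      have "(\<Prod>j\<in>D l. \<integral>t. exp ((w * h) * f t) \<partial>\<mu> j) \<le> (\<Prod>j\<in>D l. exp ((w * h) * \<bar>\<integral>t. f t \<partial>\<mu> j\<bar> + (w * h)\<^sup>2 / 2 * exp u * (\<integral>t. (f t)\<^sup>2 \<partial>\<mu> j)))"
      proof (rule prod_mono)
        fix j assume "j \<in> D l"
        interpret \<mu>: real_distribution "\<mu> j" by (rule \<mu>_rd)
        show "0 \<le> (\<integral>t. exp ((w * h) * f t) \<partial>\<mu> j) \<and> (\<integral>t. exp ((w * h) * f t) \<partial>\<mu> j) \<le> exp ((w * h) * \<bar>\<integral>t. f t \<partial>\<mu> j\<bar> + (w * h)\<^sup>2 / 2 * exp u * (\<integral>t. (f t)\<^sup>2 \<partial>\<mu> j))"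
          using \<mu>.mgf_bounds(1)[of f "w * h" u] fm w h hu[OF w] A4 unfolding u_def by simp
      qed
      also have "\<dots> = exp (w * (h * Mn) + (w * h)\<^sup>2 / 2 * exp u * Vs)"
        unfolding Mn_def Vs_def using finD by (simp add: exp_sum[symmetric] sum.distrib sum_distrib_left mult.assoc)
      also have "\<dots> \<le> exp (2 * (\<eta> * W l) + (w * h)\<^sup>2 / 2 * exp u * v (NN l))"
      proof -
        have "w * (h * Mn) \<le> 2 * (\<eta> * W l)" using Mn0 by (intro mult_mono[OF w(2) Mn]) auto
        moreover have "(w * h)\<^sup>2 / 2 * exp u * Vs \<le> (w * h)\<^sup>2 / 2 * exp u * v (NN l)" using Vs2 by (intro mult_left_mono) auto
        ultimately show ?thesis by simp
      qed
      also have "(w * h)\<^sup>2 / 2 * exp u * v (NN l) = w\<^sup>2 / 2 * exp u * W l" unfolding hv[symmetric] by (simp add: power_mult_distrib)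
      also have "2 * (\<eta> * W l) + w\<^sup>2 / 2 * exp u * W l \<le> W l * (w\<^sup>2 / 2 + \<eta>0)"
      proof -
        have "w\<^sup>2 / 2 * (exp u - 1) \<le> 2 * (\<eta>0 / 4)"
          using w2 A1 unfolding u_def \<eta>0_def[symmetric] using \<alpha> \<eta>0 by (intro mult_mono) auto
        then have "2 * \<eta> + w\<^sup>2 / 2 * exp u \<le> w\<^sup>2 / 2 + \<eta>0" unfolding \<eta>_def using \<eta>0 by (simp add: algebra_simps)
        then have "W l * (2 * \<eta> + w\<^sup>2 / 2 * exp u) \<le> W l * (w\<^sup>2 / 2 + \<eta>0)" using Wp by (intro mult_left_mono) auto
        then show ?thesis by (simp add: algebra_simps)
      qed
      finally show ?thesis unfolding mgf by simp
    qed
    have lo: "exp (W l * (w\<^sup>2 / 2 - \<eta>0)) \<le> (\<integral>x. exp (w * Z x) \<partial>Q)" if w: "0 \<le> w" "w \<le> 2" for w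
    proof -
      have w2: "w\<^sup>2 / 2 \<le> 2" using power_mono[OF w(2) w(1), of 2] by simp
      have "w\<^sup>2 / 2 * (1 - k * e) \<le> w\<^sup>2 / 2 * (\<eta>0 / 4)"
        using A2 unfolding k_def[symmetric] u_def[symmetric] e_def[symmetric] \<eta>0_def[symmetric] by (intro mult_left_mono) auto
      also have "\<dots> \<le> 2 * (\<eta>0 / 4)" using w2 \<eta>0 by (intro mult_right_mono) auto
      finally have "w\<^sup>2 / 2 - \<eta>0 \<le> w\<^sup>2 / 2 * (k * e) - 6 * \<eta>" unfolding \<eta>_def by (simp add: field_simps)
      then have "W l * (w\<^sup>2 / 2 - \<eta>0) \<le> W l * (w\<^sup>2 / 2 * (k * e) - 6 * \<eta>)" using Wp by (intro mult_left_mono) auto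
      also have "\<dots> = (w * h)\<^sup>2 / 2 * e * (k * v (NN l)) - 3 * (2 * (\<eta> * W l))"
        unfolding hv[symmetric] by (simp add: power_mult_distrib field_simps)
      also have "\<dots> \<le> (w * h)\<^sup>2 / 2 * e * Vs - 3 * (w * (h * Mn))"
      proof -
        have "w * (h * Mn) \<le> 2 * (\<eta> * W l)" using Mn0 by (intro mult_mono[OF w(2) Mn]) auto
        moreover have "(w * h)\<^sup>2 / 2 * e * (k * v (NN l)) \<le> (w * h)\<^sup>2 / 2 * e * Vs" using Vs1[folded k_def] e by (intro mult_left_mono) auto
        ultimately show ?thesis by linarith
      qed
      finally have "exp (W l * (w\<^sup>2 / 2 - \<eta>0)) \<le> exp ((w * h)\<^sup>2 / 2 * e * Vs - 3 * (w * (h * Mn)))" by simp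
      also have "\<dots> = (\<Prod>j\<in>D l. exp ((w * h)\<^sup>2 / 2 * e * (\<integral>t. (f t)\<^sup>2 \<partial>\<mu> j) - 3 * ((w * h) * \<bar>\<integral>t. f t \<partial>\<mu> j\<bar>)))"
        unfolding Mn_def Vs_def using finD by (simp add: exp_sum[symmetric] sum_subtractf sum_distrib_left mult.assoc)
      also have "\<dots> \<le> (\<Prod>j\<in>D l. \<integral>t. exp ((w * h) * f t) \<partial>\<mu> j)"
      proof (rule prod_mono)
        fix j assume "j \<in> D l"
        interpret \<mu>: real_distribution "\<mu> j" by (rule \<mu>_rd)
        show "0 \<le> exp ((w * h)\<^sup>2 / 2 * e * (\<integral>t. (f t)\<^sup>2 \<partial>\<mu> j) - 3 * ((w * h) * \<bar>\<integral>t. f t \<partial>\<mu> j\<bar>))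
          \<and> exp ((w * h)\<^sup>2 / 2 * e * (\<integral>t. (f t)\<^sup>2 \<partial>\<mu> j) - 3 * ((w * h) * \<bar>\<integral>t. f t \<partial>\<mu> j\<bar>)) \<le> (\<integral>t. exp ((w * h) * f t) \<partial>\<mu> j)"
          using \<mu>.mgf_bounds(2)[of f "w * h" u] fm w h hu[OF w] A4 unfolding u_def[symmetric] e_def by simp
      qed
      finally show ?thesis unfolding mgf .
    qed
    define w where "w = 1 - 2 * \<kappa>"
    have w: "1/2 \<le> w" "w \<le> 1" unfolding w_def using \<kappa> by auto
    have wk: "0 \<le> w * (1 + \<kappa>)" "w * (1 + \<kappa>) \<le> 2" "0 \<le> w * (1 - \<kappa>)" "w * (1 - \<kappa>) \<le> 2"
      using w \<kappa> mult_mono[of w 1 "1 + \<kappa>" 2] mult_mono[of w 1 "1 - \<kappa>" 2] by auto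
    have "exp (- (W l * (w\<^sup>2 / 2 + \<kappa> * w\<^sup>2 + \<eta>0))) / 2 \<le> Q.prob {x \<in> space Q. (1 - \<kappa>) * w * W l \<le> Z x}"
    proof (rule Q.tilted_lower_bound[where B = "h * (\<Sum>j\<in>D l. y)"])
      show "Z \<in> borel_measurable Q"
        unfolding Z_def by (intro borel_measurable_times borel_measurable_const borel_measurable_sum measurable_compose[OF co(3) fm])
      show "\<bar>Z x\<bar> \<le> h * (\<Sum>j\<in>D l. y)" for x
      proof -
        have "\<bar>\<Sum>j\<in>D l. f (x j)\<bar> \<le> (\<Sum>j\<in>D l. y)" by (rule order_trans[OF sum_abs sum_mono]) (rule fb)
        then show ?thesis unfolding Z_def abs_mult using h by (simp add: mult_left_mono)
      qed
      show "0 < w" "0 < \<kappa>" "\<kappa> < 1" using w \<kappa> by auto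
      show "exp (W l * (w\<^sup>2 / 2 - \<eta>0)) \<le> Q.expectation (\<lambda>x. exp (w * Z x))" using w by (intro lo) auto
      show "Q.expectation (\<lambda>x. exp (w * (1 + \<kappa>) * Z x)) \<le> exp (W l * ((w * (1 + \<kappa>))\<^sup>2 / 2 + \<eta>0))" by (intro up wk)
      show "Q.expectation (\<lambda>x. exp (w * (1 - \<kappa>) * Z x)) \<le> exp (W l * ((w * (1 - \<kappa>))\<^sup>2 / 2 + \<eta>0))" by (intro up wk)
      have "(1/2)\<^sup>2 \<le> w\<^sup>2" using w by (intro power_mono) auto
      then have "\<kappa>\<^sup>2 * (1/4) \<le> \<kappa>\<^sup>2 * w\<^sup>2" by (intro mult_left_mono) (auto simp: power2_eq_square)
      then have "2 * \<eta>0 - \<kappa>\<^sup>2 * w\<^sup>2 / 2 \<le> - (\<kappa>\<^sup>2 / 16)" unfolding \<eta>0_def by simp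
      then have "W l * (2 * \<eta>0 - \<kappa>\<^sup>2 * w\<^sup>2 / 2) \<le> W l * (- (\<kappa>\<^sup>2 / 16))" using Wp by (intro mult_left_mono) auto
      also have "\<dots> \<le> - ln 4"
      proof -
        have "ln 4 * 16 / \<kappa>\<^sup>2 \<le> W l" using L3[OF l(3)] sc(3) by linarith
        then show ?thesis using \<kappa> by (simp add: field_simps)
      qed
      finally have "exp (W l * (2 * \<eta>0 - \<kappa>\<^sup>2 * w\<^sup>2 / 2)) \<le> exp (- ln 4)" by simp
      then show "4 * exp (W l * (2 * \<eta>0 - \<kappa>\<^sup>2 * w\<^sup>2 / 2)) \<le> 1" by (simp add: exp_minus)
    qed
    moreover have "exp (- ((1 - \<kappa>) * LL (v (NN l)))) \<le> exp (- (W l * (w\<^sup>2 / 2 + \<kappa> * w\<^sup>2 + \<eta>0)))"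
    proof -
      have "w\<^sup>2 * (1 + 2 * \<kappa>) = (1 - 2 * \<kappa>) * (1 - 4 * \<kappa>\<^sup>2)" unfolding w_def by (simp add: power2_eq_square algebra_simps)
      also have "\<dots> \<le> (1 - 2 * \<kappa>) * 1" using \<kappa> by (intro mult_left_mono) auto
      finally have 1: "w\<^sup>2 * (1 + 2 * \<kappa>) \<le> 1 - 2 * \<kappa>" by simp
      have "\<kappa>\<^sup>2 \<le> \<kappa>" using \<kappa> by (simp add: power2_eq_square mult_le_cancel_left1)
      then have "2 * \<eta>0 \<le> \<kappa>" unfolding \<eta>0_def using \<kappa> by simp
      with 1 have "w\<^sup>2 / 2 + \<kappa> * w\<^sup>2 + \<eta>0 \<le> (1 - \<kappa>) / 2" by (simp add: algebra_simps)
      then have "W l * (w\<^sup>2 / 2 + \<kappa> * w\<^sup>2 + \<eta>0) \<le> W l * ((1 - \<kappa>) / 2)" using Wp by (intro mult_left_mono) auto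
      then show ?thesis unfolding W_def by (simp add: mult_ac)
    qed
    ultimately show "exp (- ((1 - \<kappa>) * LL (v (NN l)))) / 2
      \<le> measure Q {x \<in> space Q. (1 - \<kappa>) * (1 - 2 * \<kappa>) * W l \<le> W l / a l * (\<Sum>j\<in>D l. sg * clamp (2 * c l) (x j))}"
      unfolding Z_def f_def y_def h_def w_def by linarith
  qed
qed

end

section \<open>Divergence of the block probabilities\<close>

context lil_blocks
begin

text \<open>Condition (iii) with \<open>\<delta> = \<kappa>\<close>, summed by levels: the indices
  of one level contribute at most \<theta> times the term in the claim, and a level that contains an
  index is inhabited.\<close>

lemma not_summable_inhab:
  assumes \<kappa>: "0 < \<kappa>" "\<kappa> < 1"
  shows "\<not> summable (\<lambda>l. if inhab l then logp (\<theta> ^ l) powr (\<kappa> - 1) else 0)"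
proof
  define G where "G l = (if inhab l then logp (\<theta> ^ l) powr (\<kappa> - 1) else 0)" for l
  assume "summable (\<lambda>l. if inhab l then logp (\<theta> ^ l) powr (\<kappa> - 1) else 0)"
  then have sG: "summable G" unfolding G_def .
  have G0: "0 \<le> G l" for l unfolding G_def by simp
  define \<tau> where "\<tau> n = 1 / v (Suc n) * logp (v (Suc n)) powr (\<kappa> - 1) * \<sigma>2 n" for n
  have \<tau>0: "0 \<le> \<tau> n" for n unfolding \<tau>_def using v_nonneg \<sigma>2_nonneg by simp
  have block: "(\<Sum>n=NN l..<NN (Suc l). \<tau> n) \<le> \<theta> * G (Suc l)" for l
  proof (cases "NN l < NN (Suc l)")
    case True
    have vge: "\<theta> ^ Suc l \<le> v (Suc n)" if "NN l \<le> n" for n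
      using N_iff[OF \<theta>, of "Suc n" l] that by simp
    have "\<theta> ^ Suc l \<le> v (NN (Suc l))" using N_iff[OF \<theta>, of "NN (Suc l)" l] True by simp
    then have inh: "inhab (Suc l)" by (simp add: inhab_def)
    have "\<tau> n \<le> 1 / \<theta> ^ Suc l * logp (\<theta> ^ Suc l) powr (\<kappa> - 1) * \<sigma>2 n" if n: "NN l \<le> n" for n
      unfolding \<tau>_def
    proof (intro mult_right_mono mult_mono \<sigma>2_nonneg)
      show "1 / v (Suc n) \<le> 1 / \<theta> ^ Suc l" using vge[OF n] \<theta>_pow_pos[of "Suc l"] by (intro divide_left_mono) auto
      show "logp (v (Suc n)) powr (\<kappa> - 1) \<le> logp (\<theta> ^ Suc l) powr (\<kappa> - 1)"
        using logp_mono[OF vge[OF n]] logp_ge_1[of "\<theta> ^ Suc l"] \<kappa> by (intro powr_mono2') auto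
    qed (use \<theta> in auto)
    then have "(\<Sum>n=NN l..<NN (Suc l). \<tau> n) \<le> (\<Sum>n=NN l..<NN (Suc l). 1 / \<theta> ^ Suc l * logp (\<theta> ^ Suc l) powr (\<kappa> - 1) * \<sigma>2 n)"
      by (intro sum_mono) auto
    also have "\<dots> = 1 / \<theta> ^ Suc l * logp (\<theta> ^ Suc l) powr (\<kappa> - 1) * (\<Sum>n=NN l..<NN (Suc l). \<sigma>2 n)"
      by (simp only: sum_distrib_left)
    also have "\<dots> \<le> 1 / \<theta> ^ Suc l * logp (\<theta> ^ Suc l) powr (\<kappa> - 1) * (\<theta> * \<theta> ^ Suc l)"
    proof (rule mult_left_mono)
      have "(\<Sum>n=NN l..<NN (Suc l). \<sigma>2 n) \<le> v (NN (Suc l))"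
        unfolding v_def using \<sigma>2_nonneg by (intro sum_mono2) auto
      then show "(\<Sum>n=NN l..<NN (Suc l). \<sigma>2 n) \<le> \<theta> * \<theta> ^ Suc l" using v_N_less[OF \<theta>, of "Suc l"] by simp
    qed (use \<theta> in auto)
    also have "\<dots> = \<theta> * G (Suc l)" unfolding G_def using inh \<theta>_pow_pos[of "Suc l"] by simp
    finally show ?thesis .
  next
    case False
    then show ?thesis using G0[of "Suc l"] \<theta> by simp
  qed
  have tele: "(\<Sum>n<NN L. \<tau> n) = (\<Sum>n<NN 0. \<tau> n) + (\<Sum>l<L. \<Sum>n=NN l..<NN (Suc l). \<tau> n)" for L
  proof (induction L)
    case (Suc L)
    have "(\<Sum>n<NN (Suc L). \<tau> n) = (\<Sum>n<NN L. \<tau> n) + (\<Sum>n=NN L..<NN (Suc L). \<tau> n)"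
      using N_mono[OF \<theta>, of L "Suc L"] by (simp add: lessThan_atLeast0 sum.atLeastLessThan_concat)
    with Suc show ?case by simp
  qed simp
  define B where "B = (\<Sum>n<NN 0. \<tau> n) + \<theta> * (\<Sum>l. G (Suc l))"
  have "(\<Sum>n. ereal (1 / s2 E X (Suc n) * logp (s2 E X (Suc n)) powr (\<kappa> - 1)) * E (\<lambda>\<omega>. (X (Suc n) \<omega>)\<^sup>2)) \<le> ereal B"
  proof (rule suminf_bound, rule allI)
    fix n
    obtain L where L: "n \<le> NN L" using NN_unbounded by blast
    have "(\<Sum>k<n. \<tau> k) \<le> (\<Sum>k<NN L. \<tau> k)" using L \<tau>0 by (intro sum_mono2) auto
    also have "\<dots> \<le> (\<Sum>n<NN 0. \<tau> n) + (\<Sum>l<L. \<theta> * G (Suc l))" unfolding tele[of L] by (intro add_left_mono sum_mono block)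
    also have "(\<Sum>l<L. \<theta> * G (Suc l)) = \<theta> * (\<Sum>l<L. G (Suc l))" by (simp add: sum_distrib_left)
    also have "(\<Sum>l<L. G (Suc l)) \<le> (\<Sum>l. G (Suc l))" using sG G0 by (intro sum_le_suminf) (auto simp: summable_Suc_iff)
    finally have "(\<Sum>k<n. \<tau> k) \<le> B" unfolding B_def using \<theta> by (simp add: mult_left_mono)
    then show "(\<Sum>k<n. ereal (1 / s2 E X (Suc k) * logp (s2 E X (Suc k)) powr (\<kappa> - 1)) * E (\<lambda>\<omega>. (X (Suc k) \<omega>)\<^sup>2)) \<le> ereal B"
      unfolding E_square s2_eq \<tau>_def by simp
    show "0 \<le> ereal (1 / s2 E X (Suc k) * logp (s2 E X (Suc k)) powr (\<kappa> - 1)) * E (\<lambda>\<omega>. (X (Suc k) \<omega>)\<^sup>2)" for k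
      unfolding E_square s2_eq using \<tau>0[of k] unfolding \<tau>_def by simp
  qed
  then show False using iii[OF \<kappa>(1)] by simp
qed

text \<open>The bad levels contribute a convergent series: their terms decay exponentially in
  \<open>tt l\<close>, faster than \<open>tt l powr (- r)\<close>, which on a bad level is at most
  \<open>lam l powr q\<close>. Hence the divergence comes from the good levels.\<close>

lemma not_summable_good:
  assumes \<kappa>: "0 < \<kappa>" "\<kappa> < 1"
  shows "\<not> summable (\<lambda>l. if good l then exp (- ((1 - \<kappa>) * LL (v (NN l)))) else 0)"
proof
  define G where "G l = logp (\<theta> ^ l) powr (\<kappa> - 1)" for l
  define r where "r = 2 * p * q"
  \<comment> \<open>Chosen so that \<open>r * b = (1 - \<kappa>) / 2\<close>: the linear bound on
    \<open>ln (b * tt l)\<close> then compares \<open>r * ln (tt l)\<close> with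
    \<open>(1 - \<kappa>) * tt l / 2\<close>.\<close>
  define b where "b = (1 - \<kappa>) / (2 * r)"
  have r: "0 < r" unfolding r_def using p q by simp
  have b: "0 < b" unfolding b_def using r \<kappa> by simp
  define C where "C = exp ((1 - \<kappa>) - r - r * ln b)"
  \<comment> \<open>The loss in passing from \<open>ln (logp (\<theta> ^ l))\<close> to
    \<open>LL (v (NN l))\<close>: 1 for the maximum with e inside \<open>logp\<close>, and
    \<open>ln \<theta>\<close> for the width of the level.\<close>
  define K where "K = exp (1 - \<kappa>) * \<theta> powr (1 - \<kappa>)"
  assume s: "summable (\<lambda>l. if good l then exp (- ((1 - \<kappa>) * LL (v (NN l)))) else 0)"
  have Gexp: "G l = exp (- ((1 - \<kappa>) * ln (logp (\<theta> ^ l))))" for l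
    unfolding G_def powr_def using logp_neq_0[of "\<theta> ^ l"] by (simp add: algebra_simps)
  have good: "G l \<le> K * exp (- ((1 - \<kappa>) * LL (v (NN l))))" for l
  proof -
    have l0: "1 \<le> logp (\<theta> ^ l)" by (rule logp_ge_1)
    have "logp (v (NN l)) \<le> logp (\<theta> * \<theta> ^ l)" using v_N_less[OF \<theta>, of l] by (intro logp_mono) auto
    also have "\<dots> \<le> \<theta> * logp (\<theta> ^ l)" using \<theta> by (intro logp_mult_le) auto
    finally have le: "ln (logp (v (NN l))) \<le> ln (\<theta> * logp (\<theta> ^ l))" using logp_ge_1[of "v (NN l)"] by (intro ln_mono) auto
    have "LL (v (NN l)) \<le> 1 + ln (logp (v (NN l)))" unfolding LL_def by (rule logp_le_Suc_ln[OF logp_ge_1])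
    also have "\<dots> \<le> 1 + (ln \<theta> + ln (logp (\<theta> ^ l)))" using le \<theta> l0 by (simp add: ln_mult)
    finally have "(1 - \<kappa>) * LL (v (NN l)) \<le> (1 - \<kappa>) * (1 + (ln \<theta> + ln (logp (\<theta> ^ l))))" using \<kappa> by (intro mult_left_mono) auto
    then have "exp (- ((1 - \<kappa>) * ln (logp (\<theta> ^ l)))) \<le> exp ((1 - \<kappa>) + (1 - \<kappa>) * ln \<theta> + - ((1 - \<kappa>) * LL (v (NN l))))"
      by (simp add: algebra_simps)
    also have "\<dots> = K * exp (- ((1 - \<kappa>) * LL (v (NN l))))"
      unfolding K_def exp_add powr_def using \<theta> by simp
    finally show ?thesis unfolding Gexp .
  qed
  have bad: "G l \<le> C * lam l powr q" if "inhab l" "\<not> good l" for l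
  proof -
    have t: "2 \<le> tt l" by (rule tt_ge)
    have "1 < lam l * tt l powr (2 * p)" using that unfolding good_def by linarith
    then have "1 / tt l powr (2 * p) < lam l" using t by (simp add: divide_less_eq)
    then have "tt l powr (- (2 * p)) \<le> lam l" by (simp add: powr_minus_divide)
    then have "(tt l powr (- (2 * p))) powr q \<le> lam l powr q" using q by (intro powr_mono2) auto
    then have 1: "tt l powr (- r) \<le> lam l powr q" unfolding r_def by (simp add: powr_powr)
    have "LL (\<theta> ^ l) \<le> 1 + ln (logp (\<theta> ^ l))" unfolding LL_def by (rule logp_le_Suc_ln[OF logp_ge_1])
    then have "(1 - \<kappa>) * LL (\<theta> ^ l) \<le> (1 - \<kappa>) * (1 + ln (logp (\<theta> ^ l)))" using \<kappa> by (intro mult_left_mono) auto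
    then have g1: "- ((1 - \<kappa>) * ln (logp (\<theta> ^ l))) \<le> (1 - \<kappa>) - (1 - \<kappa>) * (tt l / 2)" unfolding tt_def by (simp add: algebra_simps)
    have "ln (b * tt l) \<le> b * tt l - 1" using b t by (intro ln_le_minus_one) auto
    then have "ln (tt l) \<le> b * tt l - 1 - ln b" using b t by (simp add: ln_mult)
    then have "r * ln (tt l) \<le> r * (b * tt l - 1 - ln b)" using r by (intro mult_left_mono) auto
    also have "\<dots> = (1 - \<kappa>) * (tt l / 2) - r - r * ln b" unfolding b_def using r by (simp add: field_simps)
    finally have "- ((1 - \<kappa>) * ln (logp (\<theta> ^ l))) \<le> ((1 - \<kappa>) - r - r * ln b) + (- r) * ln (tt l)" using g1 by simp
    then have "G l \<le> exp (((1 - \<kappa>) - r - r * ln b) + (- r) * ln (tt l))" unfolding Gexp by simp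
    also have "\<dots> = C * tt l powr (- r)" unfolding C_def exp_add powr_def using t by simp
    also have "\<dots> \<le> C * lam l powr q" unfolding C_def using 1 by (intro mult_left_mono) auto
    finally show ?thesis .
  qed
  have "summable (\<lambda>l. if inhab l then G l else 0)"
  proof (rule summable_comparison_test')
    show "summable (\<lambda>l. K * (if good l then exp (- ((1 - \<kappa>) * LL (v (NN l)))) else 0) + C * lam l powr q)"
      by (intro summable_add summable_mult s lam_summable)
    fix l :: nat
    have C0: "0 \<le> C * lam l powr q" unfolding C_def by simp
    have K0: "0 \<le> K" unfolding K_def by simp
    have G0: "0 \<le> G l" unfolding G_def by simp
    show "norm (if inhab l then G l else 0) \<le> K * (if good l then exp (- ((1 - \<kappa>) * LL (v (NN l)))) else 0) + C * lam l powr q"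
    proof (cases "good l")
      case True
      then show ?thesis using good[of l] C0 G0 good_inhab[OF True] by simp
    next
      case False
      then show ?thesis using bad[of l] C0 G0 by (cases "inhab l") auto
    qed
  qed
  then show False using not_summable_inhab[OF \<kappa>] unfolding G_def by simp
qed

end

section \<open>The limit set\<close>

lemma limsup_ratio_eq_1:
  fixes s a :: "nat \<Rightarrow> real"
  assumes a: "\<forall>\<^sub>F n in sequentially. 0 < a n"
    and up: "\<And>k. \<forall>\<^sub>F n in sequentially. s n \<le> (1 + 1 / real (Suc k)) * a n"
    and lo: "\<And>k. \<exists>\<^sub>\<infinity>n. (1 - 1 / real (Suc k)) * a n \<le> s n"
  shows "limsup (\<lambda>n. ereal (s n / a n)) = 1"
proof (rule antisym)
  have u: "limsup (\<lambda>n. ereal (s n / a n)) \<le> ereal (1 + 1 / real (Suc k))" for k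
  proof (rule Limsup_bounded)
    show "\<forall>\<^sub>F n in sequentially. ereal (s n / a n) \<le> ereal (1 + 1 / real (Suc k))"
      using up[of k] a by eventually_elim (simp add: pos_divide_le_eq)
  qed
  show "limsup (\<lambda>n. ereal (s n / a n)) \<le> 1"
  proof (rule ereal_le_epsilon2)
    fix e :: real assume "0 < e"
    then obtain k where k: "1 / real (Suc k) < e" using reals_Archimedean[of e] by (auto simp: inverse_eq_divide)
    have "limsup (\<lambda>n. ereal (s n / a n)) \<le> ereal (1 + 1 / real (Suc k))" by (rule u)
    also have "\<dots> \<le> 1 + ereal e" using k by (simp add: one_ereal_def)
    finally show "limsup (\<lambda>n. ereal (s n / a n)) \<le> 1 + ereal e" .
  qed
  have l: "ereal (1 - 1 / real (Suc k)) \<le> limsup (\<lambda>n. ereal (s n / a n))" for k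
  proof (rule ccontr)
    assume "\<not> ?thesis"
    then have "limsup (\<lambda>n. ereal (s n / a n)) < ereal (1 - 1 / real (Suc k))" by simp
    then have "\<forall>\<^sub>F n in sequentially. ereal (s n / a n) < ereal (1 - 1 / real (Suc k))" by (rule Limsup_lessD)
    then have "\<forall>\<^sub>F n in sequentially. \<not> ((1 - 1 / real (Suc k)) * a n \<le> s n)"
      using a by eventually_elim (simp add: pos_divide_less_eq not_le)
    then show False using lo[of k] unfolding frequently_def[symmetric] cofinite_eq_sequentially by (simp add: frequently_def)
  qed
  show "1 \<le> limsup (\<lambda>n. ereal (s n / a n))"
  proof (rule ereal_le_epsilon2)
    fix e :: real assume "0 < e"
    then obtain k where k: "1 / real (Suc k) < e" using reals_Archimedean[of e] by (auto simp: inverse_eq_divide)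
    have "(1::ereal) \<le> ereal (1 - 1 / real (Suc k)) + ereal e" using k by (simp add: one_ereal_def)
    also have "\<dots> \<le> limsup (\<lambda>n. ereal (s n / a n)) + ereal e" by (rule add_right_mono[OF l])
    finally show "1 \<le> limsup (\<lambda>n. ereal (s n / a n)) + ereal e" .
  qed
qed

context lil_lower
begin

lemma Q_copy_P: "Q \<in> copy_P E X"
  unfolding Q_def by (rule product_measure_in_copy_P[OF \<mu>_rd \<mu>_dom integ_X])

text \<open>Blocks of neighbouring levels overlap, so even and odd levels are separated. One of the
  two series of probabilities diverges, and within its parity class the blocks are disjoint, hence
  independent.\<close>

lemma block_sums_large:
  assumes \<kappa>: "0 < \<kappa>" "\<kappa> \<le> 1/4" and sg: "\<bar>sg\<bar> = 1"
    and A1: "4 * (exp (4 * \<alpha>) - 1) \<le> \<kappa>\<^sup>2 / 32"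
    and A2: "4 * (1 - (1 - 2 / \<theta>) * (exp (- (4 * \<alpha>)) - 2 * (4 * \<alpha>)\<^sup>2)) \<le> \<kappa>\<^sup>2 / 32"
    and A3: "0 \<le> exp (- (4 * \<alpha>)) - 2 * (4 * \<alpha>)\<^sup>2" and A4: "4 * \<alpha> \<le> 2/5"
  shows "AE x in Q. \<exists>\<^sub>\<infinity>l. 2 \<le> l \<and> good l \<and> (1 - 3 * \<kappa>) * a l \<le> (\<Sum>j\<in>D l. sg * clamp (2 * c l) (x j))"
proof -
  interpret Q: prob_space Q by (rule Q_prob)
  note co = indep_vars_PiM_coordinates[of \<mu>, OF \<mu>_rd, folded Q_def]
  define S where "S l x = W l / a l * (\<Sum>j\<in>D l. sg * clamp (2 * c l) (x j))" for l and x :: "nat \<Rightarrow> real"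
  define K where "K l = (1 - \<kappa>) * (1 - 2 * \<kappa>) * W l" for l
  define e where "e l = exp (- ((1 - \<kappa>) * LL (v (NN l))))" for l
  obtain L0 where L0: "\<And>l. L0 \<le> l \<Longrightarrow> good l \<Longrightarrow> e l / 2 \<le> Q.prob {x \<in> space Q. K l \<le> S l x}"
    using block_probability[OF assms] unfolding S_def K_def e_def by blast
  define I where "I b = {l. max L0 2 \<le> l \<and> good l \<and> (even l \<longleftrightarrow> b)}" for b
  define pr where "pr b l = (if l \<in> I b then Q.prob {x \<in> space Q. K l \<le> S l x} else 0)" for b l
  have "\<exists>b. \<not> summable (pr b)"
  proof (rule ccontr)
    assume "\<not> ?thesis"
    then have s: "summable (pr b)" for b by simp
    have "summable (\<lambda>l. if good l then e l else 0)"
    proof (rule summable_comparison_test_ev)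
      show "summable (\<lambda>l. 2 * (pr True l + pr False l))" by (intro summable_mult summable_add s)
      show "\<forall>\<^sub>F l in sequentially. norm (if good l then e l else 0) \<le> 2 * (pr True l + pr False l)"
        unfolding eventually_sequentially
      proof (intro exI[of _ "max L0 2"] allI impI)
        fix l assume l: "max L0 2 \<le> l"
        have pr0: "0 \<le> pr b l" for b unfolding pr_def by simp
        show "norm (if good l then e l else 0) \<le> 2 * (pr True l + pr False l)"
        proof (cases "good l")
          case True
          then have "pr (even l) l = Q.prob {x \<in> space Q. K l \<le> S l x}" unfolding pr_def I_def using l by simp
          then have "e l / 2 \<le> pr (even l) l" using L0[OF _ True] l by simp
          also have "pr (even l) l \<le> pr True l + pr False l" using pr0[of True] pr0[of False] by (cases "even l") auto
          finally show ?thesis using True unfolding e_def by simp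
        next
          case False
          then show ?thesis using pr0[of True] pr0[of False] by simp
        qed
      qed
    qed
    then show False using not_summable_good[of \<kappa>] \<kappa> unfolding e_def by simp
  qed
  then obtain b where b: "\<not> summable (pr b)" by blast
  have disj: "disjoint_family_on D (I b)"
  proof -
    have d: "D l \<inter> D k = {}" if "l \<in> I b" "k \<in> I b" "l < k" for l k
    proof -
      have "even l = even k" using that unfolding I_def by simp
      then have "l + 2 \<le> k" using that(3) by presburger
      then have "NN l \<le> NN (k - 2)" by (intro N_mono[OF \<theta>]) simp
      then show ?thesis unfolding D_def by auto
    qed
    show ?thesis unfolding disjoint_family_on_def
    proof (intro ballI impI)
      fix l k assume lk: "l \<in> I b" "k \<in> I b" "l \<noteq> k"
      show "D l \<inter> D k = {}"
      proof (cases "l < k")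
        case True then show ?thesis by (rule d[OF lk(1,2)])
      next
        case False
        then have "k < l" using lk(3) by simp
        from d[OF lk(2,1) this] show ?thesis by (simp add: Int_commute)
      qed
    qed
  qed
  have "Q.indep_vars (\<lambda>l. PiM (D l) (\<lambda>_. borel)) (\<lambda>l x. restrict (\<lambda>i. x i) (D l)) (I b)"
    by (rule Q.indep_vars_restrict[OF co(1) subset_UNIV disj])
  then have "Q.indep_vars (\<lambda>_. borel) (\<lambda>l x. W l / a l * (\<Sum>j\<in>D l. sg * clamp (2 * c l) (restrict (\<lambda>i. x i) (D l) j))) (I b)"
  proof (rule Q.indep_vars_compose2)
    fix l assume "l \<in> I b"
    then have y: "0 \<le> 2 * c l" using c_bounds(3)[OF good_inhab, of l] unfolding I_def by simp
    have "(\<lambda>f. clamp (2 * c l) (f j)) \<in> borel_measurable (PiM (D l) (\<lambda>_. borel))" if j: "j \<in> D l" for j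
    proof -
      have "(\<lambda>f :: nat \<Rightarrow> real. f j) \<in> borel_measurable (PiM (D l) (\<lambda>_. borel))"
        using j by (rule measurable_component_singleton)
      from measurable_compose[OF this blip_measurable[OF blip_clamp[OF y, of 1]]] show ?thesis by simp
    qed
    then show "(\<lambda>f. W l / a l * (\<Sum>j\<in>D l. sg * clamp (2 * c l) (f j))) \<in> PiM (D l) (\<lambda>_. borel) \<rightarrow>\<^sub>M borel"
      by (intro borel_measurable_times borel_measurable_const borel_measurable_sum)
  qed
  also have "(\<lambda>l x. W l / a l * (\<Sum>j\<in>D l. sg * clamp (2 * c l) (restrict (\<lambda>i. x i) (D l) j))) = S"
    unfolding S_def by (intro ext arg_cong2[where f = "(*)"] sum.cong refl) simp
  finally have ind: "Q.indep_vars (\<lambda>_. borel) S (I b)" .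
  have "AE x in Q. \<exists>\<^sub>\<infinity>l. l \<in> I b \<and> K l \<le> S l x"
    by (rule Q.borel_cantelli_indep_vars[OF ind]) (use b in \<open>simp add: pr_def[abs_def]\<close>)
  then show ?thesis
  proof (rule AE_mp, intro AE_I2 impI)
    fix x assume "\<exists>\<^sub>\<infinity>l. l \<in> I b \<and> K l \<le> S l x"
    then show "\<exists>\<^sub>\<infinity>l. 2 \<le> l \<and> good l \<and> (1 - 3 * \<kappa>) * a l \<le> (\<Sum>j\<in>D l. sg * clamp (2 * c l) (x j))"
    proof (rule INFM_mono)
      fix l assume l: "l \<in> I b \<and> K l \<le> S l x"
      then have g: "good l" "2 \<le> l" unfolding I_def by auto
      note sc = inhab_scale[OF good_inhab[OF g(1)]]
      have Wp: "0 < W l" using sc(3) tt_ge[of l] by linarith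
      define s where "s = (\<Sum>j\<in>D l. sg * clamp (2 * c l) (x j))"
      have "(1 - \<kappa>) * (1 - 2 * \<kappa>) * W l \<le> W l / a l * s" using l unfolding K_def S_def s_def by simp
      then have "a l / W l * ((1 - \<kappa>) * (1 - 2 * \<kappa>) * W l) \<le> a l / W l * (W l / a l * s)"
        using sc(1) Wp by (intro mult_left_mono) auto
      then have "a l * ((1 - \<kappa>) * (1 - 2 * \<kappa>)) \<le> s" using sc(1) Wp by simp
      then have "(1 - \<kappa>) * (1 - 2 * \<kappa>) * a l \<le> s" by (simp only: mult.commute)
      moreover have "(1 - 3 * \<kappa>) * a l \<le> (1 - \<kappa>) * (1 - 2 * \<kappa>) * a l"
        using sc(1) by (intro mult_right_mono) (auto simp: algebra_simps)
      ultimately show "2 \<le> l \<and> good l \<and> (1 - 3 * \<kappa>) * a l \<le> (\<Sum>j\<in>D l. sg * clamp (2 * c l) (x j))"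
        using g unfolding s_def by simp
    qed
  qed
qed

text \<open>The upper half with the opposite sign bounds what the sum before the block can destroy
  by \<open>2 * aa (v (NN (l - 2)))\<close>, at most \<open>2 / sqrt \<theta>\<close> times
  \<open>a l\<close>. Returning from clamped to true variables costs another
  \<open>2 * \<delta>\<close>.\<close>

lemma partial_sums_large:
  assumes \<kappa>: "0 < \<kappa>" "\<kappa> \<le> 1/4" and sg: "\<bar>sg\<bar> = 1" and \<delta>: "0 < \<delta>"
    and A1: "4 * (exp (4 * \<alpha>) - 1) \<le> \<kappa>\<^sup>2 / 32"
    and A2: "4 * (1 - (1 - 2 / \<theta>) * (exp (- (4 * \<alpha>)) - 2 * (4 * \<alpha>)\<^sup>2)) \<le> \<kappa>\<^sup>2 / 32"
    and A3: "0 \<le> exp (- (4 * \<alpha>)) - 2 * (4 * \<alpha>)\<^sup>2" and A4: "4 * \<alpha> \<le> 2/5"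
    and up: "null {x. \<exists>\<^sub>\<infinity>n. 2 * aa (v n) < (\<Sum>j<n. (- sg) * x j)}"
  shows "AE x in Q. \<exists>\<^sub>\<infinity>n. (1 - (3 * \<kappa> + 2 * \<delta> + 2 / sqrt \<theta>)) * aa (v n) \<le> (\<Sum>j<n. sg * x j)"
proof -
  have 1: "AE x in Q. x \<notin> {x. \<exists>\<^sub>\<infinity>n. 2 * aa (v n) < (\<Sum>j<n. (- sg) * x j)}" by (rule null_AE[OF Q_copy_P up])
  have 2: "AE x in Q. x \<notin> {x. \<exists>\<^sub>\<infinity>l. good l \<and> 2 * \<delta> * A l \<le> (\<Sum>j<NN l. max (\<bar>x j\<bar> - 2 * c l) 0)}"
    by (rule null_AE[OF Q_copy_P null_good_tail[OF \<delta>]])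
  have 3: "AE x in Q. \<exists>\<^sub>\<infinity>l. 2 \<le> l \<and> good l \<and> (1 - 3 * \<kappa>) * a l \<le> (\<Sum>j\<in>D l. sg * clamp (2 * c l) (x j))"
    by (rule block_sums_large[OF \<kappa> sg A1 A2 A3 A4])
  show ?thesis
    using 1 2 3
  proof eventually_elim
    case (elim x)
    have m: "\<forall>\<^sub>\<infinity>n. \<not> (2 * aa (v n) < (\<Sum>j<n. (- sg) * x j))"
      "\<forall>\<^sub>\<infinity>l. \<not> (good l \<and> 2 * \<delta> * A l \<le> (\<Sum>j<NN l. max (\<bar>x j\<bar> - 2 * c l) 0))"
      using elim(1,2) by (simp_all only: mem_Collect_eq not_INFM)
    obtain n0 where n0: "\<forall>n\<ge>n0. \<not> (2 * aa (v n) < (\<Sum>j<n. (- sg) * x j))"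
      using m(1) unfolding MOST_nat_le by (rule exE)
    obtain L1 where L1: "\<forall>l\<ge>L1. \<not> (good l \<and> 2 * \<delta> * A l \<le> (\<Sum>j<NN l. max (\<bar>x j\<bar> - 2 * c l) 0))"
      using m(2) unfolding MOST_nat_le by (rule exE)
    show ?case unfolding INFM_nat_le
    proof
      fix n :: nat
      obtain L2 where L2: "\<And>l. L2 \<le> l \<Longrightarrow> max n n0 \<le> NN l" using NN_unbounded by blast
      obtain l where l: "max L1 (L2 + 2) \<le> l" "2 \<le> l" "good l" "(1 - 3 * \<kappa>) * a l \<le> (\<Sum>j\<in>D l. sg * clamp (2 * c l) (x j))"
        using elim(3) unfolding INFM_nat_le by blast
      note inh = good_inhab[OF l(3)]
      note sc = inhab_scale[OF inh]
      have Nl: "n \<le> NN l" "n0 \<le> NN (l - 2)" using L2[of l] L2[of "l - 2"] l(1) by auto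
      have NN2: "NN (l - 2) \<le> NN l" by (intro N_mono[OF \<theta>]) simp
      have c0: "0 \<le> 2 * c l" using c_bounds(3)[OF inh] by simp
      have "(\<Sum>j<NN (l - 2). (- sg) * x j) \<le> 2 * aa (v (NN (l - 2)))" using n0 Nl(2) by (simp add: not_less)
      moreover have "aa (v (NN (l - 2))) \<le> a l / sqrt \<theta>"
      proof -
        have Sl: "Suc (l - 2) = l - 1" using l(2) by simp
        have "v (NN (l - 2)) \<le> \<theta> ^ (l - 1)" using v_N_less[OF \<theta>, of "l - 2"] unfolding Sl by simp
        then have "aa (v (NN (l - 2))) \<le> aa (\<theta> ^ (l - 1))" by (intro aa_mono v_nonneg)
        then have "sqrt \<theta> * aa (v (NN (l - 2))) \<le> sqrt \<theta> * aa (\<theta> ^ (l - 1))" using \<theta> by (intro mult_left_mono) auto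
        also have "\<dots> \<le> aa (\<theta> * \<theta> ^ (l - 1))" using \<theta> by (intro aa_mult_ge) auto
        also have "\<theta> * \<theta> ^ (l - 1) = \<theta> ^ l" using l(2) by (simp add: power_eq_if)
        also have "aa (\<theta> ^ l) \<le> a l" using sc(2) unfolding A_def .
        finally show ?thesis using \<theta> by (simp add: pos_le_divide_eq mult.commute)
      qed
      moreover have "(\<Sum>j\<in>D l. (- sg) * x j) \<le> (\<Sum>j\<in>D l. (- sg) * clamp (2 * c l) (x j)) + (\<Sum>j\<in>D l. max (\<bar>x j\<bar> - 2 * c l) 0)"
        unfolding sum.distrib[symmetric] using sg by (intro sum_mono clamp_diff_le c0) auto
      moreover have "(\<Sum>j\<in>D l. max (\<bar>x j\<bar> - 2 * c l) 0) \<le> 2 * \<delta> * a l"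
      proof -
        have "(\<Sum>j\<in>D l. max (\<bar>x j\<bar> - 2 * c l) 0) \<le> (\<Sum>j<NN l. max (\<bar>x j\<bar> - 2 * c l) 0)"
          unfolding D_def by (intro sum_mono2) auto
        also have "\<dots> \<le> 2 * \<delta> * A l" using L1[rule_format, of l] l by auto
        also have "\<dots> \<le> 2 * \<delta> * a l" using sc(2) \<delta> by (intro mult_left_mono) auto
        finally show ?thesis .
      qed
      moreover have "(\<Sum>j<NN l. sg * x j) = - (\<Sum>j<NN (l - 2). (- sg) * x j) - (\<Sum>j\<in>D l. (- sg) * x j)"
      proof -
        have "(\<Sum>j<NN l. sg * x j) = (\<Sum>j<NN (l - 2). sg * x j) + (\<Sum>j\<in>D l. sg * x j)"
          unfolding D_def using NN2 by (simp add: lessThan_atLeast0 sum.atLeastLessThan_concat)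
        then show ?thesis by (simp add: sum_negf)
      qed
      moreover have "(\<Sum>j\<in>D l. (- sg) * clamp (2 * c l) (x j)) = - (\<Sum>j\<in>D l. sg * clamp (2 * c l) (x j))" by (simp add: sum_negf)
      ultimately have "(1 - 3 * \<kappa>) * a l - 2 * (a l / sqrt \<theta>) - 2 * \<delta> * a l \<le> (\<Sum>j<NN l. sg * x j)" using l(4) by linarith
      then have "(1 - (3 * \<kappa> + 2 * \<delta> + 2 / sqrt \<theta>)) * aa (v (NN l)) \<le> (\<Sum>j<NN l. sg * x j)"
        unfolding a_def by (simp add: algebra_simps)
      then show "\<exists>m\<ge>n. (1 - (3 * \<kappa> + 2 * \<delta> + 2 / sqrt \<theta>)) * aa (v m) \<le> (\<Sum>j<m. sg * x j)" using Nl(1) by blast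
    qed
  qed
qed

end

section \<open>Choice of the parameters and the limit set\<close>

context lil_hypotheses
begin

lemma upper_limit:
  assumes sg: "\<bar>sg\<bar> = 1" and \<epsilon>: "0 < \<epsilon>"
  shows "null {x. \<exists>\<^sub>\<infinity>n. (1 + \<epsilon>) * aa (v n) < (\<Sum>j<n. sg * x j)}"
proof -
  define \<delta> where "\<delta> = \<epsilon> / 3"
  have \<delta>: "0 < \<delta>" "3 * \<delta> = \<epsilon>" unfolding \<delta>_def using \<epsilon> by auto
  \<comment> \<open>\<theta> and \<alpha> are chosen so that \<open>\<theta> * exp (2 * (\<alpha> *
    \<theta>)) = \<theta> * \<theta> = 1 + \<delta>\<close>, the extreme case allowed by
    \<open>null_upper\<close>.\<close>
  define \<theta> where "\<theta> = sqrt (1 + \<delta>)"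
  have \<theta>: "1 < \<theta>" "\<theta> * \<theta> = 1 + \<delta>" unfolding \<theta>_def using \<delta> by auto
  define \<alpha> where "\<alpha> = ln \<theta> / (2 * \<theta>)"
  have \<alpha>: "0 < \<alpha>" "2 * (\<alpha> * \<theta>) = ln \<theta>" unfolding \<alpha>_def using \<theta> by auto
  obtain p q lam where T: "2 \<le> p \<and> 1 \<le> q \<and>
    (\<forall>j. 0 < v (Suc j) \<longrightarrow> integ (\<lambda>\<omega>. max (\<bar>X (Suc j) \<omega>\<bar> - \<alpha> * ss (v (Suc j))) 0 powr p)) \<and>
    (\<forall>l. 0 < lam l) \<and> (\<forall>l. U \<alpha> p (N \<theta> l) \<le> lam l * aa (\<theta> ^ l) powr p) \<and> summable (\<lambda>l. lam l powr q)"
    using tail_moments[OF \<theta>(1) \<alpha>(1)] by (elim exE) (rule that)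
  have th: "\<theta> * exp (2 * (\<alpha> * \<theta>)) \<le> 1 + \<delta>" unfolding \<alpha>(2) using \<theta> by simp
  interpret lil_blocks M H E X VV \<theta> \<alpha> p q lam
    by unfold_locales (use \<theta> \<alpha> T in auto)
  from null_upper[OF sg \<delta>(1) th] show ?thesis unfolding \<delta>(2) .
qed

lemma attaining_distributions_exist:
  "\<exists>\<mu>. (\<forall>j. real_distribution (\<mu> j)) \<and> (\<forall>j f. blip f \<longrightarrow> (\<integral>u. f u \<partial>\<mu> j) \<le> ER (\<lambda>\<omega>. f (X (Suc j) \<omega>))) \<and>
    (\<forall>j. (\<integral>u. (clamp (real j * ss (v (Suc j))) u)\<^sup>2 \<partial>\<mu> j) = ER (\<lambda>\<omega>. (clamp (real j * ss (v (Suc j))) (X (Suc j) \<omega>))\<^sup>2))"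
proof -
  have "\<exists>m. real_distribution m \<and> (\<forall>f. blip f \<longrightarrow> (\<integral>u. f u \<partial>m) \<le> ER (\<lambda>\<omega>. f (X (Suc j) \<omega>))) \<and>
    (\<integral>u. (clamp (real j * ss (v (Suc j))) u)\<^sup>2 \<partial>m) = ER (\<lambda>\<omega>. (clamp (real j * ss (v (Suc j))) (X (Suc j) \<omega>))\<^sup>2)" for j
  proof -
    have b: "blip (\<lambda>u. (clamp (real j * ss (v (Suc j))) u)\<^sup>2)"
      using ss_nonneg[OF v_nonneg] by (intro blip_clamp_square) auto
    show ?thesis using dominated_distribution_exists[OF integ_X b, of j] by metis
  qed
  then have "\<forall>j. \<exists>m. real_distribution m \<and> (\<forall>f. blip f \<longrightarrow> (\<integral>u. f u \<partial>m) \<le> ER (\<lambda>\<omega>. f (X (Suc j) \<omega>))) \<and>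
    (\<integral>u. (clamp (real j * ss (v (Suc j))) u)\<^sup>2 \<partial>m) = ER (\<lambda>\<omega>. (clamp (real j * ss (v (Suc j))) (X (Suc j) \<omega>))\<^sup>2)" by blast
  from choice[OF this] show ?thesis by (simp only: all_conj_distrib)
qed

text \<open>The laws come first; \<kappa>, \<delta>, \<theta> and \<alpha> are adapted to
  \<epsilon>. The terms \<open>3 * \<kappa>\<close>, \<open>2 * \<delta>\<close> and
  \<open>2 / sqrt \<theta>\<close> take at most \<open>\<epsilon> / 4\<close> each.\<close>

lemma lower_limit:
  assumes \<mu>: "\<And>j. real_distribution (\<mu> j)"
    "\<And>j f. blip f \<Longrightarrow> (\<integral>u. f u \<partial>\<mu> j) \<le> ER (\<lambda>\<omega>. f (X (Suc j) \<omega>))"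
    "\<And>j. (\<integral>u. (clamp (real j * ss (v (Suc j))) u)\<^sup>2 \<partial>\<mu> j) = ER (\<lambda>\<omega>. (clamp (real j * ss (v (Suc j))) (X (Suc j) \<omega>))\<^sup>2)"
    and sg: "\<bar>sg\<bar> = 1" and \<epsilon>: "0 < \<epsilon>"
  shows "AE x in PiM UNIV \<mu>. \<exists>\<^sub>\<infinity>n. (1 - \<epsilon>) * aa (v n) \<le> (\<Sum>j<n. sg * x j)"
proof -
  define \<kappa> where "\<kappa> = min (1/4) (\<epsilon> / 12)"
  have \<kappa>: "0 < \<kappa>" "\<kappa> \<le> 1/4" "3 * \<kappa> \<le> \<epsilon> / 4" unfolding \<kappa>_def using \<epsilon> by auto
  define \<delta> where "\<delta> = \<epsilon> / 8"
  have \<delta>: "0 < \<delta>" unfolding \<delta>_def using \<epsilon> by simp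
  \<comment> \<open>The first lower bound gives
    \<open>2 / sqrt \<theta> \<le> \<epsilon> / 4\<close>, the second
    \<open>8 / \<theta> \<le> \<kappa>^2 / 64\<close>, half of the budget in A2.\<close>
  define \<theta> where "\<theta> = max ((8 / \<epsilon>)\<^sup>2) (512 / \<kappa>\<^sup>2) + 1"
  have \<theta>: "1 < \<theta>" "(8 / \<epsilon>)\<^sup>2 \<le> \<theta>" "512 / \<kappa>\<^sup>2 \<le> \<theta>"
    unfolding \<theta>_def using \<kappa> by (auto simp: less_max_iff_disj)
  have \<theta>1: "2 / sqrt \<theta> \<le> \<epsilon> / 4"
  proof -
    have "8 / \<epsilon> \<le> sqrt \<theta>" using \<theta>(2) by (rule real_le_rsqrt)
    then show ?thesis using \<epsilon> \<theta>(1) by (simp add: field_simps)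
  qed
  have \<theta>2: "8 / \<theta> \<le> \<kappa>\<^sup>2 / 64" using \<theta>(1,3) \<kappa> by (simp add: field_simps)
  have \<kappa>2: "\<kappa>\<^sup>2 \<le> 1/16" using power_mono[OF \<kappa>(2), of 2] \<kappa> by (simp add: power2_eq_square)
  \<comment> \<open>9216 is 144 times 64: as \<open>1 - e \<le> 36 * \<alpha>\<close>, the other
    half of the budget in A2 is met by \<open>144 * \<alpha> = \<kappa>^2 / 64\<close>.\<close>
  define \<alpha> where "\<alpha> = \<kappa>\<^sup>2 / 9216"
  have \<alpha>: "0 < \<alpha>" "\<alpha> \<le> 1 / 100" "144 * \<alpha> = \<kappa>\<^sup>2 / 64" unfolding \<alpha>_def using \<kappa> \<kappa>2 by auto
  define e where "e = exp (- (4 * \<alpha>)) - 2 * (4 * \<alpha>)\<^sup>2"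
  have \<alpha>sq: "\<alpha>\<^sup>2 \<le> \<alpha>" using \<alpha> by (simp add: power2_eq_square mult_le_cancel_left1)
  have e1: "1 - 36 * \<alpha> \<le> e"
    using exp_ge_add_one_self[of "- (4 * \<alpha>)"] \<alpha>sq unfolding e_def by (simp add: power_mult_distrib)
  have e2: "e \<le> 1"
  proof -
    have "exp (- (4 * \<alpha>)) \<le> 1" using \<alpha> by simp
    then show ?thesis unfolding e_def using zero_le_power2[of "4 * \<alpha>"] by linarith
  qed
  have A1: "4 * (exp (4 * \<alpha>) - 1) \<le> \<kappa>\<^sup>2 / 32"
    using exp_bound_lemma[of "4 * \<alpha>"] \<alpha> by simp
  have A2: "4 * (1 - (1 - 2 / \<theta>) * e) \<le> \<kappa>\<^sup>2 / 32"
  proof -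
    have "2 / \<theta> * e \<le> 2 / \<theta> * 1" using e2 \<theta>(1) by (intro mult_left_mono) auto
    moreover have "4 * (1 - (1 - 2 / \<theta>) * e) = 4 * (1 - e) + 4 * (2 / \<theta> * e)" by (simp add: algebra_simps)
    moreover have "4 * (2 / \<theta> * 1) \<le> \<kappa>\<^sup>2 / 64" using \<theta>2 by simp
    moreover have "4 * (1 - e) \<le> \<kappa>\<^sup>2 / 64"
    proof -
      have "4 * (1 - e) \<le> 4 * (36 * \<alpha>)" using e1 by simp
      then show ?thesis using \<alpha>(3) by simp
    qed
    ultimately show ?thesis by (simp del: mult_1_right)
  qed
  have A3: "0 \<le> e" using e1 \<alpha>(2) by simp
  have A4: "4 * \<alpha> \<le> 2/5" using \<alpha>(2) by simp
  obtain p q lam where T: "2 \<le> p \<and> 1 \<le> q \<and>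
    (\<forall>j. 0 < v (Suc j) \<longrightarrow> integ (\<lambda>\<omega>. max (\<bar>X (Suc j) \<omega>\<bar> - \<alpha> * ss (v (Suc j))) 0 powr p)) \<and>
    (\<forall>l. 0 < lam l) \<and> (\<forall>l. U \<alpha> p (N \<theta> l) \<le> lam l * aa (\<theta> ^ l) powr p) \<and> summable (\<lambda>l. lam l powr q)"
    using tail_moments[OF \<theta>(1) \<alpha>(1)] by (elim exE) (rule that)
  interpret lil_blocks M H E X VV \<theta> \<alpha> p q lam
    by unfold_locales (use \<theta> \<alpha> T in auto)
  interpret lil_lower M H E X VV \<theta> \<alpha> p q lam \<mu>
    by intro_locales (rule lil_lower_axioms.intro, (fact \<mu>)+)
  have "null {x. \<exists>\<^sub>\<infinity>n. 2 * aa (v n) < (\<Sum>j<n. (- sg) * x j)}"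
    using upper_limit[of "- sg" 1] sg by simp
  from partial_sums_large[OF \<kappa>(1,2) sg \<delta> A1 A2[unfolded e_def] A3[unfolded e_def] A4 this]
  have "AE x in PiM UNIV \<mu>. \<exists>\<^sub>\<infinity>n. (1 - (3 * \<kappa> + 2 * \<delta> + 2 / sqrt \<theta>)) * aa (v n) \<le> (\<Sum>j<n. sg * x j)"
    unfolding Q_def .
  then show ?thesis
  proof (rule AE_mp, intro AE_I2 impI)
    fix x assume "\<exists>\<^sub>\<infinity>n. (1 - (3 * \<kappa> + 2 * \<delta> + 2 / sqrt \<theta>)) * aa (v n) \<le> (\<Sum>j<n. sg * x j)"
    then show "\<exists>\<^sub>\<infinity>n. (1 - \<epsilon>) * aa (v n) \<le> (\<Sum>j<n. sg * x j)"
    proof (rule INFM_mono)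
      fix n assume n: "(1 - (3 * \<kappa> + 2 * \<delta> + 2 / sqrt \<theta>)) * aa (v n) \<le> (\<Sum>j<n. sg * x j)"
      have "(1 - \<epsilon>) * aa (v n) \<le> (1 - (3 * \<kappa> + 2 * \<delta> + 2 / sqrt \<theta>)) * aa (v n)"
        using \<kappa>(3) \<theta>1 \<epsilon> unfolding \<delta>_def by (intro mult_right_mono aa_nonneg v_nonneg) auto
      with n show "(1 - \<epsilon>) * aa (v n) \<le> (\<Sum>j<n. sg * x j)" by linarith
    qed
  qed
qed

lemma copy_S_eq: "copy_S n x = (\<Sum>j<n. x j)"
  unfolding copy_S_def copy_X_def by (rule sum.reindex_bij_witness[of _ Suc "\<lambda>k. k - 1"]) auto

lemma eventually_aa_pos: "\<forall>\<^sub>F n in sequentially. 0 < aa (v n)"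
proof -
  obtain n0 where "0 < v n0" using v_unbounded by blast
  then have "0 < aa (v n)" if "n0 \<le> n" for n using v_mono[OF that] by (intro aa_pos) linarith
  then show ?thesis unfolding eventually_sequentially by blast
qed

text \<open>A countable union over both signs and the accuracies 1/(k + 1); off it the absolute
  value is eventually controlled at every accuracy.\<close>

lemma null_limsup_abs_gt_1: "null {x. limsup (\<lambda>n. ereal (\<bar>copy_S n x\<bar> / a_norm E X n)) > 1}"
proof -
  let ?B = "\<lambda>sg k. {x. \<exists>\<^sub>\<infinity>n. (1 + 1 / real (Suc k)) * aa (v n) < (\<Sum>j<n. sg * x j)}"
  have nul: "null (\<Union>k. ?B 1 k \<union> ?B (- 1) k)"
    by (intro null_UN null_Un upper_limit) auto
  show ?thesis
  proof (rule null_subset[OF nul], rule subsetI, rule ccontr)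
    fix x assume x: "x \<in> {x. limsup (\<lambda>n. ereal (\<bar>copy_S n x\<bar> / a_norm E X n)) > 1}" and nx: "x \<notin> (\<Union>k. ?B 1 k \<union> ?B (- 1) k)"
    have "limsup (\<lambda>n. ereal (\<bar>copy_S n x\<bar> / a_norm E X n)) \<le> 1"
    proof (rule ereal_le_epsilon2)
      fix e :: real assume "0 < e"
      then obtain k where k: "1 / real (Suc k) < e" using reals_Archimedean[of e] by (auto simp: inverse_eq_divide)
      have m: "\<forall>\<^sub>\<infinity>n. \<not> ((1 + 1 / real (Suc k)) * aa (v n) < (\<Sum>j<n. 1 * x j))"
        "\<forall>\<^sub>\<infinity>n. \<not> ((1 + 1 / real (Suc k)) * aa (v n) < (\<Sum>j<n. (- 1) * x j))"
        using nx by (simp_all add: not_INFM[symmetric] del: not_INFM)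
      have "limsup (\<lambda>n. ereal (\<bar>copy_S n x\<bar> / a_norm E X n)) \<le> ereal (1 + 1 / real (Suc k))"
      proof (rule Limsup_bounded)
        show "\<forall>\<^sub>F n in sequentially. ereal (\<bar>copy_S n x\<bar> / a_norm E X n) \<le> ereal (1 + 1 / real (Suc k))"
          using m[unfolded cofinite_eq_sequentially] eventually_aa_pos
        proof eventually_elim
          case (elim n)
          then have "\<bar>copy_S n x\<bar> \<le> (1 + 1 / real (Suc k)) * aa (v n)"
            unfolding copy_S_eq abs_le_iff by (simp add: not_less sum_negf)
          then show ?case using elim(3) unfolding a_norm_eq by (simp add: pos_divide_le_eq)
        qed
      qed
      also have "\<dots> \<le> 1 + ereal e" using k by (simp add: one_ereal_def)
      finally show "limsup (\<lambda>n. ereal (\<bar>copy_S n x\<bar> / a_norm E X n)) \<le> 1 + ereal e" .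
    qed
    with x show False by simp
  qed
qed

text \<open>One measure carries the lower bounds for all accuracies and both signs, so countable
  intersections suffice; the limit inferior comes from the limit superior of the reflected
  sums.\<close>

lemma full_limit_set:
  obtains P where "P \<in> copy_P E X"
    "AE x in P. liminf (\<lambda>n. ereal (copy_S n x / a_norm E X n)) = -1 \<and> limsup (\<lambda>n. ereal (copy_S n x / a_norm E X n)) = 1"
proof -
  obtain \<mu> where \<mu>: "\<And>j. real_distribution (\<mu> j)"
    "\<And>j f. blip f \<Longrightarrow> (\<integral>u. f u \<partial>\<mu> j) \<le> ER (\<lambda>\<omega>. f (X (Suc j) \<omega>))"
    "\<And>j. (\<integral>u. (clamp (real j * ss (v (Suc j))) u)\<^sup>2 \<partial>\<mu> j) = ER (\<lambda>\<omega>. (clamp (real j * ss (v (Suc j))) (X (Suc j) \<omega>))\<^sup>2)"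
    using attaining_distributions_exist by blast
  define P where "P = PiM UNIV \<mu>"
  have P: "P \<in> copy_P E X" unfolding P_def by (rule product_measure_in_copy_P[OF \<mu>(1,2) integ_X])
  have lim: "AE x in P. limsup (\<lambda>n. ereal ((\<Sum>j<n. sg * x j) / aa (v n))) = 1" if sg: "\<bar>sg\<bar> = 1" for sg
  proof -
    have 1: "AE x in P. \<forall>k. x \<notin> {x. \<exists>\<^sub>\<infinity>n. (1 + 1 / real (Suc k)) * aa (v n) < (\<Sum>j<n. sg * x j)}"
      unfolding AE_all_countable by (intro allI null_AE[OF P] upper_limit sg zero_less_divide_1_iff[THEN iffD2] of_nat_0_less_iff[THEN iffD2] zero_less_Suc)
    have 2: "AE x in P. \<forall>k. \<exists>\<^sub>\<infinity>n. (1 - 1 / real (Suc k)) * aa (v n) \<le> (\<Sum>j<n. sg * x j)"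
      unfolding AE_all_countable P_def by (intro allI lower_limit[OF \<mu> sg] zero_less_divide_1_iff[THEN iffD2] of_nat_0_less_iff[THEN iffD2] zero_less_Suc)
    show ?thesis
      using 1 2
    proof eventually_elim
      case (elim x)
      show ?case
      proof (rule limsup_ratio_eq_1[OF eventually_aa_pos])
        fix k
        show "\<exists>\<^sub>\<infinity>n. (1 - 1 / real (Suc k)) * aa (v n) \<le> (\<Sum>j<n. sg * x j)" using elim(2) by blast
        have "\<forall>\<^sub>\<infinity>n. \<not> ((1 + 1 / real (Suc k)) * aa (v n) < (\<Sum>j<n. sg * x j))"
          using elim(1)[rule_format, of k] by (simp only: mem_Collect_eq not_INFM)
        then show "\<forall>\<^sub>F n in sequentially. (\<Sum>j<n. sg * x j) \<le> (1 + 1 / real (Suc k)) * aa (v n)"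
          unfolding cofinite_eq_sequentially not_less .
      qed
    qed
  qed
  have l1: "AE x in P. limsup (\<lambda>n. ereal ((\<Sum>j<n. 1 * x j) / aa (v n))) = 1" by (rule lim) simp
  have l2: "AE x in P. limsup (\<lambda>n. ereal ((\<Sum>j<n. (- 1) * x j) / aa (v n))) = 1" by (rule lim) simp
  have "AE x in P. liminf (\<lambda>n. ereal (copy_S n x / a_norm E X n)) = -1 \<and> limsup (\<lambda>n. ereal (copy_S n x / a_norm E X n)) = 1"
    using l1 l2
  proof eventually_elim
    case (elim x)
    have "liminf (\<lambda>n. ereal (copy_S n x / a_norm E X n)) = liminf (\<lambda>n. - ereal ((\<Sum>j<n. (- 1) * x j) / aa (v n)))"
      unfolding copy_S_eq a_norm_eq by (simp add: sum_negf)
    also have "\<dots> = - limsup (\<lambda>n. ereal ((\<Sum>j<n. (- 1) * x j) / aa (v n)))" by (rule ereal_Liminf_uminus)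
    also have "\<dots> = -1" using elim(2) by simp
    finally show ?case using elim(1) unfolding copy_S_eq a_norm_eq by simp
  qed
  with P show ?thesis using that by blast
qed

end

theorem theorem5p8:
  fixes M :: "'a measure"
    and H :: "('a \<Rightarrow> real) set"
    and E :: "('a \<Rightarrow> real) \<Rightarrow> ereal"
    and VV :: "'a set \<Rightarrow> real"
    and X :: "nat \<Rightarrow> 'a \<Rightarrow> real"
  assumes space: "sublinear_expectation_space M H E"
    and indep: "indep_sequence H E X"
    and second_moments: "\<And>n. n \<ge> 1 \<Longrightarrow> E (\<lambda>\<omega>. (X n \<omega>)\<^sup>2) < \<infinity>"
    and capacity: "subadditive_capacity M VV"
    and compatible: "property_C M H E VV"
    and i: "\<And>\<epsilon>::real. \<epsilon> > 0 \<Longrightarrow>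
      (\<Sum>n. ereal (VV {\<omega>\<in>space M. \<bar>X (Suc n) \<omega>\<bar> \<ge> \<epsilon> * a_norm E X (Suc n)})) < \<infinity>"
    and ii: "\<And>\<alpha>::real. \<alpha> > 0 \<Longrightarrow>
      \<exists>p d :: real. p \<ge> 2 \<and> d \<ge> 0 \<and> (\<Sum>n. moment_term E X (Suc n) p \<alpha> d) < \<infinity>"
    and iii: "\<And>\<delta>::real. \<delta> > 0 \<Longrightarrow>
      (\<Sum>n. ereal (1 / s2 E X (Suc n) * logp (s2 E X (Suc n)) powr (\<delta> - 1))
             * E (\<lambda>\<omega>. (X (Suc n) \<omega>)\<^sup>2)) = \<infinity>"
    and iv: "(\<lambda>n. (\<Sum>j=1..n. \<bar>E (X j)\<bar> + \<bar>conj_expectation E (X j)\<bar>) / ereal (a_norm E X n))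
      \<longlonglongrightarrow> 0"
  shows "\<forall>V \<in> {V_P E X, C_star E X, V_star E X}.
      V {x. limsup (\<lambda>n. ereal (\<bar>copy_S n x\<bar> / a_norm E X n)) > 1} = 0 \<and>
      V {x. liminf (\<lambda>n. ereal (copy_S n x / a_norm E X n)) = -1 \<and>
            limsup (\<lambda>n. ereal (copy_S n x / a_norm E X n)) = 1} = 1"
proof -
  interpret sublinear_expectation_space M H E by (rule space)
  interpret lil_hypotheses M H E X VV
    by unfold_locales (fact indep second_moments capacity compatible i ii iii iv)+
  let ?A = "{x. limsup (\<lambda>n. ereal (\<bar>copy_S n x\<bar> / a_norm E X n)) > 1}"
  let ?B = "{x. liminf (\<lambda>n. ereal (copy_S n x / a_norm E X n)) = -1 \<and> limsup (\<lambda>n. ereal (copy_S n x / a_norm E X n)) = 1}"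
  have nA: "null ?A" by (rule null_limsup_abs_gt_1)
  then have A1: "V_star E X ?A = 0" by (simp add: null_def)
  \<comment> \<open>Nonnegativity is read off from a dominated measure: some \<open>P\<close>
    exists, and it bounds \<open>C_star\<close> from below on the empty set.\<close>
  have C0: "0 \<le> C_star E X A" for A
  proof -
    obtain P where P: "P \<in> copy_P E X" using full_limit_set by blast
    have "ereal (measure P {}) \<le> C_star E X {}" by (rule copy_P_le_C_star[OF P]) simp
    also have "\<dots> \<le> C_star E X A" unfolding C_star_def
      by (intro INF_superset_mono) (auto simp: indicator_def intro!: suminf_0_le)
    finally show ?thesis by (simp add: zero_ereal_def)
  qed
  have A2: "C_star E X ?A = 0" using C_star_le_V_star[of ?A] C0[of ?A] A1 by simp
  obtain Q where Q: "Q \<in> copy_P E X"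
    "AE x in Q. liminf (\<lambda>n. ereal (copy_S n x / a_norm E X n)) = -1 \<and> limsup (\<lambda>n. ereal (copy_S n x / a_norm E X n)) = 1"
    by (rule full_limit_set)
  have ne: "copy_P E X \<noteq> {}" using Q(1) by blast
  have PA: "measure P ?A = 0" if P: "P \<in> copy_P E X" for P
  proof -
    interpret P: prob_space P using P by (simp add: copy_P_def)
    show ?thesis
    proof (cases "?A \<in> sets P")
      case True
      then show ?thesis using P.prob_eq_0[OF True] null_AE[OF P nA] by simp
    next
      \<comment> \<open>\<open>measure\<close> is 0 by convention outside the sigma-algebra, so both
        cases give 0.\<close>
      case False then show ?thesis by (rule measure_notin_sets)
    qed
  qed
  have A3: "V_P E X ?A = 0"
    unfolding V_P_def using ne by (simp add: PA zero_ereal_def[symmetric] cong: SUP_cong)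
  have [measurable]: "(\<lambda>x :: nat \<Rightarrow> real. x j) \<in> borel_measurable borel" for j by (rule measurable_product_coordinates)
  have [measurable]: "(\<lambda>x. ereal (copy_S n x / a_norm E X n)) \<in> borel_measurable borel" for n
    unfolding copy_S_eq by measurable
  have B: "?B \<in> sets borel"
  proof -
    have "{x \<in> space borel. liminf (\<lambda>n. ereal (copy_S n x / a_norm E X n)) = -1 \<and> limsup (\<lambda>n. ereal (copy_S n x / a_norm E X n)) = 1} \<in> sets borel"
      by measurable
    then show ?thesis by simp
  qed
  have QB: "measure Q ?B = 1"
  proof -
    interpret Q: prob_space Q using Q(1) by (simp add: copy_P_def)
    have "?B \<in> sets Q" using B Q(1) by (simp add: copy_P_def)
    then show ?thesis using Q.prob_eq_1[of ?B] Q(2) by simp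
  qed
  have P1: "V_P E X ?B = 1"
  proof (rule antisym)
    show "V_P E X ?B \<le> 1"
      unfolding V_P_def using ne by (auto intro!: SUP_least simp: copy_P_def prob_space.prob_le_1 one_ereal_def)
    have "ereal (measure Q ?B) \<le> V_P E X ?B"
      unfolding V_P_def using ne by (auto intro!: SUP_upper Q(1))
    then show "1 \<le> V_P E X ?B" unfolding QB by (simp add: one_ereal_def)
  qed
  \<comment> \<open>\<open>Q\<close> bounds \<open>C_star\<close> from below by 1, and
    \<open>V_star\<close> lies between \<open>C_star\<close> and 1, which forces equality for
    both.\<close>
  have C1: "1 \<le> C_star E X ?B" using copy_P_le_C_star[OF Q(1) B] unfolding QB by (simp add: one_ereal_def)
  have "C_star E X ?B = 1" "V_star E X ?B = 1"
    using C1 C_star_le_V_star[of ?B] V_star_le_1[of ?B] by (auto intro: antisym order_trans)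
  then show ?thesis using A1 A2 A3 P1 by simp
qed

end
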